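(* Let $\Lambda=\mathbb{Z}_p[\mathbb{Z}/p\mathbb{Z}]\simeq\mathbb{Z}_p\times_{\mathbb{F}_p}\mathbb{Z}_p[\omega]$, where $p$ is a prime and $\omega$ is a primitive $p$-th root of unity. Let $L$ be a $\Lambda$-lattice, and let $a,b,c$ be the unique nonnegative integers such that $$L\simeq \mathbb{Z}_p^{\oplus a}\oplus\mathbb{Z}_p[\omega]^{\oplus b}\oplus\Lambda^{\oplus c}.$$ Let $\Lambda'\simeq\mathbb{Z}_p\times\mathbb{Z}_p[\omega]$ be the maximal $\mathbb{Z}_p$-order in $\mathbb{Q}_p[\mathbb{Z}/p\mathbb{Z}]$. Then $$\zeta_{\Lambda'}(\Lambda'L;s)=\prod_{h=0}^{a+c-1}(1-p^{h-s})^{-1}\prod_{i=0}^{b+c-1}(1-p^{i-s})^{-1},$$ and $$\frac{\zeta_\Lambda(L;s)}{\zeta_{\Lambda'}(\Lambda'L;s)}=\sum_{j=0}^c \binom{c}{j}_p p^{-(c-j)s}P_j^{a,b,c}(p,s)\prod_{k=0}^{j-1}(1-p^{k-s})^2,$$ where $$P_j^{a,b,c}(p,s)=\sum_{\ell=0}^{\min(a+c-j,\,b+c-j)}\binom{a+c-j}{\ell}_p\binom{b+c-j}{\ell}_p |\mathrm{GL}_\ell(\mathbb{F}_p)|\,p^{\ell(j-s)}.$$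
   Context: A $\Lambda$-lattice is a $\Lambda$-module that is finitely generated and free over $\mathbb{Z}_p$. A fixed generator of $\mathbb{Z}/p\mathbb{Z}$ acts trivially on $\mathbb{Z}_p$ and by multiplication by $\omega$ on $\mathbb{Z}_p[\omega]$; the fibre product is over the residue maps to $\mathbb{F}_p$. It is a known fact (Heller–Reiner together with Krull–Schmidt–Azumaya) that $\mathbb{Z}_p$, $\mathbb{Z}_p[\omega]$, $\Lambda$ are, up to isomorphism, the only indecomposable $\Lambda$-lattices and that $a,b,c$ exist and are unique. $\Lambda'L$ is the $\Lambda'$-submodule generated by $L$ in $\mathbb{Q}_p\otimes_{\mathbb{Z}_p}L$. For an order $\Gamma$ ($=\Lambda$ or $\Lambda'$) and a left $\Gamma$-lattice $N$, the Solomon zeta function is $\zeta_\Gamma(N;s)=\sum_{X}|N/X|^{-s}\in\mathbb{Z}\llbracket p^{-s}\rrbracket$, the sum running over all finite-index $\Gamma$-submodules $X$ of $N$; here $p^{-s}$ is a formal variable, $(p^n)^{-s}=(p^{-s})^n$, and $p^{m-s}$ means $p^m\cdot p^{-s}$. $\binom{\alpha}{\beta}_p$ is the Gaussian binomial coefficient, the number of $\beta$-dimensional subspaces of $\mathbb{F}_p^{\oplus\alpha}$. $|\mathrm{GL}_0(\mathbb{F}_p)|=1$ and empty products equal $1$. *)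

theory Defs
  imports
    "HOL-Library.Poly_Mapping"
    "HOL-Library.Product_Plus"
    "HOL-Computational_Algebra.Computational_Algebra"
    "HOL-Algebra.Algebraic_Closure_Type"
    "Berlekamp_Zassenhaus.Finite_Field"
    "Jordan_Normal_Form.Matrix"
begin

text \<open>
  The prime \<open>p\<close> is carried by a type \<open>'p :: prime_card\<close> with \<open>p = CARD('p)\<close>; the
  field with \<open>p\<close> elements and the additive group \<open>\<int>/p\<int>\<close> are both \<open>'p mod_ring\<close>.
  The bare name \<open>module\<close> would refer to the carrier-based modules of \<open>HOL-Algebra\<close>,
  so \<open>Modules.module\<close> is written out below.
\<close>


section \<open>p-adic integers and p-adic numbers\<close>

text \<open>
  The inverse limit of the rings \<open>\<int>/p\<^sup>n\<int>\<close>: the \<open>n\<close>-th entry is the canonical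
  representative of the residue class modulo \<open>p\<^sup>n\<close>.
\<close>

typedef ('p :: prime_card) padic_int =
  "{f :: nat \<Rightarrow> int. \<forall>n. f n \<in> {0..<int CARD('p) ^ n} \<and> f (Suc n) mod int CARD('p) ^ n = f n}"
  by (rule exI[of _ "\<lambda>_. 0"]) (auto simp: prime_card_int prime_gt_0_int)

setup_lifting type_definition_padic_int

lemma card_pos: "0 < int CARD('p :: prime_card)"
  by simp

lemma padic_op_aux:
  fixes q :: int
  assumes "q > 0" "\<And>n. f n \<in> {0..<q ^ n} \<and> f (Suc n) mod q ^ n = f n"
    "\<And>n. g n \<in> {0..<q ^ n} \<and> g (Suc n) mod q ^ n = g n"
  shows "(f n + g n) mod q ^ n \<in> {0..<q ^ n} \<and>
           (f (Suc n) + g (Suc n)) mod q ^ Suc n mod q ^ n = (f n + g n) mod q ^ n"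
    and "(f n - g n) mod q ^ n \<in> {0..<q ^ n} \<and>
           (f (Suc n) - g (Suc n)) mod q ^ Suc n mod q ^ n = (f n - g n) mod q ^ n"
    and "(f n * g n) mod q ^ n \<in> {0..<q ^ n} \<and>
           (f (Suc n) * g (Suc n)) mod q ^ Suc n mod q ^ n = (f n * g n) mod q ^ n"
    and "(- f n) mod q ^ n \<in> {0..<q ^ n} \<and>
           (- f (Suc n)) mod q ^ Suc n mod q ^ n = (- f n) mod q ^ n"
proof -
  have d: "q ^ n dvd q ^ Suc n" by simp
  have f: "f (Suc n) mod q ^ n = f n mod q ^ n" and g: "g (Suc n) mod q ^ n = g n mod q ^ n"
    using assms(2,3) by (metis mod_mod_trivial)+
  have q: "0 < q ^ n" using assms(1) by simp
  have m: "x mod q ^ Suc n mod q ^ n = x mod q ^ n" for x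
    by (rule mod_mod_cancel[OF d])
  show "(f n + g n) mod q ^ n \<in> {0..<q ^ n} \<and>
           (f (Suc n) + g (Suc n)) mod q ^ Suc n mod q ^ n = (f n + g n) mod q ^ n"
    using q unfolding m by (auto intro: mod_add_cong f g)
  show "(f n - g n) mod q ^ n \<in> {0..<q ^ n} \<and>
           (f (Suc n) - g (Suc n)) mod q ^ Suc n mod q ^ n = (f n - g n) mod q ^ n"
    using q unfolding m by (auto intro: mod_diff_cong f g)
  show "(f n * g n) mod q ^ n \<in> {0..<q ^ n} \<and>
           (f (Suc n) * g (Suc n)) mod q ^ Suc n mod q ^ n = (f n * g n) mod q ^ n"
    using q unfolding m by (auto intro: mod_mult_cong f g)
  show "(- f n) mod q ^ n \<in> {0..<q ^ n} \<and>
           (- f (Suc n)) mod q ^ Suc n mod q ^ n = (- f n) mod q ^ n"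
    using q unfolding m by (auto intro: mod_minus_cong f)
qed

instantiation padic_int :: (prime_card) comm_ring_1
begin

lift_definition zero_padic_int :: "'a padic_int" is "\<lambda>_. 0"
  by simp

lift_definition one_padic_int :: "'a padic_int" is "\<lambda>n. 1 mod int CARD('a) ^ n"
  by (auto simp: mod_mod_cancel simp del: power_Suc intro!: mod_mod_cancel le_imp_power_dvd)

lift_definition plus_padic_int :: "'a padic_int \<Rightarrow> 'a padic_int \<Rightarrow> 'a padic_int"
  is "\<lambda>f g n. (f n + g n) mod int CARD('a) ^ n"
  by (rule padic_op_aux(1)[OF card_pos])

lift_definition minus_padic_int :: "'a padic_int \<Rightarrow> 'a padic_int \<Rightarrow> 'a padic_int"
  is "\<lambda>f g n. (f n - g n) mod int CARD('a) ^ n"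
  by (rule padic_op_aux(2)[OF card_pos])

lift_definition times_padic_int :: "'a padic_int \<Rightarrow> 'a padic_int \<Rightarrow> 'a padic_int"
  is "\<lambda>f g n. (f n * g n) mod int CARD('a) ^ n"
  by (rule padic_op_aux(3)[OF card_pos])

lift_definition uminus_padic_int :: "'a padic_int \<Rightarrow> 'a padic_int"
  is "\<lambda>f n. (- f n) mod int CARD('a) ^ n"
  by (rule padic_op_aux(4)[OF card_pos])

instance
proof
  fix a b c :: "'a padic_int"
  show "a * b * c = a * (b * c)" by transfer (auto simp: mod_simps mult.assoc)
  show "a * b = b * a" by transfer (auto simp: mult.commute)
  show "1 * a = a" by transfer (auto simp: mod_simps)
  show "a + b + c = a + (b + c)" by transfer (auto simp: mod_simps add.assoc)
  show "a + b = b + a" by transfer (auto simp: add.commute)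
  show "0 + a = a" by transfer auto
  show "- a + a = 0" by transfer (auto simp: mod_simps)
  show "a - b = a + - b" by transfer (auto simp: mod_simps)
  show "(a + b) * c = a * c + b * c" by transfer (auto simp: mod_simps algebra_simps)
  show "(0 :: 'a padic_int) \<noteq> 1"
  proof transfer
    have "1 mod int CARD('a) ^ 1 \<noteq> 0"
      using nontriv[where 'a = 'a] by simp
    thus "(\<lambda>_. 0) \<noteq> (\<lambda>n. 1 mod int CARD('a) ^ n)" by metis
  qed
qed

end

lemma padic_mod_eq:
  assumes "\<forall>n. f n \<in> {0..<(q :: int) ^ n} \<and> f (Suc n) mod q ^ n = f n"
  shows "f (n + k) mod q ^ n = f n"
proof (induction k)
  case 0
  thus ?case using assms by (auto simp: mod_pos_pos_trivial)
next
  case (Suc k)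
  have "f (n + Suc k) mod q ^ n = f (Suc (n + k)) mod q ^ (n + k) mod q ^ n"
    by (simp add: mod_mod_cancel le_imp_power_dvd)
  also have "\<dots> = f n" using assms Suc by auto
  finally show ?case .
qed

instance padic_int :: (prime_card) idom
proof
  fix a b :: "'a padic_int"
  assume "a \<noteq> 0" "b \<noteq> 0"
  thus "a * b \<noteq> 0"
  proof transfer
    define q where "q = int CARD('a)"
    fix f g :: "nat \<Rightarrow> int"
    assume f: "\<forall>n. f n \<in> {0..<int CARD('a) ^ n} \<and> f (Suc n) mod int CARD('a) ^ n = f n"
    assume g: "\<forall>n. g n \<in> {0..<int CARD('a) ^ n} \<and> g (Suc n) mod int CARD('a) ^ n = g n"
    assume "f \<noteq> (\<lambda>_. 0)" "g \<noteq> (\<lambda>_. 0)"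
    then obtain m n where mn: "f m \<noteq> 0" "g n \<noteq> 0" by fastforce
    have q: "prime q" unfolding q_def using prime_card[where 'a = 'a] by simp
    define N where "N = m + n"
    have "f N mod q ^ m = f m" "g N mod q ^ n = g n"
      using padic_mod_eq[OF f, of m n] padic_mod_eq[OF g, of n m]
      by (simp_all add: N_def q_def add.commute)
    with mn have nd: "\<not> q ^ m dvd f N" "\<not> q ^ n dvd g N" by auto
    hence nz: "f N \<noteq> 0" "g N \<noteq> 0" by auto
    have "multiplicity q (f N) < m" "multiplicity q (g N) < n"
      using nd q nz by (metis multiplicity_dvd' not_less)+
    moreover have "multiplicity q (f N * g N) = multiplicity q (f N) + multiplicity q (g N)"
      using q nz by (intro prime_elem_multiplicity_mult_distrib) auto
    ultimately have "multiplicity q (f N * g N) < N" by (simp add: N_def)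
    hence "\<not> q ^ N dvd f N * g N"
      using nz prime_elem_not_unit[OF prime_imp_prime_elem[OF q]]
      by (subst power_dvd_iff_le_multiplicity) auto
    thus "(\<lambda>n. f n * g n mod int CARD('a) ^ n) \<noteq> (\<lambda>_. 0)"
      unfolding q_def by (metis dvd_eq_mod_eq_0)
  qed
qed

type_synonym 'p padic = "'p padic_int fract"

abbreviation padic_of_int :: "'p :: prime_card padic_int \<Rightarrow> 'p padic" where
  "padic_of_int r \<equiv> Fract r 1"


section \<open>The group rings, lattices and orders\<close>

text \<open>
  \<open>'g \<Rightarrow>\<^sub>0 'r\<close> is the type of finitely supported functions with the convolution
  product, i.e. the group ring; \<open>Poly_Mapping.single g r\<close> is \<open>r \<cdot> g\<close>, and
  \<open>Poly_Mapping.single 0 r\<close> is the scalar \<open>r\<close>.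
\<close>

type_synonym 'p group_ring_Zp = "'p mod_ring \<Rightarrow>\<^sub>0 'p padic_int"

type_synonym 'p group_ring_Qp = "'p mod_ring \<Rightarrow>\<^sub>0 'p padic"

definition group_ring_lattice ::
  "('p :: prime_card group_ring_Zp \<Rightarrow> 'l :: ab_group_add \<Rightarrow> 'l) \<Rightarrow> bool" where
  "group_ring_lattice scale \<longleftrightarrow> Modules.module scale \<and>
     (let scaleZ = (\<lambda>r. scale (Poly_Mapping.single 0 r)) in
        (\<exists>S. finite S \<and> Modules.module.span scaleZ S = UNIV) \<and>
        (\<exists>B. \<not> Modules.module.dependent scaleZ B \<and> Modules.module.span scaleZ B = UNIV))"

definition is_order :: "'p :: prime_card group_ring_Qp set \<Rightarrow> bool" where
  "is_order \<Gamma> \<longleftrightarrow>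
     1 \<in> \<Gamma> \<and> (\<forall>x\<in>\<Gamma>. \<forall>y\<in>\<Gamma>. x - y \<in> \<Gamma> \<and> x * y \<in> \<Gamma>) \<and>
     (\<exists>S. finite S \<and>
        \<Gamma> = Modules.module.span (\<lambda>r. (*) (Poly_Mapping.single 0 (padic_of_int r))) S) \<and>
     Modules.module.span (\<lambda>q. (*) (Poly_Mapping.single 0 q)) \<Gamma> = UNIV"

definition is_maximal_order :: "'p :: prime_card group_ring_Qp set \<Rightarrow> bool" where
  "is_maximal_order \<Gamma> \<longleftrightarrow> is_order \<Gamma> \<and> (\<forall>\<Delta>. is_order \<Delta> \<longrightarrow> \<Gamma> \<subseteq> \<Delta> \<longrightarrow> \<Delta> = \<Gamma>)"


section \<open>The lattice with given multiplicities\<close>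

definition primitive_root_of_unity :: "nat \<Rightarrow> 'a :: field \<Rightarrow> bool" where
  "primitive_root_of_unity n w \<longleftrightarrow> w ^ n = 1 \<and> (\<forall>k. 0 < k \<and> k < n \<longrightarrow> w ^ k \<noteq> 1)"

abbreviation padic_int_to_ac :: "'p :: prime_card padic_int \<Rightarrow> 'p padic alg_closure" where
  "padic_int_to_ac r \<equiv> to_ac (padic_of_int r)"

definition Zp_adjoin :: "'p :: prime_card padic alg_closure \<Rightarrow> 'p padic alg_closure set" where
  "Zp_adjoin w = {poly (map_poly padic_int_to_ac f) w | f. True}"

text \<open>
  How an element of the group ring acts on \<open>\<int>\<^sub>p\<close> (trivial action of the group) and on
  \<open>\<int>\<^sub>p[\<omega>]\<close> (the generator \<open>1\<close> of \<open>\<int>/p\<int>\<close> acts by \<open>\<omega>\<close>).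
\<close>

definition augmentation :: "'p :: prime_card group_ring_Zp \<Rightarrow> 'p padic_int" where
  "augmentation r = (\<Sum>g\<in>UNIV. Poly_Mapping.lookup r g)"

definition eval_at_root ::
  "'p :: prime_card padic alg_closure \<Rightarrow> 'p group_ring_Zp \<Rightarrow> 'p padic alg_closure" where
  "eval_at_root w r =
     (\<Sum>g\<in>UNIV. padic_int_to_ac (Poly_Mapping.lookup r g) * w ^ nat (to_int_mod_ring g))"

text \<open>
  Coordinate vectors of length \<open>n\<close> with entries in \<open>R\<close> are finitely supported sequences that
  vanish from the index \<open>n\<close> on (so that \<open>n = 0\<close> is allowed).
\<close>

definition coord_vecs :: "nat \<Rightarrow> 'r :: zero set \<Rightarrow> (nat \<Rightarrow>\<^sub>0 'r) set" where
  "coord_vecs n R = {v. Poly_Mapping.keys v \<subseteq> {..<n} \<and> (\<forall>i<n. Poly_Mapping.lookup v i \<in> R)}"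

definition coord_scale :: "'r :: comm_ring_1 \<Rightarrow> ('i \<Rightarrow>\<^sub>0 'r) \<Rightarrow> ('i \<Rightarrow>\<^sub>0 'r)" where
  "coord_scale r = Poly_Mapping.map ((*) r)"

type_synonym 'p model =
  "(nat \<Rightarrow>\<^sub>0 'p padic_int) \<times> (nat \<Rightarrow>\<^sub>0 'p padic alg_closure) \<times> (nat \<Rightarrow>\<^sub>0 'p group_ring_Zp)"

definition model_lattice ::
  "'p :: prime_card padic alg_closure \<Rightarrow> nat \<Rightarrow> nat \<Rightarrow> nat \<Rightarrow> 'p model set" where
  "model_lattice w a b c = coord_vecs a UNIV \<times> coord_vecs b (Zp_adjoin w) \<times> coord_vecs c UNIV"

definition model_scale ::
  "'p :: prime_card padic alg_closure \<Rightarrow> 'p group_ring_Zp \<Rightarrow> 'p model \<Rightarrow> 'p model" where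
  "model_scale w r = (\<lambda>(x, y, z).
     (coord_scale (augmentation r) x, coord_scale (eval_at_root w r) y, coord_scale r z))"

definition iso_to_model ::
  "('p :: prime_card group_ring_Zp \<Rightarrow> 'l :: ab_group_add \<Rightarrow> 'l) \<Rightarrow>
     'p padic alg_closure \<Rightarrow> nat \<Rightarrow> nat \<Rightarrow> nat \<Rightarrow> bool" where
  "iso_to_model scale w a b c \<longleftrightarrow>
     (\<exists>\<phi>. bij_betw \<phi> UNIV (model_lattice w a b c) \<and>
          (\<forall>x y. \<phi> (x + y) = \<phi> x + \<phi> y) \<and>
          (\<forall>r x. \<phi> (scale r x) = model_scale w r (\<phi> x)))"


section \<open>Tensor products and extension of scalars\<close>

text \<open>
  \<open>T\<close> with the pairing \<open>\<tau>\<close> is a tensor product of the \<open>R\<close>-modules \<open>M\<close> and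
  \<open>N\<close>: the linear extension of \<open>\<tau>\<close> to the free module on \<open>M \<times> N\<close> is
  onto, and its kernel is spanned by the bilinearity relations.  (The carriers are the whole types.)
\<close>

definition tensor_relations ::
  "('r :: comm_ring_1 \<Rightarrow> 'm :: ab_group_add \<Rightarrow> 'm) \<Rightarrow> ('r \<Rightarrow> 'n :: ab_group_add \<Rightarrow> 'n) \<Rightarrow>
     ('m \<times> 'n \<Rightarrow>\<^sub>0 'r) set" where
  "tensor_relations scaleM scaleN = (let e = (\<lambda>x y. Poly_Mapping.single (x, y) 1) in
     {e (x + x') y - e x y - e x' y | x x' y. True} \<union>
     {e x (y + y') - e x y - e x y' | x y y'. True} \<union>
     {e (scaleM r x) y - coord_scale r (e x y) | r x y. True} \<union>
     {e x (scaleN r y) - coord_scale r (e x y) | r x y. True})"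

definition is_tensor_product ::
  "('r :: comm_ring_1 \<Rightarrow> 'm :: ab_group_add \<Rightarrow> 'm) \<Rightarrow> ('r \<Rightarrow> 'n :: ab_group_add \<Rightarrow> 'n) \<Rightarrow>
     ('r \<Rightarrow> 't :: ab_group_add \<Rightarrow> 't) \<Rightarrow> ('m \<Rightarrow> 'n \<Rightarrow> 't) \<Rightarrow> bool" where
  "is_tensor_product scaleM scaleN scaleT \<tau> \<longleftrightarrow>
     (let ext = (\<lambda>f. \<Sum>(x, y)\<in>Poly_Mapping.keys f. scaleT (Poly_Mapping.lookup f (x, y)) (\<tau> x y)) in
        surj ext \<and>
        {f. ext f = 0} = Modules.module.span coord_scale (tensor_relations scaleM scaleN))"

text \<open>
  The module \<open>V\<close> over the rational group ring, with \<open>\<tau> q x = q \<otimes> x\<close>, is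
  \<open>\<rat>\<^sub>p \<otimes> L\<close>, where \<open>q g\<close> acts by \<open>q' \<otimes> x \<mapsto> q q' \<otimes> g x\<close>.
\<close>

definition is_rational_extension ::
  "('p :: prime_card group_ring_Zp \<Rightarrow> 'l :: ab_group_add \<Rightarrow> 'l) \<Rightarrow>
     ('p group_ring_Qp \<Rightarrow> 'v :: ab_group_add \<Rightarrow> 'v) \<Rightarrow> ('p padic \<Rightarrow> 'l \<Rightarrow> 'v) \<Rightarrow> bool" where
  "is_rational_extension scale scaleV \<tau> \<longleftrightarrow>
     Modules.module scaleV \<and>
     is_tensor_product (\<lambda>r. (*) (padic_of_int r)) (\<lambda>r. scale (Poly_Mapping.single 0 r))
       (\<lambda>r. scaleV (Poly_Mapping.single 0 (padic_of_int r))) \<tau> \<and>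
     (\<forall>g q q' x. scaleV (Poly_Mapping.single g q) (\<tau> q' x) =
                  \<tau> (q * q') (scale (Poly_Mapping.single g 1) x))"


section \<open>Solomon zeta functions\<close>

text \<open>
  \<open>\<Gamma>\<close> is a subring of the ring of scalars, so \<open>\<Gamma> = UNIV\<close> gives all submodules.
\<close>

definition is_submodule_over ::
  "'r set \<Rightarrow> ('r \<Rightarrow> 'm :: ab_group_add \<Rightarrow> 'm) \<Rightarrow> 'm set \<Rightarrow> bool" where
  "is_submodule_over \<Gamma> scale Y \<longleftrightarrow>
     0 \<in> Y \<and> (\<forall>x\<in>Y. \<forall>y\<in>Y. x - y \<in> Y) \<and> (\<forall>r\<in>\<Gamma>. \<forall>x\<in>Y. scale r x \<in> Y)"

definition quotient_set :: "'m :: ab_group_add set \<Rightarrow> 'm set \<Rightarrow> 'm set set" where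
  "quotient_set N Y = N // {(x, y). x \<in> N \<and> y \<in> N \<and> x - y \<in> Y}"

text \<open>
  As a formal power series in \<open>p\<^sup>-\<^sup>s = fps_X\<close>: the coefficient at \<open>n\<close> collects the
  submodules \<open>Y\<close> with \<open>|N/Y| = p\<^sup>n\<close>.  Every finite index in a lattice is a power of
  \<open>p\<close>, and there are finitely many submodules of each index.  The coefficients are
  integers, but taken in \<open>\<rat>\<close> so that the library division of power series applies.
\<close>

definition solomon_zeta ::
  "nat \<Rightarrow> 'r set \<Rightarrow> ('r \<Rightarrow> 'm :: ab_group_add \<Rightarrow> 'm) \<Rightarrow> 'm set \<Rightarrow> rat fps" where
  "solomon_zeta p \<Gamma> scale N = Abs_fps (\<lambda>n. of_nat (card
     {Y. Y \<subseteq> N \<and> is_submodule_over \<Gamma> scale Y \<and>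
         finite (quotient_set N Y) \<and> card (quotient_set N Y) = p ^ n}))"

text \<open>The formal expression \<open>p\<^bsup>m-s\<^esup> = p\<^sup>m \<cdot> p\<^sup>-\<^sup>s\<close>.\<close>

definition p_pow_minus_s :: "nat \<Rightarrow> nat \<Rightarrow> rat fps" where
  "p_pow_minus_s p m = fps_const (of_nat p ^ m) * fps_X"

definition generated_submodule ::
  "'r set \<Rightarrow> ('r \<Rightarrow> 'm :: ab_group_add \<Rightarrow> 'm) \<Rightarrow> 'm set \<Rightarrow> 'm set" where
  "generated_submodule \<Gamma> scale S = is_submodule_over \<Gamma> scale hull S"


section \<open>Gaussian binomials, general linear groups and the polynomials\<close>

definition gauss_binomial :: "'p :: prime_card itself \<Rightarrow> nat \<Rightarrow> nat \<Rightarrow> nat" where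
  "gauss_binomial _ \<alpha> \<beta> = card {W :: (nat \<Rightarrow>\<^sub>0 'p mod_ring) set.
     W \<subseteq> coord_vecs \<alpha> UNIV \<and> Modules.module.subspace coord_scale W \<and>
     vector_space.dim coord_scale W = \<beta>}"

definition card_GL :: "'p :: prime_card itself \<Rightarrow> nat \<Rightarrow> nat" where
  "card_GL _ l = card {A :: 'p mod_ring mat. A \<in> carrier_mat l l \<and> invertible_mat A}"

definition P_poly :: "'p :: prime_card itself \<Rightarrow> nat \<Rightarrow> nat \<Rightarrow> nat \<Rightarrow> nat \<Rightarrow> rat fps" where
  "P_poly P a b c j = (\<Sum>l = 0..min (a + c - j) (b + c - j).
     of_nat (gauss_binomial P (a + c - j) l * gauss_binomial P (b + c - j) l * card_GL P l) *
     p_pow_minus_s CARD('p) j ^ l)"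

end

(*
  Embed L as the fibre product H = {(x, y) in S1^(a+c) x S2^(b+c) : x and y have the same residues
  in the last c coordinates}, where S1 = Z_p and S2 = Z_p[omega] are discrete valuation rings with
  residue field F_p. For a submodule Y of H with projections M1 and M2, both projections have the
  same image W in F_p^c, and Y contains t1 M1 x t2 M2 for the uniformizers t1, t2. Hence Y
  corresponds to a subdirect subspace of M1/t1 M1 x M2/t2 M2 that lies in the fibre product over
  W. If |W| = p^j, these subspaces are counted by their codimension, by induction through the
  pairs of nested subdirect subspaces whose codimensions differ by one, and this gives P_j. The
  submodules M of S^m whose image in F_p^c is W are enumerated by inverting a sum over the
  subspaces of W with the q-binomial (Cauchy) identity: their generating function is X^(c-j)
  (1-X)(1-pX)...(1-p^(j-1) X) times the zeta function of S^m, which accounts for the squared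
  product. The zeta function of S^m itself follows by splitting off the last coordinate.

  Every order is contained in the elements of Q_p[G] that act integrally on both factors: all its
  elements have one common denominator, hence the powers of the values of an element are bounded
  and the valuation ring contains the values. So the maximal order is Z_p x Z_p[omega], and it
  generates S1^(a+c) x S2^(b+c) from H.
*)
theory Submission
  imports
    Defs
    "Jordan_Normal_Form.Determinant"
    "Berlekamp_Zassenhaus.Berlekamp_Type_Based"
    "HOL-Number_Theory.Cong"
begin

section \<open>Subspaces of finite vector spaces\<close>

text \<open>Indices are first measured in S1^(a+c) x S2^(b+c), where H has index p^c. A pair (M1,
  M2) with common image of dimension j brings in X^(c-j) twice, and the submodules over it start at
  index p^j in M1 x M2; removing X^c leaves the single factor X^(c-j) of the theorem. The count over
  (M1, M2) depends on j alone because a submodule M of finite index in S^m is again free of rank m,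
  so M/tM always has dimension m.

  The arithmetic obstacle is that Z_p[omega] is given merely as a subset of an algebraic closure.
  Irreducibility of the cyclotomic polynomial is not invoked. Expanding ((omega - 1) + 1)^p = 1
  gives (omega - 1)^(p-1) = -p v with v congruent to 1 modulo omega - 1, the augmentation modulo p
  supplies the residue map, and a Nakayama argument over Z_p turns elements of non-zero residue into
  units. The same expansion inside the group ring shows that augmentation and evaluation at omega
  are jointly injective.\<close>

locale finite_field_space = vector_space scale
  for scale :: "'k :: {field, finite} \<Rightarrow> 'v :: ab_group_add \<Rightarrow> 'v" (infixr \<open>*s\<close> 75) +
  fixes q :: nat
  assumes q_eq: "q = CARD('k)"
begin

lemma q_gt_1: "1 < q"
proof -
  have "card {0, 1 :: 'k} \<le> q" unfolding q_eq by (rule card_mono) auto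
  thus ?thesis by simp
qed

text \<open>Replaces bases in the counts below: a subspace that contains U and is q times as large
  arises by adjoining any one of its vectors outside U.\<close>

definition adjoin :: "'v set \<Rightarrow> 'v \<Rightarrow> 'v set" where
  "adjoin U y = (\<lambda>(x, s). x + s *s y) ` (U \<times> UNIV)"

lemma adjoin_iff: "z \<in> adjoin U y \<longleftrightarrow> (\<exists>s. z - s *s y \<in> U)"
proof -
  have "z \<in> adjoin U y" if "z - s *s y \<in> U" for s
    unfolding adjoin_def using that by (intro image_eqI[of _ _ "(z - s *s y, s)"]) auto
  moreover have "\<exists>s. z - s *s y \<in> U" if zz: "z \<in> adjoin U y"
  proof -
    obtain a s where "a \<in> U" "z = a + s *s y" using zz by (auto simp: adjoin_def)
    hence "z - s *s y \<in> U" by simp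
    thus ?thesis ..
  qed
  ultimately show ?thesis by blast
qed

lemma subspace_adjoin:
  assumes "subspace U"
  shows "subspace (adjoin U y)"
proof (rule subspaceI)
  show "0 \<in> adjoin U y"
    using subspace_0[OF assms] by (auto simp: adjoin_iff intro!: exI[of _ 0])
next
  fix u v assume "u \<in> adjoin U y" "v \<in> adjoin U y"
  then obtain s t where "u - s *s y \<in> U" "v - t *s y \<in> U" by (auto simp: adjoin_iff)
  hence "u + v - (s + t) *s y \<in> U"
    using subspace_add[OF assms] by (force simp: algebra_simps)
  thus "u + v \<in> adjoin U y" by (auto simp: adjoin_iff)
next
  fix c u assume "u \<in> adjoin U y"
  then obtain s where "u - s *s y \<in> U" by (auto simp: adjoin_iff)
  hence "c *s u - (c * s) *s y \<in> U"
    using subspace_scale[OF assms] by (force simp: scale_right_diff_distrib)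
  thus "c *s u \<in> adjoin U y" by (auto simp: adjoin_iff)
qed

lemma subset_adjoin: "U \<subseteq> adjoin U y"
  by (auto simp: adjoin_iff intro!: exI[of _ 0])

lemma mem_adjoin: "subspace U \<Longrightarrow> y \<in> adjoin U y"
  by (auto simp: adjoin_iff subspace_0 intro!: exI[of _ 1])

lemma adjoin_minimal: "subspace Y \<Longrightarrow> U \<subseteq> Y \<Longrightarrow> y \<in> Y \<Longrightarrow> adjoin U y \<subseteq> Y"
  unfolding adjoin_def by (auto intro!: subspace_add subspace_scale)

lemma subspace_scale_cancel: "subspace U \<Longrightarrow> c \<noteq> 0 \<Longrightarrow> c *s y \<in> U \<Longrightarrow> y \<in> U"
  using subspace_scale[of U "c *s y" "inverse c"] by simp

lemma scale_mem_iff: "subspace U \<Longrightarrow> c *s y \<in> U \<longleftrightarrow> c = 0 \<or> y \<in> U"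
  using subspace_scale_cancel subspace_scale subspace_0 by (metis scale_zero_left)

lemma card_adjoin:
  assumes "subspace U" "finite U" "y \<notin> U"
  shows "card (adjoin U y) = q * card U" "finite (adjoin U y)"
proof -
  have "inj_on (\<lambda>(x, s). x + s *s y) (U \<times> UNIV)"
  proof (rule inj_onI, clarify)
    fix x s x' t assume *: "x \<in> U" "x' \<in> U" "x + s *s y = x' + t *s y"
    hence "(s - t) *s y = x' - x" by (simp add: algebra_simps)
    hence "(s - t) *s y \<in> U" using * assms subspace_diff by auto
    hence "s = t" using scale_mem_iff[OF assms(1)] assms(3) by simp
    with * show "x = x' \<and> s = t" by simp
  qed
  thus "card (adjoin U y) = q * card U" "finite (adjoin U y)"
    using assms by (auto simp: adjoin_def card_image card_cartesian_product q_eq)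
qed

lemma adjoin_eqI:
  assumes "subspace U" "finite Y" "subspace Y" "U \<subseteq> Y" "y \<in> Y" "y \<notin> U" "card Y = q * card U"
  shows "adjoin U y = Y"
proof (rule card_subset_eq)
  have "finite U" using assms finite_subset by blast
  thus "card (adjoin U y) = card Y" using card_adjoin assms by simp
qed (use assms adjoin_minimal in auto)

text \<open>For a subspace U of H these are the points of the projective space of H/U. Dimensions
  are expressed through cardinalities throughout.\<close>

definition covers :: "'v set \<Rightarrow> 'v set \<Rightarrow> 'v set set" where
  "covers U H = {Y. subspace Y \<and> U \<subseteq> Y \<and> Y \<subseteq> H \<and> card Y = q * card U}"

lemma finite_covers: "finite H \<Longrightarrow> finite (covers U H)"
  unfolding covers_def by (rule finite_subset[of _ "Pow H"]) auto

lemma card_pos_subspace: "finite U \<Longrightarrow> subspace U \<Longrightarrow> 0 < card U"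
  using subspace_0 by (auto simp: card_gt_0_iff)

text \<open>Each vector y of H outside U lies in exactly one cover, namely
  \<open>adjoin U y\<close>, and each cover has (q - 1) * |U| vectors outside U. So the sets Y - U
  partition H - U.\<close>

lemma card_covers:
  assumes "subspace U" "subspace H" "finite H" "U \<subseteq> H" "card H = q ^ e * card U"
  shows "(q - 1) * card (covers U H) = q ^ e - 1"
proof -
  have fX: "finite U" using assms finite_subset by blast
  have U0: "0 < card U" by (rule card_pos_subspace) fact+
  have U: "H - U = (\<Union>Y\<in>covers U H. Y - U)"
  proof -
    have "adjoin U y \<in> covers U H" if "y \<in> H - U" for y
      unfolding covers_def using that assms fX adjoin_minimal[of H U y] subset_adjoin[of U y]
      by (simp add: card_adjoin subspace_adjoin)
    thus ?thesis using mem_adjoin[OF assms(1)] by (fastforce simp: covers_def)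
  qed
  have "card (H - U) = (\<Sum>Y\<in>covers U H. card (Y - U))"
    unfolding U
  proof (rule card_UN_disjoint)
    show "\<forall>Y\<in>covers U H. finite (Y - U)"
      using assms finite_subset by (auto simp: covers_def)
    show "\<forall>Y\<in>covers U H. \<forall>Y'\<in>covers U H. Y \<noteq> Y' \<longrightarrow> (Y - U) \<inter> (Y' - U) = {}"
    proof (intro ballI impI, rule ccontr)
      fix Y Y' assume *: "Y \<in> covers U H" "Y' \<in> covers U H" "Y \<noteq> Y'" "(Y - U) \<inter> (Y' - U) \<noteq> {}"
      then obtain y where "y \<in> Y" "y \<in> Y'" "y \<notin> U" by auto
      moreover have "finite Y" "finite Y'" using * assms finite_subset by (auto simp: covers_def)
      ultimately have "adjoin U y = Y" "adjoin U y = Y'"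
        using * assms by (intro adjoin_eqI; simp add: covers_def)+
      with * show False by simp
    qed
  qed (simp add: finite_covers assms)
  also have "\<dots> = (\<Sum>Y\<in>covers U H. (q - 1) * card U)"
    by (rule sum.cong) (auto simp: covers_def card_Diff_subset fX diff_mult_distrib)
  finally have "card H - card U = card (covers U H) * ((q - 1) * card U)"
    using assms fX by (simp add: card_Diff_subset)
  hence "card U * (q ^ e - 1) = card U * ((q - 1) * card (covers U H))"
    using assms by (simp add: algebra_simps)
  thus ?thesis using U0 by simp
qed

lemma exists_not_mem: "finite Y \<Longrightarrow> U \<subseteq> Y \<Longrightarrow> card U < card Y \<Longrightarrow> \<exists>y. y \<in> Y \<and> y \<notin> U"
  by (metis card_mono finite_subset leD subsetI)

text \<open>These are the hyperplanes of Y/Z. They are counted by enlarging Z, not through the dual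
  space.\<close>

definition hyperplanes :: "'v set \<Rightarrow> 'v set \<Rightarrow> 'v set set" where
  "hyperplanes Z Y = {H. subspace H \<and> Z \<subseteq> H \<and> H \<subseteq> Y \<and> card Y = q * card H}"

lemma finite_hyperplanes: "finite Y \<Longrightarrow> finite (hyperplanes Z Y)"
  unfolding hyperplanes_def by (rule finite_subset[of _ "Pow Y"]) auto

text \<open>Let z lie outside the span of Z and y. A hyperplane without y spans Y together with y,
  so it contains some z + s*y, and only one of them because the difference of two is a multiple of
  y. Sorting the hyperplanes by s replaces Z by q subspaces that are q times as large and still
  avoid y.\<close>

lemma card_hyperplanes_avoiding:
  assumes "subspace Z" "subspace Y" "finite Y" "Z \<subseteq> Y" "card Y = q ^ Suc e * card Z"
    "y \<in> Y" "y \<notin> Z"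
  shows "card {H \<in> hyperplanes Z Y. y \<notin> H} = q ^ e"
  using assms
proof (induction e arbitrary: Z)
  case 0
  have fZ: "finite Z" using 0 finite_subset by blast
  have "{H \<in> hyperplanes Z Y. y \<notin> H} = {Z}"
  proof (intro equalityI subsetI)
    fix H assume "H \<in> {H \<in> hyperplanes Z Y. y \<notin> H}"
    hence H: "Z \<subseteq> H" "H \<subseteq> Y" "card Y = q * card H" by (auto simp: hyperplanes_def)
    with 0 q_gt_1 have "card H = card Z" by simp
    with H 0 show "H \<in> {Z}" using card_subset_eq[of H Z] finite_subset[of H Y] by fastforce
  qed (use 0 in \<open>auto simp: hyperplanes_def\<close>)
  thus ?case by simp
next
  case (Suc e)
  have fZ: "finite Z" using Suc.prems finite_subset by blast
  have Z0: "0 < card Z" by (rule card_pos_subspace) (use fZ Suc.prems in auto)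
  let ?A = "\<lambda>Z. {H \<in> hyperplanes Z Y. y \<notin> H}"
  have cA: "card (adjoin Z y) = q * card Z" using card_adjoin fZ Suc.prems by simp
  have sA: "subspace (adjoin Z y)" using subspace_adjoin Suc.prems by simp
  have lt: "card (adjoin Z y) < card Y"
    using Z0 q_gt_1 one_less_power[OF q_gt_1, of "Suc e"] unfolding cA Suc.prems by simp
  obtain z where z: "z \<in> Y" "z \<notin> adjoin Z y"
    using exists_not_mem[OF _ _ lt] adjoin_minimal Suc.prems by blast
  let ?Z = "\<lambda>s. adjoin Z (z + s *s y)"
  have zZ: "z + s *s y \<notin> Z" for s
  proof
    assume "z + s *s y \<in> Z"
    hence "z - (- s) *s y \<in> Z" by simp
    with z show False unfolding adjoin_iff by blast
  qed
  have zY: "z + s *s y \<in> Y" for s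
    using z Suc.prems by (auto intro!: subspace_add subspace_scale)
  have IH: "card (?A (?Z s)) = q ^ e" for s
  proof (rule Suc.IH)
    show "subspace (?Z s)" using subspace_adjoin Suc.prems by simp
    show "?Z s \<subseteq> Y" using adjoin_minimal Suc.prems zY by simp
    show "card Y = q ^ Suc e * card (?Z s)"
      using card_adjoin(1)[OF _ fZ zZ] Suc.prems by simp
    show "y \<notin> ?Z s"
    proof
      assume "y \<in> ?Z s"
      then obtain t where t: "y - t *s (z + s *s y) \<in> Z" by (auto simp: adjoin_iff)
      have "t \<noteq> 0" using t Suc.prems by auto
      moreover have "t *s (z + s *s y) - y \<in> Z" using t Suc.prems(1) subspace_neg by fastforce
      hence "t *s (z - (inverse t - s) *s y) \<in> Z" using \<open>t \<noteq> 0\<close>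
        by (simp add: algebra_simps scale_right_diff_distrib)
      ultimately have "z - (inverse t - s) *s y \<in> Z" using Suc.prems subspace_scale_cancel by blast
      with z show False by (auto simp: adjoin_iff)
    qed
  qed (use Suc.prems in auto)
  have U: "?A Z = (\<Union>s. ?A (?Z s))"
  proof (intro equalityI subsetI)
    fix H assume "H \<in> ?A Z"
    hence H: "subspace H" "Z \<subseteq> H" "H \<subseteq> Y" "card Y = q * card H" "y \<notin> H"
      by (auto simp: hyperplanes_def)
    have "adjoin H y = Y" using H Suc.prems by (intro adjoin_eqI) auto
    then obtain s where "z - s *s y \<in> H" using z by (auto simp: adjoin_iff)
    hence "?Z (- s) \<subseteq> H" using H by (intro adjoin_minimal) auto
    hence "H \<in> ?A (?Z (- s))" using H by (simp add: hyperplanes_def)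
    thus "H \<in> (\<Union>s. ?A (?Z s))" by blast
  next
    fix H assume "H \<in> (\<Union>s. ?A (?Z s))"
    thus "H \<in> ?A Z" using subset_adjoin by (auto simp: hyperplanes_def)
  qed
  have "card (?A Z) = (\<Sum>s\<in>UNIV. card (?A (?Z s)))"
    unfolding U
  proof (rule card_UN_disjoint)
    show "\<forall>s\<in>UNIV. \<forall>t\<in>UNIV. s \<noteq> t \<longrightarrow> ?A (?Z s) \<inter> ?A (?Z t) = {}"
    proof (intro ballI impI, rule ccontr)
      fix s t assume "s \<noteq> t" "?A (?Z s) \<inter> ?A (?Z t) \<noteq> {}"
      then obtain H where H: "subspace H" "?Z s \<subseteq> H" "?Z t \<subseteq> H" "y \<notin> H"
        by (auto simp: hyperplanes_def)
      hence "z + s *s y \<in> H" "z + t *s y \<in> H" using mem_adjoin Suc.prems(1) by blast+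
      hence "(s - t) *s y \<in> H" using subspace_diff[OF H(1)] by (fastforce simp: algebra_simps)
      thus False using \<open>s \<noteq> t\<close> H scale_mem_iff by simp
    qed
  qed (use Suc.prems in \<open>auto simp: finite_hyperplanes\<close>)
  thus ?case unfolding IH by (simp add: q_eq[symmetric])
qed

text \<open>Fix y outside Z. The hyperplanes through y are those over \<open>adjoin Z y\<close>, and
  q^e avoid y. This gives (q^e - 1) + (q - 1) * q^e = q^(e+1) - 1.\<close>

lemma card_hyperplanes:
  assumes "subspace Z" "subspace Y" "finite Y" "Z \<subseteq> Y" "card Y = q ^ e * card Z"
  shows "(q - 1) * card (hyperplanes Z Y) = q ^ e - 1"
  using assms
proof (induction e arbitrary: Z)
  case 0
  have fZ: "finite Z" using 0 finite_subset by blast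
  have "H \<notin> hyperplanes Z Y" for H
  proof
    assume "H \<in> hyperplanes Z Y"
    hence H: "Z \<subseteq> H" "H \<subseteq> Y" "card Y = q * card H" by (auto simp: hyperplanes_def)
    hence "card Y \<le> card H" using 0 card_mono[of H Z] finite_subset[of H Y] by auto
    moreover have "0 < card Y" using 0 card_pos_subspace by blast
    ultimately show False using H q_gt_1 by (cases "card H = 0") auto
  qed
  hence "hyperplanes Z Y = {}" by blast
  thus ?case by simp
next
  case (Suc e)
  have fZ: "finite Z" using Suc.prems finite_subset by blast
  have Z0: "0 < card Z" by (rule card_pos_subspace) (use fZ Suc.prems in auto)
  obtain y where y: "y \<in> Y" "y \<notin> Z"
    using exists_not_mem[of Y Z] Suc.prems one_less_power[OF q_gt_1, of "Suc e"] Z0 by force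
  have "card (adjoin Z y) = q * card Z" using card_adjoin fZ Suc.prems y by simp
  hence "(q - 1) * card (hyperplanes (adjoin Z y) Y) = q ^ e - 1"
    using Suc.prems y by (intro Suc.IH) (auto intro: subspace_adjoin dest: subsetD[OF adjoin_minimal, rotated -1])
  moreover have "hyperplanes Z Y = hyperplanes (adjoin Z y) Y \<union> {H \<in> hyperplanes Z Y. y \<notin> H}"
    using adjoin_minimal subset_adjoin[of Z y] unfolding hyperplanes_def by blast
  moreover have "hyperplanes (adjoin Z y) Y \<inter> {H \<in> hyperplanes Z Y. y \<notin> H} = {}"
    using mem_adjoin Suc.prems by (fastforce simp: hyperplanes_def)
  ultimately have "card (hyperplanes Z Y) = card (hyperplanes (adjoin Z y) Y) + q ^ e"
    using card_hyperplanes_avoiding[of Z Y e y] Suc.prems y finite_hyperplanes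
    by (metis (no_types, lifting) card_Un_disjoint finite_Un)
  thus ?case using \<open>(q - 1) * card (hyperplanes (adjoin Z y) Y) = q ^ e - 1\<close> q_gt_1
    by (simp add: algebra_simps)
qed

end

section \<open>Gaussian binomial coefficients and the Cauchy identity\<close>

fun q_binomial :: "nat \<Rightarrow> nat \<Rightarrow> nat \<Rightarrow> nat" where
  "q_binomial q n 0 = 1"
| "q_binomial q 0 (Suc k) = 0"
| "q_binomial q (Suc n) (Suc k) = q ^ Suc k * q_binomial q n (Suc k) + q_binomial q n k"

lemma q_binomial_eq_0: "n < k \<Longrightarrow> q_binomial q n k = 0"
  by (induction q n k rule: q_binomial.induct) auto

text \<open>The quotient rule for Gaussian binomials, multiplied by q^k to avoid the exponent n - k.
  It thus holds for k > n too, where both sides vanish, and the induction can use it at two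
  consecutive values of k.\<close>

lemma q_binomial_Suc_right:
  "int q ^ k * (int q ^ Suc k - 1) * int (q_binomial q n (Suc k)) =
     (int q ^ n - int q ^ k) * int (q_binomial q n k)"
proof (induction n arbitrary: k)
  case 0
  show ?case by (cases k) auto
next
  case (Suc n)
  show ?case
  proof (cases k)
    case 0
    have "int q ^ 0 * (int q ^ Suc 0 - 1) * int (q_binomial q n (Suc 0)) = int q ^ n - 1"
      using Suc.IH[of 0] by simp
    hence "(int q - 1) * (int q * int (q_binomial q n (Suc 0))) = int q * (int q ^ n - 1)" by simp
    thus ?thesis using 0 by (simp add: algebra_simps)
  next
    case (Suc k')
    let ?Q = "int q" and ?B = "\<lambda>k. int (q_binomial q n k)"
    have 1: "?Q ^ k' * (?Q * ?Q ^ k' - 1) * ?B (Suc k') = (?Q ^ n - ?Q ^ k') * ?B k'"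
      using Suc.IH[of k'] by simp
    have 2: "?Q * ?Q ^ k' * (?Q * (?Q * ?Q ^ k') - 1) * ?B (Suc (Suc k')) =
        (?Q ^ n - ?Q * ?Q ^ k') * ?B (Suc k')"
      using Suc.IH[of "Suc k'"] by simp
    show ?thesis
      unfolding Suc q_binomial.simps of_nat_add of_nat_mult of_nat_power power_Suc
      using arg_cong[OF 1, of "\<lambda>t. ?Q * t"] arg_cong[OF 2, of "\<lambda>t. ?Q * (?Q * ?Q ^ k') * t"]
      by (simp add: algebra_simps)
  qed
qed

lemma q_binomial_Suc_right_diff:
  assumes "k \<le> n"
  shows "(q ^ Suc k - 1) * q_binomial q n (Suc k) = (q ^ (n - k) - 1) * q_binomial q n k"
\<comment> \<open>Cancelling q^k and reading q^i - 1 as an integer difference both fail for q =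
  0.\<close>
proof (cases "q = 0")
  case True
  with assms show ?thesis
  proof (cases "k = n")
    case False
    obtain m where "n - k = Suc m" using assms False by (metis diff_is_0_eq le_antisym old.nat.exhaust)
    thus ?thesis using True by simp
  qed (simp add: q_binomial_eq_0)
next
  case False
  have "int q ^ k * ((int q ^ Suc k - 1) * int (q_binomial q n (Suc k))) =
      int q ^ k * ((int q ^ (n - k) - 1) * int (q_binomial q n k))"
  proof -
    have e: "int q ^ n = int q ^ k * int q ^ (n - k)" using assms by (simp flip: power_add)
    show ?thesis using q_binomial_Suc_right[of q k n] unfolding e by (simp only: algebra_simps)
  qed
  hence "(int q ^ Suc k - 1) * int (q_binomial q n (Suc k)) = (int q ^ (n - k) - 1) * int (q_binomial q n k)"
    using False by simp
  moreover have "int (q ^ i - 1) = int q ^ i - 1" for i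
    using False by (simp add: of_nat_diff)
  ultimately show ?thesis by (metis of_nat_eq_iff of_nat_mult)
qed

text \<open>After Pascal's rule the i-th term for n appears twice in the sum for n + 1, once with
  the factor q^i * x and once with 1 - q^i * x, and these add up to 1. The identity later inverts a
  sum over the subspaces of a fixed space.\<close>

lemma q_binomial_cauchy:
  fixes x :: "'a :: comm_ring_1"
  shows "(\<Sum>i\<le>n. of_nat (q_binomial q n i) * x ^ (n - i) * (\<Prod>k<i. 1 - of_nat q ^ k * x)) = 1"
proof (induction n)
  case (Suc n)
  let ?P = "\<lambda>i. \<Prod>k<i. 1 - of_nat q ^ k * x" and ?B = "\<lambda>i. of_nat (q_binomial q n i) :: 'a"
  \<comment> \<open>At i = n + 1 the truncated exponents disagree, but there the coefficient is
    0.\<close>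
  have 1: "?B i * x ^ (Suc n - i) = ?B i * (x * x ^ (n - i))" for i
    by (cases "i \<le> n") (auto simp: Suc_diff_le q_binomial_eq_0)
  have "(\<Sum>i\<le>Suc n. of_nat (q_binomial q (Suc n) i) * x ^ (Suc n - i) * ?P i) =
      x ^ Suc n + (\<Sum>i\<le>n. (of_nat q ^ Suc i * ?B (Suc i) + ?B i) * x ^ (n - i) * ?P (Suc i))"
    by (subst sum.atMost_Suc_shift) simp
  also have "\<dots> = (x ^ Suc n + (\<Sum>i\<le>n. of_nat q ^ Suc i * (?B (Suc i) * x ^ (Suc n - Suc i)) * ?P (Suc i))) +
      (\<Sum>i\<le>n. ?B i * x ^ (n - i) * ?P (Suc i))"
    unfolding add.assoc sum.distrib[symmetric] diff_Suc_Suc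
    by (intro arg_cong[of _ _ "(+) _"] sum.cong refl) (simp only: distrib_right mult.assoc)
  also have "x ^ Suc n + (\<Sum>i\<le>n. of_nat q ^ Suc i * (?B (Suc i) * x ^ (Suc n - Suc i)) * ?P (Suc i)) =
      (\<Sum>i\<le>Suc n. of_nat q ^ i * (?B i * x ^ (Suc n - i)) * ?P i)"
    by (subst sum.atMost_Suc_shift) simp
  also have "\<dots> = (\<Sum>i\<le>n. of_nat q ^ i * ?B i * x * x ^ (n - i) * ?P i)"
    unfolding 1 by (simp add: q_binomial_eq_0 mult.assoc)
  also have "\<dots> + (\<Sum>i\<le>n. ?B i * x ^ (n - i) * ?P (Suc i)) = (\<Sum>i\<le>n. ?B i * x ^ (n - i) * ?P i)"
    by (simp add: algebra_simps flip: sum.distrib)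
  finally show ?case using Suc.IH by simp
qed simp

context finite_field_space
begin

definition subspaces_of_card :: "'v set \<Rightarrow> nat \<Rightarrow> 'v set set" where
  "subspaces_of_card W c = {U. subspace U \<and> U \<subseteq> W \<and> card U = c}"

lemma finite_subspaces_of_card: "finite W \<Longrightarrow> finite (subspaces_of_card W c)"
  unfolding subspaces_of_card_def by (rule finite_subset[of _ "Pow W"]) auto

text \<open>The factor c takes the denominator q - 1 of the numbers of covers and hyperplanes, which
  keeps the count of incidences within the natural numbers.\<close>

lemma double_count:
  assumes "finite A" "finite B" "\<And>a. a \<in> A \<Longrightarrow> card {b \<in> B. R a b} * c = k"
    "\<And>b. b \<in> B \<Longrightarrow> card {a \<in> A. R a b} * c = l"
  shows "card A * k = card B * (l :: nat)"
proof -
  have "card A * k = (\<Sum>a\<in>A. card {b \<in> B. R a b}) * c"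
    using assms(3) by (simp add: sum_distrib_right)
  also have "(\<Sum>a\<in>A. card {b \<in> B. R a b}) = (\<Sum>b\<in>B. card {a \<in> A. R a b})"
    by (rule sum_multicount_gen) (use assms in auto)
  also have "\<dots> * c = card B * l"
    using assms(4) by (simp add: sum_distrib_right)
  finally show ?thesis .
qed

text \<open>Incidences between subspaces of dimensions k and k + 1 are counted from both ends: each
  smaller one has (q^(n-k) - 1)/(q - 1) covers, each larger one (q^(k+1) - 1)/(q - 1) hyperplanes.
  The resulting quotient is that of consecutive Gaussian binomials.\<close>

lemma card_subspaces:
  assumes "subspace W" "finite W" "card W = q ^ n"
  shows "card (subspaces_of_card W (q ^ k)) = q_binomial q n k"
proof (induction k)
  case 0
  have "subspaces_of_card W (q ^ 0) = {{0}}"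
    using assms subspace_0 by (auto simp: subspaces_of_card_def card_1_singleton_iff)
  thus ?case by simp
next
  case (Suc k)
  show ?case
  proof (cases "k < n")
    case False
    have "card U \<le> q ^ n" if "U \<subseteq> W" for U using card_mono[OF assms(2) that] assms by simp
    moreover have "q ^ n < q ^ Suc k" using False q_gt_1 by (intro power_strict_increasing) auto
    ultimately have "U \<notin> subspaces_of_card W (q ^ Suc k)" for U
      unfolding subspaces_of_card_def by (metis (mono_tags, lifting) mem_Collect_eq not_le)
    hence "subspaces_of_card W (q ^ Suc k) = {}" by blast
    thus ?thesis using False by (simp add: q_binomial_eq_0)
  next
    case True
    have "card (subspaces_of_card W (q ^ k)) * (q ^ (n - k) - 1) =
        card (subspaces_of_card W (q ^ Suc k)) * (q ^ Suc k - 1)"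
    proof (rule double_count[where R = "(\<subseteq>)" and c = "q - 1"])
      fix U assume "U \<in> subspaces_of_card W (q ^ k)"
      hence U: "subspace U" "U \<subseteq> W" "card U = q ^ k" by (auto simp: subspaces_of_card_def)
      hence "(q - 1) * card (covers U W) = q ^ (n - k) - 1"
        using assms True by (intro card_covers) (auto simp flip: power_add)
      moreover have "{Y \<in> subspaces_of_card W (q ^ Suc k). U \<subseteq> Y} = covers U W"
        using U by (auto simp: subspaces_of_card_def covers_def)
      ultimately show "card {Y \<in> subspaces_of_card W (q ^ Suc k). U \<subseteq> Y} * (q - 1) = q ^ (n - k) - 1"
        by (simp add: mult.commute)
    next
      fix Y assume "Y \<in> subspaces_of_card W (q ^ Suc k)"
      hence Y: "subspace Y" "Y \<subseteq> W" "card Y = q ^ Suc k" by (auto simp: subspaces_of_card_def)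
      hence "(q - 1) * card (hyperplanes {0} Y) = q ^ Suc k - 1"
        using assms finite_subset subspace_0 by (intro card_hyperplanes) auto
      moreover have "{U \<in> subspaces_of_card W (q ^ k). U \<subseteq> Y} = hyperplanes {0} Y"
        using Y q_gt_1 subspace_0 by (auto simp: subspaces_of_card_def hyperplanes_def)
      ultimately show "card {U \<in> subspaces_of_card W (q ^ k). U \<subseteq> Y} * (q - 1) = q ^ Suc k - 1"
        by (simp add: mult.commute)
    qed (use assms finite_subspaces_of_card in auto)
    hence "(q ^ Suc k - 1) * card (subspaces_of_card W (q ^ Suc k)) =
        (q ^ Suc k - 1) * q_binomial q n (Suc k)"
      using q_binomial_Suc_right_diff[OF less_imp_le[OF True], of q] Suc.IH by (metis mult.commute)
    moreover have "0 < q ^ Suc k - 1" using one_less_power[OF q_gt_1, of "Suc k"] by simp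
    ultimately show ?thesis by simp
  qed
qed

end

section \<open>Injective matrices and the order of the general linear group\<close>

definition injective_mats :: "nat \<Rightarrow> nat \<Rightarrow> 'k :: field mat set" where
  "injective_mats n i =
     {A \<in> carrier_mat n i. \<forall>v\<in>carrier_vec i. A *\<^sub>v v = 0\<^sub>v n \<longrightarrow> v = 0\<^sub>v i}"

definition append_col :: "'k mat \<Rightarrow> 'k vec \<Rightarrow> 'k :: field mat" where
  "append_col A w = mat (dim_row A) (Suc (dim_col A)) (\<lambda>(r, c). if c < dim_col A then A $$ (r, c) else w $ r)"

lemma append_col_mult:
  assumes "A \<in> carrier_mat n i" "w \<in> carrier_vec n" "v \<in> carrier_vec (Suc i)"
  shows "append_col A w *\<^sub>v v = A *\<^sub>v vec i (\<lambda>j. v $ j) + (v $ i) \<cdot>\<^sub>v w"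
proof (rule eq_vecI)
  fix r assume "r < dim_vec (A *\<^sub>v vec i (\<lambda>j. v $ j) + (v $ i) \<cdot>\<^sub>v w)"
  hence "r < n" using assms by simp
  thus "(append_col A w *\<^sub>v v) $ r = (A *\<^sub>v vec i (\<lambda>j. v $ j) + (v $ i) \<cdot>\<^sub>v w) $ r"
    using assms by (simp add: append_col_def scalar_prod_def mult.commute)
qed (use assms in \<open>simp add: append_col_def\<close>)

lemma mult_mat_vec_diff:
  fixes A :: "'k :: field mat"
  assumes "A \<in> carrier_mat n i" "u \<in> carrier_vec i" "v \<in> carrier_vec i"
  shows "A *\<^sub>v (u - v) = A *\<^sub>v u - A *\<^sub>v v"
  using assms by (intro eq_vecI) (auto simp: scalar_prod_minus_distrib[of _ i])

text \<open>A kernel vector of the extended matrix with non-zero last entry expresses w through the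
  columns of A; one with last entry 0 is a kernel vector of A.\<close>

lemma append_col_injective_iff:
  fixes A :: "'k :: field mat"
  assumes "A \<in> carrier_mat n i" "w \<in> carrier_vec n"
  shows "append_col A w \<in> injective_mats n (Suc i) \<longleftrightarrow>
           A \<in> injective_mats n i \<and> w \<notin> (*\<^sub>v) A ` carrier_vec i"
proof
  assume L: "append_col A w \<in> injective_mats n (Suc i)"
  have "v = 0\<^sub>v i" if v: "v \<in> carrier_vec i" "A *\<^sub>v v = 0\<^sub>v n" for v
  proof -
    let ?u = "vec (Suc i) (\<lambda>j. if j < i then v $ j else 0)"
    have e: "vec i (\<lambda>j. ?u $ j) = v" using v by (intro eq_vecI) auto
    have "append_col A w *\<^sub>v ?u = 0\<^sub>v n"
      by (subst append_col_mult[OF assms], simp, subst e) (use v assms in auto)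
    hence u: "?u = 0\<^sub>v (Suc i)" using L by (auto simp: injective_mats_def)
    show ?thesis
    proof (rule eq_vecI)
      fix j assume "j < dim_vec (0\<^sub>v i :: 'k vec)"
      moreover have "?u $ j = 0\<^sub>v (Suc i) $ j" using u by simp
      ultimately show "v $ j = 0\<^sub>v i $ j" by simp
    qed (use v in auto)
  qed
  moreover have False if "v \<in> carrier_vec i" "w = A *\<^sub>v v" for v
  proof -
    \<comment> \<open>The entry -1 at the new column turns w = A v into a kernel vector.\<close>
    let ?u = "vec (Suc i) (\<lambda>j. if j < i then v $ j else - 1)"
    have e: "vec i (\<lambda>j. ?u $ j) = v" using that by (intro eq_vecI) auto
    have "append_col A w *\<^sub>v ?u = 0\<^sub>v n"
      by (subst append_col_mult[OF assms], simp, subst e) (use that assms in \<open>auto intro!: eq_vecI\<close>)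
    hence "?u = 0\<^sub>v (Suc i)" using L by (auto simp: injective_mats_def)
    hence "?u $ i = 0\<^sub>v (Suc i) $ i" by simp
    thus False by simp
  qed
  ultimately show "A \<in> injective_mats n i \<and> w \<notin> (*\<^sub>v) A ` carrier_vec i"
    using assms by (auto simp: injective_mats_def)
next
  assume R: "A \<in> injective_mats n i \<and> w \<notin> (*\<^sub>v) A ` carrier_vec i"
  have "v = 0\<^sub>v (Suc i)" if v: "v \<in> carrier_vec (Suc i)" "append_col A w *\<^sub>v v = 0\<^sub>v n" for v
  proof -
    let ?u = "vec i (\<lambda>j. v $ j)"
    have eq: "A *\<^sub>v ?u + (v $ i) \<cdot>\<^sub>v w = 0\<^sub>v n" using append_col_mult[OF assms v(1)] v by simp
    have eq': "(A *\<^sub>v ?u) $ r + v $ i * w $ r = 0" if "r < n" for r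
    proof -
      have "(A *\<^sub>v ?u + (v $ i) \<cdot>\<^sub>v w) $ r = 0" using eq that by simp
      thus ?thesis using that assms by simp
    qed
    have vi: "v $ i = 0"
    proof (rule ccontr)
      assume nz: "v $ i \<noteq> 0"
      have "w = A *\<^sub>v ((- inverse (v $ i)) \<cdot>\<^sub>v ?u)"
      proof (rule eq_vecI)
        fix r assume "r < dim_vec (A *\<^sub>v ((- inverse (v $ i)) \<cdot>\<^sub>v ?u))"
        hence r: "r < n" using assms by simp
        have "(A *\<^sub>v ((- inverse (v $ i)) \<cdot>\<^sub>v ?u)) $ r = - inverse (v $ i) * (A *\<^sub>v ?u) $ r"
          using r assms by simp
        also have "\<dots> = inverse (v $ i) * (v $ i * w $ r)"
        proof -
          have "(A *\<^sub>v ?u) $ r = - (v $ i * w $ r)" using eq'[OF r] by (simp add: eq_neg_iff_add_eq_0)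
          thus ?thesis by simp
        qed
        also have "\<dots> = w $ r" using nz by simp
        finally show "w $ r = (A *\<^sub>v ((- inverse (v $ i)) \<cdot>\<^sub>v ?u)) $ r" by simp
      qed (use assms in auto)
      thus False using R by (auto simp: image_iff)
    qed
    have "A *\<^sub>v ?u = 0\<^sub>v n"
      using eq' vi assms by (intro eq_vecI) auto
    hence u: "?u = 0\<^sub>v i" using R by (auto simp: injective_mats_def)
    show ?thesis
    proof (rule eq_vecI)
      fix j assume "j < dim_vec (0\<^sub>v (Suc i) :: 'k vec)"
      moreover have "j < i \<Longrightarrow> ?u $ j = 0\<^sub>v i $ j" using u by simp
      ultimately show "v $ j = 0\<^sub>v (Suc i) $ j" using vi by (cases "j = i") auto
    qed (use v in auto)
  qed
  moreover have "append_col A w \<in> carrier_mat n (Suc i)" using assms by (simp add: append_col_def)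
  ultimately show "append_col A w \<in> injective_mats n (Suc i)"
    by (auto simp: injective_mats_def)
qed

lemma bij_append_col:
  "bij_betw (\<lambda>(A, w). append_col A w) (carrier_mat n i \<times> carrier_vec n) (carrier_mat n (Suc i))"
proof (rule bij_betw_byWitness[where f' = "\<lambda>M. (mat n i (\<lambda>rc. M $$ rc), vec n (\<lambda>r. M $$ (r, i)))"])
  show "\<forall>a\<in>carrier_mat n i \<times> carrier_vec n. (\<lambda>M. (mat n i (\<lambda>rc. M $$ rc), vec n (\<lambda>r. M $$ (r, i))))
      (case a of (A, w) \<Rightarrow> append_col A w) = a"
    by (auto simp: append_col_def intro!: eq_matI eq_vecI)
  show "\<forall>a'\<in>carrier_mat n (Suc i). (case (mat n i (\<lambda>rc. a' $$ rc), vec n (\<lambda>r. a' $$ (r, i))) of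
      (A, w) \<Rightarrow> append_col A w) = a'"
    by (auto simp: append_col_def less_Suc_eq intro!: eq_matI)
qed (auto simp: append_col_def)

lemma finite_carrier_mat': "finite (carrier_mat n i :: 'k :: {field, finite} mat set)"
proof (induction i)
  case 0
  have "(carrier_mat n 0 :: 'k mat set) \<subseteq> {mat n 0 (\<lambda>_. 0)}" by (auto intro!: eq_matI)
  thus ?case using finite_subset by blast
next
  case (Suc i)
  thus ?case using bij_betw_finite[OF bij_append_col[of n i]] by auto
qed

text \<open>Columns are chosen one at a time, each outside the span of the earlier ones; rectangular
  matrices make this an induction on i. For i > n the factor at t = n makes the product 0.\<close>

lemma card_injective_mats:
  "card (injective_mats n i :: 'k :: {field, finite} mat set) = (\<Prod>t<i. CARD('k) ^ n - CARD('k) ^ t)"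
proof (induction i)
  case 0
  have "(injective_mats n 0 :: 'k mat set) = {mat n 0 (\<lambda>_. 0)}"
    by (auto simp: injective_mats_def intro!: eq_matI eq_vecI)
  thus ?case by simp
next
  case (Suc i)
  let ?I = "\<lambda>A :: 'k mat. (*\<^sub>v) A ` carrier_vec i"
  let ?S = "SIGMA A : injective_mats n i. carrier_vec n - ?I A"
  have sub: "?S \<subseteq> carrier_mat n i \<times> carrier_vec n" by (auto simp: injective_mats_def)
  have cI: "card (?I A) = CARD('k) ^ i" "?I A \<subseteq> carrier_vec n" if A: "A \<in> injective_mats n i" for A
  proof -
    have c: "A \<in> carrier_mat n i" using A by (simp add: injective_mats_def)
    have "inj_on ((*\<^sub>v) A) (carrier_vec i)"
    proof (rule inj_onI)
      fix u v assume uv: "u \<in> carrier_vec i" "v \<in> carrier_vec i" "A *\<^sub>v u = A *\<^sub>v v"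
      hence "A *\<^sub>v (u - v) = 0\<^sub>v n" using mult_mat_vec_diff[OF c] c by simp
      hence "u - v = 0\<^sub>v i" using A uv by (auto simp: injective_mats_def)
      hence "u $ j - v $ j = 0" if "j < i" for j using uv that
        by (metis carrier_vecD index_minus_vec(1) index_zero_vec(1))
      thus "u = v" using uv by (intro eq_vecI) auto
    qed
    thus "card (?I A) = CARD('k) ^ i" by (simp add: card_image card_carrier_vec)
    show "?I A \<subseteq> carrier_vec n" using c by auto
  qed
  have "(\<lambda>(A, w). append_col A w) ` ?S = injective_mats n (Suc i)"
  proof (intro equalityI subsetI)
    fix M :: "'k mat" assume M: "M \<in> injective_mats n (Suc i)"
    hence "M \<in> carrier_mat n (Suc i)" by (simp add: injective_mats_def)
    hence "M \<in> (\<lambda>(A, w). append_col A w) ` (carrier_mat n i \<times> carrier_vec n)"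
      using bij_betw_imp_surj_on[OF bij_append_col[of n i]] by blast
    then obtain A w where "M = append_col A w" "A \<in> carrier_mat n i" "w \<in> carrier_vec n"
      by auto
    thus "M \<in> (\<lambda>(A, w). append_col A w) ` ?S"
      using M append_col_injective_iff[of A n i w] by (intro image_eqI[of _ _ "(A, w)"]) auto
  next
    fix M assume "M \<in> (\<lambda>(A, w). append_col A w) ` ?S"
    then obtain A w where "M = append_col A w" "A \<in> injective_mats n i" "w \<in> carrier_vec n" "w \<notin> ?I A"
      by auto
    moreover from this have "A \<in> carrier_mat n i" by (simp add: injective_mats_def)
    ultimately show "M \<in> injective_mats n (Suc i)" using append_col_injective_iff[of A n i w] by simp
  qed
  hence "bij_betw (\<lambda>(A, w). append_col A w) ?S (injective_mats n (Suc i))"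
    using bij_betw_subset[OF bij_append_col sub] by blast
  hence "card (injective_mats n (Suc i) :: 'k mat set) = card ?S" by (simp add: bij_betw_same_card)
  also have "\<dots> = (\<Sum>A\<in>injective_mats n i. card (carrier_vec n - ?I A))"
    by (rule card_SigmaI) (auto intro: finite_subset[OF _ finite_carrier_mat'] simp: injective_mats_def)
  also have "\<dots> = (\<Sum>A\<in>(injective_mats n i :: 'k mat set). CARD('k) ^ n - CARD('k) ^ i)"
  proof (rule sum.cong[OF refl])
    fix A :: "'k mat" assume A: "A \<in> injective_mats n i"
    have "card (carrier_vec n - ?I A) = card (carrier_vec n :: 'k vec set) - card (?I A)"
      using cI(2)[OF A] by (intro card_Diff_subset) (auto intro: finite_subset)
    thus "card (carrier_vec n - ?I A) = CARD('k) ^ n - CARD('k) ^ i"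
      using cI(1)[OF A] by (simp add: card_carrier_vec)
  qed
  finally show ?case using Suc.IH by (simp add: mult.commute)
qed

lemma card_GL_eq: "card_GL TYPE('p :: prime_card) l = (\<Prod>t<l. CARD('p) ^ l - CARD('p) ^ t)"
proof -
  have "{A :: 'p mod_ring mat. A \<in> carrier_mat l l \<and> invertible_mat A} = injective_mats l l"
  proof (intro equalityI subsetI)
    fix A :: "'p mod_ring mat" assume A: "A \<in> {A. A \<in> carrier_mat l l \<and> invertible_mat A}"
    then obtain B where B: "B * A = 1\<^sub>m (dim_row B)" "A * B = 1\<^sub>m l"
      by (auto simp: invertible_mat_def inverts_mat_def)
    have "dim_col (B * A) = dim_row B" "dim_col (A * B) = l" using B by (metis index_one_mat(3))+
    hence "dim_row B = l" "dim_col B = l" using A by auto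
    hence Bc: "B \<in> carrier_mat l l" and BA: "B * A = 1\<^sub>m l" using B by auto
    have "v = 0\<^sub>v l" if "v \<in> carrier_vec l" "A *\<^sub>v v = 0\<^sub>v l" for v
    proof -
      have "v = B *\<^sub>v (A *\<^sub>v v)"
        using that A Bc BA by (subst assoc_mult_mat_vec[symmetric, of _ l l _ l]) auto
      thus ?thesis using that Bc by auto
    qed
    thus "A \<in> injective_mats l l" using A by (simp add: injective_mats_def)
  next
    fix A :: "'p mod_ring mat" assume A: "A \<in> injective_mats l l"
    hence c: "A \<in> carrier_mat l l" by (simp add: injective_mats_def)
    have "det A \<noteq> 0" using A det_0_iff_vec_prod_zero_field[OF c] by (auto simp: injective_mats_def)
    then obtain B where "B \<in> carrier_mat l l" "B * A = 1\<^sub>m l" "A * B = 1\<^sub>m l"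
      using det_non_zero_imp_unit[OF c, of "()"] by (auto simp: Units_def ring_mat_def)
    thus "A \<in> {A. A \<in> carrier_mat l l \<and> invertible_mat A}"
      using c by (auto simp: invertible_mat_def inverts_mat_def)
  qed
  thus ?thesis by (simp add: card_GL_def card_injective_mats)
qed

definition GL_order :: "nat \<Rightarrow> nat \<Rightarrow> nat" where
  "GL_order q l = (\<Prod>t<l. q ^ l - q ^ t)"

text \<open>The factor at t = 0 is q^(l+1) - 1, and every other factor is q times a factor of
  \<open>GL_order q l\<close>. In this form the recursion combines with two uses of
  \<open>q_binomial_Suc_right\<close>.\<close>

lemma GL_order_Suc: "GL_order q (Suc l) = q ^ l * (q ^ Suc l - 1) * GL_order q l"
proof -
  have "GL_order q (Suc l) = (q ^ Suc l - 1) * (\<Prod>t<l. q * (q ^ l - q ^ t))"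
    by (simp add: GL_order_def prod.lessThan_Suc_shift diff_mult_distrib2 del: prod.lessThan_Suc)
  thus ?thesis by (simp add: prod.distrib GL_order_def)
qed

context finite_field_space
begin

lemma card_eq_image_times_kernel:
  fixes f :: "'v \<Rightarrow> 'b :: ab_group_add"
  assumes "subspace U" "finite U" "\<And>x y. f (x - y) = f x - f y"
  shows "card U = card (f ` U) * card {x \<in> U. f x = 0}"
proof -
  have f_add: "f (x + y) = f x + f y" for x y
  proof -
    have "f x = f (x + y - y)" by simp
    thus ?thesis unfolding assms(3) by (simp add: algebra_simps)
  qed
  have "card {x \<in> U. f x = b} = card {x \<in> U. f x = 0}" if "b \<in> f ` U" for b
  proof -
    obtain a where a: "a \<in> U" "b = f a" using \<open>b \<in> f ` U\<close> by blast
    have "bij_betw (\<lambda>x. x - a) {x \<in> U. f x = b} {x \<in> U. f x = 0}"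
      by (rule bij_betw_byWitness[where f' = "\<lambda>x. x + a"])
        (use assms a f_add in \<open>auto simp: subspace_diff subspace_add\<close>)
    thus ?thesis by (rule bij_betw_same_card)
  qed
  moreover have "card U = (\<Sum>b\<in>f ` U. card {x \<in> U. f x = b})"
    using assms(2) by (subst card_UN_disjoint[symmetric]) (auto intro: arg_cong[where f = card])
  ultimately show ?thesis by simp
qed

text \<open>If H misses a kernel vector k, then H and k span U, and adding multiples of k does not
  change the image. If H contains the kernel and has the full image, every element of U differs from
  one of H by a kernel vector, so H = U, against the cardinalities.\<close>

lemma hyperplane_image_iff:
  fixes f :: "'v \<Rightarrow> 'b :: ab_group_add"
  assumes "subspace U" "finite U" "\<And>x y. f (x - y) = f x - f y"
    "\<And>c x. f x = 0 \<Longrightarrow> f (c *s x) = 0" "H \<in> hyperplanes Z U"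
  shows "f ` H = f ` U \<longleftrightarrow> \<not> {x \<in> U. f x = 0} \<subseteq> H"
proof
  have H: "subspace H" "H \<subseteq> U" "card U = q * card H"
    using assms by (auto simp: hyperplanes_def)
  show "\<not> {x \<in> U. f x = 0} \<subseteq> H" if eq: "f ` H = f ` U"
  proof
    assume K: "{x \<in> U. f x = 0} \<subseteq> H"
    have "x \<in> H" if x: "x \<in> U" for x
    proof -
      obtain h where h: "h \<in> H" "f x = f h" using eq x by blast
      hence "x - h \<in> {x \<in> U. f x = 0}" using x H assms by (auto intro: subspace_diff)
      hence "x - h + h \<in> H" using K H h by (blast intro: subspace_add)
      thus ?thesis by simp
    qed
    hence "H = U" using H by blast
    with H card_pos_subspace[of U] q_gt_1 assms show False by simp
  qed
  show "f ` H = f ` U" if nK: "\<not> {x \<in> U. f x = 0} \<subseteq> H"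
  proof -
    obtain k where k: "k \<in> U" "f k = 0" "k \<notin> H" using nK by blast
    have ad: "adjoin H k = U" using H assms k by (intro adjoin_eqI) auto
    have "f x \<in> f ` H" if "x \<in> U" for x
    proof -
      have "x \<in> adjoin H k" using that ad by simp
      then obtain s where "x - s *s k \<in> H" by (auto simp: adjoin_iff)
      moreover have "f (x - s *s k) = f x" using assms k by simp
      ultimately show ?thesis by (metis imageI)
    qed
    thus ?thesis using H by blast
  qed
qed

end

section \<open>Subdirect subspaces of a product, counted by codimension\<close>

locale finite_field_space_pair =
  V1: finite_field_space s1 q + V2: finite_field_space s2 q
  for s1 :: "'k :: {field, finite} \<Rightarrow> 'v :: ab_group_add \<Rightarrow> 'v"
    and s2 :: "'k \<Rightarrow> 'w :: ab_group_add \<Rightarrow> 'w" and q :: nat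
begin

definition scale_pair :: "'k \<Rightarrow> 'v \<times> 'w \<Rightarrow> 'v \<times> 'w" where
  "scale_pair c = (\<lambda>(x, y). (s1 c x, s2 c y))"

sublocale P: finite_field_space scale_pair q
  by unfold_locales
    (auto simp: scale_pair_def V1.scale_right_distrib V2.scale_right_distrib
      V1.scale_left_distrib V2.scale_left_distrib V1.q_eq split: prod.splits)

definition subdirect :: "('v \<times> 'w) set \<Rightarrow> nat \<Rightarrow> ('v \<times> 'w) set set" where
  "subdirect D k = {U. P.subspace U \<and> U \<subseteq> D \<and> fst ` U = fst ` D \<and> snd ` U = snd ` D \<and> card U = k}"

lemma subspace_kernels:
  assumes "P.subspace U"
  shows "P.subspace {x \<in> U. fst x = 0}" "P.subspace {x \<in> U. snd x = 0}"
  using assms by (auto simp: P.subspace_def scale_pair_def split: prod.splits)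

text \<open>Here r is the codimension of U in the product of its projections. A hyperplane keeps the
  first projection iff it does not contain K2, and the second iff it does not contain K1.
  Inclusion-exclusion therefore runs over the hyperplanes containing 0, K1, K2 and K1 + K2, where
  the quotients of U have dimensions m + n - r, n, m and r.\<close>

lemma card_subdirect_hyperplanes:
  assumes "P.subspace U" "finite U" "card (fst ` U) = q ^ m" "card (snd ` U) = q ^ n"
    "card U * q ^ r = q ^ (m + n)"
  shows "int (card {H \<in> P.hyperplanes {0} U. fst ` H = fst ` U \<and> snd ` H = snd ` U}) * (int q - 1) * int q ^ r =
           (int q ^ m - int q ^ r) * (int q ^ n - int q ^ r)"
proof -
  have q1: "1 < q" by (rule P.q_gt_1)
  define K1 K2 where "K1 = {x \<in> U. snd x = 0}" and "K2 = {x \<in> U. fst x = 0}"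
  define K where "K = {x + y |x y. x \<in> K1 \<and> y \<in> K2}"
  have K_image: "K = (\<lambda>(x, y). x + y) ` (K1 \<times> K2)" by (force simp: K_def)
  have sub: "P.subspace K1" "P.subspace K2" "K1 \<subseteq> U" "K2 \<subseteq> U" "finite K1" "finite K2"
    using subspace_kernels[OF assms(1)] assms(2) by (auto simp: K1_def K2_def)
  have sK: "P.subspace K"
    unfolding K_def using P.subspace_sums[OF sub(1,2)] .
  have KU: "K \<subseteq> U" using sub assms(1) P.subspace_add unfolding K_def by blast
  have inK: "K1 \<subseteq> K" "K2 \<subseteq> K"
    unfolding K_image using P.subspace_0[OF sub(1)] P.subspace_0[OF sub(2)] by force+
  have K_least: "K \<subseteq> H \<longleftrightarrow> K1 \<subseteq> H \<and> K2 \<subseteq> H" if "P.subspace H" for H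
  proof
    show "K \<subseteq> H" if "K1 \<subseteq> H \<and> K2 \<subseteq> H"
      using that \<open>P.subspace H\<close> P.subspace_add unfolding K_def by blast
  qed (use inK in blast)
  have cU2: "card U = q ^ m * card K2"
    using P.card_eq_image_times_kernel[OF assms(1,2), of fst] assms by (simp add: K2_def)
  have cU1: "card U = q ^ n * card K1"
    using P.card_eq_image_times_kernel[OF assms(1,2), of snd] assms by (simp add: K1_def)
  have cK: "card K = card K1 * card K2"
  proof -
    have "inj_on (\<lambda>(x, y). x + y) (K1 \<times> K2)"
      by (auto simp: inj_on_def K1_def K2_def)
    thus ?thesis unfolding K_image using sub by (simp add: card_image card_cartesian_product)
  qed
  have rel: "card K2 * q ^ r = q ^ n" "card K1 * q ^ r = q ^ m"
  proof -
    have "q ^ m * (card K2 * q ^ r) = q ^ m * q ^ n" using assms(5) cU2 by (simp add: power_add mult.assoc)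
    thus "card K2 * q ^ r = q ^ n" using q1 by simp
    have "q ^ n * (card K1 * q ^ r) = q ^ n * q ^ m" using assms(5) cU1 by (simp add: power_add ac_simps)
    thus "card K1 * q ^ r = q ^ m" using q1 by simp
  qed
  have "q ^ r \<le> q ^ n" "q ^ r \<le> q ^ m"
    using rel P.card_pos_subspace sub by (metis Suc_leI mult_le_mono1 mult_1 One_nat_def)+
  hence r: "r \<le> n" "r \<le> m" using power_le_imp_le_exp[OF q1] by blast+
  have cU: "card U = q ^ (m + n - r)"
  proof -
    have "card U * q ^ r = q ^ (m + n - r) * q ^ r" using assms(5) r by (simp flip: power_add)
    thus ?thesis using q1 by simp
  qed
  \<comment> \<open>As in Goursat's lemma, U is the fibre product of its two projections over U/K;
    this common quotient has dimension r.\<close>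
  have cUK: "card U = q ^ r * card K"
  proof -
    have "q ^ r * (q ^ r * card K) = q ^ r * card U"
      unfolding cK using assms(5) rel by (metis mult.assoc mult.commute power_add)
    thus ?thesis using q1 by simp
  qed
  let ?h = "\<lambda>Z. P.hyperplanes Z U"
  have h: "int (card (?h Z)) * (int q - 1) = int q ^ e - 1"
    if "P.subspace Z" "Z \<subseteq> U" "card U = q ^ e * card Z" for Z e
  proof -
    have "(q - 1) * card (?h Z) = q ^ e - 1" using P.card_hyperplanes[OF that(1) assms(1,2) that(2,3)] .
    hence "int (q - 1) * int (card (?h Z)) = int (q ^ e - 1)" by (metis of_nat_mult)
    thus ?thesis using q1 by (simp add: of_nat_diff mult.commute)
  qed
  have fin: "finite (?h Z)" for Z by (rule P.finite_hyperplanes) fact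
  have good: "{H \<in> ?h {0}. fst ` H = fst ` U \<and> snd ` H = snd ` U} = ?h {0} - (?h K1 \<union> ?h K2)"
  proof -
    have AB: "fst ` H = fst ` U \<longleftrightarrow> \<not> K2 \<subseteq> H" "snd ` H = snd ` U \<longleftrightarrow> \<not> K1 \<subseteq> H" if "H \<in> ?h {0}" for H
      unfolding K1_def K2_def
      by (rule P.hyperplane_image_iff[OF assms(1,2) _ _ that]; force simp: scale_pair_def)+
    have C: "H \<in> ?h Z \<longleftrightarrow> H \<in> ?h {0} \<and> Z \<subseteq> H" for H Z
      by (auto simp: P.hyperplanes_def dest: P.subspace_0)
    show ?thesis
    proof (rule Set.set_eqI)
      fix H
      show "H \<in> {H \<in> ?h {0}. fst ` H = fst ` U \<and> snd ` H = snd ` U} \<longleftrightarrow> H \<in> ?h {0} - (?h K1 \<union> ?h K2)"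
        using AB[of H] C[of H K1] C[of H K2] by blast
    qed
  qed
  have "?h K1 \<union> ?h K2 \<subseteq> ?h {0}" by (auto simp: P.hyperplanes_def dest: P.subspace_0)
  hence "card (?h {0} - (?h K1 \<union> ?h K2)) + card (?h K1 \<union> ?h K2) = card (?h {0})"
    using fin by (metis card_Un_disjoint Diff_disjoint Un_Diff_cancel2 Un_absorb2 finite_Diff finite_UnI inf_commute)
  moreover have "card (?h K1 \<union> ?h K2) + card (?h K) = card (?h K1) + card (?h K2)"
  proof -
    have "?h K1 \<inter> ?h K2 = ?h K" using K_least by (auto simp: P.hyperplanes_def)
    thus ?thesis using card_Un_Int[OF fin fin] by metis
  qed
  ultimately have sum: "int (card {H \<in> ?h {0}. fst ` H = fst ` U \<and> snd ` H = snd ` U}) =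
      int (card (?h {0})) - int (card (?h K1)) - int (card (?h K2)) + int (card (?h K))"
    unfolding good by linarith
  hence "int (card {H \<in> ?h {0}. fst ` H = fst ` U \<and> snd ` H = snd ` U}) * (int q - 1) =
      int (card (?h {0})) * (int q - 1) - int (card (?h K1)) * (int q - 1)
      - int (card (?h K2)) * (int q - 1) + int (card (?h K)) * (int q - 1)"
    unfolding sum by (simp only: algebra_simps)
  also have "\<dots> = (int q ^ (m + n - r) - 1) - (int q ^ n - 1) - (int q ^ m - 1) + (int q ^ r - 1)"
    using h[OF _ _ , of "{0}" "m + n - r"] h[OF sub(1,3) cU1] h[OF sub(2,4) cU2] h[OF sK KU cUK]
      cU P.subspace_0[OF assms(1)] by simp
  finally have "int (card {H \<in> ?h {0}. fst ` H = fst ` U \<and> snd ` H = snd ` U}) * (int q - 1) * int q ^ r =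
      (int q ^ (m + n - r) - int q ^ n - int q ^ m + int q ^ r) * int q ^ r" by simp
  also have "\<dots> = int q ^ (m + n - r) * int q ^ r - int q ^ n * int q ^ r - int q ^ m * int q ^ r
      + int q ^ r * int q ^ r" by (simp only: algebra_simps)
  also have "int q ^ (m + n - r) * int q ^ r = int q ^ m * int q ^ n"
    using r by (simp flip: power_add)
  finally show ?thesis by (simp add: algebra_simps)
qed

text \<open>Nested pairs of subdirect subspaces of codimensions r + 1 and r are counted from both
  ends. Below the larger one \<open>card_subdirect_hyperplanes\<close> applies. Above the smaller
  one lie (q^(r+1-d) - 1)/(q - 1) subspaces of D, all of which have the projections of D since they
  are squeezed in between.\<close>

lemma card_subdirect_Suc:
  assumes "P.subspace D" "finite D" "card (fst ` D) = q ^ m" "card (snd ` D) = q ^ n"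
    "card D * q ^ d = q ^ (m + n)" "d \<le> r" "r < m + n"
  shows "int (card (subdirect D (q ^ (m + n - Suc r)))) * (int q ^ (Suc r - d) - 1) * int q ^ r =
     int (card (subdirect D (q ^ (m + n - r)))) * ((int q ^ m - int q ^ r) * (int q ^ n - int q ^ r))"
proof -
  have q1: "1 < q" by (rule P.q_gt_1)
  let ?A = "subdirect D (q ^ (m + n - r))" and ?B = "subdirect D (q ^ (m + n - Suc r))"
  have fin: "finite (subdirect D k)" for k
    unfolding subdirect_def by (rule finite_subset[of _ "Pow D"]) (use assms in auto)
  have pS: "q ^ (m + n - r) = q * q ^ (m + n - Suc r)"
    using assms(7) by (metis Suc_diff_Suc power_Suc)
  have cD: "card D = q ^ (Suc r - d) * q ^ (m + n - Suc r)"
  proof -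
    have "Suc r - d + (m + n - Suc r) + d = m + n" using assms by simp
    hence "card D * q ^ d = q ^ (Suc r - d) * q ^ (m + n - Suc r) * q ^ d"
      using assms(5) by (metis power_add)
    thus ?thesis using q1 by simp
  qed
  have a: "int (card {H \<in> ?B. H \<subseteq> U}) * ((int q - 1) * int q ^ r) =
      (int q ^ m - int q ^ r) * (int q ^ n - int q ^ r)" if "U \<in> ?A" for U
  proof -
    have U: "P.subspace U" "finite U" "U \<subseteq> D" "fst ` U = fst ` D" "snd ` U = snd ` D" "card U = q ^ (m + n - r)"
      using that assms(2) finite_subset by (auto simp: subdirect_def)
    have "{H \<in> ?B. H \<subseteq> U} = {H \<in> P.hyperplanes {0} U. fst ` H = fst ` U \<and> snd ` H = snd ` U}"
      using U pS q1 by (auto simp: subdirect_def P.hyperplanes_def dest: P.subspace_0)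
    moreover have "card U * q ^ r = q ^ (m + n)" using U assms by (simp flip: power_add)
    ultimately show ?thesis
      using card_subdirect_hyperplanes[OF U(1,2), of m n r] U assms by (simp add: mult.assoc)
  qed
  have b: "int (card {U \<in> ?A. H \<subseteq> U}) * (int q - 1) = int q ^ (Suc r - d) - 1" if "H \<in> ?B" for H
  proof -
    have H: "P.subspace H" "H \<subseteq> D" "fst ` H = fst ` D" "snd ` H = snd ` D" "card H = q ^ (m + n - Suc r)"
      using that by (auto simp: subdirect_def)
    have "fst ` U = fst ` D \<and> snd ` U = snd ` D" if "H \<subseteq> U" "U \<subseteq> D" for U
      using H that by (metis image_mono subset_antisym)
    hence "{U \<in> ?A. H \<subseteq> U} = {Y. P.subspace Y \<and> H \<subseteq> Y \<and> Y \<subseteq> D \<and> card Y = q * q ^ (m + n - Suc r)}"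
      unfolding subdirect_def pS by blast
    hence "{U \<in> ?A. H \<subseteq> U} = P.covers H D" using H by (simp add: P.covers_def)
    hence *: "(q - 1) * card {U \<in> ?A. H \<subseteq> U} = q ^ (Suc r - d) - 1"
      using P.card_covers[OF H(1) assms(1,2) H(2), of "Suc r - d"] cD H by simp
    have "int (q - 1) * int (card {U \<in> ?A. H \<subseteq> U}) = int (q ^ (Suc r - d) - 1)"
      using arg_cong[OF *, of int] by (simp only: of_nat_mult)
    thus ?thesis using q1 by (simp add: of_nat_diff mult.commute)
  qed
  have "int (\<Sum>H\<in>?B. card {U \<in> ?A. H \<subseteq> U}) = int (\<Sum>U\<in>?A. card {H \<in> ?B. H \<subseteq> U})"
    by (subst sum_multicount_gen[OF fin fin, where k = "\<lambda>U. card {H \<in> ?B. H \<subseteq> U}"]) auto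
  hence "int (\<Sum>H\<in>?B. card {U \<in> ?A. H \<subseteq> U}) * (int q - 1) * int q ^ r =
      int (\<Sum>U\<in>?A. card {H \<in> ?B. H \<subseteq> U}) * ((int q - 1) * int q ^ r)" by (simp add: mult.assoc)
  thus ?thesis by (simp add: sum_distrib_right a b)
qed

text \<open>The quotient of consecutive counts from \<open>card_subdirect_Suc\<close> is the product
  of the quotients for the two Gaussian binomials and for \<open>GL_order\<close>, times q^d. The
  induction starts at D itself, which has codimension d.\<close>

theorem card_subdirect:
  assumes "P.subspace D" "finite D" "card (fst ` D) = q ^ m" "card (snd ` D) = q ^ n"
    "card D * q ^ d = q ^ (m + n)" "d \<le> m" "d \<le> n" "d + l \<le> m + n"
  shows "card (subdirect D (q ^ (m + n - (d + l)))) =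
     q_binomial q (m - d) l * q_binomial q (n - d) l * GL_order q l * q ^ (d * l)"
  using assms(8)
proof (induction l)
  case 0
  have q1: "1 < q" by (rule P.q_gt_1)
  have "card D * q ^ d = q ^ (m + n - d) * q ^ d" using assms by (simp flip: power_add)
  hence "card D = q ^ (m + n - d)" using q1 by simp
  hence "subdirect D (q ^ (m + n - d)) = {D}"
    using assms card_subset_eq[OF assms(2)] by (auto simp: subdirect_def)
  thus ?case by (simp add: GL_order_def)
next
  case (Suc l)
  have q1: "1 < q" by (rule P.q_gt_1)
  let ?Q = "int q"
  define S where "S = int (card (subdirect D (q ^ (m + n - (d + Suc l)))))"
  define G where "G = int (GL_order q l)"
  define B C B' C' where "B = int (q_binomial q (m - d) l)" and "C = int (q_binomial q (n - d) l)"
    and "B' = int (q_binomial q (m - d) (Suc l))" and "C' = int (q_binomial q (n - d) (Suc l))"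
  define L where "L = ?Q ^ l"
  define Dd where "Dd = ?Q ^ d"
  define M N where "M = ?Q ^ (m - d)" and "N = ?Q ^ (n - d)"
  have bB: "L * (?Q * L - 1) * B' = (M - L) * B" "L * (?Q * L - 1) * C' = (N - L) * C"
    using q_binomial_Suc_right[of q l] by (simp_all add: L_def B_def C_def B'_def C'_def M_def N_def)
  have m: "?Q ^ m = M * Dd" "?Q ^ n = N * Dd" "?Q ^ (d + l) = Dd * L"
    using assms by (simp_all add: M_def N_def L_def Dd_def flip: power_add)
  have "S * (?Q ^ (Suc (d + l) - d) - 1) * ?Q ^ (d + l) =
     int (card (subdirect D (q ^ (m + n - (d + l))))) *
       ((?Q ^ m - ?Q ^ (d + l)) * (?Q ^ n - ?Q ^ (d + l)))"
    unfolding S_def add_Suc_right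
    by (rule card_subdirect_Suc[OF assms(1-5)]) (use Suc.prems in auto)
  also have "int (card (subdirect D (q ^ (m + n - (d + l))))) = B * C * G * ?Q ^ (d * l)"
    using Suc by (simp add: B_def C_def G_def)
  also have "?Q ^ (Suc (d + l) - d) = ?Q * L" by (simp add: Suc_diff_le L_def)
  finally have "S * (?Q * L - 1) * (Dd * L) =
      B * C * G * ?Q ^ (d * l) * ((M * Dd - Dd * L) * (N * Dd - Dd * L))" unfolding m .
  \<comment> \<open>Each of the two differences contributes a factor q^d. One cancels against
    q^(d+l), the other raises q^(d*l) to q^(d*(l+1)).\<close>
  also have "\<dots> = ((M - L) * B) * ((N - L) * C) * G * ?Q ^ (d * l) * Dd * Dd" by (simp add: algebra_simps)
  also have "\<dots> = (L * (?Q * L - 1) * B') * (L * (?Q * L - 1) * C') * G * ?Q ^ (d * l) * Dd * Dd"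
    unfolding bB ..
  also have "\<dots> = (B' * C' * (L * (?Q * L - 1) * G) * (?Q ^ (d * l) * Dd)) * (?Q * L - 1) * (Dd * L)"
    by (simp add: algebra_simps)
  finally have eq: "S * (?Q * L - 1) * (Dd * L) = \<dots>" .
  have "?Q * L - 1 \<noteq> 0" using one_less_power[of ?Q "Suc l"] q1 by (simp add: L_def)
  moreover have "Dd * L \<noteq> 0" using q1 by (simp add: Dd_def L_def)
  ultimately have "S = B' * C' * (L * (?Q * L - 1) * G) * (?Q ^ (d * l) * Dd)" using eq by simp
  moreover have "L * (?Q * L - 1) * G = int (GL_order q (Suc l))"
    using q1 by (simp add: GL_order_Suc L_def G_def of_nat_diff)
  moreover have "?Q ^ (d * l) * Dd = ?Q ^ (d * Suc l)" by (simp add: Dd_def power_add)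
  ultimately show ?case
    unfolding S_def B'_def C'_def by (metis of_nat_mult of_nat_power of_nat_eq_iff)
qed

end

section \<open>Indices and generating functions\<close>

text \<open>Indices depend on the additive structure alone, so one notion serves modules over S,
  over the product of two such rings and over the fibre ring.\<close>

definition subgroup_set :: "'a :: ab_group_add set \<Rightarrow> bool" where
  "subgroup_set H \<longleftrightarrow> 0 \<in> H \<and> (\<forall>x\<in>H. \<forall>y\<in>H. x - y \<in> H)"

lemma subgroup_setD:
  assumes "subgroup_set H"
  shows "0 \<in> H" "x \<in> H \<Longrightarrow> y \<in> H \<Longrightarrow> x - y \<in> H" "x \<in> H \<Longrightarrow> - x \<in> H"
    "x \<in> H \<Longrightarrow> y \<in> H \<Longrightarrow> x + y \<in> H"
proof -
  show 0: "0 \<in> H" and diff: "x \<in> H \<Longrightarrow> y \<in> H \<Longrightarrow> x - y \<in> H" for x y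
    using assms by (auto simp: subgroup_set_def)
  show neg: "x \<in> H \<Longrightarrow> - x \<in> H" for x using diff[OF 0, of x] by simp
  show "x \<in> H \<Longrightarrow> y \<in> H \<Longrightarrow> x + y \<in> H" using diff[OF _ neg, of x y] by simp
qed

text \<open>An infinite index has the value 0, so that an assumption "index non-zero" expresses
  finite index.\<close>

definition subgroup_index :: "'a :: ab_group_add set \<Rightarrow> 'a set \<Rightarrow> nat" where
  "subgroup_index N Y = card (quotient_set N Y)"

definition coset_of :: "'a :: ab_group_add set \<Rightarrow> 'a \<Rightarrow> 'a set" where
  "coset_of Y x = {y. x - y \<in> Y}"

lemma coset_of_eq_iff: "subgroup_set Y \<Longrightarrow> coset_of Y x = coset_of Y y \<longleftrightarrow> x - y \<in> Y"
proof
  assume Y: "subgroup_set Y"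
  show "x - y \<in> Y" if "coset_of Y x = coset_of Y y"
  proof -
    have "y \<in> coset_of Y y" using subgroup_setD(1)[OF Y] by (simp add: coset_of_def)
    hence "y \<in> coset_of Y x" using that by simp
    thus ?thesis by (simp add: coset_of_def)
  qed
  show "coset_of Y x = coset_of Y y" if "x - y \<in> Y"
  proof -
    have "x - z \<in> Y \<longleftrightarrow> y - z \<in> Y" for z
      using subgroup_setD(4)[OF Y that, of "y - z"] subgroup_setD(2)[OF Y _ that, of "x - z"]
      by auto
    thus ?thesis by (simp add: coset_of_def)
  qed
qed

lemma card_image_cong_kernel:
  assumes "\<And>x y. x \<in> N \<Longrightarrow> y \<in> N \<Longrightarrow> g x = g y \<longleftrightarrow> f x = f y"
  shows "card (g ` N) = card (f ` N)"
proof -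
  have inv: "inv_into N g (g x) \<in> N" "f (inv_into N g (g x)) = f x" if "x \<in> N" for x
  proof -
    show *: "inv_into N g (g x) \<in> N" using that by (simp add: inv_into_into)
    show "f (inv_into N g (g x)) = f x"
      using assms[OF * that] f_inv_into_f[of "g x" g N] that by blast
  qed
  have "inj_on (\<lambda>b. f (inv_into N g b)) (g ` N)"
    by (rule inj_onI) (use inv assms in auto)
  moreover have "(\<lambda>b. f (inv_into N g b)) ` g ` N = f ` N"
    using inv(2) by (force simp: image_image intro: image_cong)
  ultimately show ?thesis by (metis card_image)
qed

text \<open>Any labelling whose fibres on N are the cosets of Y will do; f need not be a
  homomorphism. The index computations below come down to a suitable labelling.\<close>

lemma subgroup_index_eq_card_image:
  assumes "\<And>x y. x \<in> N \<Longrightarrow> y \<in> N \<Longrightarrow> f x = f y \<longleftrightarrow> x - y \<in> Y"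
  shows "subgroup_index N Y = card (f ` N)"
proof -
  let ?r = "{(x, y). x \<in> N \<and> y \<in> N \<and> x - y \<in> Y}"
  have r: "?r = {(x, y). x \<in> N \<and> y \<in> N \<and> f x = f y}" using assms by auto
  have q: "quotient_set N Y = (\<lambda>x. ?r `` {x}) ` N"
    by (auto simp: quotient_set_def quotient_def)
  have "?r `` {x} = ?r `` {y} \<longleftrightarrow> f x = f y" if "x \<in> N" "y \<in> N" for x y
    unfolding r using that by auto
  thus ?thesis unfolding subgroup_index_def q by (rule card_image_cong_kernel)
qed

lemma subgroup_index_eq_card_cosets:
  "subgroup_set Y \<Longrightarrow> subgroup_index N Y = card (coset_of Y ` N)"
  by (rule subgroup_index_eq_card_image) (simp add: coset_of_eq_iff)

text \<open>A coset of Y in N is labelled by a representative r x of its coset modulo M together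
  with the coset of x - r x modulo Y. Infinite indices are covered as well: both sides are then
  0.\<close>

lemma subgroup_index_mult:
  assumes "subgroup_set N" "subgroup_set M" "subgroup_set Y" "Y \<subseteq> M" "M \<subseteq> N"
  shows "subgroup_index N Y = subgroup_index N M * subgroup_index M Y"
proof -
  define r where "r x = (SOME z. z \<in> N \<and> x - z \<in> M)" for x
  have r: "r x \<in> N" "x - r x \<in> M" if "x \<in> N" for x
    using someI[of "\<lambda>z. z \<in> N \<and> x - z \<in> M" x] that subgroup_setD(1)[OF assms(2)]
    by (auto simp: r_def)
  have r_eq: "r x = r y" if "x - y \<in> M" for x y
  proof -
    have "x - z \<in> M \<longleftrightarrow> y - z \<in> M" for z
      using coset_of_eq_iff[OF assms(2), of x y] that by (auto simp: coset_of_def)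
    thus ?thesis by (simp add: r_def)
  qed
  have r_iff: "r x = r y \<longleftrightarrow> x - y \<in> M" if "x \<in> N" "y \<in> N" for x y
    using r_eq[of x y] subgroup_setD(2)[OF assms(2) r(2)[OF that(1)] r(2)[OF that(2)]] by auto
  define F where "F x = (r x, coset_of Y (x - r x))" for x
  have F: "F x = F y \<longleftrightarrow> x - y \<in> Y" if "x \<in> N" "y \<in> N" for x y
  proof -
    have "x - y \<in> Y \<Longrightarrow> r x = r y" using r_eq assms(4) by blast
    thus ?thesis by (auto simp: F_def coset_of_eq_iff[OF assms(3)])
  qed
  have "F ` N = r ` N \<times> coset_of Y ` M"
  proof (intro equalityI subsetI)
    fix u assume "u \<in> r ` N \<times> coset_of Y ` M"
    then obtain x z where u: "u = (r x, coset_of Y z)" "x \<in> N" "z \<in> M" by auto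
    let ?y = "r x + z"
    have y: "?y \<in> N" using u r assms(5) subgroup_setD(4)[OF assms(1)] by blast
    have e: "?y - x = z - (x - r x)" by (simp add: algebra_simps)
    have "?y - x \<in> M" unfolding e by (rule subgroup_setD(2)[OF assms(2) u(3) r(2)[OF u(2)]])
    hence "r ?y = r x" using r_eq by blast
    hence "F ?y = u" using u by (simp add: F_def)
    thus "u \<in> F ` N" using y by blast
  qed (auto simp: F_def r)
  thus ?thesis
    using subgroup_index_eq_card_image[OF F] subgroup_index_eq_card_image[OF r_iff]
      subgroup_index_eq_card_cosets[OF assms(3), of M]
    by (simp add: card_cartesian_product)
qed

lemma subgroup_index_vimage:
  assumes "subgroup_set Y" "\<And>x y. x \<in> N \<Longrightarrow> y \<in> N \<Longrightarrow> f (x - y) = f x - f y"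
    "\<And>x y. x \<in> N \<Longrightarrow> y \<in> N \<Longrightarrow> x - y \<in> N"
  shows "subgroup_index N {x \<in> N. f x \<in> Y} = subgroup_index (f ` N) Y"
proof -
  have "subgroup_index N {x \<in> N. f x \<in> Y} = card ((\<lambda>x. coset_of Y (f x)) ` N)"
    by (rule subgroup_index_eq_card_image) (simp add: coset_of_eq_iff assms)
  thus ?thesis by (simp add: subgroup_index_eq_card_cosets[OF assms(1)] image_image)
qed

lemma subgroup_index_image:
  assumes "subgroup_set N" "subgroup_set Y" "Y \<subseteq> N" "inj_on f N"
    "\<And>x y. x \<in> N \<Longrightarrow> y \<in> N \<Longrightarrow> f (x - y) = f x - f y"
  shows "subgroup_index (f ` N) (f ` Y) = subgroup_index N Y"
proof -
  have "subgroup_set (f ` Y)"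
    unfolding subgroup_set_def
  proof (intro conjI ballI)
    have "f 0 = f 0 - f 0" using assms(5)[of 0 0] subgroup_setD(1)[OF assms(1)] by simp
    thus "0 \<in> f ` Y" using subgroup_setD(1)[OF assms(2)] by (metis diff_self imageI)
    fix u v assume "u \<in> f ` Y" "v \<in> f ` Y"
    then obtain x y where "u = f x" "v = f y" "x \<in> Y" "y \<in> Y" by blast
    moreover from this have "u - v = f (x - y)" using assms by (metis subsetD)
    ultimately show "u - v \<in> f ` Y" using subgroup_setD(2)[OF assms(2)] by blast
  qed
  hence "subgroup_index N {x \<in> N. f x \<in> f ` Y} = subgroup_index (f ` N) (f ` Y)"
    using assms subgroup_setD(2)[OF assms(1)] by (intro subgroup_index_vimage) auto
  moreover have "{x \<in> N. f x \<in> f ` Y} = Y"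
    using inj_on_image_mem_iff[OF assms(4) _ assms(3)] assms(3) by auto
  ultimately show ?thesis by simp
qed

text \<open>Second isomorphism theorem: A meets every coset of B in A + B.\<close>

lemma subgroup_index_sum:
  assumes "subgroup_set A" "subgroup_set B"
  shows "subgroup_index {x + y |x y. x \<in> A \<and> y \<in> B} B = subgroup_index A (A \<inter> B)"
proof -
  let ?S = "{x + y |x y. x \<in> A \<and> y \<in> B}"
  have eq: "coset_of B (x + y) = coset_of B x" if "y \<in> B" for x y
    using that coset_of_eq_iff[OF assms(2), of "x + y" x] by simp
  have "coset_of B ` ?S = coset_of B ` A"
  proof (intro equalityI subsetI)
    fix u assume "u \<in> coset_of B ` A"
    then obtain a where "a \<in> A" "u = coset_of B (a + 0)" by auto
    thus "u \<in> coset_of B ` ?S" using subgroup_setD(1)[OF assms(2)] by blast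
  qed (auto simp: eq)
  moreover have "subgroup_index A (A \<inter> B) = card (coset_of B ` A)"
    by (rule subgroup_index_eq_card_image)
      (use subgroup_setD(2)[OF assms(1)] coset_of_eq_iff[OF assms(2)] in auto)
  ultimately show ?thesis by (simp add: subgroup_index_eq_card_cosets[OF assms(2)])
qed

lemma subgroup_index_Times:
  assumes "subgroup_set A'" "subgroup_set B'"
  shows "subgroup_index (A \<times> B) (A' \<times> B') = subgroup_index A A' * subgroup_index B B'"
proof -
  have "subgroup_index (A \<times> B) (A' \<times> B') = card (map_prod (coset_of A') (coset_of B') ` (A \<times> B))"
    by (rule subgroup_index_eq_card_image) (auto simp: coset_of_eq_iff assms)
  also have "map_prod (coset_of A') (coset_of B') ` (A \<times> B) = coset_of A' ` A \<times> coset_of B' ` B" by force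
  finally show ?thesis using assms by (simp add: subgroup_index_eq_card_cosets card_cartesian_product)
qed

lemma card_eq_subgroup_index_mult:
  assumes "subgroup_set N" "subgroup_set Y" "Y \<subseteq> N"
  shows "card N = subgroup_index N Y * card Y"
proof -
  have "subgroup_index M {0} = card M" for M :: "'a set"
    using subgroup_index_eq_card_image[of M id "{0}"] by simp
  thus ?thesis using subgroup_index_mult[OF assms(1,2), of "{0}"] assms subgroup_setD(1)[OF assms(2)]
    by (simp add: subgroup_set_def)
qed

lemma subgroup_index_self: "Y \<noteq> {} \<Longrightarrow> subgroup_set Y \<Longrightarrow> subgroup_index Y Y = 1"
proof -
  assume "Y \<noteq> {}" "subgroup_set Y"
  hence "coset_of Y x = coset_of Y 0" if "x \<in> Y" for x using that coset_of_eq_iff[of Y x 0] by simp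
  hence "coset_of Y ` Y = {coset_of Y 0}" using \<open>Y \<noteq> {}\<close> by auto
  thus ?thesis using \<open>subgroup_set Y\<close> by (simp add: subgroup_index_eq_card_cosets)
qed

section \<open>Generating functions of graded families of sets\<close>

definition gen_fun :: "(nat \<Rightarrow> 'a set) \<Rightarrow> rat fps" where
  "gen_fun A = Abs_fps (\<lambda>n. of_nat (card (A n)))"

text \<open>The fibre over an element of degree i may depend on i through a factor d i, besides the
  factor c r for the added degree r. This weight later produces the substitution of p X for
  X.\<close>

lemma gen_fun_fibration:
  assumes fin: "\<And>n. finite (A n)" and disj: "\<And>i j. i \<noteq> j \<Longrightarrow> A i \<inter> A j = {}"
    and f: "\<And>n x. x \<in> B n \<Longrightarrow> \<exists>i\<le>n. f x \<in> A i"
    and fib: "\<And>i r a. a \<in> A i \<Longrightarrow> card {x \<in> B (i + r). f x = a} = d i * c r"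
    and ffib: "\<And>i r a. a \<in> A i \<Longrightarrow> finite {x \<in> B (i + r). f x = a}"
  shows "gen_fun B = Abs_fps (\<lambda>i. of_nat (d i * card (A i))) * Abs_fps (\<lambda>r. of_nat (c r))"
    and "finite (B n)"
proof -
  have B: "B n = (\<Union>i\<in>{0..n}. \<Union>a\<in>A i. {x \<in> B n. f x = a})" for n using f by fastforce
  have ffib': "finite {x \<in> B n. f x = a}" if "i \<le> n" "a \<in> A i" for i n a
    using ffib[of a i "n - i"] that by simp
  have fib': "card {x \<in> B n. f x = a} = d i * c (n - i)" if "i \<in> {0..n}" "a \<in> A i" for i n a
    using fib[of a i "n - i"] that by simp
  have "card (B n) = (\<Sum>i=0..n. d i * card (A i) * c (n - i))" for n
  proof -
    have "card (B n) = (\<Sum>i=0..n. card (\<Union>a\<in>A i. {x \<in> B n. f x = a}))"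
      using disj ffib' fin by (subst B, subst card_UN_disjoint) fastforce+
    also have "\<dots> = (\<Sum>i=0..n. \<Sum>a\<in>A i. card {x \<in> B n. f x = a})"
      using ffib' fin by (intro sum.cong refl card_UN_disjoint) auto
    also have "\<dots> = (\<Sum>i=0..n. \<Sum>a\<in>A i. d i * c (n - i))"
      by (intro sum.cong refl) (simp add: fib')
    finally show ?thesis by (simp add: ac_simps)
  qed
  thus "gen_fun B = Abs_fps (\<lambda>i. of_nat (d i * card (A i))) * Abs_fps (\<lambda>r. of_nat (c r))"
    by (intro fps_ext) (simp add: gen_fun_def fps_mult_nth)
  show "finite (B n)" using ffib' fin by (subst B) auto
qed

lemma gen_fun_UN:
  assumes "finite I" "\<And>n. B n = (\<Union>w\<in>I. A w n)" "\<And>w n. w \<in> I \<Longrightarrow> finite (A w n)"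
    "\<And>w w' n. w \<in> I \<Longrightarrow> w' \<in> I \<Longrightarrow> w \<noteq> w' \<Longrightarrow> A w n \<inter> A w' n = {}"
  shows "gen_fun B = (\<Sum>w\<in>I. gen_fun (A w))"
proof (rule fps_ext)
  fix n
  have "card (B n) = (\<Sum>w\<in>I. card (A w n))"
    unfolding assms(2) by (rule card_UN_disjoint) (use assms in auto)
  thus "fps_nth (gen_fun B) n = fps_nth (\<Sum>w\<in>I. gen_fun (A w)) n"
    by (simp add: gen_fun_def fps_sum_nth)
qed

lemma gen_fun_pairs:
  assumes "\<And>n. finite (A n)" "\<And>i j. i \<noteq> j \<Longrightarrow> A i \<inter> A j = {}" "\<And>n. finite (B n)"
  shows "gen_fun (\<lambda>n. \<Union>i\<le>n. A i \<times> B (n - i)) = gen_fun A * gen_fun B"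
proof -
  have "{x \<in> \<Union>j\<le>i + r. A j \<times> B (i + r - j). fst x = a} = {a} \<times> B r" if "a \<in> A i" for a i r
  proof -
    have ij: "j = i" if "a \<in> A j" for j using assms(2)[of i j] that \<open>a \<in> A i\<close> by blast
    show ?thesis
    proof (intro equalityI subsetI)
      fix x assume "x \<in> {x \<in> \<Union>j\<le>i + r. A j \<times> B (i + r - j). fst x = a}"
      then obtain j where "fst x \<in> A j" "snd x \<in> B (i + r - j)" "fst x = a" by auto
      with ij[of j] show "x \<in> {a} \<times> B r" by (cases x) auto
    next
      fix x assume "x \<in> {a} \<times> B r"
      hence "fst x = a" "x \<in> A i \<times> B (i + r - i)" using that by auto
      thus "x \<in> {x \<in> \<Union>j\<le>i + r. A j \<times> B (i + r - j). fst x = a}" by force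
    qed
  qed
  hence "gen_fun (\<lambda>n. \<Union>i\<le>n. A i \<times> B (n - i)) =
      Abs_fps (\<lambda>i. of_nat (1 * card (A i))) * Abs_fps (\<lambda>r. of_nat (card (B r)))"
    by (intro gen_fun_fibration(1)[where f = fst]) (use assms in \<open>auto simp: card_cartesian_product\<close>)
  thus ?thesis by (simp add: gen_fun_def)
qed

lemma gen_fun_shift:
  assumes "\<And>n. n < k \<Longrightarrow> B n = {}" "\<And>n. card (B (n + k)) = card (A n)"
  shows "gen_fun B = fps_X ^ k * gen_fun A"
proof (rule fps_ext)
  fix n
  show "fps_nth (gen_fun B) n = fps_nth (fps_X ^ k * gen_fun A) n"
    using assms(1)[of n] assms(2)[of "n - k"] by (auto simp: gen_fun_def fps_X_power_mult_nth)
qed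

section \<open>Lattices over a discrete valuation ring\<close>

lemma lookup_coord_scale [simp]: "Poly_Mapping.lookup (coord_scale r v) i = r * Poly_Mapping.lookup v i"
  by (simp add: coord_scale_def Poly_Mapping.map.rep_eq when_def)

lemma coord_vecs_iff:
  "v \<in> coord_vecs n R \<longleftrightarrow>
     (\<forall>i<n. Poly_Mapping.lookup v i \<in> R) \<and> (\<forall>i\<ge>n. Poly_Mapping.lookup v i = 0)"
  unfolding coord_vecs_def by (auto simp: in_keys_iff subset_iff not_less) (metis not_le)

lemma coord_scale_simps:
  "coord_scale r (u + v) = coord_scale r u + coord_scale r v"
  "coord_scale r (u - v) = coord_scale r u - coord_scale r v"
  "coord_scale (r + s) v = coord_scale r v + coord_scale s v"
  "coord_scale (r - s) v = coord_scale r v - coord_scale s v"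
  "coord_scale r (coord_scale s v) = coord_scale (r * s) v"
  "coord_scale 1 v = v" "coord_scale 0 v = 0" "coord_scale r 0 = 0"
  by (rule poly_mapping_eqI; simp add: lookup_add lookup_minus algebra_simps)+

lemma module_coord_scale: "Modules.module (coord_scale :: 'r :: comm_ring_1 \<Rightarrow> ('i \<Rightarrow>\<^sub>0 'r) \<Rightarrow> _)"
  by unfold_locales (simp_all add: coord_scale_simps)

interpretation coord: finite_field_space
  "coord_scale :: 'p :: prime_card mod_ring \<Rightarrow> ('i \<Rightarrow>\<^sub>0 'p mod_ring) \<Rightarrow> _" "CARD('p)"
  by unfold_locales (simp_all add: coord_scale_simps)

lemma subspace_coord_vecs: "coord.subspace (coord_vecs n UNIV)"
  by (rule coord.subspaceI) (auto simp: coord_vecs_iff lookup_add)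

lemma coord_vecs_0: "coord_vecs 0 R = {0}"
  by (auto simp: coord_vecs_iff intro: poly_mapping_eqI)

lemma coord_vecs_Suc_iff:
  assumes "0 \<in> R"
  shows "v \<in> coord_vecs n R \<longleftrightarrow> v \<in> coord_vecs (Suc n) R \<and> Poly_Mapping.lookup v n = 0"
proof -
  have "(\<forall>i\<ge>n. Q i) \<longleftrightarrow> Q n \<and> (\<forall>i\<ge>Suc n. Q i)" for Q
    by (metis Suc_leD Suc_leI le_eq_less_or_eq order_refl)
  thus ?thesis using assms by (auto simp: coord_vecs_iff less_Suc_eq)
qed

lemma finite_coord_vecs: "finite (coord_vecs n (UNIV :: 'p :: prime_card mod_ring set))"
  and card_coord_vecs: "card (coord_vecs n (UNIV :: 'p mod_ring set)) = CARD('p) ^ n"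
proof (induction n)
  case 0
  { case 1 show ?case by (simp add: coord_vecs_0) }
  { case 2 show ?case by (simp add: coord_vecs_0) }
next
  case (Suc n)
  let ?f = "\<lambda>v :: nat \<Rightarrow>\<^sub>0 'p mod_ring. Poly_Mapping.lookup v n"
  have ker: "{v \<in> coord_vecs (Suc n) UNIV. ?f v = 0} = coord_vecs n UNIV"
    using coord_vecs_Suc_iff[of "UNIV :: 'p mod_ring set" _ n] by auto
  have sub: "coord_vecs (Suc n) UNIV \<subseteq>
      (\<lambda>(v, x). v + Poly_Mapping.single n x) ` (coord_vecs n (UNIV :: 'p mod_ring set) \<times> UNIV)"
  proof
    fix v :: "nat \<Rightarrow>\<^sub>0 'p mod_ring" assume "v \<in> coord_vecs (Suc n) UNIV"
    hence "v - Poly_Mapping.single n (?f v) \<in> coord_vecs n UNIV"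
      by (subst coord_vecs_Suc_iff) (auto simp: coord_vecs_iff lookup_minus lookup_single when_def)
    thus "v \<in> (\<lambda>(v, x). v + Poly_Mapping.single n x) ` (coord_vecs n UNIV \<times> UNIV)"
      by (intro image_eqI[of _ _ "(v - Poly_Mapping.single n (?f v), ?f v)"]) auto
  qed
  hence fin: "finite (coord_vecs (Suc n) (UNIV :: 'p mod_ring set))"
    using finite_subset[OF sub] Suc.IH(1) by simp
  have "x \<in> ?f ` coord_vecs (Suc n) UNIV" for x
    by (intro image_eqI[of _ _ "Poly_Mapping.single n x"])
      (auto simp: coord_vecs_iff lookup_single when_def)
  hence "?f ` coord_vecs (Suc n) UNIV = UNIV" by blast
  { case 1 show ?case by (rule fin) }
  { case 2 show ?case
      using coord.card_eq_image_times_kernel[OF subspace_coord_vecs fin, of ?f]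
      unfolding ker \<open>?f ` coord_vecs (Suc n) UNIV = UNIV\<close> Suc.IH(2)
      by (simp add: lookup_minus) }
qed

lemma is_submodule_overD:
  assumes "is_submodule_over \<Gamma> scale Y"
  shows "subgroup_set Y" "r \<in> \<Gamma> \<Longrightarrow> x \<in> Y \<Longrightarrow> scale r x \<in> Y"
  using assms by (auto simp: is_submodule_over_def subgroup_set_def)

lemma is_submodule_over_iff:
  "is_submodule_over \<Gamma> scale Y \<longleftrightarrow> subgroup_set Y \<and> (\<forall>r\<in>\<Gamma>. \<forall>x\<in>Y. scale r x \<in> Y)"
  by (auto simp: is_submodule_over_def subgroup_set_def)

text \<open>A cardinality p^n > 0 already forces the quotient to be finite.\<close>

lemma solomon_zeta_eq_gen_fun:
  assumes "p > 0"
  shows "solomon_zeta p \<Gamma> scale N =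
    gen_fun (\<lambda>n. {Y. Y \<subseteq> N \<and> is_submodule_over \<Gamma> scale Y \<and> subgroup_index N Y = p ^ n})"
proof -
  have "finite (quotient_set N Y) \<and> card (quotient_set N Y) = p ^ n \<longleftrightarrow> subgroup_index N Y = p ^ n" for Y n
    using assms card_ge_0_finite[of "quotient_set N Y"] by (auto simp: subgroup_index_def)
  thus ?thesis by (simp add: solomon_zeta_def gen_fun_def)
qed

lemma subgroup_set_vimage:
  assumes "subgroup_set Y" "subgroup_set N" "\<And>x y. x \<in> N \<Longrightarrow> y \<in> N \<Longrightarrow> f (x - y) = f x - f y"
  shows "subgroup_set {x \<in> N. f x \<in> Y}"
  using subgroup_setD[OF assms(1)] subgroup_setD[OF assms(2)] assms(3)[of 0 0] assms(3)
  by (auto simp: subgroup_set_def)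

text \<open>A discrete valuation ring inside a field, with residue field of p elements, described
  without a valuation: \<open>factor\<close> supplies the exponent of the uniformizer. Z_p and
  Z_p[omega] are the two instances. The map \<open>\<rho>\<close> is total but constrained on S
  alone.\<close>

locale residue_dvr =
  fixes S :: "'k :: field set" and \<pi> :: 'k and \<rho> :: "'k \<Rightarrow> 'p :: prime_card mod_ring" and p :: nat
  assumes p_eq: "p = CARD('p)"
    and one: "1 \<in> S"
    and diff: "x \<in> S \<Longrightarrow> y \<in> S \<Longrightarrow> x - y \<in> S"
    and mult: "x \<in> S \<Longrightarrow> y \<in> S \<Longrightarrow> x * y \<in> S"
    and unif: "\<pi> \<in> S" "\<pi> \<noteq> 0"
    and res_one: "\<rho> 1 = 1"
    and res_diff: "x \<in> S \<Longrightarrow> y \<in> S \<Longrightarrow> \<rho> (x - y) = \<rho> x - \<rho> y"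
    and res_mult: "x \<in> S \<Longrightarrow> y \<in> S \<Longrightarrow> \<rho> (x * y) = \<rho> x * \<rho> y"
    and res_eq_0: "x \<in> S \<Longrightarrow> \<rho> x = 0 \<longleftrightarrow> (\<exists>y\<in>S. x = \<pi> * y)"
    and inv: "x \<in> S \<Longrightarrow> \<rho> x \<noteq> 0 \<Longrightarrow> inverse x \<in> S"
    and factor: "x \<in> S \<Longrightarrow> x \<noteq> 0 \<Longrightarrow> \<exists>k u. u \<in> S \<and> \<rho> u \<noteq> 0 \<and> x = \<pi> ^ k * u"
begin

lemma p_gt_1: "1 < p" unfolding p_eq using prime_card[where 'a = 'p] prime_gt_1_nat by blast

lemma zero: "0 \<in> S" using diff[OF one one] by simp

lemma neg: "x \<in> S \<Longrightarrow> - x \<in> S" using diff[OF zero, of x] by simp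

lemma add: "x \<in> S \<Longrightarrow> y \<in> S \<Longrightarrow> x + y \<in> S" using diff[OF _ neg, of x y] by simp

lemma pow: "x \<in> S \<Longrightarrow> x ^ k \<in> S" by (induction k) (auto simp: one mult)

lemma res_zero: "\<rho> 0 = 0" using res_diff[OF zero zero] by simp

lemma res_neg: "x \<in> S \<Longrightarrow> \<rho> (- x) = - \<rho> x" using res_diff[OF zero, of x] res_zero by simp

lemma res_add: "x \<in> S \<Longrightarrow> y \<in> S \<Longrightarrow> \<rho> (x + y) = \<rho> x + \<rho> y"
  using res_diff[OF _ neg, of x y] res_neg[of y] by simp

lemma res_unif: "\<rho> \<pi> = 0" using res_eq_0[OF unif(1)] one by force

lemma nat_mem: "of_nat n \<in> S" "\<rho> (of_nat n) = of_nat n"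
  by (induction n) (auto simp: zero one add res_zero res_one res_add)

text \<open>F_p is a prime field, so natural numbers represent all residue classes. Up to multiples
  of the uniformizer, scalar multiplication is thus repeated addition.\<close>

lemma res_surj: "\<exists>n. \<rho> (of_nat n) = c"
  using surj_of_nat_mod_ring[of c] nat_mem(2) by metis

definition ideal_pow :: "nat \<Rightarrow> 'k set" where "ideal_pow k = {x. \<exists>y\<in>S. x = \<pi> ^ k * y}"

lemma subgroup_set_S: "subgroup_set S" by (auto simp: subgroup_set_def zero diff)

lemma subgroup_ideal_pow: "subgroup_set (ideal_pow k)"
  unfolding subgroup_set_def ideal_pow_def
  using zero diff by (auto simp flip: right_diff_distrib intro: bexI[of _ 0])

lemma ideal_pow_subset: "ideal_pow k \<subseteq> S"
  by (auto simp: ideal_pow_def mult pow unif)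

text \<open>Division by pi^k followed by the residue map identifies the quotient of two consecutive
  ideals with F_p, so each step multiplies the index by p.\<close>

lemma index_ideal_pow: "subgroup_index S (ideal_pow k) = p ^ k"
proof (induction k)
  case 0
  have "ideal_pow 0 = S" by (auto simp: ideal_pow_def)
  thus ?case using subgroup_index_self[of S] subgroup_set_S zero by auto
next
  case (Suc k)
  have sub: "ideal_pow (Suc k) \<subseteq> ideal_pow k"
  proof
    fix x assume "x \<in> ideal_pow (Suc k)"
    then obtain y where "y \<in> S" "x = \<pi> ^ k * (\<pi> * y)" by (auto simp: ideal_pow_def ac_simps)
    thus "x \<in> ideal_pow k" using mult unif by (auto simp: ideal_pow_def)
  qed
  let ?f = "\<lambda>x. \<rho> (x / \<pi> ^ k)"
  have "subgroup_index (ideal_pow k) (ideal_pow (Suc k)) = card (?f ` ideal_pow k)"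
  proof (rule subgroup_index_eq_card_image)
    fix x y assume "x \<in> ideal_pow k" "y \<in> ideal_pow k"
    then obtain u v where uv: "u \<in> S" "v \<in> S" "x = \<pi> ^ k * u" "y = \<pi> ^ k * v"
      by (auto simp: ideal_pow_def)
    have "?f x = ?f y \<longleftrightarrow> \<rho> (u - v) = 0" using uv unif res_diff by simp
    also have "\<dots> \<longleftrightarrow> (\<exists>w\<in>S. u - v = \<pi> * w)" using res_eq_0 uv diff by simp
    also have "\<dots> \<longleftrightarrow> x - y \<in> ideal_pow (Suc k)"
    proof -
      have "x - y = \<pi> ^ Suc k * w \<longleftrightarrow> u - v = \<pi> * w" for w
        using uv unif by (simp flip: right_diff_distrib add: mult.assoc)
      thus ?thesis by (simp add: ideal_pow_def del: power_Suc)
    qed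
    finally show "?f x = ?f y \<longleftrightarrow> x - y \<in> ideal_pow (Suc k)" .
  qed
  also have "?f ` ideal_pow k = UNIV"
  proof -
    have "c \<in> ?f ` ideal_pow k" for c
    proof -
      obtain n where "\<rho> (of_nat n) = c" using res_surj by blast
      moreover have "\<pi> ^ k * of_nat n \<in> ideal_pow k" using nat_mem by (auto simp: ideal_pow_def)
      ultimately show ?thesis using unif by (intro image_eqI[of _ _ "\<pi> ^ k * of_nat n"]) auto
    qed
    thus ?thesis by blast
  qed
  finally have "subgroup_index (ideal_pow k) (ideal_pow (Suc k)) = p" by (simp add: p_eq)
  thus ?case
    using subgroup_index_mult[OF subgroup_set_S subgroup_ideal_pow subgroup_ideal_pow sub ideal_pow_subset] Suc.IH
    by simp
qed

text \<open>Unit factors can be cancelled inside I: with pi^j * u it also contains pi^j. The least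
  such power generates the ideal.\<close>

lemma ideal_eq_ideal_pow:
  assumes "subgroup_set I" "I \<subseteq> S" "\<And>s x. s \<in> S \<Longrightarrow> x \<in> I \<Longrightarrow> s * x \<in> I" "x \<in> I" "x \<noteq> 0"
  shows "\<exists>k. I = ideal_pow k"
proof -
  have pw: "\<pi> ^ k \<in> I" if "u \<in> S" "\<rho> u \<noteq> 0" "\<pi> ^ k * u \<in> I" for k u
  proof -
    have "u \<noteq> 0" using that res_zero by auto
    hence "inverse u * (\<pi> ^ k * u) = \<pi> ^ k" by simp
    thus ?thesis using assms(3)[OF inv[OF that(1,2)] that(3)] by metis
  qed
  define k where "k = (LEAST k. \<pi> ^ k \<in> I)"
  have "\<exists>k. \<pi> ^ k \<in> I" using factor[of x] assms pw by blast
  hence k: "\<pi> ^ k \<in> I" unfolding k_def by (rule LeastI_ex)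
  have "I = ideal_pow k"
  proof (intro equalityI subsetI)
    fix y assume y: "y \<in> I"
    show "y \<in> ideal_pow k"
    proof (cases "y = 0")
      case False
      then obtain j u where u: "u \<in> S" "\<rho> u \<noteq> 0" "y = \<pi> ^ j * u" using factor y assms(2) by blast
      hence "\<pi> ^ j \<in> I" using pw y by blast
      hence "k \<le> j" unfolding k_def by (rule Least_le)
      hence "y = \<pi> ^ k * (\<pi> ^ (j - k) * u)" using u by (simp flip: power_add mult.assoc)
      thus ?thesis using u mult pow unif unfolding ideal_pow_def by blast
    qed (use subgroup_setD(1)[OF subgroup_ideal_pow] in auto)
  qed (use assms(3)[OF _ k] in \<open>auto simp: ideal_pow_def mult.commute\<close>)
  thus ?thesis ..
qed

text \<open>Otherwise a positive power of pi would be 1, although its residue is 0. It yields a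
  non-zero element of an ideal once two powers of pi fall into one coset.\<close>

lemma power_unif_diff_nonzero: "i < j \<Longrightarrow> \<pi> ^ i - \<pi> ^ j \<noteq> 0"
proof
  assume "i < j" "\<pi> ^ i - \<pi> ^ j = 0"
  have "\<pi> ^ i * \<pi> ^ (j - i) = \<pi> ^ j" using \<open>i < j\<close> by (simp flip: power_add)
  hence "\<pi> ^ i * \<pi> ^ (j - i) = \<pi> ^ i * 1" using \<open>\<pi> ^ i - \<pi> ^ j = 0\<close> by simp
  hence "\<pi> ^ (j - i) = 1" using unif by simp
  moreover obtain d where "j - i = Suc d" using \<open>i < j\<close> by (metis Suc_diff_Suc)
  ultimately have "\<pi> * \<pi> ^ d = 1" by simp
  hence "\<rho> 1 = \<rho> \<pi> * \<rho> (\<pi> ^ d)" using res_mult[OF unif(1) pow[OF unif(1)]] by metis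
  thus False using res_unif res_one by simp
qed

abbreviation lattice :: "nat \<Rightarrow> (nat \<Rightarrow>\<^sub>0 'k) set" where "lattice m \<equiv> coord_vecs m S"

abbreviation submod :: "(nat \<Rightarrow>\<^sub>0 'k) set \<Rightarrow> bool" where "submod \<equiv> is_submodule_over S coord_scale"

lemma submod_lattice: "submod (lattice m)"
  by (auto simp: is_submodule_over_def coord_vecs_iff lookup_minus zero diff mult)

lemmas lattice_closed = subgroup_setD[OF is_submodule_overD(1)[OF submod_lattice]]
  is_submodule_overD(2)[OF submod_lattice]

lemma lattice_Suc_iff:
  "v \<in> lattice m \<longleftrightarrow> v \<in> lattice (Suc m) \<and> Poly_Mapping.lookup v m = 0"
  by (rule coord_vecs_Suc_iff[OF zero])

lemma lattice_Suc_subset: "lattice m \<subseteq> lattice (Suc m)" using lattice_Suc_iff by blast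

lemma single_mem_lattice: "x \<in> S \<Longrightarrow> Poly_Mapping.single m x \<in> lattice (Suc m)"
  by (auto simp: coord_vecs_iff lookup_single when_def zero)

lemma lookup_mem_S: "v \<in> lattice m \<Longrightarrow> Poly_Mapping.lookup v i \<in> S"
  by (cases "i < m") (auto simp: coord_vecs_iff zero)

text \<open>A submodule of finite index of \<open>S\<^sup>m\<^sup>+\<^sup>1\<close> is determined by the ideal of its last coordinates,
  by its intersection with \<open>S\<^sup>m\<close>, and by a coset of that intersection.\<close>

definition extensions :: "nat \<Rightarrow> nat \<Rightarrow> (nat \<Rightarrow>\<^sub>0 'k) set \<Rightarrow> (nat \<Rightarrow>\<^sub>0 'k) set set" where
  "extensions m k M' = {M. M \<subseteq> lattice (Suc m) \<and> submod M \<and>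
     (\<lambda>v. Poly_Mapping.lookup v m) ` M = ideal_pow k \<and> M \<inter> lattice m = M'}"

text \<open>This is M' + S x for x = h + pi^k e_m; the coefficient s is pinned down by the last
  coordinate.\<close>

definition extend :: "nat \<Rightarrow> nat \<Rightarrow> (nat \<Rightarrow>\<^sub>0 'k) set \<Rightarrow> (nat \<Rightarrow>\<^sub>0 'k) \<Rightarrow> (nat \<Rightarrow>\<^sub>0 'k) set" where
  "extend m k M' h = {v. \<exists>s\<in>S. Poly_Mapping.lookup v m = s * \<pi> ^ k \<and>
     v - coord_scale s (h + Poly_Mapping.single m (\<pi> ^ k)) \<in> M'}"

lemma lookup_lattice_last: "h \<in> lattice m \<Longrightarrow> Poly_Mapping.lookup h m = 0"
  by (simp add: coord_vecs_iff)

lemma extensions_eq_extend: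
  assumes "M \<in> extensions m k M'" "h \<in> lattice m" "h + Poly_Mapping.single m (\<pi> ^ k) \<in> M"
  shows "M = extend m k M' h"
proof (intro equalityI subsetI)
  let ?x = "h + Poly_Mapping.single m (\<pi> ^ k)"
  have M: "M \<subseteq> lattice (Suc m)" "submod M" "(\<lambda>v. Poly_Mapping.lookup v m) ` M = ideal_pow k" "M \<inter> lattice m = M'"
    using assms by (auto simp: extensions_def)
  note sub = is_submodule_overD[OF M(2)]
  {
    fix v assume v: "v \<in> M"
    have "Poly_Mapping.lookup v m \<in> ideal_pow k" using v M(3) by blast
    then obtain s where s: "s \<in> S" "Poly_Mapping.lookup v m = s * \<pi> ^ k" by (auto simp: ideal_pow_def mult.commute)
    have "v - coord_scale s ?x \<in> M" using v s assms sub by (auto intro: subgroup_setD)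
    moreover have "Poly_Mapping.lookup (v - coord_scale s ?x) m = 0"
      using s lookup_lattice_last[OF assms(2)] by (simp add: lookup_minus lookup_add)
    ultimately have "v - coord_scale s ?x \<in> M'" using M lattice_Suc_iff by blast
    thus "v \<in> extend m k M' h" using s by (auto simp: extend_def)
  next
    fix v assume "v \<in> extend m k M' h"
    then obtain s where s: "s \<in> S" "v - coord_scale s ?x \<in> M'" by (auto simp: extend_def)
    hence "v - coord_scale s ?x + coord_scale s ?x \<in> M"
      using M(4) assms sub by (intro subgroup_setD(4)) auto
    thus "v \<in> M" by simp
  }
qed

lemma extend_mem_extensions:
  assumes "M' \<subseteq> lattice m" "submod M'" "h \<in> lattice m"
  shows "extend m k M' h \<in> extensions m k M'" "h + Poly_Mapping.single m (\<pi> ^ k) \<in> extend m k M' h"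
proof -
  let ?x = "h + Poly_Mapping.single m (\<pi> ^ k)" and ?E = "extend m k M' h"
  note sub = subgroup_setD[OF is_submodule_overD(1)[OF assms(2)]] is_submodule_overD(2)[OF assms(2)]
  have x: "?x \<in> lattice (Suc m)" "Poly_Mapping.lookup ?x m = \<pi> ^ k"
    using assms(3) lattice_Suc_subset single_mem_lattice[of "\<pi> ^ k" m] pow unif lookup_lattice_last[of h m]
    by (auto intro!: lattice_closed(4) simp: lookup_add)
  have "?E \<subseteq> lattice (Suc m)"
  proof
    fix v assume "v \<in> ?E"
    then obtain s where "s \<in> S" "v - coord_scale s ?x \<in> M'" by (auto simp: extend_def)
    hence "v - coord_scale s ?x + coord_scale s ?x \<in> lattice (Suc m)"
      using lattice_closed(4)[OF _ lattice_closed(5)[OF _ x(1)]] assms(1) lattice_Suc_subset by blast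
    thus "v \<in> lattice (Suc m)" by simp
  qed
  moreover have "submod ?E"
    unfolding is_submodule_over_def
  proof (intro conjI ballI)
    show "0 \<in> ?E" using sub(1) zero by (auto simp: extend_def coord_scale_simps intro!: bexI[of _ 0])
    fix u v assume "u \<in> ?E" "v \<in> ?E"
    then obtain s t where st: "s \<in> S" "t \<in> S" "Poly_Mapping.lookup u m = s * \<pi> ^ k" "Poly_Mapping.lookup v m = t * \<pi> ^ k"
      "u - coord_scale s ?x \<in> M'" "v - coord_scale t ?x \<in> M'" by (auto simp: extend_def)
    have "u - v - coord_scale (s - t) ?x = (u - coord_scale s ?x) - (v - coord_scale t ?x)"
      by (simp add: coord_scale_simps)
    hence "u - v - coord_scale (s - t) ?x \<in> M'" using sub(2) st by metis
    thus "u - v \<in> ?E" using st diff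
      by (auto simp: extend_def lookup_minus left_diff_distrib intro!: bexI[of _ "s - t"])
  next
    fix r u assume r: "r \<in> S" "u \<in> ?E"
    then obtain s where s: "s \<in> S" "Poly_Mapping.lookup u m = s * \<pi> ^ k" "u - coord_scale s ?x \<in> M'"
      by (auto simp: extend_def)
    have "coord_scale r u - coord_scale (r * s) ?x = coord_scale r (u - coord_scale s ?x)"
      by (simp add: coord_scale_simps)
    hence "coord_scale r u - coord_scale (r * s) ?x \<in> M'" using sub(5) s r by metis
    thus "coord_scale r u \<in> ?E" using s r mult
      by (auto simp: extend_def intro!: bexI[of _ "r * s"])
  qed
  moreover have xs: "coord_scale s ?x \<in> ?E" if "s \<in> S" for s
    using that sub(1) x(2) by (auto simp: extend_def intro!: bexI[of _ s])
  have "(\<lambda>v. Poly_Mapping.lookup v m) ` ?E = ideal_pow k"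
  proof (intro equalityI subsetI)
    fix y assume "y \<in> ideal_pow k"
    then obtain s where "s \<in> S" "y = s * \<pi> ^ k" by (auto simp: ideal_pow_def mult.commute)
    thus "y \<in> (\<lambda>v. Poly_Mapping.lookup v m) ` ?E"
      using xs x(2) by (intro image_eqI[of _ _ "coord_scale s ?x"]) auto
  qed (auto simp: extend_def ideal_pow_def mult.commute)
  moreover have "?E \<inter> lattice m = M'"
  proof (intro equalityI subsetI)
    fix v assume v: "v \<in> ?E \<inter> lattice m"
    then obtain s where s: "s \<in> S" "0 = s * \<pi> ^ k" "v - coord_scale s ?x \<in> M'"
      using lookup_lattice_last by (auto simp: extend_def)
    hence "s = 0" using unif by simp
    thus "v \<in> M'" using s by (simp add: coord_scale_simps)
  next
    fix v assume "v \<in> M'"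
    thus "v \<in> ?E \<inter> lattice m"
      using assms(1) lookup_lattice_last zero
      by (auto simp: extend_def coord_scale_simps intro!: bexI[of _ 0])
  qed
  ultimately show "?E \<in> extensions m k M'" by (simp add: extensions_def)
  show "?x \<in> ?E" using xs[OF one] by (simp add: coord_scale_simps)
qed

lemma extensions_obtain:
  assumes M: "M \<in> extensions m k M'"
  obtains h where "h \<in> lattice m" "h + Poly_Mapping.single m (\<pi> ^ k) \<in> M"
proof -
  let ?e = "Poly_Mapping.single m (\<pi> ^ k)"
  have "\<pi> ^ k * 1 \<in> ideal_pow k" unfolding ideal_pow_def using one by blast
  hence "\<pi> ^ k \<in> (\<lambda>v. Poly_Mapping.lookup v m) ` M" using M by (simp add: extensions_def)
  then obtain v where v: "v \<in> M" "Poly_Mapping.lookup v m = \<pi> ^ k" by auto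
  have "v - ?e \<in> lattice (Suc m)"
    using v M single_mem_lattice pow unif by (intro lattice_closed(2)) (auto simp: extensions_def)
  hence "v - ?e \<in> lattice m" using v by (simp add: lattice_Suc_iff[of _ m] lookup_minus)
  thus thesis using that[of "v - ?e"] v by simp
qed

text \<open>The vectors h with h + pi^k e_m in M form one coset of M' in S^m, and each coset belongs
  to exactly one M. The number does not depend on k.\<close>

lemma card_extensions:
  assumes "M' \<subseteq> lattice m" "submod M'"
  shows "card (extensions m k M') = subgroup_index (lattice m) M'"
    and "subgroup_index (lattice m) M' \<noteq> 0 \<Longrightarrow> finite (extensions m k M')"
proof -
  let ?e = "Poly_Mapping.single m (\<pi> ^ k)"
  note sub = subgroup_setD[OF is_submodule_overD(1)[OF assms(2)]]
  define D where "D M = {h \<in> lattice m. h + ?e \<in> M}" for M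
  define Q where "Q h = {h' \<in> lattice m. h' - h \<in> M'}" for h
  have D: "D M = Q h" if "M \<in> extensions m k M'" "h \<in> D M" for M h
  proof -
    have M: "submod M" "M \<inter> lattice m = M'" "h \<in> lattice m" "h + ?e \<in> M"
      using that by (auto simp: extensions_def D_def)
    note subM = subgroup_setD[OF is_submodule_overD(1)[OF M(1)]]
    have "h' + ?e \<in> M \<longleftrightarrow> h' - h \<in> M'" if h': "h' \<in> lattice m" for h'
    proof -
      have "h' - h \<in> M' \<longleftrightarrow> h' - h \<in> M" using M h' lattice_closed(2) by blast
      also have "\<dots> \<longleftrightarrow> h' + ?e \<in> M"
        using subM(2)[OF _ M(4), of "h' + ?e"] subM(4)[OF _ M(4), of "h' - h"] by auto
      finally show ?thesis by simp
    qed
    thus ?thesis unfolding D_def Q_def by auto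
  qed
  have nonempty: "D M \<noteq> {}" if M: "M \<in> extensions m k M'" for M
    using extensions_obtain[OF M] unfolding D_def by blast
  have "inj_on D (extensions m k M')"
  proof (rule inj_onI)
    fix M N assume MN: "M \<in> extensions m k M'" "N \<in> extensions m k M'" "D M = D N"
    obtain h where h: "h \<in> D M" using nonempty MN by blast
    hence "h \<in> lattice m" "h + ?e \<in> M" "h + ?e \<in> N" using MN(3) by (auto simp: D_def)
    hence "M = extend m k M' h" "N = extend m k M' h"
      using MN extensions_eq_extend by blast+
    thus "M = N" by simp
  qed
  moreover have im: "D ` extensions m k M' = Q ` lattice m"
  proof (intro equalityI subsetI)
    fix u assume "u \<in> D ` extensions m k M'"
    then obtain M where M: "M \<in> extensions m k M'" "u = D M" by blast
    obtain h where h: "h \<in> D M" using nonempty[OF M(1)] by blast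
    have "u = Q h" "h \<in> lattice m" using D[OF M(1) h] M h by (auto simp: D_def)
    thus "u \<in> Q ` lattice m" by blast
  next
    fix u assume "u \<in> Q ` lattice m"
    then obtain h where h: "h \<in> lattice m" "u = Q h" by blast
    have "h \<in> D (extend m k M' h)" using extend_mem_extensions(2)[OF assms h(1)] h by (simp add: D_def)
    thus "u \<in> D ` extensions m k M'"
      using D extend_mem_extensions(1)[OF assms h(1)] h by (metis imageI)
  qed
  moreover have idx: "subgroup_index (lattice m) M' = card (Q ` lattice m)"
  proof (rule subgroup_index_eq_card_image)
    fix x y assume xy: "x \<in> lattice m" "y \<in> lattice m"
    show "Q x = Q y \<longleftrightarrow> x - y \<in> M'"
    proof
      assume "Q x = Q y"
      moreover have "x \<in> Q x" using xy sub(1) by (simp add: Q_def)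
      ultimately have "x \<in> Q y" by simp
      thus "x - y \<in> M'" by (simp add: Q_def)
    next
      assume *: "x - y \<in> M'"
      have "z - x \<in> M' \<longleftrightarrow> z - y \<in> M'" for z
        using sub(4)[OF _ *, of "z - x"] sub(2)[OF _ *, of "z - y"] by auto
      thus "Q x = Q y" by (simp add: Q_def)
    qed
  qed
  ultimately show "card (extensions m k M') = subgroup_index (lattice m) M'" by (metis card_image)
  show "finite (extensions m k M')" if "subgroup_index (lattice m) M' \<noteq> 0"
    using that \<open>inj_on D (extensions m k M')\<close> unfolding idx im[symmetric]
    by (metis card.infinite finite_imageD)
qed

text \<open>Between M and S^(m+1) lie the vectors with last coordinate in pi^k S. They form S^m + M,
  in which M has the index of M' in S^m, and their own index in S^(m+1) is p^k.\<close>

lemma index_extensions: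
  assumes "M \<in> extensions m k M'"
  shows "subgroup_index (lattice (Suc m)) M = p ^ k * subgroup_index (lattice m) M'"
proof -
  let ?t = "\<lambda>v. Poly_Mapping.lookup v m"
  have M: "M \<subseteq> lattice (Suc m)" "submod M" "?t ` M = ideal_pow k" "M \<inter> lattice m = M'"
    using assms by (auto simp: extensions_def)
  let ?N = "{v \<in> lattice (Suc m). ?t v \<in> ideal_pow k}"
  have sg: "subgroup_set (lattice n)" for n using submod_lattice is_submodule_overD(1) by blast
  have sgM: "subgroup_set M" using M(2) by (rule is_submodule_overD(1))
  have N: "?N = {x + y |x y. x \<in> lattice m \<and> y \<in> M}"
  proof (intro equalityI subsetI)
    fix v assume v: "v \<in> ?N"
    then obtain y where y: "y \<in> M" "?t v = ?t y" using M(3) by (metis (no_types, lifting) image_iff mem_Collect_eq)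
    hence "v - y \<in> lattice m" using v M(1) lattice_closed(2)[of v "Suc m" y]
      by (auto simp: lattice_Suc_iff[of _ m] lookup_minus)
    moreover have "v = (v - y) + y" by simp
    ultimately show "v \<in> {x + y |x y. x \<in> lattice m \<and> y \<in> M}" using y by blast
  next
    fix v assume "v \<in> {x + y |x y. x \<in> lattice m \<and> y \<in> M}"
    then obtain x y where xy: "v = x + y" "x \<in> lattice m" "y \<in> M" by blast
    have "?t v = ?t y" using xy lookup_lattice_last by (simp add: lookup_add)
    moreover have "v \<in> lattice (Suc m)" using xy M(1) lattice_Suc_subset by (auto intro!: lattice_closed(4))
    ultimately show "v \<in> ?N" using xy M(3) by auto
  qed
  have "?t ` lattice (Suc m) = S"
  proof (intro equalityI subsetI)
    fix x assume "x \<in> S"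
    thus "x \<in> ?t ` lattice (Suc m)" using single_mem_lattice by (intro image_eqI[of _ _ "Poly_Mapping.single m x"]) auto
  qed (use lookup_mem_S in auto)
  hence "subgroup_index (lattice (Suc m)) ?N = p ^ k"
    using subgroup_index_vimage[OF subgroup_ideal_pow, of "lattice (Suc m)" ?t k] index_ideal_pow lattice_closed(2)
    by (simp add: lookup_minus)
  moreover have "subgroup_index ?N M = subgroup_index (lattice m) M'"
    unfolding N using subgroup_index_sum[OF sg sgM] M(4) by (simp add: Int_commute)
  moreover have "subgroup_set ?N"
    by (rule subgroup_set_vimage[OF subgroup_ideal_pow sg]) (simp add: lookup_minus)
  moreover have "M \<subseteq> ?N" using M by auto
  ultimately show ?thesis using subgroup_index_mult[OF sg _ sgM, of ?N "Suc m"] by auto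
qed

text \<open>Finite index puts pi^i e_m and pi^j e_m into one coset of M for some i < j, so the ideal
  of last coordinates is non-zero and hence generated by a power of pi.\<close>

lemma mem_extensions:
  assumes "M \<subseteq> lattice (Suc m)" "submod M" "subgroup_index (lattice (Suc m)) M \<noteq> 0"
  shows "\<exists>k. M \<in> extensions m k (M \<inter> lattice m)"
proof -
  let ?t = "\<lambda>v. Poly_Mapping.lookup v m"
  note sub = subgroup_setD[OF is_submodule_overD(1)[OF assms(2)]] is_submodule_overD(2)[OF assms(2)]
  have "finite (coset_of M ` lattice (Suc m))"
    using assms(3) subgroup_index_eq_card_cosets[OF is_submodule_overD(1)[OF assms(2)]]
    by (metis card.infinite)
  moreover have "(\<lambda>i. coset_of M (Poly_Mapping.single m (\<pi> ^ i))) ` UNIV \<subseteq> coset_of M ` lattice (Suc m)"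
    using single_mem_lattice pow unif by auto
  ultimately have "\<not> inj (\<lambda>i :: nat. coset_of M (Poly_Mapping.single m (\<pi> ^ i)))"
    using finite_imageD finite_subset infinite_UNIV_nat by meson
  then obtain i j :: nat where "i < j" "coset_of M (Poly_Mapping.single m (\<pi> ^ i)) = coset_of M (Poly_Mapping.single m (\<pi> ^ j))"
    unfolding inj_def by (metis nat_neq_iff)
  hence "Poly_Mapping.single m (\<pi> ^ i) - Poly_Mapping.single m (\<pi> ^ j) \<in> M"
    using coset_of_eq_iff[OF is_submodule_overD(1)[OF assms(2)]] by blast
  hence mem: "\<pi> ^ i - \<pi> ^ j \<in> ?t ` M" by (rule rev_image_eqI) (simp add: lookup_minus)
  have "subgroup_set (?t ` M)"
    unfolding subgroup_set_def
  proof (intro conjI ballI)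
    show "0 \<in> ?t ` M" using sub(1) by (rule rev_image_eqI) simp
    fix x y assume "x \<in> ?t ` M" "y \<in> ?t ` M"
    then obtain u v where "u \<in> M" "v \<in> M" "x = ?t u" "y = ?t v" by blast
    thus "x - y \<in> ?t ` M" using sub(2)[of u v] by (intro image_eqI[of _ _ "u - v"]) (auto simp: lookup_minus)
  qed
  moreover have "?t ` M \<subseteq> S" using assms(1) lookup_mem_S by blast
  moreover have "s * x \<in> ?t ` M" if "s \<in> S" "x \<in> ?t ` M" for s x
  proof -
    obtain u where "u \<in> M" "x = ?t u" using \<open>x \<in> ?t ` M\<close> by blast
    thus ?thesis using sub(5)[OF that(1)] by (intro image_eqI[of _ _ "coord_scale s u"]) auto
  qed
  ultimately obtain k where "?t ` M = ideal_pow k"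
    using ideal_eq_ideal_pow[OF _ _ _ mem power_unif_diff_nonzero[OF \<open>i < j\<close>]] by blast
  thus ?thesis using assms by (auto simp: extensions_def)
qed

end

section \<open>The zeta function of S^m\<close>

definition fps_dilate :: "'a :: idom \<Rightarrow> 'a fps \<Rightarrow> 'a fps" where
  "fps_dilate c f = f oo (fps_const c * fps_X)"

lemma fps_dilate_eq: "fps_dilate c f = Abs_fps (\<lambda>n. c ^ n * fps_nth f n)"
  by (rule fps_ext) (simp add: fps_dilate_def fps_compose_nth power_mult_distrib fps_const_power
      fps_X_power_nth mult_delta_right sum.delta mult.commute cong: sum.cong)

text \<open>The substitution of p X for X comes from the p^i cosets over a submodule of index p^i.
  It moves every factor from h to h + 1 and makes room for the factor h = 0 of a further
  coordinate.\<close>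

lemma fps_dilate_prod_inverse:
  "fps_dilate (of_nat p) (\<Prod>h<m. inverse (1 - p_pow_minus_s p h)) =
     (\<Prod>h<m. inverse (1 - p_pow_minus_s p (Suc h)))"
proof -
  have 1: "inverse (1 - p_pow_minus_s p h) oo (fps_const (of_nat p) * fps_X) = inverse (1 - p_pow_minus_s p (Suc h))"
    for h
  proof -
    have "p_pow_minus_s p h oo (fps_const (of_nat p) * fps_X) = fps_const (of_nat p ^ h) * (fps_const (of_nat p) * fps_X)"
      unfolding p_pow_minus_s_def by (subst fps_compose_mult_distrib) simp_all
    also have "\<dots> = p_pow_minus_s p (Suc h)"
      unfolding p_pow_minus_s_def power_Suc mult.assoc[symmetric] fps_const_mult by (simp only: mult.commute)
    finally have "(1 - p_pow_minus_s p h) oo (fps_const (of_nat p) * fps_X) = 1 - p_pow_minus_s p (Suc h)"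
      by (simp add: fps_compose_sub_distrib)
    thus ?thesis by (subst fps_inverse_compose) (simp_all add: p_pow_minus_s_def)
  qed
  show ?thesis
    unfolding fps_dilate_def by (subst fps_compose_prod_distrib) (simp_all add: 1)
qed

lemma prime_power_mult_eqD:
  assumes "1 < (p :: nat)" "p ^ k * x = p ^ n"
  shows "k \<le> n" "x = p ^ (n - k)"
proof -
  have "x \<noteq> 0" using assms by (metis less_nat_zero_code mult_0_right power_not_zero)
  hence "p ^ k \<le> p ^ n" using assms(2) by (metis One_nat_def Suc_leI mult.right_neutral mult_le_mono2 neq0_conv)
  thus k: "k \<le> n" using power_le_imp_le_exp[OF assms(1)] by blast
  have "p ^ k * x = p ^ k * p ^ (n - k)" using k assms(2) by (simp flip: power_add)
  thus "x = p ^ (n - k)" using assms(1) by simp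
qed

context residue_dvr
begin

definition submods :: "nat \<Rightarrow> nat \<Rightarrow> (nat \<Rightarrow>\<^sub>0 'k) set set" where
  "submods m n = {M. M \<subseteq> lattice m \<and> submod M \<and> subgroup_index (lattice m) M = p ^ n}"

lemma submods_disjoint: "i \<noteq> j \<Longrightarrow> submods m i \<inter> submods m j = {}"
  using p_gt_1 by (auto simp: submods_def)

lemma submod_Int_lattice: "submod M \<Longrightarrow> submod (M \<inter> lattice m)"
  using submod_lattice[of m] by (auto simp: is_submodule_over_def)

text \<open>Intersecting with S^m is the fibration: over a submodule of index p^i there are p^i
  extensions for each exponent r of the ideal of last coordinates, and r adds to the exponent of the
  index.\<close>

lemma submods_Suc:
  assumes "\<And>n. finite (submods m n)"
  shows "gen_fun (submods (Suc m)) =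
      Abs_fps (\<lambda>i. of_nat (p ^ i * card (submods m i))) * Abs_fps (\<lambda>r. of_nat 1)"
    and "finite (submods (Suc m) n)"
proof -
  have f: "\<exists>i\<le>n. M \<inter> lattice m \<in> submods m i" if M: "M \<in> submods (Suc m) n" for M n
  proof -
    obtain k where k: "M \<in> extensions m k (M \<inter> lattice m)"
      using mem_extensions[of M m] M p_gt_1 by (auto simp: submods_def)
    have "p ^ k * subgroup_index (lattice m) (M \<inter> lattice m) = p ^ n"
      using index_extensions[OF k] M by (simp add: submods_def)
    thus ?thesis
      using prime_power_mult_eqD[OF p_gt_1, of k _ n] M submod_Int_lattice[of M m]
      by (intro exI[of _ "n - k"]) (auto simp: submods_def)
  qed
  have fib: "{M \<in> submods (Suc m) (i + r). M \<inter> lattice m = M'} = extensions m r M'" if M': "M' \<in> submods m i" for i r M'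
  proof (intro equalityI subsetI)
    fix M assume M: "M \<in> {M \<in> submods (Suc m) (i + r). M \<inter> lattice m = M'}"
    then obtain k where k: "M \<in> extensions m k M'"
      using mem_extensions[of M m] p_gt_1 by (auto simp: submods_def)
    have "p ^ k * p ^ i = p ^ (i + r)"
      using index_extensions[OF k] M M' by (simp add: submods_def)
    hence "k = r" using p_gt_1 by (simp flip: power_add)
    thus "M \<in> extensions m r M'" using k by simp
  next
    fix M assume M: "M \<in> extensions m r M'"
    hence "subgroup_index (lattice (Suc m)) M = p ^ (i + r)"
      using index_extensions[OF M] M' by (simp add: submods_def power_add)
    thus "M \<in> {M \<in> submods (Suc m) (i + r). M \<inter> lattice m = M'}"
      using M by (auto simp: submods_def extensions_def)
  qed
  have c: "card (extensions m r M') = p ^ i * 1" "finite (extensions m r M')" if "M' \<in> submods m i" for i r M'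
    using card_extensions[of M' m r] that p_gt_1 by (auto simp: submods_def)
  show "gen_fun (submods (Suc m)) =
      Abs_fps (\<lambda>i. of_nat (p ^ i * card (submods m i))) * Abs_fps (\<lambda>r. of_nat 1)"
    by (rule gen_fun_fibration(1)[where f = "\<lambda>M. M \<inter> lattice m"])
      (use assms submods_disjoint f c in \<open>auto simp: fib\<close>)
  show "finite (submods (Suc m) n)"
    by (rule gen_fun_fibration(2)[where f = "\<lambda>M. M \<inter> lattice m" and A = "submods m"
          and d = "\<lambda>i. p ^ i" and c = "\<lambda>_. 1"])
      (use assms submods_disjoint f c in \<open>auto simp: fib\<close>)
qed

lemma submods_0: "submods 0 n = (if n = 0 then {{0}} else {})"
proof -
  have "subgroup_set ({0} :: (nat \<Rightarrow>\<^sub>0 'k) set)" by (simp add: subgroup_set_def)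
  hence 1: "subgroup_index {0 :: nat \<Rightarrow>\<^sub>0 'k} {0} = 1" by (intro subgroup_index_self) auto
  have "M \<subseteq> {0} \<and> submod M \<longleftrightarrow> M = {0}" for M
    by (auto simp: is_submodule_over_def coord_scale_simps)
  hence "submods 0 n = {M. M = {0} \<and> p ^ n = 1}"
    unfolding submods_def coord_vecs_0 using 1 by (metis (no_types, lifting))
  thus ?thesis using p_gt_1 by simp
qed

lemma finite_submods: "finite (submods m n)"
  by (induction m arbitrary: n) (simp add: submods_0, rule submods_Suc(2))

theorem gen_fun_submods: "gen_fun (submods m) = (\<Prod>h<m. inverse (1 - p_pow_minus_s p h))"
proof (induction m)
  case 0
  show ?case by (rule fps_ext) (simp add: gen_fun_def submods_0)
next
  case (Suc m)
  have "Abs_fps (\<lambda>i. of_nat (p ^ i * card (submods m i))) = fps_dilate (of_nat p) (gen_fun (submods m))"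
    by (simp add: fps_dilate_eq gen_fun_def)
  also have "\<dots> = (\<Prod>h<m. inverse (1 - p_pow_minus_s p (Suc h)))"
    unfolding Suc.IH by (rule fps_dilate_prod_inverse)
  finally have 1: "Abs_fps (\<lambda>i. of_nat (p ^ i * card (submods m i))) = (\<Prod>h<m. inverse (1 - p_pow_minus_s p (Suc h)))" .
  \<comment> \<open>The exponents r of the last coordinate contribute a geometric series, which is
    the factor h = 0.\<close>
  have "Abs_fps (\<lambda>r. of_nat 1 :: rat) = inverse (inverse (Abs_fps (\<lambda>_. 1)))"
    by (subst fps_inverse_idempotent) simp_all
  also have "\<dots> = inverse (1 - p_pow_minus_s p 0)"
    by (simp add: fps_inverse_gp' p_pow_minus_s_def)
  finally show ?case
    unfolding submods_Suc(1)[OF finite_submods] 1 prod.lessThan_Suc_shift by (simp add: mult.commute)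
qed

text \<open>A basis of the intersection with S^m, together with one element of M whose last
  coordinate is pi^k, is a basis of M. Full rank is used twice: a preimage has as many submodules of
  given index as S^m, and M/pi M has dimension m.\<close>

lemma submod_free:
  assumes "M \<subseteq> lattice m" "submod M" "subgroup_index (lattice m) M \<noteq> 0"
  shows "\<exists>f. bij_betw f (lattice m) M \<and>
    (\<forall>u\<in>lattice m. \<forall>v\<in>lattice m. f (u - v) = f u - f v) \<and>
    (\<forall>s\<in>S. \<forall>v\<in>lattice m. f (coord_scale s v) = coord_scale s (f v))"
  using assms
proof (induction m arbitrary: M)
  case 0
  hence "M = {0}" by (auto simp: coord_vecs_0 is_submodule_over_def)
  thus ?case by (intro exI[of _ id]) (simp add: coord_vecs_0 coord_scale_simps)
next
  case (Suc m)
  let ?t = "\<lambda>v. Poly_Mapping.lookup v m"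
  let ?M' = "M \<inter> lattice m"
  obtain k where k: "M \<in> extensions m k ?M'" using mem_extensions[OF Suc.prems] by blast
  note sub = subgroup_setD[OF is_submodule_overD(1)[OF Suc.prems(2)]] is_submodule_overD(2)[OF Suc.prems(2)]
  have "subgroup_index (lattice m) ?M' \<noteq> 0"
    using index_extensions[OF k] Suc.prems(3) by auto
  then obtain g where g: "bij_betw g (lattice m) ?M'"
    and g_diff: "\<And>u v. u \<in> lattice m \<Longrightarrow> v \<in> lattice m \<Longrightarrow> g (u - v) = g u - g v"
    and g_scale: "\<And>s v. s \<in> S \<Longrightarrow> v \<in> lattice m \<Longrightarrow> g (coord_scale s v) = coord_scale s (g v)"
    using Suc.IH[of ?M'] submod_Int_lattice[OF Suc.prems(2)] by auto
  obtain h where h: "h \<in> lattice m" "h + Poly_Mapping.single m (\<pi> ^ k) \<in> M" using extensions_obtain[OF k] .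
  define x where "x = h + Poly_Mapping.single m (\<pi> ^ k)"
  have x: "x \<in> M" "?t x = \<pi> ^ k" using h lookup_lattice_last by (auto simp: x_def lookup_add)
  define r where "r v = v - Poly_Mapping.single m (?t v)" for v :: "nat \<Rightarrow>\<^sub>0 'k"
  have r: "r v \<in> lattice m" if "v \<in> lattice (Suc m)" for v
    using that lattice_closed(2)[OF that single_mem_lattice[OF lookup_mem_S[OF that], of m m]]
    by (auto simp: lattice_Suc_iff[of _ m] r_def lookup_minus)
  have r_lin: "r (u - v) = r u - r v" "r (coord_scale s v) = coord_scale s (r v)" for u v s
    by (rule poly_mapping_eqI; simp add: r_def lookup_minus lookup_add lookup_single when_def algebra_simps)+
  have g0: "g v = 0 \<longleftrightarrow> v = 0" if "v \<in> lattice m" for v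
  proof -
    have "g 0 = 0" using g_diff[of 0 0] lattice_closed(1) by simp
    thus ?thesis using bij_betw_imp_inj_on[OF g] that lattice_closed(1)[of m] by (metis inj_onD)
  qed
  \<comment> \<open>The last coordinate becomes the coefficient of x, the others pass through g.
    Since pi^k is non-zero, the last coordinate can be recovered from the image.\<close>
  define f where "f v = g (r v) + coord_scale (?t v) x" for v
  have gM: "g v \<in> ?M'" if "v \<in> lattice m" for v using g that by (auto simp: bij_betw_def)
  have f_diff: "f (u - v) = f u - f v" if "u \<in> lattice (Suc m)" "v \<in> lattice (Suc m)" for u v
    using g_diff r that by (simp add: f_def r_lin lookup_minus coord_scale_simps)
  have f_scale: "f (coord_scale s v) = coord_scale s (f v)" if "s \<in> S" "v \<in> lattice (Suc m)" for s v
    using g_scale r that by (simp add: f_def r_lin coord_scale_simps)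
  have f0: "v = 0" if v: "v \<in> lattice (Suc m)" "f v = 0" for v
  proof -
    have "?t (g (r v)) = 0" using gM[OF r[OF v(1)]] lookup_lattice_last by blast
    moreover have "?t (f v) = 0" using v by simp
    ultimately have "?t v * \<pi> ^ k = 0" using x by (simp add: f_def lookup_add)
    hence t: "?t v = 0" using unif by simp
    hence "g (r v) = 0" using v by (simp add: f_def coord_scale_simps)
    hence "r v = 0" using g0 r v by blast
    thus ?thesis using t by (simp add: r_def)
  qed
  have "inj_on f (lattice (Suc m))"
  proof (rule inj_onI)
    fix u v assume "u \<in> lattice (Suc m)" "v \<in> lattice (Suc m)" "f u = f v"
    moreover from this have "f (u - v) = 0" using f_diff by simp
    ultimately have "u - v = 0" using f0 lattice_closed(2) by blast
    thus "u = v" by simp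
  qed
  moreover have "f ` lattice (Suc m) = M"
  proof (intro equalityI subsetI)
    fix v assume "v \<in> f ` lattice (Suc m)"
    then obtain u where u: "u \<in> lattice (Suc m)" "v = f u" by blast
    show "v \<in> M" unfolding u(2) f_def
      using gM[OF r[OF u(1)]] sub(5)[OF lookup_mem_S[OF u(1)] x(1)] by (intro sub(4)) auto
  next
    fix v assume v: "v \<in> M"
    hence "?t v \<in> ideal_pow k" using k by (auto simp: extensions_def)
    then obtain s where s: "s \<in> S" "?t v = s * \<pi> ^ k" by (auto simp: ideal_pow_def mult.commute)
    have "v - coord_scale s x \<in> M" using v s x sub by simp
    moreover from this have "v - coord_scale s x \<in> lattice m"
      using Suc.prems(1) s x by (auto simp: lattice_Suc_iff[of _ m] lookup_minus)
    ultimately obtain w where w: "w \<in> lattice m" "g w = v - coord_scale s x"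
      using g unfolding bij_betw_def by (metis IntI imageE)
    let ?u = "w + Poly_Mapping.single m s"
    have t: "?t ?u = s" using lookup_lattice_last[OF w(1)] by (simp add: lookup_add)
    hence "r ?u = w" by (simp add: r_def)
    hence "f ?u = v" using w t by (simp add: f_def)
    moreover have "?u \<in> lattice (Suc m)"
      using w s lattice_Suc_subset single_mem_lattice by (intro lattice_closed(4)) auto
    ultimately show "v \<in> f ` lattice (Suc m)" by blast
  qed
  ultimately show ?case using f_diff f_scale by (intro exI[of _ f]) (auto simp: bij_betw_def)
qed

section \<open>Reduction modulo the uniformizer, and submodules with prescribed image\<close>

definition res_vec :: "(nat \<Rightarrow>\<^sub>0 'k) \<Rightarrow> (nat \<Rightarrow>\<^sub>0 'p mod_ring)" where
  "res_vec = Poly_Mapping.map \<rho>"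

lemma lookup_res_vec: "Poly_Mapping.lookup (res_vec v) i = \<rho> (Poly_Mapping.lookup v i)"
  by (simp add: res_vec_def Poly_Mapping.map.rep_eq when_def res_zero)

lemma res_vec_simps:
  "u \<in> lattice m \<Longrightarrow> v \<in> lattice m \<Longrightarrow> res_vec (u - v) = res_vec u - res_vec v"
  "s \<in> S \<Longrightarrow> v \<in> lattice m \<Longrightarrow> res_vec (coord_scale s v) = coord_scale (\<rho> s) (res_vec v)"
  by (rule poly_mapping_eqI; simp add: lookup_res_vec lookup_minus res_diff res_mult lookup_mem_S)+

lemma res_vec_surj: "res_vec ` lattice m = coord_vecs m UNIV"
proof (induction m)
  case 0
  have "res_vec 0 = 0" by (rule poly_mapping_eqI) (simp add: lookup_res_vec res_zero)
  thus ?case by (simp add: coord_vecs_0)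
next
  case (Suc m)
  show ?case
  proof (intro equalityI subsetI)
    fix w :: "nat \<Rightarrow>\<^sub>0 'p mod_ring" assume w: "w \<in> coord_vecs (Suc m) UNIV"
    let ?e = "Poly_Mapping.single m (Poly_Mapping.lookup w m)"
    have "w - ?e \<in> coord_vecs m UNIV"
      using w by (subst coord_vecs_Suc_iff) (auto simp: coord_vecs_iff lookup_minus lookup_single when_def)
    then obtain v where v: "v \<in> lattice m" "res_vec v = w - ?e" unfolding Suc.IH[symmetric] by (metis imageE)
    obtain n where n: "\<rho> (of_nat n) = Poly_Mapping.lookup w m" using res_surj by blast
    let ?u = "v + Poly_Mapping.single m (of_nat n)"
    have "Poly_Mapping.lookup (res_vec ?u) i = Poly_Mapping.lookup w i" for i
    proof -
      have "Poly_Mapping.lookup (res_vec v) i = Poly_Mapping.lookup (w - ?e) i" using v by simp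
      thus ?thesis using n lookup_lattice_last[OF v(1)]
        by (cases "i = m") (simp_all add: lookup_res_vec lookup_add lookup_single lookup_minus res_zero)
    qed
    hence "res_vec ?u = w" by (rule poly_mapping_eqI)
    moreover have "?u \<in> lattice (Suc m)"
      using v lattice_Suc_subset single_mem_lattice nat_mem by (intro lattice_closed(4)) auto
    ultimately show "w \<in> res_vec ` lattice (Suc m)" by blast
  qed (auto simp: coord_vecs_iff lookup_res_vec res_zero)
qed

lemma res_vec_eq_0_iff:
  assumes "v \<in> lattice m"
  shows "res_vec v = 0 \<longleftrightarrow> (\<exists>u\<in>lattice m. v = coord_scale \<pi> u)"
proof
  assume "res_vec v = 0"
  hence "\<rho> (Poly_Mapping.lookup v i) = 0" for i using lookup_res_vec[of v i] by simp
  hence div: "\<exists>y\<in>S. Poly_Mapping.lookup v i = \<pi> * y" for i using res_eq_0 lookup_mem_S[OF assms] by simp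
  let ?u = "coord_scale (inverse \<pi>) v"
  have "Poly_Mapping.lookup ?u i \<in> S" for i using div[of i] unif by (auto simp flip: mult.assoc)
  moreover have "Poly_Mapping.lookup ?u i = 0" if "i \<ge> m" for i using assms that by (simp add: coord_vecs_iff)
  ultimately have "?u \<in> lattice m" by (simp add: coord_vecs_iff)
  moreover have "v = coord_scale \<pi> ?u" using unif by (simp add: coord_scale_simps)
  ultimately show "\<exists>u\<in>lattice m. v = coord_scale \<pi> u" by blast
next
  assume "\<exists>u\<in>lattice m. v = coord_scale \<pi> u"
  then obtain u where u: "u \<in> lattice m" "v = coord_scale \<pi> u" by blast
  show "res_vec v = 0"
    unfolding u(2) res_vec_simps(2)[OF unif(1) u(1)] by (simp add: res_unif coord_scale_simps)
qed

end

text \<open>A surjection of S^m onto F_p^c that is linear along the residue map. In the application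
  it takes the residues of the last c coordinates.\<close>

locale lattice_quotient = residue_dvr S \<pi> \<rho> p
  for S :: "'k :: field set" and \<pi> :: 'k and \<rho> :: "'k \<Rightarrow> 'p :: prime_card mod_ring" and p :: nat +
  fixes m :: nat and \<phi> :: "(nat \<Rightarrow>\<^sub>0 'k) \<Rightarrow> (nat \<Rightarrow>\<^sub>0 'p mod_ring)" and c :: nat
  assumes phi_diff: "u \<in> lattice m \<Longrightarrow> v \<in> lattice m \<Longrightarrow> \<phi> (u - v) = \<phi> u - \<phi> v"
    and phi_scale: "s \<in> S \<Longrightarrow> v \<in> lattice m \<Longrightarrow> \<phi> (coord_scale s v) = coord_scale (\<rho> s) (\<phi> v)"
    and phi_surj: "\<phi> ` lattice m = coord_vecs c UNIV"
begin

abbreviation T :: "(nat \<Rightarrow>\<^sub>0 'p mod_ring) set" where "T \<equiv> coord_vecs c UNIV"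

lemma phi_add: "u \<in> lattice m \<Longrightarrow> v \<in> lattice m \<Longrightarrow> \<phi> (u + v) = \<phi> u + \<phi> v"
  using phi_diff[of "u + v" v] lattice_closed(4) by simp

lemma subspace_image:
  assumes "M \<subseteq> lattice m" "submod M"
  shows "coord.subspace (\<phi> ` M)"
proof (rule coord.subspaceI)
  note sub = subgroup_setD[OF is_submodule_overD(1)[OF assms(2)]] is_submodule_overD(2)[OF assms(2)]
  have "\<phi> 0 = 0" using phi_diff[of 0 0] lattice_closed(1) by simp
  thus "0 \<in> \<phi> ` M" using sub(1) by (metis imageI)
  fix x assume "x \<in> \<phi> ` M"
  then obtain u where u: "u \<in> M" "x = \<phi> u" by blast
  {
    fix y assume "y \<in> \<phi> ` M"
    then obtain v where v: "v \<in> M" "y = \<phi> v" by blast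
    have "x + y = \<phi> (u + v)" using phi_add u v assms(1) by (simp add: subset_iff)
    thus "x + y \<in> \<phi> ` M" using sub(4)[OF u(1) v(1)] by blast
  next
    fix a :: "'p mod_ring"
    obtain n where n: "\<rho> (of_nat n) = a" using res_surj by blast
    have "coord_scale a x = \<phi> (coord_scale (of_nat n) u)"
      using phi_scale[of "of_nat n" u] nat_mem u assms(1) n by (simp add: subset_iff)
    thus "coord_scale a x \<in> \<phi> ` M" using sub(5)[OF nat_mem(1) u(1)] by blast
  }
qed

lemma subgroup_subspace: "coord.subspace W \<Longrightarrow> subgroup_set W" for W :: "(nat \<Rightarrow>\<^sub>0 'p mod_ring) set"
  by (simp add: subgroup_set_def coord.subspace_0 coord.subspace_diff)

lemma subgroup_T: "subgroup_set T" by (rule subgroup_subspace[OF subspace_coord_vecs])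

lemma index_mult_card_subspace: "coord.subspace W \<Longrightarrow> W \<subseteq> T \<Longrightarrow> p ^ c = subgroup_index T W * card W"
  using card_eq_subgroup_index_mult[OF subgroup_T subgroup_subspace] by (simp add: card_coord_vecs p_eq)

lemma index_subspace:
  assumes "coord.subspace W" "W \<subseteq> T" "card W = p ^ w"
  shows "w \<le> c" "subgroup_index T W = p ^ (c - w)"
  using index_mult_card_subspace[OF assms(1,2)] prime_power_mult_eqD[OF p_gt_1, of w "subgroup_index T W" c] assms(3)
  by (simp_all add: mult.commute)

lemma card_subspace:
  assumes "coord.subspace W" "W \<subseteq> T"
  obtains w where "card W = p ^ w"
proof -
  have "card W dvd p ^ c" using index_mult_card_subspace[OF assms] by simp
  moreover have "prime p" unfolding p_eq by (rule prime_card)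
  ultimately show thesis using that divides_primepow_nat by blast
qed

definition submods_onto :: "(nat \<Rightarrow>\<^sub>0 'p mod_ring) set \<Rightarrow> nat \<Rightarrow> (nat \<Rightarrow>\<^sub>0 'k) set set" where
  "submods_onto W n = {M \<in> submods m n. \<phi> ` M = W}"

text \<open>The preimage N of W has index p^(c-w) and is free of rank m. A basis of N matches its
  submodules with those of S^m, and the index in S^m is larger by p^(c-w).\<close>

lemma gen_fun_submods_into:
  assumes "coord.subspace W" "W \<subseteq> T" "card W = p ^ w"
  shows "gen_fun (\<lambda>n. {M \<in> submods m n. \<phi> ` M \<subseteq> W}) = fps_X ^ (c - w) * gen_fun (submods m)"
proof -
  define N where "N = {v \<in> lattice m. \<phi> v \<in> W}"
  have sgL: "subgroup_set (lattice m)" using submod_lattice is_submodule_overD(1) by blast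
  have sgN: "subgroup_set N"
    unfolding N_def by (rule subgroup_set_vimage[OF subgroup_subspace[OF assms(1)] sgL phi_diff])
  have subN: "submod N"
    unfolding is_submodule_over_iff using sgN lattice_closed(5) phi_scale coord.subspace_scale[OF assms(1)]
    by (auto simp: N_def)
  have NL: "N \<subseteq> lattice m" by (auto simp: N_def)
  have idxN: "subgroup_index (lattice m) N = p ^ (c - w)"
    unfolding N_def using subgroup_index_vimage[OF subgroup_subspace[OF assms(1)] phi_diff lattice_closed(2)]
      index_subspace(2)[OF assms] phi_surj by simp
  obtain f where f: "bij_betw f (lattice m) N"
    and f_diff: "\<And>u v. u \<in> lattice m \<Longrightarrow> v \<in> lattice m \<Longrightarrow> f (u - v) = f u - f v"
    and f_scale: "\<And>s v. s \<in> S \<Longrightarrow> v \<in> lattice m \<Longrightarrow> f (coord_scale s v) = coord_scale s (f v)"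
    using submod_free[OF NL subN] idxN p_gt_1 by auto
  have finj: "inj_on f (lattice m)" and fim: "f ` lattice m = N" using f by (auto simp: bij_betw_def)
  let ?B = "\<lambda>n. {M \<in> submods m n. \<phi> ` M \<subseteq> W}"
  have B: "M \<in> ?B n \<longleftrightarrow> M \<subseteq> N \<and> submod M \<and> p ^ (c - w) * subgroup_index N M = p ^ n" for M n
  proof -
    have "M \<subseteq> N \<longleftrightarrow> M \<subseteq> lattice m \<and> \<phi> ` M \<subseteq> W" by (auto simp: N_def)
    moreover have "subgroup_index (lattice m) M = p ^ (c - w) * subgroup_index N M" if "submod M" "M \<subseteq> N"
      using subgroup_index_mult[OF sgL sgN is_submodule_overD(1)[OF that(1)] that(2) NL] idxN by simp
    ultimately show ?thesis by (auto simp: submods_def)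
  qed
  show ?thesis
  proof (rule gen_fun_shift)
    show "?B n = {}" if "n < c - w" for n
      using that B prime_power_mult_eqD(1)[OF p_gt_1, of "c - w" _ n] by (metis (no_types, lifting) all_not_in_conv not_le)
    fix n
    have img: "f ` M0 \<in> ?B (n + (c - w))" if M0: "M0 \<in> submods m n" for M0
    proof -
      have M: "M0 \<subseteq> lattice m" "submod M0" "subgroup_index (lattice m) M0 = p ^ n"
        using M0 by (auto simp: submods_def)
      note sub = subgroup_setD[OF is_submodule_overD(1)[OF M(2)]] is_submodule_overD(2)[OF M(2)]
      have "f 0 = 0" using f_diff[of 0 0] lattice_closed(1) by simp
      have "submod (f ` M0)"
        unfolding is_submodule_over_def
      proof (intro conjI ballI)
        show "0 \<in> f ` M0" using sub(1) \<open>f 0 = 0\<close> by (metis imageI)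
        show "x - y \<in> f ` M0" if xy: "x \<in> f ` M0" "y \<in> f ` M0" for x y
        proof -
          obtain u v where "u \<in> M0" "v \<in> M0" "x = f u" "y = f v" using xy by blast
          moreover from this have "x - y = f (u - v)" using f_diff M(1) by (simp add: subset_iff)
          ultimately show ?thesis using sub(2) by blast
        qed
        show "coord_scale s x \<in> f ` M0" if sx: "s \<in> S" "x \<in> f ` M0" for s x
        proof -
          obtain u where "u \<in> M0" "x = f u" using sx by blast
          moreover from this have "coord_scale s x = f (coord_scale s u)" using f_scale M(1) sx by (simp add: subset_iff)
          ultimately show ?thesis using sub(5) sx by blast
        qed
      qed
      moreover have "subgroup_index N (f ` M0) = p ^ n"
        using subgroup_index_image[OF sgL is_submodule_overD(1)[OF M(2)] M(1) finj f_diff] M(3) fim by simp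
      moreover have "f ` M0 \<subseteq> N" using M(1) fim by blast
      ultimately show ?thesis unfolding B by (simp add: power_add mult.commute)
    qed
    have "bij_betw (image f) (submods m n) (?B (n + (c - w)))"
      unfolding bij_betw_def
    proof (intro conjI equalityI subsetI)
      show "inj_on (image f) (submods m n)"
        by (rule inj_on_subset[OF inj_on_image_Pow[OF finj]]) (auto simp: submods_def)
      show "M \<in> ?B (n + (c - w))" if "M \<in> image f ` submods m n" for M using that img by blast
      fix M assume "M \<in> ?B (n + (c - w))"
      hence M: "M \<subseteq> N" "submod M" "p ^ (c - w) * subgroup_index N M = p ^ (n + (c - w))" unfolding B by auto
      note sub = is_submodule_overD[OF M(2)]
      let ?M0 = "{v \<in> lattice m. f v \<in> M}"
      have im: "f ` ?M0 = M" using M(1) fim by blast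
      have "subgroup_set ?M0" by (rule subgroup_set_vimage[OF sub(1) sgL f_diff])
      moreover have "submod ?M0"
        unfolding is_submodule_over_iff using \<open>subgroup_set ?M0\<close> sub(2) f_scale lattice_closed(5) by auto
      moreover have "subgroup_index (lattice m) ?M0 = subgroup_index N M"
        using subgroup_index_vimage[OF sub(1) f_diff lattice_closed(2)] fim by simp
      moreover have "subgroup_index N M = p ^ n" using M(3) p_gt_1 by (simp add: power_add mult.commute)
      ultimately have "?M0 \<in> submods m n" by (auto simp: submods_def)
      thus "M \<in> image f ` submods m n" using im by blast
    qed
    from bij_betw_same_card[OF this] show "card (?B (n + (c - w))) = card (submods m n)" by (rule sym)
  qed
qed

text \<open>The submodules with image inside W are sorted by their exact image. This triangular
  system determines the series for W from those of smaller subspaces, and the claimed values solve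
  it.\<close>

theorem gen_fun_submods_onto:
  assumes "coord.subspace W" "W \<subseteq> T" "card W = p ^ w"
  shows "gen_fun (submods_onto W) =
    fps_X ^ (c - w) * (\<Prod>k<w. 1 - p_pow_minus_s p k) * gen_fun (submods m)"
  using assms
proof (induction w arbitrary: W rule: less_induct)
  case (less w)
  let ?G = "\<lambda>i. fps_X ^ (c - i) * (\<Prod>k<i. 1 - p_pow_minus_s p k) * gen_fun (submods m)"
  let ?Sub = "{W'. coord.subspace W' \<and> W' \<subseteq> W}"
  have finT: "finite T" by (rule finite_coord_vecs)
  have finW: "finite W" using less.prems finT finite_subset by blast
  have finSub: "finite ?Sub" by (rule finite_subset[of _ "Pow W"]) (use finW in auto)
  have wc: "w \<le> c" using index_subspace(1)[OF less.prems] .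
  have "gen_fun (\<lambda>n. {M \<in> submods m n. \<phi> ` M \<subseteq> W}) = (\<Sum>W'\<in>?Sub. gen_fun (submods_onto W'))"
  proof (rule gen_fun_UN[OF finSub])
    show "{M \<in> submods m n. \<phi> ` M \<subseteq> W} = (\<Union>W'\<in>?Sub. submods_onto W' n)" for n
      using subspace_image by (auto simp: submods_onto_def submods_def)
    show "finite (submods_onto W' n)" for W' n
      using finite_submods by (simp add: submods_onto_def)
  qed (auto simp: submods_onto_def)
  also have "?Sub = (\<Union>i\<in>{..w}. coord.subspaces_of_card W (p ^ i))"
  proof (intro equalityI subsetI)
    fix W' assume W': "W' \<in> ?Sub"
    then obtain i where i: "card W' = p ^ i" using card_subspace[of W'] less.prems by auto
    have "card W' \<le> card W" using W' finW by (auto intro: card_mono)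
    hence "i \<le> w" using i less.prems power_le_imp_le_exp[OF p_gt_1] by auto
    thus "W' \<in> (\<Union>i\<in>{..w}. coord.subspaces_of_card W (p ^ i))"
      using W' i by (auto simp: coord.subspaces_of_card_def)
  qed (auto simp: coord.subspaces_of_card_def)
  also have "(\<Sum>W'\<in>\<dots>. gen_fun (submods_onto W')) =
      (\<Sum>i\<le>w. \<Sum>W'\<in>coord.subspaces_of_card W (p ^ i). gen_fun (submods_onto W'))"
    by (rule sum.UNION_disjoint)
      (use finW p_gt_1 coord.finite_subspaces_of_card in \<open>auto simp: coord.subspaces_of_card_def\<close>)
  also have "\<dots> = (\<Sum>i<w. \<Sum>W'\<in>coord.subspaces_of_card W (p ^ i). gen_fun (submods_onto W')) +
      gen_fun (submods_onto W)"
  proof -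
    have "coord.subspaces_of_card W (p ^ w) = {W}"
      using less.prems card_subset_eq[OF finW] by (auto simp: coord.subspaces_of_card_def)
    thus ?thesis by (simp add: lessThan_Suc_atMost[symmetric])
  qed
  also have "(\<Sum>i<w. \<Sum>W'\<in>coord.subspaces_of_card W (p ^ i). gen_fun (submods_onto W')) =
      (\<Sum>i<w. of_nat (q_binomial p w i) * ?G i)"
  proof (rule sum.cong[OF refl])
    fix i assume "i \<in> {..<w}"
    hence i: "i < w" by simp
    have "(\<Sum>W'\<in>coord.subspaces_of_card W (p ^ i). gen_fun (submods_onto W')) =
        (\<Sum>W'\<in>coord.subspaces_of_card W (p ^ i). ?G i)"
    proof (rule sum.cong[OF refl])
      fix W' assume "W' \<in> coord.subspaces_of_card W (p ^ i)"
      thus "gen_fun (submods_onto W') = ?G i"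
        using less.IH[OF i, of W'] less.prems by (auto simp: coord.subspaces_of_card_def)
    qed
    thus "(\<Sum>W'\<in>coord.subspaces_of_card W (p ^ i). gen_fun (submods_onto W')) = of_nat (q_binomial p w i) * ?G i"
      using coord.card_subspaces[OF less.prems(1) finW, of w i] less.prems(3) by (simp add: p_eq)
  qed
  finally have eq: "fps_X ^ (c - w) * gen_fun (submods m) =
      (\<Sum>i<w. of_nat (q_binomial p w i) * ?G i) + gen_fun (submods_onto W)"
    unfolding gen_fun_submods_into[OF less.prems] .
  \<comment> \<open>The Cauchy identity at x = X inserts a factor 1. Its i-th term becomes the
    claimed value for dimension i times the number of i-dimensional subspaces of W.\<close>
  have "fps_X ^ (c - w) * gen_fun (submods m) = fps_X ^ (c - w) * gen_fun (submods m) *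
      (\<Sum>i\<le>w. of_nat (q_binomial p w i) * fps_X ^ (w - i) * (\<Prod>k<i. 1 - of_nat p ^ k * fps_X))"
    unfolding q_binomial_cauchy by simp
  also have "\<dots> = (\<Sum>i\<le>w. of_nat (q_binomial p w i) * ?G i)"
    unfolding sum_distrib_left
  proof (rule sum.cong[OF refl])
    fix i assume "i \<in> {..w}"
    hence "c - i = c - w + (w - i)" using wc by simp
    hence "fps_X ^ (c - i) = (fps_X ^ (c - w) * fps_X ^ (w - i) :: rat fps)" by (simp only: power_add)
    moreover have "p_pow_minus_s p k = of_nat p ^ k * fps_X" for k
      by (simp add: p_pow_minus_s_def fps_of_nat flip: fps_const_power)
    ultimately show "fps_X ^ (c - w) * gen_fun (submods m) *
        (of_nat (q_binomial p w i) * fps_X ^ (w - i) * (\<Prod>k<i. 1 - of_nat p ^ k * fps_X)) =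
        of_nat (q_binomial p w i) * ?G i"
      by (simp only: ac_simps)
  qed
  also have "\<dots> = (\<Sum>i<w. of_nat (q_binomial p w i) * ?G i) + ?G w"
  proof -
    have "q_binomial p w w = 1"
      by (induction w) (simp_all add: q_binomial_eq_0)
    thus ?thesis by (simp add: lessThan_Suc_atMost[symmetric])
  qed
  finally show ?case using eq by simp
qed

end

section \<open>Submodules of a fibre product\<close>

interpretation pair: finite_field_space_pair
  "coord_scale :: 'p :: prime_card mod_ring \<Rightarrow> (nat \<Rightarrow>\<^sub>0 'p mod_ring) \<Rightarrow> _"
  "coord_scale :: 'p mod_ring \<Rightarrow> (nat \<Rightarrow>\<^sub>0 'p mod_ring) \<Rightarrow> _" "CARD('p)"
  by unfold_locales

text \<open>Every scalar of the prime field is a natural number, so scaling is repeated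
  addition.\<close>

lemma subgroup_imp_pair_subspace:
  fixes U :: "((nat \<Rightarrow>\<^sub>0 'p :: prime_card mod_ring) \<times> (nat \<Rightarrow>\<^sub>0 'p mod_ring)) set"
  assumes "subgroup_set U"
  shows "pair.P.subspace U"
proof (rule pair.P.subspaceI)
  fix a :: "'p mod_ring" and x assume x: "x \<in> U"
  have "pair.scale_pair (of_nat n) x \<in> U" for n
  proof (induction n)
    case (Suc n)
    have "pair.scale_pair (of_nat (Suc n)) x = x + pair.scale_pair (of_nat n) x"
      using pair.P.scale_left_distrib[of 1 "of_nat n" x] by simp
    thus ?case using Suc subgroup_setD(4)[OF assms x] by metis
  qed (simp add: subgroup_setD(1)[OF assms])
  thus "pair.scale_pair a x \<in> U" using surj_of_nat_mod_ring[of a] by metis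
qed (use subgroup_setD[OF assms] in auto)

context residue_dvr
begin

text \<open>Coordinates with respect to a basis of M, reduced modulo pi, identify M/pi M with F_p^m.
  An additive map is asked for, since subgroups of F_p-spaces are subspaces.\<close>

lemma submod_residue_map:
  assumes "M \<subseteq> lattice m" "submod M" "subgroup_index (lattice m) M \<noteq> 0"
  obtains \<theta> :: "(nat \<Rightarrow>\<^sub>0 'k) \<Rightarrow> (nat \<Rightarrow>\<^sub>0 'p mod_ring)" where
    "\<theta> ` M = coord_vecs m UNIV"
    "\<And>x y. x \<in> M \<Longrightarrow> y \<in> M \<Longrightarrow> \<theta> (x - y) = \<theta> x - \<theta> y"
    "\<And>x. x \<in> M \<Longrightarrow> \<theta> x = 0 \<longleftrightarrow> x \<in> coord_scale \<pi> ` M"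
proof -
  obtain f where f: "bij_betw f (lattice m) M"
    and f_diff: "\<And>u v. u \<in> lattice m \<Longrightarrow> v \<in> lattice m \<Longrightarrow> f (u - v) = f u - f v"
    and f_scale: "\<And>s v. s \<in> S \<Longrightarrow> v \<in> lattice m \<Longrightarrow> f (coord_scale s v) = coord_scale s (f v)"
    using submod_free[OF assms] by auto
  define g where "g = the_inv_into (lattice m) f"
  have g: "g x \<in> lattice m" "f (g x) = x" if "x \<in> M" for x
    using f that f_the_inv_into_f_bij_betw[OF f] bij_betw_the_inv_into[OF f]
    by (auto simp: g_def bij_betw_def)
  have gf: "g (f v) = v" if "v \<in> lattice m" for v
    using f that by (simp add: g_def the_inv_into_f_f bij_betw_def)
  have fM: "f v \<in> M" if "v \<in> lattice m" for v using f that by (auto simp: bij_betw_def)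
  have g_diff: "g (x - y) = g x - g y" if "x \<in> M" "y \<in> M" for x y
    using gf[of "g x - g y"] f_diff g that lattice_closed(2) by simp
  show thesis
  proof (rule that[of "\<lambda>x. res_vec (g x)"])
    have "g ` M = lattice m" using g gf fM by force
    thus "(\<lambda>x. res_vec (g x)) ` M = coord_vecs m UNIV"
      using res_vec_surj[of m] by (simp flip: image_image)
    show "res_vec (g (x - y)) = res_vec (g x) - res_vec (g y)" if "x \<in> M" "y \<in> M" for x y
      using that g_diff g(1) res_vec_simps(1) by metis
    show "res_vec (g x) = 0 \<longleftrightarrow> x \<in> coord_scale \<pi> ` M" if x: "x \<in> M" for x
    proof -
      have "res_vec (g x) = 0 \<longleftrightarrow> (\<exists>u\<in>lattice m. g x = coord_scale \<pi> u)"
        using res_vec_eq_0_iff[OF g(1)[OF x]] .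
      also have "\<dots> \<longleftrightarrow> x \<in> coord_scale \<pi> ` M"
      proof
        assume "\<exists>u\<in>lattice m. g x = coord_scale \<pi> u"
        then obtain u where "u \<in> lattice m" "g x = coord_scale \<pi> u" by blast
        hence "x = coord_scale \<pi> (f u)" "f u \<in> M" using f_scale[OF unif(1)] g(2)[OF x] fM by auto
        thus "x \<in> coord_scale \<pi> ` M" by blast
      next
        assume "x \<in> coord_scale \<pi> ` M"
        then obtain y where y: "y \<in> M" "x = coord_scale \<pi> y" by blast
        hence "f (coord_scale \<pi> (g y)) = x" using f_scale[OF unif(1)] g by simp
        hence "g x = coord_scale \<pi> (g y)" using gf[of "coord_scale \<pi> (g y)"] lattice_closed(5)[OF unif(1)] g y by auto
        thus "\<exists>u\<in>lattice m. g x = coord_scale \<pi> u" using g y by blast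
      qed
      finally show ?thesis .
    qed
  qed
qed

end

definition scale_prod :: "'k :: comm_ring_1 \<times> 'l :: comm_ring_1 \<Rightarrow> ('i \<Rightarrow>\<^sub>0 'k) \<times> ('j \<Rightarrow>\<^sub>0 'l) \<Rightarrow> ('i \<Rightarrow>\<^sub>0 'k) \<times> ('j \<Rightarrow>\<^sub>0 'l)" where
  "scale_prod r x = (coord_scale (fst r) (fst x), coord_scale (snd r) (snd x))"

locale fibre_lattice =
  Q1: lattice_quotient S1 \<pi>1 \<rho>1 p m \<phi> c + Q2: lattice_quotient S2 \<pi>2 \<rho>2 p n \<psi> c
  for S1 :: "'k :: field set" and \<pi>1 and \<rho>1 :: "'k \<Rightarrow> 'p :: prime_card mod_ring" and p :: nat
    and m :: nat and \<phi> and c :: nat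
    and S2 :: "'l :: field set" and \<pi>2 and \<rho>2 :: "'l \<Rightarrow> 'p mod_ring" and n :: nat and \<psi> +
  assumes c_le: "c \<le> m" "c \<le> n"
begin

abbreviation L1 where "L1 \<equiv> Q1.lattice m"
abbreviation L2 where "L2 \<equiv> Q2.lattice n"

text \<open>In the application this is the image of the group ring under augmentation and evaluation
  at omega.\<close>

definition fibre_ring :: "('k \<times> 'l) set" where
  "fibre_ring = {(s, t). s \<in> S1 \<and> t \<in> S2 \<and> \<rho>1 s = \<rho>2 t}"

definition fibre :: "((nat \<Rightarrow>\<^sub>0 'k) \<times> (nat \<Rightarrow>\<^sub>0 'l)) set" where
  "fibre = {(x, y). x \<in> L1 \<and> y \<in> L2 \<and> \<phi> x = \<psi> y}"

abbreviation fibre_submod where "fibre_submod \<equiv> is_submodule_over fibre_ring scale_prod"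

lemma subgroup_L: "subgroup_set L1" "subgroup_set L2"
  using Q1.submod_lattice Q2.submod_lattice is_submodule_overD(1) by blast+

lemma subgroup_Times: "subgroup_set A \<Longrightarrow> subgroup_set B \<Longrightarrow> subgroup_set (A \<times> B)"
  by (auto simp: subgroup_set_def zero_prod_def)

lemma lift1: "s \<in> S1 \<Longrightarrow> \<exists>t. (s, t) \<in> fibre_ring"
  using Q2.res_surj[of "\<rho>1 s"] Q2.nat_mem(1) by (auto simp: fibre_ring_def) metis

lemma lift2: "t \<in> S2 \<Longrightarrow> \<exists>s. (s, t) \<in> fibre_ring"
  using Q1.res_surj[of "\<rho>2 t"] Q1.nat_mem(1) by (auto simp: fibre_ring_def)

lemma phi_unif: "x \<in> L1 \<Longrightarrow> \<phi> (coord_scale \<pi>1 x) = 0" "y \<in> L2 \<Longrightarrow> \<psi> (coord_scale \<pi>2 y) = 0"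
  using Q1.phi_scale[OF Q1.unif(1)] Q2.phi_scale[OF Q2.unif(1)]
  by (simp_all add: Q1.res_unif Q2.res_unif coord_scale_simps)

lemma subgroup_fibre: "subgroup_set fibre"
  using subgroup_setD[OF subgroup_L(1)] subgroup_setD[OF subgroup_L(2)] Q1.phi_diff Q2.phi_diff
    Q1.phi_diff[of 0 0] Q2.phi_diff[of 0 0]
  by (auto simp: subgroup_set_def fibre_def zero_prod_def)

text \<open>Every s in S1 is the first component of some element of the fibre ring, and likewise for
  S2, so the projections are modules over the full factors. The last inclusion holds because (pi1,
  0) and (0, pi2) belong to the fibre ring.\<close>

lemma fibre_submod_projections:
  assumes "U \<subseteq> fibre" "fibre_submod U"
  shows "fst ` U \<subseteq> L1" "Q1.submod (fst ` U)" "snd ` U \<subseteq> L2" "Q2.submod (snd ` U)"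
    "\<phi> ` fst ` U = \<psi> ` snd ` U"
    "coord_scale \<pi>1 ` fst ` U \<times> coord_scale \<pi>2 ` snd ` U \<subseteq> U"
proof -
  note sub = subgroup_setD[OF is_submodule_overD(1)[OF assms(2)]] is_submodule_overD(2)[OF assms(2)]
  have U: "x \<in> L1" "y \<in> L2" "\<phi> x = \<psi> y" if "(x, y) \<in> U" for x y
    using that assms(1) by (auto simp: fibre_def)
  show "fst ` U \<subseteq> L1" "snd ` U \<subseteq> L2" using U by auto
  show "\<phi> ` fst ` U = \<psi> ` snd ` U"
    unfolding image_image using U(3) by (intro image_cong) auto
  show "Q1.submod (fst ` U)"
    unfolding is_submodule_over_def
  proof (intro conjI ballI)
    show "0 \<in> fst ` U" using sub(1) by (force simp: zero_prod_def)
    show "x - y \<in> fst ` U" if "x \<in> fst ` U" "y \<in> fst ` U" for x y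
      using that sub(2) by (force intro: rev_image_eqI)
    show "coord_scale s x \<in> fst ` U" if "s \<in> S1" "x \<in> fst ` U" for s x
    proof -
      obtain t where "(s, t) \<in> fibre_ring" using lift1 \<open>s \<in> S1\<close> by blast
      moreover obtain u where "u \<in> U" "x = fst u" using \<open>x \<in> fst ` U\<close> by blast
      ultimately show ?thesis using sub(5)[of "(s, t)" u] by (auto simp: scale_prod_def intro: rev_image_eqI)
    qed
  qed
  show "Q2.submod (snd ` U)"
    unfolding is_submodule_over_def
  proof (intro conjI ballI)
    show "0 \<in> snd ` U" using sub(1) by (force simp: zero_prod_def)
    show "x - y \<in> snd ` U" if "x \<in> snd ` U" "y \<in> snd ` U" for x y
      using that sub(2) by (force intro: rev_image_eqI)
    show "coord_scale t x \<in> snd ` U" if "t \<in> S2" "x \<in> snd ` U" for t x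
    proof -
      obtain s where "(s, t) \<in> fibre_ring" using lift2 \<open>t \<in> S2\<close> by blast
      moreover obtain u where "u \<in> U" "x = snd u" using \<open>x \<in> snd ` U\<close> by blast
      ultimately show ?thesis using sub(5)[of "(s, t)" u] by (auto simp: scale_prod_def intro: rev_image_eqI)
    qed
  qed
  show "coord_scale \<pi>1 ` fst ` U \<times> coord_scale \<pi>2 ` snd ` U \<subseteq> U"
  proof (clarify)
    fix x y x' y' assume "(x, y) \<in> U" "(x', y') \<in> U"
    moreover have "(\<pi>1, 0) \<in> fibre_ring" "(0, \<pi>2) \<in> fibre_ring"
      using Q1.unif Q2.unif Q1.zero Q2.zero Q1.res_unif Q2.res_unif Q1.res_zero Q2.res_zero
      by (auto simp: fibre_ring_def)
    ultimately have "scale_prod (\<pi>1, 0) (x, y) + scale_prod (0, \<pi>2) (x', y') \<in> U"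
      using sub(4,5) by blast
    thus "(coord_scale \<pi>1 (fst (x, y)), coord_scale \<pi>2 (snd (x', y'))) \<in> U"
      by (simp add: scale_prod_def coord_scale_simps)
  qed
qed

text \<open>A scalar (s, t) of the fibre ring is a natural number k plus some (pi1 s', pi2 t'). The
  number acts by repeated addition, and the rest maps into pi1 M1 x pi2 M2.\<close>

lemma fibre_submodI:
  assumes "subgroup_set U" "fst ` U = M1" "snd ` U = M2" "Q1.submod M1" "Q2.submod M2"
    "coord_scale \<pi>1 ` M1 \<times> coord_scale \<pi>2 ` M2 \<subseteq> U"
  shows "fibre_submod U"
  unfolding is_submodule_over_iff
proof (intro conjI ballI)
  fix r u assume r: "r \<in> fibre_ring" and u: "u \<in> U"
  obtain s t where st: "r = (s, t)" "s \<in> S1" "t \<in> S2" "\<rho>1 s = \<rho>2 t" using r by (auto simp: fibre_ring_def)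
  obtain x y where xy: "u = (x, y)" by (cases u)
  moreover have "fst u \<in> M1" "snd u \<in> M2" using u assms(2,3) by blast+
  ultimately have xy: "u = (x, y)" "x \<in> M1" "y \<in> M2" by auto
  obtain k where k: "\<rho>1 (of_nat k) = \<rho>1 s" using Q1.res_surj by blast
  have "\<rho>1 (s - of_nat k) = 0" using k Q1.res_diff st Q1.nat_mem(1) by simp
  then obtain s' where s': "s' \<in> S1" "s - of_nat k = \<pi>1 * s'"
    using Q1.res_eq_0[of "s - of_nat k"] Q1.diff st Q1.nat_mem(1) by blast
  have "\<rho>2 (t - of_nat k) = 0" using k Q2.res_diff st Q1.nat_mem Q2.nat_mem by simp
  then obtain t' where t': "t' \<in> S2" "t - of_nat k = \<pi>2 * t'"
    using Q2.res_eq_0[of "t - of_nat k"] Q2.diff st Q2.nat_mem(1) by blast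
  have "scale_prod (of_nat k, of_nat k) u \<in> U" for k :: nat
  proof (induction k)
    case 0
    show ?case using subgroup_setD(1)[OF assms(1)] by (simp add: scale_prod_def coord_scale_simps zero_prod_def)
  next
    case (Suc k)
    have "scale_prod (of_nat (Suc k), of_nat (Suc k)) u = u + scale_prod (of_nat k, of_nat k) u"
      by (cases u) (simp add: scale_prod_def coord_scale_simps)
    thus ?case using Suc subgroup_setD(4)[OF assms(1) u] by metis
  qed
  moreover have "(coord_scale \<pi>1 (coord_scale s' x), coord_scale \<pi>2 (coord_scale t' y)) \<in> U"
    using assms(6) is_submodule_overD(2)[OF assms(4) s'(1) xy(2)] is_submodule_overD(2)[OF assms(5) t'(1) xy(3)]
    by blast
  moreover have "scale_prod r u = scale_prod (of_nat k, of_nat k) u +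
      (coord_scale \<pi>1 (coord_scale s' x), coord_scale \<pi>2 (coord_scale t' y))"
    using s'(2) t'(2) xy(1) st(1)
    by (simp add: scale_prod_def coord_scale_simps(5) flip: coord_scale_simps(3) s'(2) t'(2))
  ultimately show "scale_prod r u \<in> U" using subgroup_setD(4)[OF assms(1)] by simp
qed (rule assms(1))

text \<open>The largest candidate, the fibre product of M1 and M2 over W, already has index p^w in
  M1 x M2. So r - w is the codimension inside it, and nothing occurs below w.\<close>

definition fibre_count :: "nat \<Rightarrow> nat \<Rightarrow> nat" where
  "fibre_count w r = (if r < w then 0 else q_binomial p (m - w) (r - w) * q_binomial p (n - w) (r - w) *
     GL_order p (r - w) * p ^ (w * (r - w)))"

text \<open>Reduction modulo pi1 M1 x pi2 M2 turns the index p^r into the codimension r in F_p^m x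
  F_p^n. The image D of the fibre product of M1 and M2 has codimension w there, so
  \<open>card_subdirect\<close> applies with d = w.\<close>

lemma card_fibre_submods:
  assumes M1: "M1 \<subseteq> L1" "Q1.submod M1" "subgroup_index L1 M1 \<noteq> 0"
    and M2: "M2 \<subseteq> L2" "Q2.submod M2" "subgroup_index L2 M2 \<noteq> 0"
    and W: "\<phi> ` M1 = W" "\<psi> ` M2 = W" "card W = p ^ w"
  defines "F \<equiv> \<lambda>r. {U. U \<subseteq> fibre \<and> fibre_submod U \<and> fst ` U = M1 \<and> snd ` U = M2 \<and>
     subgroup_index (M1 \<times> M2) U = p ^ r}"
  shows "card (F r) = fibre_count w r" "finite (F r)"
proof -
  obtain \<theta>1 :: "(nat \<Rightarrow>\<^sub>0 'k) \<Rightarrow> (nat \<Rightarrow>\<^sub>0 'p mod_ring)" where \<theta>1: "\<theta>1 ` M1 = coord_vecs m UNIV"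
    "\<And>x y. x \<in> M1 \<Longrightarrow> y \<in> M1 \<Longrightarrow> \<theta>1 (x - y) = \<theta>1 x - \<theta>1 y"
    "\<And>x. x \<in> M1 \<Longrightarrow> \<theta>1 x = 0 \<longleftrightarrow> x \<in> coord_scale \<pi>1 ` M1"
    using Q1.submod_residue_map[OF M1] by metis
  obtain \<theta>2 :: "(nat \<Rightarrow>\<^sub>0 'l) \<Rightarrow> (nat \<Rightarrow>\<^sub>0 'p mod_ring)" where \<theta>2: "\<theta>2 ` M2 = coord_vecs n UNIV"
    "\<And>x y. x \<in> M2 \<Longrightarrow> y \<in> M2 \<Longrightarrow> \<theta>2 (x - y) = \<theta>2 x - \<theta>2 y"
    "\<And>x. x \<in> M2 \<Longrightarrow> \<theta>2 x = 0 \<longleftrightarrow> x \<in> coord_scale \<pi>2 ` M2"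
    using Q2.submod_residue_map[OF M2] by metis
  define V where "V = coord_vecs m (UNIV :: 'p mod_ring set) \<times> coord_vecs n (UNIV :: 'p mod_ring set)"
  define \<Theta> where "\<Theta> = map_prod \<theta>1 \<theta>2"
  define M where "M = M1 \<times> M2"
  define N where "N = coord_scale \<pi>1 ` M1 \<times> coord_scale \<pi>2 ` M2"
  \<comment> \<open>The submodules to be counted all lie between N and H0.\<close>
  define H0 where "H0 = {u \<in> M. \<phi> (fst u) - \<psi> (snd u) = 0}"
  define D where "D = \<Theta> ` H0"
  have p1: "1 < p" by (rule Q1.p_gt_1)
  have sgM1: "subgroup_set M1" and sgM2: "subgroup_set M2"
    using M1 M2 is_submodule_overD(1) by blast+
  have sgM: "subgroup_set M" unfolding M_def by (rule subgroup_Times) fact+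
  have \<Theta>_diff: "\<Theta> (u - v) = \<Theta> u - \<Theta> v" if "u \<in> M" "v \<in> M" for u v
    using that \<theta>1(2) \<theta>2(2) by (auto simp: \<Theta>_def M_def)
  have \<Theta>_0: "\<Theta> u = 0 \<longleftrightarrow> u \<in> N" if "u \<in> M" for u
    using that \<theta>1(3) \<theta>2(3) by (cases u) (auto simp: \<Theta>_def M_def N_def zero_prod_def)
  have \<Theta>M: "\<Theta> ` M = V" unfolding \<Theta>_def M_def V_def using \<theta>1(1) \<theta>2(1) by (simp add: map_prod_surj_on)
  have NM: "N \<subseteq> M"
    using is_submodule_overD(2)[OF M1(2) Q1.unif(1)] is_submodule_overD(2)[OF M2(2) Q2.unif(1)]
    by (auto simp: N_def M_def)
  define \<delta> where "\<delta> u = \<phi> (fst u) - \<psi> (snd u)" for u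
  have \<delta>_diff: "\<delta> (u - v) = \<delta> u - \<delta> v" if "u \<in> M" "v \<in> M" for u v
    using that M1(1) M2(1) Q1.phi_diff Q2.phi_diff by (auto simp: \<delta>_def M_def subset_iff)
  have NH0: "N \<subseteq> H0"
  proof
    fix u assume u: "u \<in> N"
    then obtain x y where xy: "x \<in> M1" "y \<in> M2" "u = (coord_scale \<pi>1 x, coord_scale \<pi>2 y)"
      by (auto simp: N_def)
    hence "x \<in> L1" "y \<in> L2" using M1(1) M2(1) by auto
    thus "u \<in> H0" using u xy NM phi_unif by (auto simp: H0_def)
  qed
  have H0_fibre: "H0 = M \<inter> fibre" using M1(1) M2(1) by (auto simp: H0_def M_def fibre_def)
  have sg0: "subgroup_set {0 :: nat \<Rightarrow>\<^sub>0 'p mod_ring}" by (simp add: subgroup_set_def)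
  have sgH0: "subgroup_set H0"
    using subgroup_set_vimage[OF sg0 sgM \<delta>_diff] by (simp add: H0_def \<delta>_def)
  have img_sub: "subgroup_set (\<Theta> ` U)" if U: "subgroup_set U" "U \<subseteq> M" for U
    unfolding subgroup_set_def
  proof (intro conjI ballI)
    have "\<Theta> 0 = 0" using \<Theta>_diff[of 0 0] subgroup_setD(1)[OF sgM] by simp
    thus "0 \<in> \<Theta> ` U" using subgroup_setD(1)[OF U(1)] by (metis imageI)
    show "x - y \<in> \<Theta> ` U" if xy: "x \<in> \<Theta> ` U" "y \<in> \<Theta> ` U" for x y
    proof -
      obtain u v where "u \<in> U" "v \<in> U" "x = \<Theta> u" "y = \<Theta> v" using xy by blast
      moreover from this have "x - y = \<Theta> (u - v)" using \<Theta>_diff[of u v] U(2) by fastforce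
      ultimately show ?thesis using subgroup_setD(2)[OF U(1)] by blast
    qed
  qed
  have pull: "{u \<in> M. \<Theta> u \<in> \<Theta> ` U} = U" if U: "subgroup_set U" "U \<subseteq> M" "N \<subseteq> U" for U
  proof (intro equalityI subsetI)
    fix u assume "u \<in> {u \<in> M. \<Theta> u \<in> \<Theta> ` U}"
    then obtain v where uv: "u \<in> M" "v \<in> U" "\<Theta> u = \<Theta> v" by blast
    have v: "v \<in> M" using uv U by blast
    hence "\<Theta> (u - v) = 0" using \<Theta>_diff[of u v] uv by simp
    hence "u - v \<in> N" using \<Theta>_0[of "u - v"] subgroup_setD(2)[OF sgM uv(1) v] by simp
    hence "u - v \<in> U" using U by blast
    thus "u \<in> U" using subgroup_setD(4)[OF U(1) _ uv(2), of "u - v"] by simp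
  qed (use U in auto)
  have index_img: "subgroup_index M U = subgroup_index V (\<Theta> ` U)" if U: "subgroup_set U" "U \<subseteq> M" "N \<subseteq> U" for U
    using subgroup_index_vimage[OF img_sub[OF U(1,2)] \<Theta>_diff subgroup_setD(2)[OF sgM]] pull[OF U] \<Theta>M by simp
  have sgV: "subgroup_set V" using img_sub[OF sgM] \<Theta>M by simp
  have finV: "finite V" and cardV: "card V = p ^ (m + n)"
    by (simp_all add: V_def finite_coord_vecs card_coord_vecs card_cartesian_product power_add Q1.p_eq)
  have DV: "D \<subseteq> V" unfolding D_def using \<Theta>M by (auto simp: H0_def)
  have finD: "finite D" using DV finV finite_subset by blast
  have sgD: "subgroup_set D" unfolding D_def by (rule img_sub[OF sgH0]) (auto simp: H0_def)
  have sD: "pair.P.subspace D" using sgD by (rule subgroup_imp_pair_subspace)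
  have full: "fst ` \<Theta> ` U = coord_vecs m UNIV" "snd ` \<Theta> ` U = coord_vecs n UNIV"
    if "fst ` U = M1" "snd ` U = M2" for U
  proof -
    have "fst ` \<Theta> ` U = \<theta>1 ` fst ` U" "snd ` \<Theta> ` U = \<theta>2 ` snd ` U" by (force simp: \<Theta>_def)+
    thus "fst ` \<Theta> ` U = coord_vecs m UNIV" "snd ` \<Theta> ` U = coord_vecs n UNIV"
      using that \<theta>1(1) \<theta>2(1) by simp_all
  qed
  have H0_proj: "fst ` H0 = M1" "snd ` H0 = M2"
  proof -
    have "x \<in> fst ` H0" if x: "x \<in> M1" for x
    proof -
      obtain y where "y \<in> M2" "\<phi> x = \<psi> y" using W x by (metis imageE imageI)
      thus ?thesis using x by (intro image_eqI[of _ _ "(x, y)"]) (auto simp: H0_def M_def)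
    qed
    moreover have "y \<in> snd ` H0" if y: "y \<in> M2" for y
    proof -
      obtain x where "x \<in> M1" "\<psi> y = \<phi> x" using W y by (metis imageE imageI)
      thus ?thesis using y by (intro image_eqI[of _ _ "(x, y)"]) (auto simp: H0_def M_def)
    qed
    ultimately show "fst ` H0 = M1" "snd ` H0 = M2" by (auto simp: H0_def M_def)
  qed
  note D_proj = full[OF H0_proj, folded D_def]
  have cardD: "card D * p ^ w = p ^ (m + n)"
  proof -
    \<comment> \<open>The difference of the two residue maps has kernel H0 and image W, so H0 has
      index p^w in M.\<close>
    have "\<delta> ` M = W"
    proof -
      have "coord.subspace W" using Q1.subspace_image[OF M1(1,2)] W by simp
      hence "\<phi> x - \<psi> y \<in> W" if "x \<in> M1" "y \<in> M2" for x y using W(1,2) that coord.subspace_diff by blast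
      hence "\<delta> ` M \<subseteq> W" by (auto simp: \<delta>_def M_def)
      moreover have "\<psi> 0 = 0" using Q2.phi_diff[of 0 0] Q2.lattice_closed(1) by simp
      hence "\<phi> x = \<delta> (x, 0)" for x by (simp add: \<delta>_def)
      hence "W \<subseteq> \<delta> ` M" using W(1) subgroup_setD(1)[OF sgM2] by (auto simp: M_def)
      ultimately show ?thesis by blast
    qed
    hence "subgroup_index M H0 = subgroup_index W {0}"
      using subgroup_index_vimage[OF sg0 \<delta>_diff subgroup_setD(2)[OF sgM]] by (simp add: H0_def \<delta>_def)
    also have "\<dots> = p ^ w"
      using subgroup_index_eq_card_image[of W id "{0}"] W(3) by simp
    finally have "subgroup_index V D = p ^ w"
      using index_img[OF sgH0 _ NH0] by (auto simp: D_def H0_def)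
    thus ?thesis using card_eq_subgroup_index_mult[OF sgV sgD DV] cardV by (simp add: mult.commute)
  qed
  have F: "U \<in> F r \<longleftrightarrow> subgroup_set U \<and> N \<subseteq> U \<and> U \<subseteq> H0 \<and> fst ` U = M1 \<and> snd ` U = M2 \<and>
      card (\<Theta> ` U) * p ^ r = p ^ (m + n)" for U r
  proof -
    have *: "U \<subseteq> fibre \<and> fibre_submod U \<and> fst ` U = M1 \<and> snd ` U = M2 \<longleftrightarrow>
        subgroup_set U \<and> N \<subseteq> U \<and> U \<subseteq> H0 \<and> fst ` U = M1 \<and> snd ` U = M2"
    proof (intro iffI; elim conjE)
      assume a: "U \<subseteq> fibre" "fibre_submod U" "fst ` U = M1" "snd ` U = M2"
      have "U \<subseteq> M"
      proof
        fix u assume "u \<in> U"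
        hence "fst u \<in> fst ` U" "snd u \<in> snd ` U" by blast+
        thus "u \<in> M" unfolding a(3,4) M_def by (simp add: mem_Times_iff)
      qed
      moreover have "N \<subseteq> U" using fibre_submod_projections(6)[OF a(1,2)] unfolding a(3,4) N_def .
      ultimately show "subgroup_set U \<and> N \<subseteq> U \<and> U \<subseteq> H0 \<and> fst ` U = M1 \<and> snd ` U = M2"
        using a(1,3,4) is_submodule_overD(1)[OF a(2)] unfolding H0_fibre by simp
    next
      assume a: "subgroup_set U" "N \<subseteq> U" "U \<subseteq> H0" "fst ` U = M1" "snd ` U = M2"
      thus "U \<subseteq> fibre \<and> fibre_submod U \<and> fst ` U = M1 \<and> snd ` U = M2"
        using fibre_submodI[OF a(1,4,5) M1(2) M2(2)] H0_fibre unfolding N_def by blast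
    qed
    have "subgroup_index M U = p ^ r \<longleftrightarrow> card (\<Theta> ` U) * p ^ r = p ^ (m + n)"
      if U: "subgroup_set U" "N \<subseteq> U" "U \<subseteq> H0"
    proof -
      have UM: "U \<subseteq> M" using U by (auto simp: H0_def)
      have "\<Theta> ` U \<subseteq> V" using UM \<Theta>M by blast
      hence e: "p ^ (m + n) = subgroup_index M U * card (\<Theta> ` U)"
        using card_eq_subgroup_index_mult[OF sgV img_sub[OF U(1) UM]] index_img[OF U(1) UM U(2)] cardV by simp
      have "card (\<Theta> ` U) \<noteq> 0" using e p1 by (metis less_nat_zero_code mult_0_right power_not_zero)
      thus ?thesis unfolding e by auto
    qed
    moreover have "U \<in> F r \<longleftrightarrow> (U \<subseteq> fibre \<and> fibre_submod U \<and> fst ` U = M1 \<and> snd ` U = M2) \<and> subgroup_index M U = p ^ r"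
      by (simp add: F_def M_def conj_assoc)
    ultimately show ?thesis unfolding * by meson
  qed
  have bij: "bij_betw (image \<Theta>) (F r) {U. pair.P.subspace U \<and> U \<subseteq> D \<and> fst ` U = fst ` D \<and> snd ` U = snd ` D \<and>
      card U * p ^ r = p ^ (m + n)}" (is "bij_betw _ _ ?R") for r
    unfolding bij_betw_def
  proof (intro conjI equalityI subsetI)
    show "inj_on (image \<Theta>) (F r)"
    proof (rule inj_onI)
      fix U U' assume a: "U \<in> F r" "U' \<in> F r" and e: "\<Theta> ` U = \<Theta> ` U'"
      have "subgroup_set U" "U \<subseteq> M" "N \<subseteq> U" "subgroup_set U'" "U' \<subseteq> M" "N \<subseteq> U'"
        using a unfolding F by (auto simp: H0_def)
      thus "U = U'" using pull[of U] pull[of U'] e by metis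
    qed
    show "Y \<in> ?R" if Y: "Y \<in> image \<Theta> ` F r" for Y
    proof -
      obtain U where U: "Y = \<Theta> ` U" "subgroup_set U" "N \<subseteq> U" "U \<subseteq> H0" "fst ` U = M1" "snd ` U = M2"
        "card (\<Theta> ` U) * p ^ r = p ^ (m + n)"
        using Y F by auto
      have "subgroup_set Y" using img_sub U by (auto simp: H0_def)
      hence "pair.P.subspace Y" by (rule subgroup_imp_pair_subspace)
      moreover have "Y \<subseteq> D" using U by (auto simp: D_def)
      ultimately show ?thesis using full[OF U(5,6)] D_proj U by simp
    qed
    fix Y assume "Y \<in> ?R"
    hence Y: "pair.P.subspace Y" "Y \<subseteq> D" "fst ` Y = fst ` D" "snd ` Y = snd ` D" "card Y * p ^ r = p ^ (m + n)"
      by auto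
    have sgY: "subgroup_set Y" using Y(1) by (simp add: subgroup_set_def pair.P.subspace_0 pair.P.subspace_diff)
    define U where "U = {u \<in> M. \<Theta> u \<in> Y}"
    have \<Theta>U: "\<Theta> ` U = Y" using Y(2) DV \<Theta>M by (auto simp: U_def)
    have sgU: "subgroup_set U" unfolding U_def by (rule subgroup_set_vimage[OF sgY sgM \<Theta>_diff])
    have NU: "N \<subseteq> U"
    proof
      fix u assume "u \<in> N"
      hence "u \<in> M" "\<Theta> u = 0" using NM \<Theta>_0 by blast+
      thus "u \<in> U" using subgroup_setD(1)[OF sgY] by (simp add: U_def)
    qed
    have UH0: "U \<subseteq> H0"
    proof -
      have "{u \<in> M. \<Theta> u \<in> D} = H0" unfolding D_def by (rule pull[OF sgH0 _ NH0]) (auto simp: H0_def)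
      thus ?thesis using Y(2) by (auto simp: U_def)
    qed
    have "fst ` U = M1"
    proof (intro equalityI subsetI)
      fix x assume x: "x \<in> M1"
      have "\<theta>1 x \<in> fst ` \<Theta> ` U" unfolding \<Theta>U Y(3) D_proj using x \<theta>1(1) by blast
      then obtain u where u: "u \<in> U" "\<theta>1 x = \<theta>1 (fst u)" by (auto simp: \<Theta>_def)
      have u1: "fst u \<in> M1" using u by (auto simp: U_def M_def)
      \<comment> \<open>x is matched only modulo pi1 M1. The error, paired with 0, lies in N and
        hence in U, so it can be added to u.\<close>
      hence "x - fst u \<in> coord_scale \<pi>1 ` M1"
        using \<theta>1(2)[OF x u1] \<theta>1(3)[OF subgroup_setD(2)[OF sgM1 x u1]] u by simp
      moreover have "0 \<in> coord_scale \<pi>2 ` M2" using subgroup_setD(1)[OF sgM2] by (force simp: coord_scale_simps)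
      ultimately have "(x - fst u, 0) \<in> U" using NU by (auto simp: N_def)
      hence "(x - fst u, 0) + u \<in> U" using subgroup_setD(4)[OF sgU] u by blast
      thus "x \<in> fst ` U" by (rule rev_image_eqI) (cases u, simp)
    qed (auto simp: U_def M_def)
    moreover have "snd ` U = M2"
    proof (intro equalityI subsetI)
      fix y assume y: "y \<in> M2"
      have "\<theta>2 y \<in> snd ` \<Theta> ` U" unfolding \<Theta>U Y(4) D_proj using y \<theta>2(1) by blast
      then obtain u where u: "u \<in> U" "\<theta>2 y = \<theta>2 (snd u)" by (auto simp: \<Theta>_def)
      have u1: "snd u \<in> M2" using u by (auto simp: U_def M_def)
      hence "y - snd u \<in> coord_scale \<pi>2 ` M2"
        using \<theta>2(2)[OF y u1] \<theta>2(3)[OF subgroup_setD(2)[OF sgM2 y u1]] u by simp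
      moreover have "0 \<in> coord_scale \<pi>1 ` M1" using subgroup_setD(1)[OF sgM1] by (force simp: coord_scale_simps)
      ultimately have "(0, y - snd u) \<in> U" using NU by (auto simp: N_def)
      hence "(0, y - snd u) + u \<in> U" using subgroup_setD(4)[OF sgU] u by blast
      thus "y \<in> snd ` U" by (rule rev_image_eqI) (cases u, simp)
    qed (auto simp: U_def M_def)
    ultimately have "U \<in> F r" unfolding F using sgU NU UH0 \<Theta>U Y(5) by simp
    thus "Y \<in> image \<Theta> ` F r" using \<Theta>U by blast
  qed
  have R: "{U. pair.P.subspace U \<and> U \<subseteq> D \<and> fst ` U = fst ` D \<and> snd ` U = snd ` D \<and> card U * p ^ r = p ^ (m + n)}
      = (if r \<le> m + n then pair.subdirect D (p ^ (m + n - r)) else {})" for r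
  proof (cases "r \<le> m + n")
    case True
    hence "p ^ (m + n) = p ^ (m + n - r) * p ^ r" by (simp flip: power_add)
    hence "card U * p ^ r = p ^ (m + n) \<longleftrightarrow> card U = p ^ (m + n - r)" for U :: "'z set"
      using p1 by simp
    thus ?thesis using True by (auto simp: pair.subdirect_def)
  next
    case False
    hence "card U * p ^ r \<noteq> p ^ (m + n)" for U :: "'z set"
      using prime_power_mult_eqD(1)[OF p1, of r "card U" "m + n"] by (auto simp: mult.commute)
    thus ?thesis using False by auto
  qed
  have wc: "w \<le> c"
    using Q1.index_subspace(1)[of W w] Q1.subspace_image[OF M1(1,2)] W M1(1) Q1.phi_surj by blast
  have "finite (pair.subdirect D k)" for k
    unfolding pair.subdirect_def by (rule finite_subset[of _ "Pow D"]) (use finD in auto)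
  thus "finite (F r)" using bij_betw_finite[OF bij[of r]] by (simp add: R)
  have card_subdir: "card (if r \<le> m + n then pair.subdirect D (p ^ (m + n - r)) else {}) = fibre_count w r"
  proof (cases "r < w")
    case True
    have "pair.subdirect D (p ^ (m + n - r)) = {}"
    proof -
      \<comment> \<open>For r < w such a subspace would be larger than D. The bounds w \<le> c \<le>
        m keep the truncated subtraction exact.\<close>
      have "card U \<noteq> p ^ (m + n - r)" if "U \<subseteq> D" for U
      proof
        assume "card U = p ^ (m + n - r)"
        hence "p ^ (m + n - r) \<le> card D" using card_mono[OF finD that] by simp
        hence "p ^ (m + n - r) * p ^ w \<le> p ^ (m + n)" using mult_le_mono1[of _ "card D" "p ^ w"] cardD by simp
        hence "p ^ (m + n - r + w) \<le> p ^ (m + n)" by (simp only: power_add)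
        hence "m + n - r + w \<le> m + n" by (rule power_le_imp_le_exp[OF p1])
        thus False using True wc c_le by simp
      qed
      thus ?thesis by (auto simp: pair.subdirect_def)
    qed
    thus ?thesis using True by (simp add: fibre_count_def)
  next
    case False
    define l where "l = r - w"
    have r: "r = w + l" using False by (simp add: l_def)
    show ?thesis
    proof (cases "r \<le> m + n")
      case True
      have "card (pair.subdirect D (p ^ (m + n - (w + l)))) =
          q_binomial p (m - w) l * q_binomial p (n - w) l * GL_order p l * p ^ (w * l)"
        unfolding Q1.p_eq
        by (rule pair.card_subdirect)
          (use sD finD D_proj cardD wc c_le True r in \<open>simp_all add: card_coord_vecs flip: Q1.p_eq\<close>)
      thus ?thesis using True r by (simp add: fibre_count_def)
    next
      case False
      hence "m - w < l" using r wc c_le by simp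
      thus ?thesis using False r by (simp add: fibre_count_def q_binomial_eq_0)
    qed
  qed
  show "card (F r) = fibre_count w r"
    using bij_betw_same_card[OF bij[of r]] card_subdir by (simp add: R)
qed

definition P_series :: "nat \<Rightarrow> rat fps" where
  "P_series j = (\<Sum>l=0..min (m - j) (n - j).
     of_nat (q_binomial p (m - j) l * q_binomial p (n - j) l * GL_order p l) * p_pow_minus_s p j ^ l)"

text \<open>The shift by X^w accounts for the start at r = w, and p^(w*l) is the coefficient of the
  l-th power of p^w X. Beyond the range of summation one of the Gaussian binomials vanishes.\<close>

lemma fps_fibre_count: "Abs_fps (\<lambda>r. of_nat (fibre_count w r)) = fps_X ^ w * P_series w"
proof (rule fps_ext)
  fix r
  have nth: "fps_nth (of_nat k * p_pow_minus_s p w ^ l) i = (if i = l then of_nat (k * p ^ (w * l)) else 0)" for k l i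
  proof -
    have "of_nat k * p_pow_minus_s p w ^ l = fps_const (of_nat (k * p ^ (w * l))) * fps_X ^ l"
      by (simp add: p_pow_minus_s_def power_mult_distrib fps_const_power power_mult mult.assoc
          flip: fps_of_nat fps_const_mult)
    thus ?thesis by (simp add: fps_X_power_nth)
  qed
  show "fps_nth (Abs_fps (\<lambda>r. of_nat (fibre_count w r))) r = fps_nth (fps_X ^ w * P_series w) r"
  proof (cases "r < w")
    case False
    have "fps_nth (P_series w) i = of_nat (q_binomial p (m - w) i * q_binomial p (n - w) i * GL_order p i * p ^ (w * i))" for i
    proof (cases "i \<le> min (m - w) (n - w)")
      case True
      thus ?thesis unfolding P_series_def fps_sum_nth nth by (simp add: sum.delta)
    next
      case False
      hence "q_binomial p (m - w) i * q_binomial p (n - w) i = 0" by (auto simp: q_binomial_eq_0)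
      thus ?thesis using False unfolding P_series_def fps_sum_nth nth by (auto simp: sum.delta)
    qed
    thus ?thesis using False by (simp add: fps_X_power_mult_nth fibre_count_def)
  qed (simp add: fps_X_power_mult_nth fibre_count_def)
qed

text \<open>The submodules U are sorted by their common image W and then fibred over the pair of
  their projections, with fibres whose size depends on the dimension of W alone. Taking indices in
  L1 x L2 makes them multiplicative along this fibration; the passage to indices in the fibre
  product comes last.\<close>

theorem solomon_zeta_fibre:
  "solomon_zeta p fibre_ring scale_prod fibre =
     (\<Prod>h<m. inverse (1 - p_pow_minus_s p h)) * (\<Prod>h<n. inverse (1 - p_pow_minus_s p h)) *
     (\<Sum>j=0..c. of_nat (q_binomial p c j) * fps_X ^ (c - j) * P_series j * (\<Prod>k<j. (1 - p_pow_minus_s p k) ^ 2))"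
proof -
  have p1: "1 < p" by (rule Q1.p_gt_1)
  define L where "L = L1 \<times> L2"
  have sgL: "subgroup_set L" unfolding L_def by (rule subgroup_Times[OF subgroup_L])
  define B where "B i = {U. U \<subseteq> fibre \<and> fibre_submod U \<and> subgroup_index L U = p ^ i}" for i
  define BW where "BW W i = {U \<in> B i. \<phi> ` fst ` U = W}" for W i
  define AW where "AW W i = (\<Union>j\<le>i. Q1.submods_onto W j \<times> Q2.submods_onto W (i - j))" for W i
  let ?Sub = "{W. coord.subspace W \<and> W \<subseteq> Q1.T}"
  let ?Z1 = "gen_fun (Q1.submods m)" and ?Z2 = "gen_fun (Q2.submods n)"
  let ?P = "\<lambda>w. \<Prod>k<w. 1 - p_pow_minus_s p k"
  have fin_onto: "finite (Q1.submods_onto W i)" "finite (Q2.submods_onto W i)" for W i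
    using Q1.finite_submods Q2.finite_submods by (simp_all add: Q1.submods_onto_def Q2.submods_onto_def)
  have disj_onto: "i \<noteq> j \<Longrightarrow> Q1.submods_onto W i \<inter> Q1.submods_onto W j = {}"
    "i \<noteq> j \<Longrightarrow> Q2.submods_onto W i \<inter> Q2.submods_onto W j = {}" for W i j
    using Q1.submods_disjoint[of i j m] Q2.submods_disjoint[of i j n]
    by (auto simp: Q1.submods_onto_def Q2.submods_onto_def)
  have AW_iff: "(M1, M2) \<in> AW W i \<longleftrightarrow> M1 \<subseteq> L1 \<and> Q1.submod M1 \<and> M2 \<subseteq> L2 \<and> Q2.submod M2 \<and>
      \<phi> ` M1 = W \<and> \<psi> ` M2 = W \<and> subgroup_index L (M1 \<times> M2) = p ^ i" for M1 M2 W i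
  proof -
    have idx: "subgroup_index L (M1 \<times> M2) = subgroup_index L1 M1 * subgroup_index L2 M2"
      if "Q1.submod M1" "Q2.submod M2"
      unfolding L_def using that by (intro subgroup_index_Times) (auto intro: is_submodule_overD)
    \<comment> \<open>Divisors of a prime power are powers of the prime, so an index p^i can only
      split into p^j and p^(i-j).\<close>
    have fac: "x * y = p ^ i \<longleftrightarrow> (\<exists>j\<le>i. x = p ^ j \<and> y = p ^ (i - j))" for x y
    proof
      assume xy: "x * y = p ^ i"
      have "prime p" unfolding Q1.p_eq by (rule prime_card)
      moreover have "x dvd p ^ i" using xy by (metis dvd_triv_left)
      ultimately obtain j where j: "j \<le> i" "x = p ^ j" using divides_primepow_nat by blast
      thus "\<exists>j\<le>i. x = p ^ j \<and> y = p ^ (i - j)" using prime_power_mult_eqD(2)[OF p1, of j y i] xy by blast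
    qed (auto simp flip: power_add)
    have "(M1, M2) \<in> AW W i \<longleftrightarrow> M1 \<subseteq> L1 \<and> Q1.submod M1 \<and> M2 \<subseteq> L2 \<and> Q2.submod M2 \<and>
      \<phi> ` M1 = W \<and> \<psi> ` M2 = W \<and> (\<exists>j\<le>i. subgroup_index L1 M1 = p ^ j \<and> subgroup_index L2 M2 = p ^ (i - j))"
      by (auto simp: AW_def Q1.submods_onto_def Q2.submods_onto_def Q1.submods_def Q2.submods_def)
    thus ?thesis unfolding fac[symmetric] using idx by auto
  qed
  have finA: "finite (AW W i)" for W i unfolding AW_def using fin_onto by auto
  have disjA: "AW W i \<inter> AW W j = {}" if "i \<noteq> j" for W i j
    using that p1 AW_iff by (auto simp: power_inject_exp)
  have genA: "gen_fun (AW W) = gen_fun (Q1.submods_onto W) * gen_fun (Q2.submods_onto W)" for W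
    unfolding AW_def[abs_def] by (rule gen_fun_pairs) (use fin_onto disj_onto in auto)
  have proj: "(fst ` U, snd ` U) \<in> AW W i \<longleftrightarrow> \<phi> ` fst ` U = W \<and> subgroup_index L (fst ` U \<times> snd ` U) = p ^ i"
    if "U \<subseteq> fibre" "fibre_submod U" for U W i
    unfolding AW_iff using fibre_submod_projections[OF that] by metis
  have idx: "subgroup_index L U = subgroup_index L (fst ` U \<times> snd ` U) * subgroup_index (fst ` U \<times> snd ` U) U"
    if U: "U \<subseteq> fibre" "fibre_submod U" for U
  proof (rule subgroup_index_mult[OF sgL])
    note pr = fibre_submod_projections[OF U]
    show "subgroup_set (fst ` U \<times> snd ` U)"
      using is_submodule_overD(1)[OF pr(2)] is_submodule_overD(1)[OF pr(4)] by (rule subgroup_Times)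
    show "subgroup_set U" using U is_submodule_overD(1) by blast
    show "U \<subseteq> fst ` U \<times> snd ` U" by force
    show "fst ` U \<times> snd ` U \<subseteq> L" using pr by (auto simp: L_def)
  qed
  have fib: "{U \<in> BW W (i + r). (fst ` U, snd ` U) = (M1, M2)} =
      {U. U \<subseteq> fibre \<and> fibre_submod U \<and> fst ` U = M1 \<and> snd ` U = M2 \<and> subgroup_index (M1 \<times> M2) U = p ^ r}"
    if A: "(M1, M2) \<in> AW W i" for M1 M2 W i r
  proof -
    have "subgroup_index L U = p ^ (i + r) \<longleftrightarrow> subgroup_index (M1 \<times> M2) U = p ^ r"
      if "U \<subseteq> fibre" "fibre_submod U" "fst ` U = M1" "snd ` U = M2" for U
      using idx[OF that(1,2)] A[unfolded AW_iff] that(3,4) p1 by (simp add: power_add)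
    moreover have "\<phi> ` M1 = W" using A AW_iff by simp
    ultimately show ?thesis unfolding BW_def B_def by blast
  qed
  have cnt: "card {U \<in> BW W (i + r). (fst ` U, snd ` U) = a} = 1 * fibre_count w r"
    "finite {U \<in> BW W (i + r). (fst ` U, snd ` U) = a}"
    if A: "a \<in> AW W i" and w: "card W = p ^ w" for a W i w r
  proof -
    obtain M1 M2 where a: "a = (M1, M2)" by (cases a)
    have M: "M1 \<subseteq> L1" "Q1.submod M1" "M2 \<subseteq> L2" "Q2.submod M2" "\<phi> ` M1 = W" "\<psi> ` M2 = W"
      "subgroup_index L (M1 \<times> M2) = p ^ i" using A AW_iff a by auto
    have "subgroup_index L (M1 \<times> M2) = subgroup_index L1 M1 * subgroup_index L2 M2"
      unfolding L_def using M by (intro subgroup_index_Times) (auto intro: is_submodule_overD)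
    moreover have "subgroup_index L (M1 \<times> M2) \<noteq> 0" using M(7) p1 by simp
    ultimately have "subgroup_index L1 M1 \<noteq> 0" "subgroup_index L2 M2 \<noteq> 0" by auto
    note cf = card_fibre_submods[OF M(1,2) this(1) M(3,4) this(2) M(5,6) w, of r]
    show "card {U \<in> BW W (i + r). (fst ` U, snd ` U) = a} = 1 * fibre_count w r"
      "finite {U \<in> BW W (i + r). (fst ` U, snd ` U) = a}"
      unfolding a fib[OF A[unfolded a]] using cf by simp_all
  qed
  have mapA: "\<exists>i\<le>N. (fst ` U, snd ` U) \<in> AW W i" if U: "U \<in> BW W N" for U W N
  proof -
    have U': "U \<subseteq> fibre" "fibre_submod U" "subgroup_index L U = p ^ N" "\<phi> ` fst ` U = W"
      using U by (auto simp: BW_def B_def)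
    have "prime p" unfolding Q1.p_eq by (rule prime_card)
    moreover have "subgroup_index L (fst ` U \<times> snd ` U) dvd p ^ N" using idx[OF U'(1,2)] U'(3) by (metis dvd_triv_left)
    ultimately obtain i where "i \<le> N" "subgroup_index L (fst ` U \<times> snd ` U) = p ^ i"
      using divides_primepow_nat by blast
    thus ?thesis using proj[OF U'(1,2), of W i] U'(4) by auto
  qed
  have genBW: "gen_fun (BW W) = gen_fun (AW W) * (fps_X ^ w * P_series w)" and finBW: "finite (BW W N)"
    if w: "card W = p ^ w" for W w N
  proof -
    have "gen_fun (BW W) = Abs_fps (\<lambda>i. of_nat (1 * card (AW W i))) * Abs_fps (\<lambda>r. of_nat (fibre_count w r))"
      by (rule gen_fun_fibration(1)[where f = "\<lambda>U. (fst ` U, snd ` U)"])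
        (use finA disjA mapA cnt[OF _ w] in auto)
    thus "gen_fun (BW W) = gen_fun (AW W) * (fps_X ^ w * P_series w)"
      unfolding fps_fibre_count by (simp add: gen_fun_def)
    show "finite (BW W N)"
      by (rule gen_fun_fibration(2)[where f = "\<lambda>U. (fst ` U, snd ` U)" and A = "AW W" and d = "\<lambda>_. 1"
            and c = "fibre_count w"])
        (use finA disjA mapA cnt[OF _ w] in auto)
  qed
  have finT: "finite Q1.T" by (rule finite_coord_vecs)
  have finSub: "finite ?Sub" by (rule finite_subset[of _ "Pow Q1.T"]) (use finT in auto)
  have "gen_fun B = (\<Sum>W\<in>?Sub. gen_fun (BW W))"
  proof (rule gen_fun_UN[OF finSub])
    show "B i = (\<Union>W\<in>?Sub. BW W i)" for i
    proof -
      have "coord.subspace (\<phi> ` fst ` U) \<and> \<phi> ` fst ` U \<subseteq> Q1.T" if "U \<in> B i" for U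
      proof -
        have "U \<subseteq> fibre" "fibre_submod U" using that by (auto simp: B_def)
        note pr = fibre_submod_projections(1,2)[OF this]
        show ?thesis using Q1.subspace_image[OF pr] image_mono[OF pr(1), of \<phi>] Q1.phi_surj by simp
      qed
      thus ?thesis by (auto simp: BW_def)
    qed
    show "finite (BW W i)" if "W \<in> ?Sub" for W i
      using that Q1.card_subspace[of W] finBW by blast
  qed (auto simp: BW_def)
  also have "?Sub = (\<Union>w\<in>{..c}. coord.subspaces_of_card Q1.T (p ^ w))"
  proof (intro equalityI subsetI)
    fix W assume W: "W \<in> ?Sub"
    then obtain w where "card W = p ^ w" using Q1.card_subspace[of W] by auto
    thus "W \<in> (\<Union>w\<in>{..c}. coord.subspaces_of_card Q1.T (p ^ w))"
      using W Q1.index_subspace(1)[of W w] by (auto simp: coord.subspaces_of_card_def)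
  qed (auto simp: coord.subspaces_of_card_def)
  also have "(\<Sum>W\<in>\<dots>. gen_fun (BW W)) = (\<Sum>w\<le>c. \<Sum>W\<in>coord.subspaces_of_card Q1.T (p ^ w). gen_fun (BW W))"
    by (rule sum.UNION_disjoint)
      (use finT p1 coord.finite_subspaces_of_card in \<open>auto simp: coord.subspaces_of_card_def\<close>)
  also have "\<dots> = (\<Sum>w\<le>c. fps_X ^ c * (?Z1 * ?Z2 *
      (of_nat (q_binomial p c w) * fps_X ^ (c - w) * P_series w * (\<Prod>k<w. (1 - p_pow_minus_s p k) ^ 2))))"
  proof (rule sum.cong[OF refl])
    fix w assume "w \<in> {..c}"
    hence wc: "w \<le> c" by simp
    have "(\<Sum>W\<in>coord.subspaces_of_card Q1.T (p ^ w). gen_fun (BW W)) =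
        (\<Sum>W\<in>coord.subspaces_of_card Q1.T (p ^ w).
          (fps_X ^ (c - w) * ?P w * ?Z1) * (fps_X ^ (c - w) * ?P w * ?Z2) * (fps_X ^ w * P_series w))"
    proof (rule sum.cong[OF refl])
      fix W assume "W \<in> coord.subspaces_of_card Q1.T (p ^ w)"
      hence W: "coord.subspace W" "W \<subseteq> Q1.T" "card W = p ^ w" by (auto simp: coord.subspaces_of_card_def)
      show "gen_fun (BW W) =
          (fps_X ^ (c - w) * ?P w * ?Z1) * (fps_X ^ (c - w) * ?P w * ?Z2) * (fps_X ^ w * P_series w)"
        unfolding genBW[OF W(3)] genA Q1.gen_fun_submods_onto[OF W] Q2.gen_fun_submods_onto[OF W] ..
    qed
    also have "\<dots> = of_nat (q_binomial p c w) *
        ((fps_X ^ (c - w) * ?P w * ?Z1) * (fps_X ^ (c - w) * ?P w * ?Z2) * (fps_X ^ w * P_series w))"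
      using coord.card_subspaces[OF subspace_coord_vecs finT, of c w] by (simp add: card_coord_vecs Q1.p_eq)
    \<comment> \<open>One of the two factors X^(c-w) merges with X^w into X^c, which is the index of
      the fibre product; the other one survives.\<close>
    also have "\<dots> = (fps_X ^ (c - w) * fps_X ^ w) * (?Z1 * ?Z2 *
      (of_nat (q_binomial p c w) * fps_X ^ (c - w) * P_series w * (?P w * ?P w)))"
      by (simp only: ac_simps)
    also have "fps_X ^ (c - w) * fps_X ^ w = (fps_X ^ c :: rat fps)" using wc by (simp flip: power_add)
    also have "?P w * ?P w = (\<Prod>k<w. (1 - p_pow_minus_s p k) ^ 2)"
      by (simp add: power2_eq_square prod.distrib)
    finally show "(\<Sum>W\<in>coord.subspaces_of_card Q1.T (p ^ w). gen_fun (BW W)) = fps_X ^ c * (?Z1 * ?Z2 *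
      (of_nat (q_binomial p c w) * fps_X ^ (c - w) * P_series w * (\<Prod>k<w. (1 - p_pow_minus_s p k) ^ 2)))" .
  qed
  finally have B1: "gen_fun B = fps_X ^ c * (?Z1 * ?Z2 *
      (\<Sum>w\<le>c. of_nat (q_binomial p c w) * fps_X ^ (c - w) * P_series w * (\<Prod>k<w. (1 - p_pow_minus_s p k) ^ 2)))"
    by (simp only: sum_distrib_left)
  have fibL: "fibre \<subseteq> L" by (auto simp: fibre_def L_def)
  \<comment> \<open>The fibre product is the kernel of the difference of the two residue maps, which
    is onto F_p^c.\<close>
  have idxfib: "subgroup_index L fibre = p ^ c"
  proof -
    define \<delta> where "\<delta> u = \<phi> (fst u) - \<psi> (snd u)" for u
    have \<delta>_diff: "\<delta> (u - v) = \<delta> u - \<delta> v" if "u \<in> L" "v \<in> L" for u v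
      using that Q1.phi_diff Q2.phi_diff by (auto simp: \<delta>_def L_def)
    have "\<delta> ` L = Q1.T"
    proof -
      have "\<phi> x - \<psi> y \<in> Q1.T" if "x \<in> L1" "y \<in> L2" for x y
        using that Q1.phi_surj Q2.phi_surj coord.subspace_diff[OF subspace_coord_vecs] by blast
      hence "\<delta> ` L \<subseteq> Q1.T" by (auto simp: \<delta>_def L_def)
      moreover have "\<psi> 0 = 0" using Q2.phi_diff[of 0 0] Q2.lattice_closed(1) by simp
      hence "\<phi> x = \<delta> (x, 0)" for x by (simp add: \<delta>_def)
      hence "Q1.T \<subseteq> \<delta> ` L" unfolding Q1.phi_surj[symmetric] using Q2.lattice_closed(1) by (auto simp: L_def)
      ultimately show ?thesis by blast
    qed
    moreover have "fibre = {u \<in> L. \<delta> u \<in> {0}}" by (auto simp: fibre_def L_def \<delta>_def)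
    moreover have "subgroup_set {0 :: nat \<Rightarrow>\<^sub>0 'p mod_ring}" by (simp add: subgroup_set_def)
    ultimately have "subgroup_index L fibre = subgroup_index Q1.T {0}"
      using subgroup_index_vimage[OF _ \<delta>_diff subgroup_setD(2)[OF sgL], of "{0}"] by simp
    thus ?thesis using subgroup_index_eq_card_image[of Q1.T id "{0}"] by (simp add: card_coord_vecs Q1.p_eq)
  qed
  have B2: "gen_fun B = fps_X ^ c * solomon_zeta p fibre_ring scale_prod fibre"
  proof -
    have e: "subgroup_index L U = p ^ c * subgroup_index fibre U" if "U \<subseteq> fibre" "fibre_submod U" for U
      using subgroup_index_mult[OF sgL subgroup_fibre is_submodule_overD(1)[OF that(2)] that(1) fibL] idxfib by simp
    have "solomon_zeta p fibre_ring scale_prod fibre =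
        gen_fun (\<lambda>i. {U. U \<subseteq> fibre \<and> fibre_submod U \<and> subgroup_index fibre U = p ^ i})"
      using p1 by (intro solomon_zeta_eq_gen_fun) simp
    moreover have "B i = {}" if "i < c" for i
      using that e prime_power_mult_eqD(1)[OF p1, of c _ i] by (fastforce simp: B_def)
    moreover have "B (i + c) = {U. U \<subseteq> fibre \<and> fibre_submod U \<and> subgroup_index fibre U = p ^ i}" for i
      using e p1 by (auto simp: B_def power_add)
    ultimately show ?thesis using gen_fun_shift[of c B] by force
  qed
  have "fps_X ^ c * solomon_zeta p fibre_ring scale_prod fibre = fps_X ^ c * (?Z1 * ?Z2 *
      (\<Sum>w\<le>c. of_nat (q_binomial p c w) * fps_X ^ (c - w) * P_series w * (\<Prod>k<w. (1 - p_pow_minus_s p k) ^ 2)))"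
    using B1 B2 by simp
  hence "solomon_zeta p fibre_ring scale_prod fibre = ?Z1 * ?Z2 *
      (\<Sum>w\<le>c. of_nat (q_binomial p c w) * fps_X ^ (c - w) * P_series w * (\<Prod>k<w. (1 - p_pow_minus_s p k) ^ 2))"
    by (subst (asm) mult_left_cancel) auto
  thus ?thesis unfolding Q1.gen_fun_submods Q2.gen_fun_submods by (simp only: atLeast0AtMost)
qed

end

section \<open>The p-adic integers\<close>

lemma Rep_padic_int_props:
  fixes x :: "'p :: prime_card padic_int"
  shows "0 \<le> Rep_padic_int x n" "Rep_padic_int x n < int CARD('p) ^ n"
    "Rep_padic_int x (Suc n) mod int CARD('p) ^ n = Rep_padic_int x n"
  using Rep_padic_int[of x] by auto

lemma Rep_padic_int_mod:
  fixes x :: "'p :: prime_card padic_int"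
  shows "Rep_padic_int x (n + k) mod int CARD('p) ^ n = Rep_padic_int x n"
  by (rule padic_mod_eq) (use Rep_padic_int_props[of x] in auto)

lemma padic_int_eqI: "(\<And>n. Rep_padic_int x n = Rep_padic_int y n) \<Longrightarrow> x = y"
  by (metis Rep_padic_int_inject ext)

lemma Rep_padic_int_of_nat:
  "Rep_padic_int (of_nat k :: 'p :: prime_card padic_int) n = int k mod int CARD('p) ^ n"
proof (induction k)
  case (Suc k)
  have "Rep_padic_int (of_nat (Suc k) :: 'p padic_int) n =
      (Rep_padic_int (1 :: 'p padic_int) n + Rep_padic_int (of_nat k :: 'p padic_int) n) mod int CARD('p) ^ n"
    by (simp add: plus_padic_int.rep_eq)
  thus ?case by (simp add: Suc.IH one_padic_int.rep_eq mod_simps add.commute)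
qed (simp add: zero_padic_int.rep_eq)

definition padic_res :: "'p :: prime_card padic_int \<Rightarrow> 'p mod_ring" where
  "padic_res x = of_int (Rep_padic_int x 1)"

lemma of_int_mod_card: "(of_int (k mod int CARD('p)) :: 'p :: prime_card mod_ring) = of_int k"
  unfolding of_int_of_int_mod_ring by transfer simp

lemma padic_res_hom:
  "padic_res (x + y) = padic_res x + padic_res y"
  "padic_res (x - y) = padic_res x - padic_res y"
  "padic_res (x * y) = padic_res x * padic_res y"
  "padic_res (1 :: 'p :: prime_card padic_int) = 1" "padic_res (0 :: 'p padic_int) = 0"
  for x y :: "'p :: prime_card padic_int"
  unfolding padic_res_def
  by (simp_all add: plus_padic_int.rep_eq minus_padic_int.rep_eq times_padic_int.rep_eq
      one_padic_int.rep_eq zero_padic_int.rep_eq of_int_mod_card)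

lemma padic_res_eq_0_iff: "padic_res x = 0 \<longleftrightarrow> Rep_padic_int x 1 = 0"
  for x :: "'p :: prime_card padic_int"
proof
  assume "padic_res x = 0"
  hence "of_int_mod_ring (Rep_padic_int x 1) = (0 :: 'p mod_ring)"
    by (simp add: padic_res_def of_int_of_int_mod_ring)
  moreover have "to_int_mod_ring (of_int_mod_ring (Rep_padic_int x 1) :: 'p mod_ring) = Rep_padic_int x 1"
    using Rep_padic_int_props(1,2)[of x 1] by (intro to_int_mod_ring_of_int_mod_ring) simp_all
  ultimately show "Rep_padic_int x 1 = 0" by simp
qed (simp add: padic_res_def)

lemma Rep_padic_int_p_mult:
  fixes y :: "'p :: prime_card padic_int"
  shows "Rep_padic_int (of_nat CARD('p) * y) n = int CARD('p) * Rep_padic_int y n mod int CARD('p) ^ n"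
  by (simp add: times_padic_int.rep_eq Rep_padic_int_of_nat mod_simps)

lemma p_padic_neq_0: "(of_nat CARD('p) :: 'p :: prime_card padic_int) \<noteq> 0"
proof
  assume "(of_nat CARD('p) :: 'p padic_int) = 0"
  hence "Rep_padic_int (of_nat CARD('p) :: 'p padic_int) 2 = 0" by (simp add: zero_padic_int.rep_eq)
  hence "int CARD('p) mod int CARD('p) ^ 2 = 0" by (simp only: Rep_padic_int_of_nat)
  moreover have "1 < int CARD('p)" by (rule prime_gt_1_int[OF prime_card_int])
  hence "int CARD('p) < int CARD('p) ^ 2" by (simp add: power2_eq_square)
  ultimately show False by (simp add: mod_pos_pos_trivial)
qed

text \<open>The n-th entry of x/p is the (n+1)-st entry of x divided by p: division costs one digit
  of precision.\<close>

lemma padic_res_eq_0_imp_dvd: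
  fixes x :: "'p :: prime_card padic_int"
  assumes "padic_res x = 0"
  shows "\<exists>y. x = of_nat CARD('p) * y"
proof -
  define q where "q = int CARD('p)"
  have q: "0 < q" by (simp add: q_def)
  note R = Rep_padic_int_props[of x, folded q_def]
  have dvd: "q dvd Rep_padic_int x (Suc n)" for n
    using Rep_padic_int_mod[of x 1 n] assms by (simp add: padic_res_eq_0_iff q_def mod_eq_0_iff_dvd)
  define f where "f n = Rep_padic_int x (Suc n) div q" for n
  have f: "f n \<in> {0..<q ^ n} \<and> f (Suc n) mod q ^ n = f n" for n
  proof -
    have "f (Suc n) mod q ^ n = (Rep_padic_int x (Suc (Suc n)) mod (q * q ^ n)) div q"
      using q by (simp add: f_def zmod_zmult2_eq)
    also have "Rep_padic_int x (Suc (Suc n)) mod (q * q ^ n) = Rep_padic_int x (Suc n)"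
      using R(3)[of "Suc n"] by simp
    finally have "f (Suc n) mod q ^ n = f n" by (simp add: f_def)
    moreover have "0 \<le> f n" using R(1) q by (simp add: f_def pos_imp_zdiv_nonneg_iff)
    moreover have "f n < q ^ n"
      using dvd[of n] R(2)[of "Suc n"] q by (auto simp: f_def elim!: dvdE)
    ultimately show ?thesis by simp
  qed
  hence Rf: "Rep_padic_int (Abs_padic_int f :: 'p padic_int) = f"
    by (intro Abs_padic_int_inverse) (simp add: q_def)
  have "x = of_nat CARD('p) * Abs_padic_int f"
  proof (rule padic_int_eqI)
    fix n
    have "q * f n = Rep_padic_int x (Suc n)" using dvd[of n] by (simp add: f_def)
    thus "Rep_padic_int x n = Rep_padic_int (of_nat CARD('p) * Abs_padic_int f :: 'p padic_int) n"
      using R(3)[of n] unfolding Rep_padic_int_p_mult Rf q_def[symmetric] by simp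
  qed
  thus ?thesis ..
qed

text \<open>Each entry of x is prime to p and so invertible modulo p^n. Inverses modulo p^n are
  unique, which makes those of successive levels compatible.\<close>

lemma padic_res_neq_0_imp_unit:
  fixes x :: "'p :: prime_card padic_int"
  assumes "padic_res x \<noteq> 0"
  shows "\<exists>y. x * y = 1"
proof -
  define q where "q = int CARD('p)"
  have q: "0 < q" "prime q" using prime_card_int[where 'a = 'p] by (simp_all add: q_def)
  note R = Rep_padic_int_props[of x, folded q_def]
  have cop: "algebraic_semidom_class.coprime (Rep_padic_int x n) (q ^ n)" for n
  proof (cases n)
    case (Suc m)
    have "Rep_padic_int x n mod q = Rep_padic_int x 1"
      using Rep_padic_int_mod[of x 1 m] Suc by (simp add: q_def)
    hence "\<not> q dvd Rep_padic_int x n"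
      using assms by (auto simp: padic_res_eq_0_iff mod_eq_0_iff_dvd)
    hence "algebraic_semidom_class.coprime q (Rep_padic_int x n)" by (rule prime_imp_coprime[OF q(2)])
    thus ?thesis by (simp add: algebraic_semidom_class.coprime_commute)
  qed simp
  have "\<exists>y. y \<in> {0..<q ^ n} \<and> [Rep_padic_int x n * y = 1] (mod q ^ n)" for n
  proof -
    obtain y where "[Rep_padic_int x n * y = 1] (mod q ^ n)" using cong_solve_coprime_int[OF cop] by blast
    hence "[Rep_padic_int x n * (y mod q ^ n) = 1] (mod q ^ n)" by (simp add: cong_def mod_mult_right_eq)
    thus ?thesis using q by (intro exI[of _ "y mod q ^ n"]) simp
  qed
  then obtain f where f: "\<And>n. f n \<in> {0..<q ^ n}" "\<And>n. [Rep_padic_int x n * f n = 1] (mod q ^ n)"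
    by metis
  have "f (Suc n) mod q ^ n = f n" for n
  proof -
    have "[Rep_padic_int x (Suc n) * f (Suc n) = 1] (mod q ^ n)"
      using f(2)[of "Suc n"] by (rule cong_dvd_modulus) simp
    moreover have "[Rep_padic_int x (Suc n) = Rep_padic_int x n] (mod q ^ n)"
      using R(3)[of n] R(1,2)[of n] by (simp add: cong_def)
    ultimately have "[Rep_padic_int x n * f (Suc n) = 1] (mod q ^ n)"
      by (meson cong_scalar_right cong_sym cong_trans)
    hence "[Rep_padic_int x n * f (Suc n) = Rep_padic_int x n * f n] (mod q ^ n)"
      using f(2)[of n] by (meson cong_sym cong_trans)
    hence "[f (Suc n) = f n] (mod q ^ n)" using cong_mult_lcancel[OF cop] by blast
    thus ?thesis using f(1)[of n] by (simp add: cong_def)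
  qed
  hence Rf: "Rep_padic_int (Abs_padic_int f :: 'p padic_int) = f"
    using f(1) by (intro Abs_padic_int_inverse) (simp add: q_def)
  have "x * Abs_padic_int f = 1"
    by (rule padic_int_eqI) (use f(2) in \<open>simp add: times_padic_int.rep_eq one_padic_int.rep_eq Rf cong_def q_def\<close>)
  thus ?thesis ..
qed

text \<open>Induction on a level at which x is non-zero: if the residue vanishes, x/p is non-zero
  one level lower.\<close>

lemma padic_int_factor:
  fixes x :: "'p :: prime_card padic_int"
  assumes "x \<noteq> 0"
  shows "\<exists>k u. padic_res u \<noteq> 0 \<and> x = of_nat CARD('p) ^ k * u"
proof -
  obtain N where "Rep_padic_int x N \<noteq> 0"
    using assms padic_int_eqI[of x 0] by (auto simp: zero_padic_int.rep_eq)
  thus ?thesis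
  proof (induction N arbitrary: x)
    case 0
    thus ?case using Rep_padic_int_props(1,2)[of x 0] by simp
  next
    case (Suc N)
    show ?case
    proof (cases "padic_res x = 0")
      case True
      then obtain y where y: "x = of_nat CARD('p) * y" using padic_res_eq_0_imp_dvd by blast
      have "Rep_padic_int y N \<noteq> 0"
      proof
        assume "Rep_padic_int y N = 0"
        hence "int CARD('p) ^ N dvd Rep_padic_int y (Suc N)"
          using Rep_padic_int_props(3)[of y N] by (simp add: mod_eq_0_iff_dvd)
        hence "Rep_padic_int x (Suc N) = 0" unfolding y Rep_padic_int_p_mult by auto
        thus False using Suc.prems by simp
      qed
      then obtain k u where "padic_res u \<noteq> 0" "y = of_nat CARD('p) ^ k * u" using Suc.IH by blast
      thus ?thesis using y by (intro exI[of _ "Suc k"] exI[of _ u]) (simp add: mult.assoc)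
    qed (intro exI[of _ 0] exI[of _ x], simp)
  qed
qed

lemma padic_of_int_eq_iff [simp]: "padic_of_int x = padic_of_int y \<longleftrightarrow> x = y"
  by (simp add: eq_fract)

lemma padic_int_to_ac_hom:
  fixes x y :: "'p :: prime_card padic_int"
  shows "padic_int_to_ac (x + y) = padic_int_to_ac x + padic_int_to_ac y"
    "padic_int_to_ac (x - y) = padic_int_to_ac x - padic_int_to_ac y"
    "padic_int_to_ac (x * y) = padic_int_to_ac x * padic_int_to_ac y"
    "padic_int_to_ac (1 :: 'p padic_int) = 1" "padic_int_to_ac (0 :: 'p padic_int) = 0"
    "padic_int_to_ac x = padic_int_to_ac y \<longleftrightarrow> x = y"
  by (simp_all add: to_ac_add[symmetric] to_ac_diff[symmetric] to_ac_mult[symmetric] One_fract_def[symmetric]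
      Zero_fract_def[symmetric] to_ac_eq_iff)

lemma padic_int_to_ac_of_nat: "padic_int_to_ac (of_nat n :: 'p :: prime_card padic_int) = of_nat n"
  by (induction n) (simp_all add: padic_int_to_ac_hom)

lemma padic_int_to_ac_power: "padic_int_to_ac (x ^ n) = padic_int_to_ac x ^ n"
  for x :: "'p :: prime_card padic_int"
  by (induction n) (simp_all add: padic_int_to_ac_hom)

text \<open>Z_p is placed inside the algebraic closure so that it and Z_p[omega] are subrings of one
  field.\<close>

abbreviation Zp_ac :: "'p :: prime_card padic alg_closure set" where "Zp_ac \<equiv> range padic_int_to_ac"

definition res_Zp :: "'p :: prime_card padic alg_closure \<Rightarrow> 'p mod_ring" where
  "res_Zp s = padic_res (the_inv padic_int_to_ac s)"

lemma res_Zp_eq [simp]: "res_Zp (padic_int_to_ac x) = padic_res x"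
  unfolding res_Zp_def by (subst the_inv_f_f) (simp_all add: inj_def)

lemma padic_res_of_nat: "padic_res (of_nat n :: 'p :: prime_card padic_int) = of_nat n"
  by (induction n) (simp_all add: padic_res_hom)

lemma padic_res_p: "padic_res (of_nat CARD('p) :: 'p :: prime_card padic_int) = 0"
  by (simp add: padic_res_of_nat)

lemma Zp_ac_closed:
  "x \<in> Zp_ac \<Longrightarrow> y \<in> Zp_ac \<Longrightarrow> x - y \<in> Zp_ac"
  "x \<in> Zp_ac \<Longrightarrow> y \<in> Zp_ac \<Longrightarrow> x * y \<in> Zp_ac"
  "of_nat n \<in> Zp_ac" "1 \<in> Zp_ac"
proof -
  show "x - y \<in> Zp_ac" "x * y \<in> Zp_ac" if "x \<in> Zp_ac" "y \<in> Zp_ac"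
    using that by (auto simp: padic_int_to_ac_hom(2,3)[symmetric] simp del: to_ac_diff to_ac_mult)
  show *: "of_nat n \<in> Zp_ac" for n
    using rangeI[of padic_int_to_ac "of_nat n"] unfolding padic_int_to_ac_of_nat .
  show "1 \<in> Zp_ac" using *[of 1] by simp
qed

lemma residue_dvr_Zp:
  "residue_dvr (Zp_ac :: 'p :: prime_card padic alg_closure set) (of_nat CARD('p)) res_Zp CARD('p)"
proof (unfold_locales, goal_cases)
  case 2 show ?case by (rule Zp_ac_closed)
next
  case (3 x y) thus ?case by (rule Zp_ac_closed)
next
  case (4 x y) thus ?case by (rule Zp_ac_closed)
next
  case 5 show ?case by (rule Zp_ac_closed)
next
  case 6
  have "padic_int_to_ac (of_nat CARD('p) :: 'p padic_int) \<noteq> padic_int_to_ac 0"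
    unfolding padic_int_to_ac_hom(6) by (rule p_padic_neq_0)
  thus ?case unfolding padic_int_to_ac_of_nat padic_int_to_ac_hom(5) .
next
  case 7 show ?case using res_Zp_eq[where x = "1 :: 'p padic_int"] unfolding padic_int_to_ac_hom(4) padic_res_hom(4) .
next
  case (8 x y)
  then obtain u v where "x = padic_int_to_ac u" "y = padic_int_to_ac v" by blast
  thus ?case by (simp only: padic_int_to_ac_hom(2)[symmetric] res_Zp_eq padic_res_hom)
next
  case (9 x y)
  then obtain u v where "x = padic_int_to_ac u" "y = padic_int_to_ac v" by blast
  thus ?case by (simp only: padic_int_to_ac_hom(3)[symmetric] res_Zp_eq padic_res_hom)
next
  case (10 x)
  then obtain u where u: "x = padic_int_to_ac u" by blast
  have "padic_res u = 0 \<longleftrightarrow> (\<exists>y. u = of_nat CARD('p) * y)"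
    using padic_res_eq_0_imp_dvd[of u] padic_res_p[where 'p = 'p] by (auto simp only: padic_res_hom mult_zero_left)
  also have "\<dots> \<longleftrightarrow> (\<exists>y. x = of_nat CARD('p) * padic_int_to_ac y)"
    unfolding u padic_int_to_ac_of_nat[symmetric] padic_int_to_ac_hom(3)[symmetric] padic_int_to_ac_hom(6) ..
  finally show ?case unfolding u res_Zp_eq by blast
next
  case (11 x)
  then obtain u where u: "x = padic_int_to_ac u" "padic_res u \<noteq> 0" by auto
  then obtain y where "u * y = 1" using padic_res_neq_0_imp_unit by blast
  hence "padic_int_to_ac u * padic_int_to_ac y = 1"
    unfolding padic_int_to_ac_hom(3)[symmetric] by (simp only: padic_int_to_ac_hom(4))
  hence "inverse x = padic_int_to_ac y" unfolding u using inverse_unique by blast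
  thus ?case by simp
next
  case (12 x)
  then obtain u where u: "x = padic_int_to_ac u" "u \<noteq> 0" using padic_int_to_ac_hom(5) by blast
  then obtain k v where "padic_res v \<noteq> 0" "u = of_nat CARD('p) ^ k * v" using padic_int_factor by blast
  hence "x = of_nat CARD('p) ^ k * padic_int_to_ac v" "res_Zp (padic_int_to_ac v) \<noteq> 0"
    unfolding u(1) by (simp_all only: padic_int_to_ac_hom(3) padic_int_to_ac_power padic_int_to_ac_of_nat res_Zp_eq simp_thms)
  thus ?case by blast
qed simp

section \<open>The cyclotomic ring\<close>

text \<open>Common form of \<open>augmentation\<close> (at w = 1), \<open>eval_at_root\<close> and
  their counterparts over Q_p; h acts on the coefficients.\<close>

definition group_eval :: "('r :: zero \<Rightarrow> 'k :: comm_ring_1) \<Rightarrow> 'k \<Rightarrow> ('p :: prime_card mod_ring \<Rightarrow>\<^sub>0 'r) \<Rightarrow> 'k" where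
  "group_eval h w r = (\<Sum>g\<in>UNIV. h (Poly_Mapping.lookup r g) * w ^ nat (to_int_mod_ring g))"

lemma augmentation_eq: "augmentation = group_eval id 1"
  by (simp add: fun_eq_iff augmentation_def group_eval_def)

lemma eval_at_root_eq: "eval_at_root w = group_eval padic_int_to_ac w"
  by (simp add: fun_eq_iff eval_at_root_def group_eval_def)

lemma poly_mapping_decompose:
  "r = (\<Sum>g\<in>UNIV. Poly_Mapping.single g (Poly_Mapping.lookup r g))"
  for r :: "'g :: finite \<Rightarrow>\<^sub>0 'r :: comm_monoid_add"
  by (rule poly_mapping_eqI) (simp add: lookup_sum lookup_single when_def)

lemma to_int_mod_ring_plus:
  "to_int_mod_ring (a + b) = (to_int_mod_ring a + to_int_mod_ring b) mod int CARD('p)"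
  for a b :: "'p :: prime_card mod_ring"
  by transfer simp

lemma to_int_mod_ring_nonneg: "0 \<le> to_int_mod_ring (a :: 'p :: prime_card mod_ring)"
  by transfer simp

lemma of_nat_to_int_mod_ring: "of_nat (nat (to_int_mod_ring a)) = (a :: 'p :: prime_card mod_ring)"
proof -
  have "of_nat (nat (to_int_mod_ring a)) = (of_int (to_int_mod_ring a) :: 'p mod_ring)"
    using to_int_mod_ring_nonneg[of a] by (simp add: of_nat_nat)
  thus ?thesis by (simp add: of_int_of_int_mod_ring)
qed

lemma root_power_mod: "w ^ n = 1 \<Longrightarrow> w ^ (k mod n) = w ^ k" for w :: "'k :: comm_ring_1"
proof -
  assume "w ^ n = 1"
  hence "w ^ (n * (k div n) + k mod n) = w ^ (k mod n)" by (simp only: power_add power_mult power_one mult_1)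
  thus ?thesis by simp
qed

text \<open>Exponents are representatives of residue classes modulo p, so w^p = 1 is what makes the
  powers of w, and with them e, multiplicative.\<close>

locale group_eval_hom =
  fixes h :: "'r :: comm_ring_1 \<Rightarrow> 'k :: comm_ring_1" and w :: 'k and e :: "('p :: prime_card mod_ring \<Rightarrow>\<^sub>0 'r) \<Rightarrow> 'k"
  assumes h_add: "h (x + y) = h x + h y" and h_mult: "h (x * y) = h x * h y"
    and h_one: "h 1 = 1" and root: "w ^ CARD('p) = 1" and e_eq: "e = group_eval h w"
begin

lemma h_zero: "h 0 = 0" using h_add[of 0 0] by simp

lemma add: "e (r + s) = e r + e s"
  by (simp add: e_eq group_eval_def lookup_add h_add algebra_simps sum.distrib)

lemma zero: "e 0 = 0" using add[of 0 0] by simp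

lemma diff: "e (r - s) = e r - e s"
  using add[of "r - s" s] by simp

lemma sum: "e (\<Sum>i\<in>A. f i) = (\<Sum>i\<in>A. e (f i))"
  by (induction A rule: infinite_finite_induct) (simp_all add: zero add)

lemma single: "e (Poly_Mapping.single g c) = h c * w ^ nat (to_int_mod_ring g)"
proof -
  have "h (Poly_Mapping.lookup (Poly_Mapping.single g c) x) * w ^ nat (to_int_mod_ring x) =
      (if x = g then h c * w ^ nat (to_int_mod_ring g) else 0)" for x
    by (simp add: lookup_single when_def h_zero)
  thus ?thesis by (simp add: e_eq group_eval_def)
qed

lemma single_0: "e (Poly_Mapping.single 0 c) = h c" by (simp add: single)

lemma one: "e 1 = 1" using single_0[of 1] by (simp add: h_one)

lemma mult: "e (r * s) = e r * e s"
proof -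
  have pw: "w ^ nat (to_int_mod_ring (a + b)) = w ^ nat (to_int_mod_ring a) * w ^ nat (to_int_mod_ring b)"
    for a b :: "'p mod_ring"
  proof -
    have "nat (to_int_mod_ring (a + b)) = (nat (to_int_mod_ring a) + nat (to_int_mod_ring b)) mod CARD('p)"
      unfolding to_int_mod_ring_plus using to_int_mod_ring_nonneg[of a] to_int_mod_ring_nonneg[of b]
      by (simp add: nat_mod_distrib nat_add_distrib)
    thus ?thesis by (simp add: root_power_mod[OF root] power_add)
  qed
  let ?s = "\<lambda>r g. Poly_Mapping.single g (Poly_Mapping.lookup r g)"
  have "r * s = (\<Sum>a\<in>UNIV. \<Sum>b\<in>UNIV. ?s r a * ?s s b)"
    by (subst poly_mapping_decompose[of r], subst poly_mapping_decompose[of s]) (rule sum_product)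
  hence "e (r * s) = (\<Sum>a\<in>UNIV. \<Sum>b\<in>UNIV. e (?s r a) * e (?s s b))"
    by (simp add: sum single mult_single h_mult pw ac_simps)
  also have "\<dots> = e (\<Sum>a\<in>UNIV. ?s r a) * e (\<Sum>b\<in>UNIV. ?s s b)"
    by (simp add: sum sum_product)
  finally show ?thesis using poly_mapping_decompose[of r] poly_mapping_decompose[of s] by simp
qed

lemma power: "e (r ^ n) = e r ^ n"
  by (induction n) (simp_all add: one mult)

lemma of_nat: "e (of_nat n) = of_nat n"
  by (induction n) (simp_all add: zero one add)

end

interpretation aug: group_eval_hom "id :: 'p :: prime_card padic_int \<Rightarrow> _" 1 "augmentation :: 'p group_ring_Zp \<Rightarrow> _"
  by unfold_locales (simp_all add: augmentation_eq)

definition gen :: "'p :: prime_card mod_ring \<Rightarrow>\<^sub>0 'r :: comm_ring_1" where "gen = Poly_Mapping.single 1 1"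

text \<open>It vanishes at omega and has augmentation p. Adding a multiple of it corrects the
  augmentation by a multiple of p while the value at omega stays fixed.\<close>

definition norm_elt :: "'p :: prime_card mod_ring \<Rightarrow>\<^sub>0 'r :: comm_ring_1" where
  "norm_elt = (\<Sum>g\<in>UNIV. Poly_Mapping.single g 1)"

lemma gen_power: "gen ^ n = Poly_Mapping.single (of_nat n) 1"
  by (induction n) (simp_all add: gen_def mult_single)

lemma gen_power_card: "gen ^ CARD('p) = (1 :: 'p :: prime_card mod_ring \<Rightarrow>\<^sub>0 'r :: comm_ring_1)"
  by (simp add: gen_power)

lemma gen_norm_elt: "gen * norm_elt = norm_elt"
proof -
  have "gen * norm_elt = (\<Sum>g\<in>UNIV. Poly_Mapping.single (1 + g) 1)"
    by (simp add: norm_elt_def sum_distrib_left gen_def mult_single)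
  also have "\<dots> = norm_elt"
    unfolding norm_elt_def
    by (rule sum.reindex_bij_witness[where i = "\<lambda>g. g - 1" and j = "\<lambda>g. 1 + g"]) auto
  finally show ?thesis .
qed

lemma lookup_norm_elt: "Poly_Mapping.lookup norm_elt g = 1"
  by (simp add: norm_elt_def lookup_sum lookup_single when_def)

lemma single_sum: "Poly_Mapping.single k (\<Sum>i\<in>A. f i) = (\<Sum>i\<in>A. Poly_Mapping.single k (f i))"
  by (induction A rule: infinite_finite_induct) (simp_all add: single_add)

text \<open>Group elements are powers of the generator, and gen^k - 1 is divisible by gen - 1. So
  the augmentation ideal is principal.\<close>

lemma gen_minus_1_dvd: "(gen - 1) dvd r - Poly_Mapping.single 0 (augmentation r)"
  for r :: "'p :: prime_card group_ring_Zp"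
proof -
  have trm: "(gen - 1) dvd Poly_Mapping.single g c - Poly_Mapping.single 0 c" for g :: "'p mod_ring" and c :: "'p padic_int"
  proof -
    have "Poly_Mapping.single g c - Poly_Mapping.single 0 c =
        Poly_Mapping.single 0 c * (gen ^ nat (to_int_mod_ring g) - 1)"
      by (simp add: gen_power of_nat_to_int_mod_ring right_diff_distrib mult_single)
    also have "(gen - 1) dvd \<dots>"
      by (simp add: power_diff_1_eq)
    finally show ?thesis .
  qed
  have "r - Poly_Mapping.single 0 (augmentation r) =
      (\<Sum>g\<in>UNIV. Poly_Mapping.single g (Poly_Mapping.lookup r g) - Poly_Mapping.single 0 (Poly_Mapping.lookup r g))"
    by (subst poly_mapping_decompose[of r]) (simp add: sum_subtractf augmentation_def single_sum)
  thus ?thesis by (simp add: dvd_sum trm)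
qed

text \<open>For prime p this is ((1 + x)^p - 1 - x^p) / (p x), written as a polynomial.\<close>

definition binomial_quot :: "nat \<Rightarrow> 'a :: comm_ring_1 \<Rightarrow> 'a" where
  "binomial_quot p x = (\<Sum>i<p - 1. of_nat ((p choose Suc i) div p) * x ^ i)"

text \<open>The inner binomial coefficients are divisible by p. The ring is arbitrary because the
  expansion is used both at omega - 1 and at gen - 1 in the group ring.\<close>

lemma power_prime_eq_binomial_quot:
  assumes "prime p" "(x + 1) ^ p = (1 :: 'a :: comm_ring_1)"
  shows "x ^ p = - (of_nat p * (x * binomial_quot p x))"
proof -
  obtain m where m: "p = Suc m" using prime_gt_0_nat[OF assms(1)] by (metis Suc_pred)
  have choose: "of_nat (p choose Suc i) = (of_nat p * of_nat ((p choose Suc i) div p) :: 'a)" if "i < m" for i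
  proof -
    have "p dvd p choose Suc i" using that m assms(1) by (intro dvd_choose_prime) auto
    thus ?thesis by (metis dvd_mult_div_cancel of_nat_mult)
  qed
  have "1 = (\<Sum>k\<le>p. of_nat (p choose k) * x ^ k)" using assms(2) by (simp add: binomial_ring)
  also have "\<dots> = 1 + (\<Sum>i\<le>m. of_nat (p choose Suc i) * x ^ Suc i)"
    unfolding m by (subst sum.atMost_Suc_shift) simp
  also have "(\<Sum>i\<le>m. of_nat (p choose Suc i) * x ^ Suc i) = (\<Sum>i<m. of_nat (p choose Suc i) * x ^ Suc i) + x ^ p"
    unfolding m lessThan_Suc_atMost[symmetric] by (simp del: binomial_Suc_Suc power_Suc)
  also have "(\<Sum>i<m. of_nat (p choose Suc i) * x ^ Suc i) = of_nat p * (x * binomial_quot p x)"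
  proof -
    have "p - 1 = m" using m by simp
    thus ?thesis
      unfolding binomial_quot_def sum_distrib_left by (intro sum.cong) (simp_all add: choose ac_simps)
  qed
  finally show ?thesis by (simp add: eq_neg_iff_add_eq_0 add.commute)
qed

text \<open>The constant term is p/p = 1. At omega - 1 the value therefore has residue 1 and turns
  out to be a unit.\<close>

lemma binomial_quot_eq:
  assumes "prime p"
  shows "\<exists>n :: nat \<Rightarrow> nat. \<forall>x :: 'a :: comm_ring_1. binomial_quot p x = 1 + x * (\<Sum>i<p - 2. of_nat (n i) * x ^ i)"
proof -
  obtain m where m: "p = Suc (Suc m)"
    using prime_gt_1_nat[OF assms] by (metis One_nat_def Suc_lessE less_imp_Suc_add)
  have "binomial_quot p x = 1 + x * (\<Sum>i<p - 2. of_nat ((p choose Suc (Suc i)) div p) * x ^ i)" for x :: 'a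
  proof -
    have "binomial_quot p x = (\<Sum>i<Suc m. of_nat ((p choose Suc i) div p) * x ^ i)"
      by (simp add: binomial_quot_def m)
    also have "\<dots> = 1 + (\<Sum>i<m. of_nat ((p choose Suc (Suc i)) div p) * x ^ Suc i)"
      by (subst sum.lessThan_Suc_shift) (use m in simp)
    finally show ?thesis by (simp add: m sum_distrib_left ac_simps)
  qed
  thus ?thesis by fast
qed

text \<open>The generators are eliminated one after the other: the coefficient of \<open>g i\<close> on its own right-hand side
  is divisible by \<open>p\<close>, so that \<open>g i\<close> can be solved for.\<close>

lemma nakayama:
  fixes g :: "'i \<Rightarrow> 'p :: prime_card padic alg_closure"
  assumes "finite I" "0 \<in> N" "\<And>x y. x \<in> N \<Longrightarrow> y \<in> N \<Longrightarrow> x + y \<in> N"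
    "\<And>c x. x \<in> N \<Longrightarrow> padic_int_to_ac c * x \<in> N"
    "\<And>i. i \<in> I \<Longrightarrow> \<exists>\<nu>\<in>N. \<exists>c. g i = \<nu> + of_nat CARD('p) * (\<Sum>j\<in>I. padic_int_to_ac (c j) * g j)"
    "i \<in> I"
  shows "g i \<in> N"
  using assms(1,5,6)
proof (induction I arbitrary: i rule: finite_induct)
  case (insert a I)
  let ?p = "of_nat CARD('p) :: 'p padic alg_closure" and ?\<iota> = "padic_int_to_ac :: 'p padic_int \<Rightarrow> _"
  obtain \<nu> c where c: "\<nu> \<in> N" "g a = \<nu> + ?p * (\<Sum>j\<in>insert a I. ?\<iota> (c j) * g j)"
    using insert.prems(1)[of a] by blast
  have "padic_res (1 - of_nat CARD('p) * c a) \<noteq> 0" by (simp add: padic_res_hom padic_res_p)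
  then obtain u where "(1 - of_nat CARD('p) * c a) * u = 1" using padic_res_neq_0_imp_unit by blast
  hence "?\<iota> ((1 - of_nat CARD('p) * c a) * u) = 1" by (simp only: padic_int_to_ac_hom)
  hence u: "(1 - ?p * ?\<iota> (c a)) * ?\<iota> u = 1"
    by (simp only: padic_int_to_ac_hom(2-4) padic_int_to_ac_of_nat)
  have "(1 - ?p * ?\<iota> (c a)) * g a = \<nu> + ?p * (\<Sum>j\<in>I. ?\<iota> (c j) * g j)"
    using c(2) insert.hyps by (simp add: algebra_simps)
  hence "?\<iota> u * ((1 - ?p * ?\<iota> (c a)) * g a) = ?\<iota> u * (\<nu> + ?p * (\<Sum>j\<in>I. ?\<iota> (c j) * g j))" by (rule arg_cong)
  hence "(1 - ?p * ?\<iota> (c a)) * ?\<iota> u * g a = ?\<iota> u * \<nu> + ?p * (\<Sum>j\<in>I. ?\<iota> u * ?\<iota> (c j) * g j)"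
    by (simp only: sum_distrib_left distrib_left ac_simps)
  hence ga: "g a = ?\<iota> u * \<nu> + ?p * (\<Sum>j\<in>I. ?\<iota> (u * c j) * g j)"
    unfolding u by (simp only: padic_int_to_ac_hom(3) mult_1)
  have I: "g i \<in> N" if "i \<in> I" for i
  proof (rule insert.IH[OF _ that])
    fix i assume "i \<in> I"
    then obtain \<mu> d where d: "\<mu> \<in> N" "g i = \<mu> + ?p * (\<Sum>j\<in>insert a I. ?\<iota> (d j) * g j)"
      using insert.prems(1)[of i] by blast
    have "g i = (\<mu> + ?\<iota> (of_nat CARD('p) * d a * u) * \<nu>) +
        ?p * (\<Sum>j\<in>I. ?\<iota> (d j + of_nat CARD('p) * d a * (u * c j)) * g j)"
    proof -
      have "g i = \<mu> + ?p * (?\<iota> (d a) * g a + (\<Sum>j\<in>I. ?\<iota> (d j) * g j))"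
        using d(2) insert.hyps by simp
      also have "\<dots> = \<mu> + ?p * (?\<iota> (d a) * (?\<iota> u * \<nu> + ?p * (\<Sum>j\<in>I. ?\<iota> (u * c j) * g j)) + (\<Sum>j\<in>I. ?\<iota> (d j) * g j))"
        by (subst ga) (rule refl)
      also have "\<dots> = (\<mu> + ?p * ?\<iota> (d a) * ?\<iota> u * \<nu>) + ?p * ((\<Sum>j\<in>I. ?\<iota> (d j) * g j) + ?p * ?\<iota> (d a) * (\<Sum>j\<in>I. ?\<iota> (u * c j) * g j))"
        by (simp only: algebra_simps)
      also have "(\<Sum>j\<in>I. ?\<iota> (d j) * g j) + ?p * ?\<iota> (d a) * (\<Sum>j\<in>I. ?\<iota> (u * c j) * g j) =
          (\<Sum>j\<in>I. (?\<iota> (d j) + ?p * ?\<iota> (d a) * ?\<iota> (u * c j)) * g j)"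
        by (simp only: sum_distrib_left sum.distrib distrib_right mult.assoc)
      finally show ?thesis by (simp only: padic_int_to_ac_hom(1,3) padic_int_to_ac_of_nat)
    qed
    thus "\<exists>\<nu>\<in>N. \<exists>c. g i = \<nu> + ?p * (\<Sum>j\<in>I. ?\<iota> (c j) * g j)"
      using assms(3)[OF d(1) assms(4)[OF c(1)]] by (intro bexI exI)
  qed
  have "(\<Sum>j\<in>J. ?\<iota> (u * c j) * g j) \<in> N" if "J \<subseteq> I" for J
  proof -
    have "finite J" using that insert.hyps(1) finite_subset by blast
    thus ?thesis using that by (induction J rule: finite_induct) (use assms(2-4) I in auto)
  qed
  from assms(4)[OF this[of I], of "of_nat CARD('p)"] have "?p * (\<Sum>j\<in>I. ?\<iota> (u * c j) * g j) \<in> N"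
    by (simp only: padic_int_to_ac_of_nat order_refl)
  hence "g a \<in> N" by (subst ga) (rule assms(3)[OF assms(4)[OF c(1)]])
  thus ?case using I insert.prems(2) by blast
qed simp

lemma padic_int_dvd_all_powers:
  fixes x :: "'p :: prime_card padic_int"
  assumes "\<And>k. \<exists>y. x = of_nat CARD('p) ^ k * y"
  shows "x = 0"
proof (rule ccontr)
  assume "x \<noteq> 0"
  then obtain m u where u: "padic_res u \<noteq> 0" "x = of_nat CARD('p) ^ m * u" using padic_int_factor by blast
  obtain y where "x = of_nat CARD('p) ^ Suc m * y" using assms by blast
  hence "of_nat CARD('p) ^ m * u = of_nat CARD('p) ^ m * (of_nat CARD('p) * y)" using u by (simp add: ac_simps)
  hence "u = of_nat CARD('p) * y" using p_padic_neq_0[where 'p = 'p] by simp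
  thus False using u(1) padic_res_p[where 'p = 'p] by (simp add: padic_res_hom)
qed

section \<open>Z_p[omega] as a discrete valuation ring\<close>

locale cyclotomic =
  fixes \<omega> :: "'p :: prime_card padic alg_closure"
  assumes primitive: "primitive_root_of_unity CARD('p) \<omega>"
begin

lemma omega_power: "\<omega> ^ CARD('p) = 1" and omega_neq_1: "\<omega> \<noteq> 1"
proof -
  have "1 < CARD('p)" using prime_card[where 'a = 'p] prime_gt_1_nat by blast
  thus "\<omega> ^ CARD('p) = 1" "\<omega> \<noteq> 1"
    using primitive unfolding primitive_root_of_unity_def by (auto dest: spec[of _ 1])
qed

definition ev :: "'p group_ring_Zp \<Rightarrow> 'p padic alg_closure" where "ev = eval_at_root \<omega>"

sublocale ev: group_eval_hom "padic_int_to_ac :: 'p padic_int \<Rightarrow> _" \<omega> ev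
  by unfold_locales (simp_all only: padic_int_to_ac_hom omega_power ev_def eval_at_root_eq)

text \<open>The image of the group ring, identified with Z_p[omega] in \<open>Zp_adjoin_eq\<close>.
  In this form every element has a preimage in the group ring, and the augmentation of that preimage
  yields its residue.\<close>

abbreviation R :: "'p padic alg_closure set" where "R \<equiv> range ev"

abbreviation P :: "'p padic alg_closure" where "P \<equiv> of_nat CARD('p)"

definition t :: "'p padic alg_closure" where "t = \<omega> - 1"

lemma prime_p: "prime CARD('p)" by (rule prime_card)

lemma p_gt_1: "1 < CARD('p)" using prime_p prime_gt_1_nat by blast

lemma R_closed:
  "x \<in> R \<Longrightarrow> y \<in> R \<Longrightarrow> x + y \<in> R" "x \<in> R \<Longrightarrow> y \<in> R \<Longrightarrow> x - y \<in> R"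
  "x \<in> R \<Longrightarrow> y \<in> R \<Longrightarrow> x * y \<in> R" "x \<in> R \<Longrightarrow> x ^ n \<in> R" "padic_int_to_ac c \<in> R" "of_nat n \<in> R" "1 \<in> R" "0 \<in> R"
  "x \<in> R \<Longrightarrow> - x \<in> R"
proof -
  show "x + y \<in> R" "x - y \<in> R" "x * y \<in> R" if "x \<in> R" "y \<in> R" for x y
    using that by (auto simp flip: ev.add ev.diff ev.mult)
  show "x ^ n \<in> R" if "x \<in> R" for x n using that by (auto simp flip: ev.power)
  show "padic_int_to_ac c \<in> R" using ev.single_0[of c] by (metis rangeI)
  show "of_nat n \<in> R" "1 \<in> R" and 0: "0 \<in> R" using ev.of_nat[of n] ev.one ev.zero by (metis rangeI)+
  show "- x \<in> R" if "x \<in> R" for x using that 0 \<open>\<And>x y. x \<in> R \<Longrightarrow> y \<in> R \<Longrightarrow> x - y \<in> R\<close>[of 0 x] by simp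
qed

lemma ev_gen: "ev gen = \<omega>"
proof -
  have "to_int_mod_ring (1 :: 'p mod_ring) = 1" by transfer simp
  thus ?thesis by (simp add: gen_def ev.single padic_int_to_ac_hom(4))
qed

lemma aug_gen: "augmentation (gen :: 'p group_ring_Zp) = 1"
  by (simp add: gen_def aug.single)

lemma ev_T: "ev (gen - 1) = t" by (simp add: ev.diff ev_gen ev.one t_def)

lemma t_mem: "t \<in> R" using ev_T by (metis rangeI)

lemma t_neq_0: "t \<noteq> 0" using omega_neq_1 by (simp add: t_def)

lemma ev_norm_elt: "ev norm_elt = 0"
proof -
  have "\<omega> * ev norm_elt = ev norm_elt" using ev.mult[of gen norm_elt] by (simp add: gen_norm_elt ev_gen)
  hence "(\<omega> - 1) * ev norm_elt = 0" by (simp add: left_diff_distrib)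
  thus ?thesis using omega_neq_1 by simp
qed

lemma aug_norm_elt: "augmentation (norm_elt :: 'p group_ring_Zp) = of_nat CARD('p)"
  by (simp add: augmentation_def lookup_norm_elt)

lemma P_neq_0: "P \<noteq> 0"
  using residue_dvr.unif(2)[OF residue_dvr_Zp[where 'p = 'p]] .

lemma power_sum_mem: "x \<in> R \<Longrightarrow> (\<Sum>i<m. of_nat (n i) * x ^ i) \<in> R"
  by (induction m) (auto simp: R_closed)

lemma binomial_quot_mem: "x \<in> R \<Longrightarrow> binomial_quot m x \<in> R"
  unfolding binomial_quot_def by (rule power_sum_mem)

lemma t_power_p: "t ^ CARD('p) = - (P * (t * binomial_quot CARD('p) t))"
  by (rule power_prime_eq_binomial_quot[OF prime_p]) (simp add: t_def omega_power)

lemma t_power_p_mem: "x \<in> R \<Longrightarrow> \<exists>y\<in>R. t ^ CARD('p) * x = P * y"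
  unfolding t_power_p
  by (intro bexI[of _ "- (t * binomial_quot CARD('p) t * x)"])
    (auto intro!: R_closed binomial_quot_mem t_mem simp: algebra_simps)

text \<open>R is spanned over Z_p by the p powers of omega, to which \<open>nakayama\<close>
  applies; the coefficients of a preimage of s' express P * s' through them.\<close>

lemma nakayama_R:
  assumes N: "0 \<in> N" "\<And>x y. x \<in> N \<Longrightarrow> y \<in> N \<Longrightarrow> x + y \<in> N" "\<And>c x. x \<in> N \<Longrightarrow> padic_int_to_ac c * x \<in> N"
    and gen: "\<And>s. s \<in> R \<Longrightarrow> \<exists>\<nu>\<in>N. \<exists>s'\<in>R. s = \<nu> + P * s'"
  shows "R \<subseteq> N"
proof
  fix s assume "s \<in> R"
  then obtain r where r: "s = ev r" by blast
  have "\<omega> ^ nat (to_int_mod_ring (a :: 'p mod_ring)) \<in> N" for a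
  proof (rule nakayama[where I = UNIV and g = "\<lambda>a :: 'p mod_ring. \<omega> ^ nat (to_int_mod_ring a)", OF _ N])
    fix a :: "'p mod_ring"
    have "\<omega> ^ nat (to_int_mod_ring a) \<in> R" using R_closed(4)[of \<omega>] ev_gen by (metis rangeI)
    then obtain \<nu> r' where "\<nu> \<in> N" "\<omega> ^ nat (to_int_mod_ring a) = \<nu> + P * ev r'" using gen by blast
    thus "\<exists>\<nu>\<in>N. \<exists>c. \<omega> ^ nat (to_int_mod_ring a) =
        \<nu> + P * (\<Sum>j\<in>UNIV. padic_int_to_ac (c j) * \<omega> ^ nat (to_int_mod_ring (j :: 'p mod_ring)))"
      by (intro bexI[of _ \<nu>] exI[of _ "Poly_Mapping.lookup r'"]) (simp_all add: ev.e_eq group_eval_def)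
  qed auto
  hence "(\<Sum>a\<in>A. padic_int_to_ac (Poly_Mapping.lookup r a) * \<omega> ^ nat (to_int_mod_ring a)) \<in> N" for A :: "'p mod_ring set"
    by (induction A rule: infinite_finite_induct) (simp_all add: N)
  thus "s \<in> N" unfolding r by (simp add: ev.e_eq group_eval_def)
qed

text \<open>Otherwise R = pR, and Nakayama with N = {0} gives R = 0.\<close>

lemma P_not_unit: "y \<in> R \<Longrightarrow> P * y \<noteq> 1"
proof
  assume y: "y \<in> R" "P * y = 1"
  have "R \<subseteq> {0}"
  proof (rule nakayama_R)
    fix s assume "s \<in> R"
    hence "s = 0 + P * (y * s)" "y * s \<in> R" using y by (simp_all add: R_closed flip: mult.assoc)
    thus "\<exists>\<nu>\<in>{0}. \<exists>s'\<in>R. s = \<nu> + P * s'" by blast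
  qed auto
  thus False using R_closed(7) by auto
qed

lemma decompose: "\<exists>r'. r = Poly_Mapping.single 0 (augmentation r) + (gen - 1) * r'" for r :: "'p group_ring_Zp"
proof -
  obtain r' where "r - Poly_Mapping.single 0 (augmentation r) = (gen - 1) * r'" using gen_minus_1_dvd[of r] by (auto elim: dvdE)
  thus ?thesis by (intro exI[of _ r']) (simp add: algebra_simps)
qed

lemma ev_decompose: "\<exists>y\<in>R. ev r = padic_int_to_ac (augmentation r) + t * y"
proof -
  obtain r' where "r = Poly_Mapping.single 0 (augmentation r) + (gen - 1) * r'" using decompose by blast
  hence "ev r = ev (Poly_Mapping.single 0 (augmentation r)) + ev (gen - 1) * ev r'" by (metis ev.add ev.mult)
  thus ?thesis by (auto simp: ev.single_0 ev_T)
qed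

text \<open>By \<open>ev_decompose\<close> the augmentation is minus a multiple of t. If it were a
  unit of Z_p, then t would be a unit of R, hence so would t^p, and p would be one too because t^p
  lies in pR.\<close>

lemma res_aug_eq_0: "ev r = 0 \<Longrightarrow> padic_res (augmentation r) = 0"
proof (rule ccontr)
  assume r: "ev r = 0" "padic_res (augmentation r) \<noteq> 0"
  obtain u where u: "augmentation r * u = 1" using padic_res_neq_0_imp_unit r by blast
  obtain y where y: "y \<in> R" "0 = padic_int_to_ac (augmentation r) + t * y" using ev_decompose[of r] r by auto
  have "padic_int_to_ac (augmentation r) = - (t * y)" using y(2) by (simp only: eq_neg_iff_add_eq_0)
  hence "- (t * y) * padic_int_to_ac u = padic_int_to_ac (augmentation r * u)" by (simp only: padic_int_to_ac_hom(3))
  also have "\<dots> = 1" unfolding u by (rule padic_int_to_ac_hom(4))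
  finally have "(t * (- y * padic_int_to_ac u)) ^ CARD('p) = 1" by (simp add: ac_simps)
  hence "t ^ CARD('p) * (- y * padic_int_to_ac u) ^ CARD('p) = 1" by (simp only: power_mult_distrib)
  moreover have "(- y * padic_int_to_ac u) ^ CARD('p) \<in> R" using y by (intro R_closed)
  ultimately show False using t_power_p_mem P_not_unit by metis
qed

text \<open>The augmentation modulo p of a preimage in the group ring; by
  \<open>res_aug_eq_0\<close> the choice of the preimage does not matter.\<close>

definition res :: "'p padic alg_closure \<Rightarrow> 'p mod_ring" where
  "res s = padic_res (augmentation (SOME r. ev r = s))"

lemma res_ev: "res (ev r) = padic_res (augmentation r)"
proof -
  have "ev (SOME r'. ev r' = ev r) = ev r" by (rule someI[of _ r]) simp
  hence "ev ((SOME r'. ev r' = ev r) - r) = 0" by (simp add: ev.diff)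
  hence "padic_res (augmentation ((SOME r'. ev r' = ev r) - r)) = 0" by (rule res_aug_eq_0)
  thus ?thesis by (simp add: res_def aug.diff padic_res_hom)
qed

lemma res_hom:
  "x \<in> R \<Longrightarrow> y \<in> R \<Longrightarrow> res (x - y) = res x - res y"
  "x \<in> R \<Longrightarrow> y \<in> R \<Longrightarrow> res (x + y) = res x + res y"
  "x \<in> R \<Longrightarrow> y \<in> R \<Longrightarrow> res (x * y) = res x * res y"
  "res 1 = 1" "res t = 0" "res (of_nat n) = of_nat n"
proof -
  show "res (x - y) = res x - res y" "res (x + y) = res x + res y" "res (x * y) = res x * res y"
    if "x \<in> R" "y \<in> R" for x y
  proof -
    obtain r s where "x = ev r" "y = ev s" using \<open>x \<in> R\<close> \<open>y \<in> R\<close> by blast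
    thus "res (x - y) = res x - res y" "res (x + y) = res x + res y" "res (x * y) = res x * res y"
      by (simp_all only: ev.diff[symmetric] ev.add[symmetric] ev.mult[symmetric] res_ev aug.diff aug.add aug.mult padic_res_hom)
  qed
  show "res 1 = 1" using res_ev[of 1] by (simp add: ev.one aug.one padic_res_hom)
  show "res t = 0" using res_ev[of "gen - 1"] by (simp add: ev_T aug.diff aug.one aug_gen padic_res_hom)
  show "res (of_nat n) = of_nat n" using res_ev[of "of_nat n"] by (simp add: ev.of_nat aug.of_nat padic_res_of_nat)
qed

text \<open>Cancelling t in t^p = -p t v with v = 1 + t w gives p = t * (-t^(p-2) - p w); for p = 2
  the power is 1.\<close>

lemma P_mem_t: "\<exists>z\<in>R. P = t * z"
proof -
  obtain n where n: "binomial_quot CARD('p) t = 1 + t * (\<Sum>i<CARD('p) - 2. of_nat (n i) * t ^ i)"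
    using binomial_quot_eq[OF prime_p] by blast
  let ?w = "\<Sum>i<CARD('p) - 2. of_nat (n i) * t ^ i"
  obtain m where m: "CARD('p) = Suc (Suc m)" using p_gt_1 by (metis One_nat_def Suc_lessE less_imp_Suc_add)
  have "t * t ^ Suc m = t * - (P * binomial_quot CARD('p) t)" using t_power_p unfolding m by (simp add: ac_simps)
  hence "t ^ Suc m = - (P * binomial_quot CARD('p) t)" by (rule mult_left_cancel[THEN iffD1, OF t_neq_0])
  hence "P = t * (- (t ^ m) - P * ?w)" unfolding n by (simp add: algebra_simps eq_neg_iff_add_eq_0)
  moreover have "- (t ^ m) - P * ?w \<in> R" by (intro R_closed power_sum_mem t_mem)
  ultimately show ?thesis by blast
qed

lemma res_eq_0_iff: "x \<in> R \<Longrightarrow> res x = 0 \<longleftrightarrow> (\<exists>y\<in>R. x = t * y)"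
proof
  assume "x \<in> R" "res x = 0"
  then obtain r where r: "x = ev r" "padic_res (augmentation r) = 0" by (auto simp: res_ev)
  obtain a where a: "augmentation r = of_nat CARD('p) * a" using padic_res_eq_0_imp_dvd r by blast
  obtain y where y: "y \<in> R" "ev r = padic_int_to_ac (augmentation r) + t * y" using ev_decompose by blast
  obtain z where z: "z \<in> R" "P = t * z" using P_mem_t by blast
  have "padic_int_to_ac (augmentation r) = P * padic_int_to_ac a"
    unfolding a by (simp only: padic_int_to_ac_hom padic_int_to_ac_of_nat)
  hence "x = t * z * padic_int_to_ac a + t * y" unfolding r(1) y(2) z(2)[symmetric] by (simp only:)
  hence "x = t * (z * padic_int_to_ac a + y)" by (simp only: distrib_left mult.assoc)
  moreover have "z * padic_int_to_ac a + y \<in> R" using y(1) z(1) by (intro R_closed)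
  ultimately show "\<exists>y\<in>R. x = t * y" by blast
next
  assume "\<exists>y\<in>R. x = t * y"
  thus "res x = 0" using res_hom(3)[OF t_mem] by (auto simp: res_hom)
qed

text \<open>Modulo t every s is x times a natural number, since the residue of x is invertible.
  Iterating p times gives R = xR + t^p R, and t^p R lies in pR, so Nakayama yields R = xR.\<close>

lemma inverse_mem: "x \<in> R \<Longrightarrow> res x \<noteq> 0 \<Longrightarrow> inverse x \<in> R"
proof -
  assume x: "x \<in> R" "res x \<noteq> 0"
  let ?N = "(\<lambda>y. x * y) ` R"
  have step: "\<exists>\<nu>\<in>?N. \<exists>s'\<in>R. s = \<nu> + t * s'" if s: "s \<in> R" for s
  proof -
    obtain n where n: "res s / res x = of_nat n" using surj_of_nat_mod_ring[of "res s / res x"] by blast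
    have "res (s - x * of_nat n) = res s - res x * of_nat n" using x s R_closed by (simp add: res_hom)
    also have "\<dots> = 0" using n x(2) by (simp flip: n)
    finally have "res (s - x * of_nat n) = 0" .
    moreover have "s - x * of_nat n \<in> R" using x s by (intro R_closed)
    ultimately obtain s' where "s' \<in> R" "s - x * of_nat n = t * s'" using res_eq_0_iff by blast
    thus ?thesis using R_closed(6)[of n] by (intro bexI[of _ "x * of_nat n"] bexI[of _ s']) (auto simp: algebra_simps)
  qed
  have N_add: "u + v \<in> ?N" if "u \<in> ?N" "v \<in> ?N" for u v
  proof -
    obtain a b where "a \<in> R" "b \<in> R" "u = x * a" "v = x * b" using \<open>u \<in> ?N\<close> \<open>v \<in> ?N\<close> by blast
    thus ?thesis using R_closed(1) by (intro image_eqI[of _ _ "a + b"]) (simp_all add: distrib_left)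
  qed
  have N_mult: "c * u \<in> ?N" if "c \<in> R" "u \<in> ?N" for c u
  proof -
    obtain a where "a \<in> R" "u = x * a" using \<open>u \<in> ?N\<close> by blast
    thus ?thesis using R_closed(3) that by (intro image_eqI[of _ _ "c * a"]) (simp_all add: ac_simps)
  qed
  have pow: "\<exists>\<nu>\<in>?N. \<exists>s'\<in>R. s = \<nu> + t ^ k * s'" if "s \<in> R" for s k
  proof (induction k)
    case 0
    have "0 \<in> ?N" by (rule image_eqI[OF _ R_closed(8)]) simp
    thus ?case using that by (intro bexI[of _ 0] bexI[of _ s]) auto
  next
    case (Suc k)
    then obtain \<nu> s' where 1: "\<nu> \<in> ?N" "s' \<in> R" "s = \<nu> + t ^ k * s'" by blast
    obtain \<mu> s'' where 2: "\<mu> \<in> ?N" "s'' \<in> R" "s' = \<mu> + t * s''" using step[OF 1(2)] by blast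
    have "s = (\<nu> + t ^ k * \<mu>) + t ^ Suc k * s''" using 1 2 by (simp add: algebra_simps)
    thus ?case using N_add[OF 1(1) N_mult[OF R_closed(4)[OF t_mem] 2(1)]] 2(2) by blast
  qed
  have "R \<subseteq> ?N"
  proof (rule nakayama_R)
    show "0 \<in> ?N" by (rule image_eqI[OF _ R_closed(8)]) simp
    show "padic_int_to_ac c * u \<in> ?N" if "u \<in> ?N" for c u using N_mult[OF R_closed(5) that] .
    fix s assume "s \<in> R"
    then obtain \<nu> s' where s: "\<nu> \<in> ?N" "s' \<in> R" "s = \<nu> + t ^ CARD('p) * s'" using pow by meson
    obtain y where "y \<in> R" "t ^ CARD('p) * s' = P * y" using t_power_p_mem[OF s(2)] by blast
    thus "\<exists>\<nu>\<in>?N. \<exists>s'\<in>R. s = \<nu> + P * s'" using s by auto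
  qed (rule N_add)
  then obtain y where "y \<in> R" "1 = x * y" using R_closed(7) by blast
  thus "inverse x \<in> R" by (metis inverse_unique)
qed

text \<open>Total ramification: t^(p-1) = -p v, where v has residue 1 and is therefore invertible in
  R.\<close>

lemma P_eq_t_power: "\<exists>z\<in>R. P = t ^ (CARD('p) - 1) * z"
proof -
  obtain n where n: "binomial_quot CARD('p) t = 1 + t * (\<Sum>i<CARD('p) - 2. of_nat (n i) * t ^ i)"
    using binomial_quot_eq[OF prime_p] by blast
  let ?v = "binomial_quot CARD('p) t"
  have w: "(\<Sum>i<CARD('p) - 2. of_nat (n i) * t ^ i) \<in> R" by (intro power_sum_mem t_mem)
  have "res ?v = 1" unfolding n using w t_mem by (simp add: res_hom R_closed)
  hence inv: "inverse ?v \<in> R" and nz: "?v \<noteq> 0"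
    using inverse_mem[of ?v] binomial_quot_mem[OF t_mem] res_hom(6)[of 0] by auto
  obtain m where m: "CARD('p) = Suc m" using p_gt_1 by (cases "CARD('p)") auto
  have "t * t ^ m = t * - (P * ?v)" using t_power_p m by (simp add: ac_simps)
  hence "t ^ m = - (P * ?v)" by (rule mult_left_cancel[THEN iffD1, OF t_neq_0])
  hence "P = t ^ (CARD('p) - 1) * (- inverse ?v)" using nz m by simp
  moreover have "- inverse ?v \<in> R" using inv by (rule R_closed)
  ultimately show ?thesis by blast
qed

lemma ev_scalar: "ev (of_nat n * r) = of_nat n * ev r" "augmentation (of_nat n * r) = of_nat n * augmentation r"
  for r :: "'p group_ring_Zp"
  by (simp_all add: ev.mult ev.of_nat aug.mult aug.of_nat)

lemma single_0_of_nat_mult: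
  "(Poly_Mapping.single 0 (of_nat n * y) :: 'p group_ring_Zp) = of_nat n * Poly_Mapping.single 0 y"
  for y :: "'p padic_int"
proof -
  have e: "of_nat n = (Poly_Mapping.single 0 (of_nat n) :: 'p group_ring_Zp)"
    by (induction n) (simp_all add: single_add)
  show ?thesis by (subst e) (simp only: mult_single add_0_left)
qed

text \<open>With T = gen - 1, factors T are split off modulo p. If r is congruent to T^(j+1) b and
  ev b is divisible by t^(p-j-1) with j + 1 < p, then ev b has residue 0. So b has augmentation
  divisible by p and is again congruent to a multiple of T. After p steps T^p appears, which is
  itself divisible by p.\<close>

lemma kernel_dvd:
  assumes r: "augmentation r = 0" "ev r = 0"
  shows "\<exists>r'. r = of_nat CARD('p) * r'"
proof -
  let ?T = "gen - 1 :: 'p group_ring_Zp"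
  have claim: "\<exists>a b. r = of_nat CARD('p) * a + ?T ^ Suc j * b \<and> (\<exists>s\<in>R. ev b = t ^ (CARD('p) - Suc j) * s)"
    if "Suc j \<le> CARD('p)" for j
    using that
  proof (induction j)
    case 0
    obtain b where b: "r = ?T * b" using decompose[of r] r by auto
    hence "t * ev b = 0" using r(2) by (simp add: ev.mult ev_T)
    hence "ev b = t ^ (CARD('p) - Suc 0) * 0" using t_neq_0 by simp
    thus ?case using b R_closed(8) by (intro exI[of _ 0] exI[of _ b]) auto
  next
    case (Suc j)
    hence "Suc j \<le> CARD('p)" by simp
    from Suc.IH[OF this] obtain a b s where
      ab: "r = of_nat CARD('p) * a + ?T ^ Suc j * b" "s \<in> R" "ev b = t ^ (CARD('p) - Suc j) * s"
      by blast
    obtain k where k: "CARD('p) - Suc j = Suc k" using Suc.prems by (metis Suc_diff_Suc Suc_le_lessD)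
    have kk: "CARD('p) - Suc (Suc j) = k" "CARD('p) - 1 = Suc k + j" using k by simp_all
    have "ev b = t * (t ^ k * s)" using ab(3) k by (simp add: mult.assoc)
    moreover have "t ^ k * s \<in> R" using ab(2) t_mem by (intro R_closed)
    ultimately have "res (ev b) = 0" using res_eq_0_iff[of "ev b"] by blast
    then obtain y where y: "augmentation b = of_nat CARD('p) * y" using padic_res_eq_0_imp_dvd by (auto simp: res_ev)
    obtain b' where b': "b = Poly_Mapping.single 0 (augmentation b) + ?T * b'" using decompose by blast
    hence b'': "b = of_nat CARD('p) * Poly_Mapping.single 0 y + ?T * b'" unfolding y single_0_of_nat_mult .
    have "r = of_nat CARD('p) * (a + ?T ^ Suc j * Poly_Mapping.single 0 y) + ?T ^ Suc (Suc j) * b'"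
      unfolding ab(1) by (subst b'') (simp add: algebra_simps)
    moreover have "\<exists>s\<in>R. ev b' = t ^ k * s"
    proof -
      \<comment> \<open>Here p carries t^(k+1+j), so one factor t can be cancelled and t^k still
        divides the rest.\<close>
      obtain z where z: "z \<in> R" "P = t ^ (CARD('p) - 1) * z" using P_eq_t_power by blast
      have "ev b = P * padic_int_to_ac y + t * ev b'"
        by (subst b'') (simp add: ev.add ev.mult ev_T ev.of_nat ev.single_0)
      hence "t * ev b' = ev b - P * padic_int_to_ac y" by simp
      also have "\<dots> = t * (t ^ k * (s - t ^ j * z * padic_int_to_ac y))"
        unfolding ab(3) k z(2) kk by (simp add: algebra_simps power_add)
      finally have "ev b' = t ^ k * (s - t ^ j * z * padic_int_to_ac y)" by (rule mult_left_cancel[THEN iffD1, OF t_neq_0])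
      moreover have "s - t ^ j * z * padic_int_to_ac y \<in> R" using ab(2) z(1) t_mem by (intro R_closed)
      ultimately show ?thesis by blast
    qed
    ultimately show ?case unfolding kk by blast
  qed
  obtain m where m: "CARD('p) = Suc m" using p_gt_1 by (cases "CARD('p)") auto
  obtain a b where ab: "r = of_nat CARD('p) * a + ?T ^ CARD('p) * b" using claim[of m] m by auto
  have "?T ^ CARD('p) = - (of_nat CARD('p) * (?T * binomial_quot CARD('p) ?T))"
    by (rule power_prime_eq_binomial_quot[OF prime_p]) (simp add: gen_power_card)
  hence "r = of_nat CARD('p) * (a - ?T * binomial_quot CARD('p) ?T * b)"
    unfolding ab by (simp only: mult_minus_left right_diff_distrib mult.assoc add_uminus_conv_diff)
  thus ?thesis ..
qed

lemma lookup_of_nat_mult: "Poly_Mapping.lookup (of_nat n * r) g = of_nat n * Poly_Mapping.lookup r g"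
  for r :: "'p group_ring_Zp"
  by (induction n) (simp_all add: distrib_right lookup_add)

text \<open>Since p is no zero divisor in Z_p and in R, the quotient r/p lies in both kernels again.
  So r is divisible by every power of p.\<close>

lemma joint_kernel:
  assumes "augmentation r = 0" "ev r = 0"
  shows "r = 0"
proof -
  have "\<exists>r'. r = of_nat (CARD('p) ^ k) * r' \<and> augmentation r' = 0 \<and> ev r' = 0" for k
  proof (induction k)
    case 0
    show ?case using assms by simp
  next
    case (Suc k)
    then obtain r' where r': "r = of_nat (CARD('p) ^ k) * r'" "augmentation r' = 0" "ev r' = 0" by blast
    obtain r'' where r'': "r' = of_nat CARD('p) * r''" using kernel_dvd r' by blast
    have "augmentation r'' = 0" "ev r'' = 0"
      using r'(2,3) p_padic_neq_0[where 'p = 'p] P_neq_0 unfolding r'' ev_scalar by simp_all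
    thus ?case using r' r'' by (intro exI[of _ r'']) (simp add: ac_simps)
  qed
  hence "\<exists>y. Poly_Mapping.lookup r g = of_nat CARD('p) ^ k * y" for g k
    by (metis lookup_of_nat_mult of_nat_power)
  hence "Poly_Mapping.lookup r g = 0" for g by (rule padic_int_dvd_all_powers)
  thus ?thesis by (intro poly_mapping_eqI) simp
qed

text \<open>The combination p r - augmentation(r) * norm_elt lies in both kernels because norm_elt
  has augmentation p; hence it is 0, and p times each coefficient of r equals the
  augmentation.\<close>

lemma kernel_ev_constant:
  assumes "ev r = 0"
  shows "Poly_Mapping.lookup r g = Poly_Mapping.lookup r g'"
proof -
  let ?r = "of_nat CARD('p) * r - Poly_Mapping.single 0 (augmentation r) * norm_elt"
  have "?r = 0"
    by (rule joint_kernel)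
      (simp_all add: aug.diff aug.mult aug.of_nat aug.single_0 aug_norm_elt ev.diff ev.mult ev_norm_elt assms)
  moreover have "Poly_Mapping.lookup (Poly_Mapping.single 0 c * norm_elt) g = c" for c :: "'p padic_int" and g :: "'p mod_ring"
    by (simp add: norm_elt_def sum_distrib_left mult_single lookup_sum lookup_single when_def)
  ultimately have "of_nat CARD('p) * Poly_Mapping.lookup r g = augmentation r" for g
    by (metis eq_iff_diff_eq_0 lookup_of_nat_mult)
  hence "of_nat CARD('p) * Poly_Mapping.lookup r g = of_nat CARD('p) * Poly_Mapping.lookup r g'" by simp
  thus ?thesis using p_padic_neq_0[where 'p = 'p] by simp
qed

lemma t_power_mem_P_power:
  "x \<in> R \<Longrightarrow> \<exists>y\<in>R. t ^ (CARD('p) * k) * x = P ^ k * y"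
proof (induction k arbitrary: x)
  case (Suc k)
  obtain y where y: "y \<in> R" "t ^ (CARD('p) * k) * x = P ^ k * y" using Suc by blast
  obtain z where z: "z \<in> R" "t ^ CARD('p) * y = P * z" using t_power_p_mem[OF y(1)] by blast
  have "t ^ (CARD('p) * Suc k) * x = t ^ CARD('p) * (t ^ (CARD('p) * k) * x)"
    by (simp add: power_add ac_simps)
  also have "\<dots> = P ^ k * (t ^ CARD('p) * y)" unfolding y(2) by (simp only: ac_simps)
  also have "\<dots> = P ^ Suc k * z" unfolding z(2) by (simp add: ac_simps)
  finally show ?case using z(1) by blast
qed auto

text \<open>Were x = ev r divisible by all powers of t, it would be divisible by all powers of p. By
  \<open>kernel_ev_constant\<close> the differences of coefficients of r would be divisible by all
  powers of p as well, so r would be a multiple of norm_elt and x = 0. Hence there is a largest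
  power of t dividing x.\<close>

lemma factor: "x \<in> R \<Longrightarrow> x \<noteq> 0 \<Longrightarrow> \<exists>k u. u \<in> R \<and> res u \<noteq> 0 \<and> x = t ^ k * u"
proof -
  assume x: "x \<in> R" "x \<noteq> 0"
  then obtain r where r: "x = ev r" by blast
  have "\<exists>k. \<not> (\<exists>y\<in>R. x = t ^ k * y)"
  proof (rule ccontr)
    assume "\<not> ?thesis"
    hence all: "\<exists>y\<in>R. x = t ^ k * y" for k by blast
    have P: "\<exists>r'. ev r = ev (of_nat (CARD('p) ^ k) * r')" for k
    proof -
      obtain y where "y \<in> R" "x = t ^ (CARD('p) * k) * y" using all by blast
      then obtain z where "z \<in> R" "x = P ^ k * z" using t_power_mem_P_power by metis
      then obtain s where "ev r = P ^ k * ev s" using r by auto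
      thus ?thesis by (intro exI[of _ s]) (subst ev_scalar, simp)
    qed
    have "\<exists>y. Poly_Mapping.lookup r g - Poly_Mapping.lookup r 0 = of_nat CARD('p) ^ k * y" for g k
    proof -
      obtain r' where "ev r = ev (of_nat (CARD('p) ^ k) * r')" using P by blast
      hence "ev (r - of_nat (CARD('p) ^ k) * r') = 0" by (simp add: ev.diff)
      hence "Poly_Mapping.lookup (r - of_nat (CARD('p) ^ k) * r') g = Poly_Mapping.lookup (r - of_nat (CARD('p) ^ k) * r') 0"
        by (rule kernel_ev_constant)
      hence "Poly_Mapping.lookup r g - of_nat (CARD('p) ^ k) * Poly_Mapping.lookup r' g =
          Poly_Mapping.lookup r 0 - of_nat (CARD('p) ^ k) * Poly_Mapping.lookup r' 0"
        by (simp only: lookup_minus lookup_of_nat_mult)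
      hence "Poly_Mapping.lookup r g - Poly_Mapping.lookup r 0 =
          of_nat CARD('p) ^ k * (Poly_Mapping.lookup r' g - Poly_Mapping.lookup r' 0)"
        by (simp add: algebra_simps)
      thus ?thesis ..
    qed
    hence "Poly_Mapping.lookup r g - Poly_Mapping.lookup r 0 = 0" for g by (rule padic_int_dvd_all_powers)
    hence "r = Poly_Mapping.single 0 (Poly_Mapping.lookup r 0) * norm_elt"
      by (intro poly_mapping_eqI)
        (simp add: norm_elt_def sum_distrib_left mult_single lookup_sum lookup_single when_def)
    hence "ev r = ev (Poly_Mapping.single 0 (Poly_Mapping.lookup r 0)) * ev norm_elt" by (metis ev.mult)
    thus False using x r by (simp add: ev_norm_elt)
  qed
  define k where "k = (LEAST k. \<not> (\<exists>y\<in>R. x = t ^ k * y))"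
  have k: "\<not> (\<exists>y\<in>R. x = t ^ k * y)" unfolding k_def by (rule LeastI_ex) fact
  have "k \<noteq> 0" using k x by (metis mult_1 power_0)
  then obtain j where j: "k = Suc j" by (metis not0_implies_Suc)
  have "\<not> \<not> (\<exists>y\<in>R. x = t ^ j * y)" using not_less_Least[of j "\<lambda>k. \<not> (\<exists>y\<in>R. x = t ^ k * y)"] j k_def by simp
  then obtain u where u: "u \<in> R" "x = t ^ j * u" by blast
  have "res u \<noteq> 0"
  proof
    assume "res u = 0"
    then obtain y where "y \<in> R" "u = t * y" using res_eq_0_iff u by blast
    hence "x = t ^ k * y" using u j by (simp add: ac_simps)
    thus False using k \<open>y \<in> R\<close> by blast
  qed
  thus ?thesis using u by blast
qed

lemma residue_dvr_R: "residue_dvr R t res CARD('p)"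
  by (unfold_locales; (rule refl R_closed t_mem t_neq_0 res_hom res_eq_0_iff inverse_mem factor; assumption)?)

text \<open>Start from any preimage of s2. Its augmentation differs from s1 by a multiple of p,
  which a multiple of norm_elt corrects without touching the value at omega.\<close>

lemma fibre_lift:
  assumes "s1 \<in> Zp_ac" "s2 \<in> R" "res_Zp s1 = res s2"
  shows "\<exists>r. padic_int_to_ac (augmentation r) = s1 \<and> ev r = s2"
proof -
  obtain a where a: "s1 = padic_int_to_ac a" using assms by blast
  obtain r where r: "s2 = ev r" using assms by blast
  have "padic_res (a - augmentation r) = 0" using assms(3) by (simp add: a r res_ev padic_res_hom)
  then obtain y where y: "a - augmentation r = of_nat CARD('p) * y" using padic_res_eq_0_imp_dvd by blast
  have "augmentation (r + Poly_Mapping.single 0 y * norm_elt) = a"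
    using y by (simp add: aug.add aug.mult aug.single_0 aug_norm_elt algebra_simps)
  moreover have "ev (r + Poly_Mapping.single 0 y * norm_elt) = s2"
    by (simp add: r ev.add ev.mult ev_norm_elt)
  ultimately show ?thesis using a by blast
qed

lemma Zp_adjoin_eq: "Zp_adjoin \<omega> = R"
proof (intro equalityI subsetI)
  let ?P = "\<lambda>f :: 'p padic_int poly. poly (map_poly padic_int_to_ac f) \<omega>"
  have omega: "\<omega> \<in> R" using ev_gen by (metis rangeI)
  have "?P f \<in> R" for f
  proof (induction f)
    case (pCons a f)
    have "?P (pCons a f) = padic_int_to_ac a + \<omega> * ?P f"
    proof -
      have "map_poly padic_int_to_ac (pCons a f) = pCons (padic_int_to_ac a) (map_poly padic_int_to_ac f)"
        by (rule poly_eqI) (simp add: coeff_map_poly coeff_pCons padic_int_to_ac_hom(5) split: nat.split)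
      thus ?thesis by simp
    qed
    thus ?case using pCons R_closed omega by auto
  qed (simp add: R_closed)
  thus "x \<in> R" if "x \<in> Zp_adjoin \<omega>" for x using that by (auto simp: Zp_adjoin_def)
  have P_add: "?P (f + g) = ?P f + ?P g" for f g
  proof -
    have "map_poly padic_int_to_ac (f + g) = map_poly padic_int_to_ac f + map_poly padic_int_to_ac g"
      by (intro poly_eqI) (simp add: coeff_map_poly padic_int_to_ac_hom(1,5))
    thus ?thesis by simp
  qed
  have "(\<Sum>g\<in>A. padic_int_to_ac (Poly_Mapping.lookup r g) * \<omega> ^ nat (to_int_mod_ring g)) \<in> range ?P"
    for A :: "'p mod_ring set" and r
  proof (induction A rule: infinite_finite_induct)
    case (insert g A)
    then obtain f where f: "(\<Sum>g\<in>A. padic_int_to_ac (Poly_Mapping.lookup r g) * \<omega> ^ nat (to_int_mod_ring g)) = ?P f"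
      by blast
    have "?P (monom (Poly_Mapping.lookup r g) (nat (to_int_mod_ring g))) =
        padic_int_to_ac (Poly_Mapping.lookup r g) * \<omega> ^ nat (to_int_mod_ring g)"
      by (subst map_poly_monom) (simp_all add: padic_int_to_ac_hom(5) poly_monom)
    hence "(\<Sum>g\<in>insert g A. padic_int_to_ac (Poly_Mapping.lookup r g) * \<omega> ^ nat (to_int_mod_ring g)) =
        ?P (monom (Poly_Mapping.lookup r g) (nat (to_int_mod_ring g)) + f)"
      unfolding P_add using insert.hyps f by simp
    thus ?case by blast
  qed (auto intro!: image_eqI[of _ _ 0])
  thus "x \<in> Zp_adjoin \<omega>" if "x \<in> R" for x
    using that by (auto simp: Zp_adjoin_def ev.e_eq group_eval_def)
qed

end

section \<open>Transfer of zeta functions and tensor products\<close>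

context finite_field_space
begin

lemma span_insert_eq_adjoin: "span (insert b B) = adjoin (span B) b"
proof (intro equalityI)
  show "span (insert b B) \<subseteq> adjoin (span B) b"
    by (rule span_minimal) (auto simp: subspace_adjoin mem_adjoin intro!: subsetD[OF subset_adjoin] span_base)
  show "adjoin (span B) b \<subseteq> span (insert b B)"
    by (rule adjoin_minimal) (auto intro: span_base subsetD[OF span_mono[of B "insert b B"]])
qed

lemma card_span_independent:
  assumes "finite B" "independent B"
  shows "card (span B) = q ^ card B \<and> finite (span B)"
  using assms
proof (induction B rule: finite_induct)
  case (insert b B)
  have "independent B" "b \<notin> span B"
    using insert.prems insert.hyps independent_insert by auto
  thus ?case using insert card_adjoin[of "span B" b] by (simp add: span_insert_eq_adjoin)
qed simp

lemma dim_eq_iff_card: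
  assumes "subspace W" "finite W"
  shows "dim W = k \<longleftrightarrow> card W = q ^ k"
proof -
  obtain B where B: "B \<subseteq> W" "independent B" "W \<subseteq> span B" "card B = dim W"
    using basis_exists by blast
  have "span B = W" using B assms(1) span_minimal by blast
  hence "card W = q ^ dim W"
    using card_span_independent[of B] B finite_subset[OF B(1) assms(2)] by simp
  thus ?thesis using q_gt_1 by simp
qed

end

lemma gauss_binomial_eq: "gauss_binomial TYPE('p :: prime_card) n k = q_binomial CARD('p) n k"
proof -
  have "{W :: (nat \<Rightarrow>\<^sub>0 'p mod_ring) set. W \<subseteq> coord_vecs n UNIV \<and> coord.subspace W \<and> coord.dim W = k} =
      coord.subspaces_of_card (coord_vecs n UNIV) (CARD('p) ^ k)"
    using coord.dim_eq_iff_card finite_subset[OF _ finite_coord_vecs]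
    by (auto simp: coord.subspaces_of_card_def)
  thus ?thesis
    using coord.card_subspaces[OF subspace_coord_vecs finite_coord_vecs card_coord_vecs, of n k]
    by (simp add: gauss_binomial_def)
qed

text \<open>If y were not in S, its inverse would be pi z with z in S. Then d = (d y^n) (pi z)^n
  would be divisible by pi^n for every n, in particular for n = a + 1, where pi^a is the exact power
  of pi in d.\<close>

lemma (in residue_dvr) bounded_powers_imp_mem:
  assumes d: "d \<in> S" "d \<noteq> 0" and y: "\<And>n. d * y ^ n \<in> S"
  shows "y \<in> S"
proof (cases "y = 0")
  case False
  obtain a u where a: "u \<in> S" "\<rho> u \<noteq> 0" "d = \<pi> ^ a * u" using factor d by blast
  obtain b v where b: "v \<in> S" "\<rho> v \<noteq> 0" "d * y = \<pi> ^ b * v" using factor[of "d * y"] y[of 1] d False by auto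
  have nz: "u \<noteq> 0" "v \<noteq> 0" "\<pi> \<noteq> 0" using a b res_zero unif by auto
  have y_eq: "\<pi> ^ a * y = \<pi> ^ b * v * inverse u" using a(3) b(3) nz by (simp add: field_simps)
  show ?thesis
  proof (cases "a \<le> b")
    case True
    hence "\<pi> ^ b = \<pi> ^ a * \<pi> ^ (b - a)" by (simp flip: power_add)
    hence "\<pi> ^ a * y = \<pi> ^ a * (\<pi> ^ (b - a) * v * inverse u)" using y_eq by (simp only: mult.assoc)
    hence "y = \<pi> ^ (b - a) * v * inverse u" using nz by simp
    thus ?thesis using mult pow unif b(1) inv[OF a(1,2)] by simp
  next
    case False
    then obtain e where e: "a = b + Suc e" by (metis add_Suc_right less_imp_Suc_add not_le)
    define z where "z = \<pi> ^ e * u * inverse v"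
    have z: "z \<in> S" using mult pow unif a(1) inv[OF b(1,2)] by (simp add: z_def)
    have "\<pi> ^ b * (\<pi> * \<pi> ^ e * y) = \<pi> ^ b * (v * inverse u)" using y_eq unfolding e by (simp add: power_add ac_simps)
    hence "\<pi> * \<pi> ^ e * y = v * inverse u" using nz by simp
    hence yz: "y * (\<pi> * z) = 1" using nz by (simp add: z_def field_simps)
    have "d = d * y ^ Suc a * (\<pi> * z) ^ Suc a"
      using yz by (simp only: mult.assoc power_mult_distrib[symmetric] power_one mult_1_right)
    also have "\<dots> = \<pi> ^ a * (\<pi> * (d * y ^ Suc a * z ^ Suc a))" by (simp add: power_mult_distrib ac_simps)
    finally have "u = \<pi> * (d * y ^ Suc a * z ^ Suc a)" using a(3) nz by simp
    moreover have "d * y ^ Suc a * z ^ Suc a \<in> S" using y z mult pow by blast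
    ultimately show ?thesis using res_eq_0 a(1,2) by blast
  qed
qed (simp add: zero)

text \<open>Only the operators that the scalars induce on N and N' have to match, in both
  directions. The scalar rings may differ, and no ring isomorphism has to be constructed.\<close>

lemma solomon_zeta_transfer:
  assumes p: "p > 0" and N: "subgroup_set N" and bij: "bij_betw f N N'"
    and f_diff: "\<And>x y. x \<in> N \<Longrightarrow> y \<in> N \<Longrightarrow> f (x - y) = f x - f y"
    and closed: "\<And>r x. r \<in> \<Gamma> \<Longrightarrow> x \<in> N \<Longrightarrow> scale r x \<in> N"
    and r1: "\<And>r. r \<in> \<Gamma> \<Longrightarrow> \<exists>r'\<in>\<Gamma>'. \<forall>x\<in>N. f (scale r x) = scale' r' (f x)"
    and r2: "\<And>r'. r' \<in> \<Gamma>' \<Longrightarrow> \<exists>r\<in>\<Gamma>. \<forall>x\<in>N. f (scale r x) = scale' r' (f x)"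
  shows "solomon_zeta p \<Gamma> scale N = solomon_zeta p \<Gamma>' scale' N'"
proof -
  have inj: "inj_on f N" and im: "f ` N = N'" using bij by (auto simp: bij_betw_def)
  have f0: "f 0 = 0" using f_diff[of 0 0] subgroup_setD(1)[OF N] by simp
  have sub: "is_submodule_over \<Gamma>' scale' (f ` Y) \<longleftrightarrow> is_submodule_over \<Gamma> scale Y" if Y: "Y \<subseteq> N" for Y
  proof
    assume L: "is_submodule_over \<Gamma> scale Y"
    show "is_submodule_over \<Gamma>' scale' (f ` Y)"
      unfolding is_submodule_over_def
    proof (intro conjI ballI)
      show "0 \<in> f ` Y" using f0 subgroup_setD(1)[OF is_submodule_overD(1)[OF L]] by (metis imageI)
      show "u - v \<in> f ` Y" if uv: "u \<in> f ` Y" "v \<in> f ` Y" for u v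
      proof -
        obtain x y where xy: "x \<in> Y" "y \<in> Y" "u = f x" "v = f y" using uv by blast
        hence "u - v = f (x - y)" using f_diff[of x y] Y by fastforce
        thus ?thesis using subgroup_setD(2)[OF is_submodule_overD(1)[OF L]] xy by blast
      qed
      show "scale' r' u \<in> f ` Y" if r: "r' \<in> \<Gamma>'" "u \<in> f ` Y" for r' u
      proof -
        obtain x where x: "x \<in> Y" "u = f x" using r by blast
        obtain r0 where "r0 \<in> \<Gamma>" "\<forall>x\<in>N. f (scale r0 x) = scale' r' (f x)" using r2 r by blast
        hence "scale' r' u = f (scale r0 x)" "scale r0 x \<in> Y"
          using x Y is_submodule_overD(2)[OF L] by auto
        thus ?thesis by blast
      qed
    qed
  next
    assume L: "is_submodule_over \<Gamma>' scale' (f ` Y)"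
    have mem: "x \<in> Y" if "x \<in> N" "f x \<in> f ` Y" for x
      using that inj_on_image_mem_iff[OF inj _ Y] by blast
    show "is_submodule_over \<Gamma> scale Y"
      unfolding is_submodule_over_def
    proof (intro conjI ballI)
      show "0 \<in> Y" using mem[of 0] f0 subgroup_setD(1)[OF is_submodule_overD(1)[OF L]] subgroup_setD(1)[OF N] by simp
      show "x - y \<in> Y" if xy: "x \<in> Y" "y \<in> Y" for x y
      proof (rule mem)
        show "x - y \<in> N" using xy Y subgroup_setD(2)[OF N] by blast
        have "f (x - y) = f x - f y" using xy Y f_diff by blast
        thus "f (x - y) \<in> f ` Y" using xy subgroup_setD(2)[OF is_submodule_overD(1)[OF L]] by simp
      qed
      show "scale r x \<in> Y" if r: "r \<in> \<Gamma>" "x \<in> Y" for r x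
      proof (rule mem)
        show "scale r x \<in> N" using r Y closed by blast
        obtain r' where "r' \<in> \<Gamma>'" "f (scale r x) = scale' r' (f x)" using r1[OF r(1)] r(2) Y by blast
        thus "f (scale r x) \<in> f ` Y" using is_submodule_overD(2)[OF L] r(2) by simp
      qed
    qed
  qed
  let ?A = "\<lambda>n. {Y. Y \<subseteq> N \<and> is_submodule_over \<Gamma> scale Y \<and> subgroup_index N Y = p ^ n}"
  let ?A' = "\<lambda>n. {Y. Y \<subseteq> N' \<and> is_submodule_over \<Gamma>' scale' Y \<and> subgroup_index N' Y = p ^ n}"
  have "bij_betw (image f) (?A n) (?A' n)" for n
    unfolding bij_betw_def
  proof (intro conjI equalityI subsetI)
    show "inj_on (image f) (?A n)" by (rule inj_on_subset[OF inj_on_image_Pow[OF inj]]) auto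
    have idx: "subgroup_index N' (f ` Y) = subgroup_index N Y" if "Y \<subseteq> N" "is_submodule_over \<Gamma> scale Y" for Y
      using subgroup_index_image[OF N is_submodule_overD(1)[OF that(2)] that(1) inj f_diff] im by simp
    show "Z \<in> ?A' n" if "Z \<in> image f ` ?A n" for Z using that sub idx im by auto
    show "Z \<in> image f ` ?A n" if Z: "Z \<in> ?A' n" for Z
    proof -
      let ?Y = "{x \<in> N. f x \<in> Z}"
      have e: "f ` ?Y = Z" using Z im by blast
      have "?Y \<subseteq> N" by blast
      moreover have "is_submodule_over \<Gamma> scale ?Y" using sub[of ?Y] e Z by simp
      ultimately have "?Y \<in> ?A n" using idx[of ?Y] e Z by simp
      thus ?thesis using e by blast
    qed
  qed
  hence "card (?A n) = card (?A' n)" for n by (rule bij_betw_same_card)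
  thus ?thesis by (simp add: solomon_zeta_eq_gen_fun[OF p] gen_fun_def)
qed

text \<open>The idempotents (1, 0) and (0, 1) split every submodule into the product of its
  projections, and the indices multiply.\<close>

lemma (in fibre_lattice) solomon_zeta_Times:
  "solomon_zeta p (S1 \<times> S2) scale_prod (L1 \<times> L2) =
     (\<Prod>h<m. inverse (1 - p_pow_minus_s p h)) * (\<Prod>h<n. inverse (1 - p_pow_minus_s p h))"
proof -
  have p1: "1 < p" by (rule Q1.p_gt_1)
  let ?A = "\<lambda>i. {Y. Y \<subseteq> L1 \<times> L2 \<and> is_submodule_over (S1 \<times> S2) scale_prod Y \<and> subgroup_index (L1 \<times> L2) Y = p ^ i}"
  let ?B = "\<lambda>i. \<Union>j\<le>i. Q1.submods m j \<times> Q2.submods n (i - j)"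
  have sub: "is_submodule_over (S1 \<times> S2) scale_prod (M1 \<times> M2)" if "Q1.submod M1" "Q2.submod M2" for M1 M2
    using that by (auto simp: is_submodule_over_def scale_prod_def zero_prod_def)
  have idx: "subgroup_index (L1 \<times> L2) (M1 \<times> M2) = subgroup_index L1 M1 * subgroup_index L2 M2"
    if "Q1.submod M1" "Q2.submod M2" for M1 M2
    using that by (intro subgroup_index_Times) (auto intro: is_submodule_overD)
  have "bij_betw (\<lambda>(M1, M2). M1 \<times> M2) (?B i) (?A i)" for i
    unfolding bij_betw_def
  proof (intro conjI equalityI subsetI)
    have nonempty: "M1 \<noteq> {}" "M2 \<noteq> {}" if "(M1, M2) \<in> ?B i" for M1 M2
      using that by (auto simp: Q1.submods_def Q2.submods_def is_submodule_over_def)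
    show "inj_on (\<lambda>(M1, M2). M1 \<times> M2) (?B i)"
    proof (rule inj_onI)
      fix a b assume ab: "a \<in> ?B i" "b \<in> ?B i" "(case a of (M1, M2) \<Rightarrow> M1 \<times> M2) = (case b of (M1, M2) \<Rightarrow> M1 \<times> M2)"
      obtain M1 M2 N1 N2 where e: "a = (M1, M2)" "b = (N1, N2)" by (cases a, cases b)
      have "M1 \<noteq> {}" "M2 \<noteq> {}" using nonempty ab(1) unfolding e by blast+
      thus "a = b" using ab(3) unfolding e by (simp add: times_eq_iff)
    qed
    show "Y \<in> ?A i" if Y: "Y \<in> (\<lambda>(M1, M2). M1 \<times> M2) ` ?B i" for Y
    proof -
      obtain j M1 M2 where M: "j \<le> i" "M1 \<in> Q1.submods m j" "M2 \<in> Q2.submods n (i - j)" "Y = M1 \<times> M2"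
        using Y by auto
      hence s: "Q1.submod M1" "Q2.submod M2" by (simp_all add: Q1.submods_def Q2.submods_def)
      have "subgroup_index (L1 \<times> L2) Y = p ^ i"
        unfolding M(4) idx[OF s] using M by (simp add: Q1.submods_def Q2.submods_def flip: power_add)
      thus ?thesis using sub[OF s] M by (auto simp: Q1.submods_def Q2.submods_def)
    qed
    show "Y \<in> (\<lambda>(M1, M2). M1 \<times> M2) ` ?B i" if Y: "Y \<in> ?A i" for Y
    proof -
      have Y': "Y \<subseteq> L1 \<times> L2" "is_submodule_over (S1 \<times> S2) scale_prod Y" "subgroup_index (L1 \<times> L2) Y = p ^ i"
        using Y by auto
      note sY = subgroup_setD[OF is_submodule_overD(1)[OF Y'(2)]] is_submodule_overD(2)[OF Y'(2)]
      let ?M1 = "fst ` Y" and ?M2 = "snd ` Y"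
      have part: "(x, 0) \<in> Y" "(0, y) \<in> Y" if "(x, y) \<in> Y" for x y
        using sY(5)[of "(1, 0)", OF _ that] sY(5)[of "(0, 1)", OF _ that] Q1.one Q2.one Q1.zero Q2.zero
        by (simp_all add: scale_prod_def coord_scale_simps)
      have eq: "Y = ?M1 \<times> ?M2"
      proof (intro equalityI subsetI)
        fix u assume "u \<in> ?M1 \<times> ?M2"
        then obtain x y x' y' where "u = (x, y')" "(x, y) \<in> Y" "(x', y') \<in> Y" by force
        thus "u \<in> Y" using sY(4)[OF part(1) part(2), of x y x' y'] by simp
      qed force
      have s1: "Q1.submod ?M1"
        unfolding is_submodule_over_def
      proof (intro conjI ballI)
        show "0 \<in> ?M1" using sY(1) by (force simp: zero_prod_def)
        show "x - y \<in> ?M1" if "x \<in> ?M1" "y \<in> ?M1" for x y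
          using that sY(2) by (force intro: rev_image_eqI)
        show "coord_scale s x \<in> ?M1" if s: "s \<in> S1" "x \<in> ?M1" for s x
        proof -
          obtain u where "u \<in> Y" "x = fst u" using s by blast
          thus ?thesis using sY(5)[of "(s, 0)" u] s(1) Q2.zero by (auto simp: scale_prod_def intro: rev_image_eqI)
        qed
      qed
      have s2: "Q2.submod ?M2"
        unfolding is_submodule_over_def
      proof (intro conjI ballI)
        show "0 \<in> ?M2" using sY(1) by (force simp: zero_prod_def)
        show "x - y \<in> ?M2" if "x \<in> ?M2" "y \<in> ?M2" for x y
          using that sY(2) by (force intro: rev_image_eqI)
        show "coord_scale s x \<in> ?M2" if s: "s \<in> S2" "x \<in> ?M2" for s x
        proof -
          obtain u where "u \<in> Y" "x = snd u" using s by blast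
          thus ?thesis using sY(5)[of "(0, s)" u] s(1) Q1.zero by (auto simp: scale_prod_def intro: rev_image_eqI)
        qed
      qed
      have xy: "subgroup_index L1 ?M1 * subgroup_index L2 ?M2 = p ^ i" using idx[OF s1 s2] eq Y'(3) by simp
      have "prime p" unfolding Q1.p_eq by (rule prime_card)
      moreover have "subgroup_index L1 ?M1 dvd p ^ i" using xy by (metis dvd_triv_left)
      ultimately obtain j where j: "j \<le> i" "subgroup_index L1 ?M1 = p ^ j" using divides_primepow_nat by blast
      have "subgroup_index L2 ?M2 = p ^ (i - j)"
        using prime_power_mult_eqD(2)[OF p1, of j _ i] xy unfolding j(2) by blast
      hence "(?M1, ?M2) \<in> ?B i" using j s1 s2 Y'(1) by (force simp: Q1.submods_def Q2.submods_def)
            thus ?thesis using eq by blast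
    qed
  qed
  hence "card (?B i) = card (?A i)" for i by (rule bij_betw_same_card)
  hence "solomon_zeta p (S1 \<times> S2) scale_prod (L1 \<times> L2) = gen_fun ?B"
    using p1 by (simp add: solomon_zeta_eq_gen_fun gen_fun_def)
  also have "\<dots> = gen_fun (Q1.submods m) * gen_fun (Q2.submods n)"
    by (rule gen_fun_pairs) (use Q1.finite_submods Q2.finite_submods Q1.submods_disjoint in auto)
  finally show ?thesis by (simp add: Q1.gen_fun_submods Q2.gen_fun_submods)
qed

definition vec_of :: "nat \<Rightarrow> (nat \<Rightarrow> 'r) \<Rightarrow> (nat \<Rightarrow>\<^sub>0 'r :: comm_monoid_add)" where
  "vec_of n f = (\<Sum>i<n. Poly_Mapping.single i (f i))"

lemma lookup_vec_of: "Poly_Mapping.lookup (vec_of n f) i = (if i < n then f i else 0)"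
  by (simp add: vec_of_def lookup_sum lookup_single when_def)

lemma (in residue_dvr) lattice_quotient_residue:
  "lattice_quotient S \<pi> \<rho> p (a + c) (\<lambda>u. vec_of c (\<lambda>i. \<rho> (Poly_Mapping.lookup u (a + i)))) c"
proof unfold_locales
  let ?\<phi> = "\<lambda>u. vec_of c (\<lambda>i. \<rho> (Poly_Mapping.lookup u (a + i)))"
  show "?\<phi> (u - v) = ?\<phi> u - ?\<phi> v" if "u \<in> lattice (a + c)" "v \<in> lattice (a + c)" for u v
    using that by (intro poly_mapping_eqI) (simp add: lookup_vec_of lookup_minus res_diff lookup_mem_S)
  show "?\<phi> (coord_scale s v) = coord_scale (\<rho> s) (?\<phi> v)" if "s \<in> S" "v \<in> lattice (a + c)" for s v
    using that by (intro poly_mapping_eqI) (simp add: lookup_vec_of res_mult lookup_mem_S)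
  show "?\<phi> ` lattice (a + c) = coord_vecs c UNIV"
  proof (intro equalityI subsetI)
    fix w :: "nat \<Rightarrow>\<^sub>0 'p mod_ring" assume w: "w \<in> coord_vecs c UNIV"
    have "\<exists>n. \<rho> (of_nat n) = Poly_Mapping.lookup w i" for i by (rule res_surj)
    then obtain k where k: "\<And>i. \<rho> (of_nat (k i)) = Poly_Mapping.lookup w i" by metis
    let ?u = "vec_of (a + c) (\<lambda>i. of_nat (k (i - a)))"
    have "?u \<in> lattice (a + c)" by (auto simp: coord_vecs_iff lookup_vec_of nat_mem)
    moreover have "?\<phi> ?u = w"
      using w by (intro poly_mapping_eqI) (auto simp: lookup_vec_of k coord_vecs_iff)
    ultimately show "w \<in> ?\<phi> ` lattice (a + c)" by blast
  qed (auto simp: coord_vecs_iff lookup_vec_of)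
qed

section \<open>Linear extension from free modules, and tensor products\<close>

lemma sum_keys_superset:
  assumes "finite A" "Poly_Mapping.keys f \<subseteq> A" "\<And>k. g 0 k = 0"
  shows "(\<Sum>k\<in>Poly_Mapping.keys f. g (Poly_Mapping.lookup f k) k) = (\<Sum>k\<in>A. g (Poly_Mapping.lookup f k) k)"
  by (rule sum.mono_neutral_left) (use assms in \<open>auto simp: in_keys_iff\<close>)

definition free_ext :: "('r :: comm_ring_1 \<Rightarrow> 't \<Rightarrow> 't) \<Rightarrow> ('k \<Rightarrow> 't) \<Rightarrow> ('k \<Rightarrow>\<^sub>0 'r) \<Rightarrow> 't :: ab_group_add" where
  "free_ext sc b f = (\<Sum>k\<in>Poly_Mapping.keys f. sc (Poly_Mapping.lookup f k) (b k))"

lemma free_ext: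
  assumes "Modules.module sc"
  shows "free_ext sc b (f + g) = free_ext sc b f + free_ext sc b g"
    "free_ext sc b (f - g) = free_ext sc b f - free_ext sc b g"
    "free_ext sc b (coord_scale r f) = sc r (free_ext sc b f)"
    "free_ext sc b (Poly_Mapping.single k 1) = b k"
    "free_ext sc b 0 = 0"
proof -
  interpret Modules.module sc by fact
  have A: "free_ext sc b f = (\<Sum>k\<in>A. sc (Poly_Mapping.lookup f k) (b k))"
    if "finite A" "Poly_Mapping.keys f \<subseteq> A" for A f
    unfolding free_ext_def by (rule sum_keys_superset) (use that in auto)
  show add: "free_ext sc b (f + g) = free_ext sc b f + free_ext sc b g" for f g
  proof -
    let ?A = "Poly_Mapping.keys f \<union> Poly_Mapping.keys g"
    have "Poly_Mapping.keys (f + g) \<subseteq> ?A" by (rule keys_add)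
    thus ?thesis by (simp add: A[of ?A] lookup_add scale_left_distrib sum.distrib)
  qed
  show "free_ext sc b (f - g) = free_ext sc b f - free_ext sc b g"
    using add[of "f - g" g] by simp
  show "free_ext sc b (coord_scale r f) = sc r (free_ext sc b f)"
  proof -
    have "Poly_Mapping.keys (coord_scale r f) \<subseteq> Poly_Mapping.keys f"
      by (auto simp: in_keys_iff)
    thus ?thesis by (simp add: A[of "Poly_Mapping.keys f"] scale_sum_right)
  qed
  show "free_ext sc b (Poly_Mapping.single k 1) = b k" by (simp add: free_ext_def)
  show "free_ext sc b 0 = 0" by (simp add: free_ext_def)
qed

lemma tensor_product_bilinear:
  assumes T: "is_tensor_product scaleM scaleN scaleT \<tau>" and modT: "Modules.module scaleT"
  shows "\<tau> x (y + y') = \<tau> x y + \<tau> x y'" "\<tau> (scaleM r x) y = scaleT r (\<tau> x y)" "\<tau> x (scaleN r y) = scaleT r (\<tau> x y)"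
proof -
  let ?b = "\<lambda>(x, y). \<tau> x y" and ?e = "\<lambda>x y. Poly_Mapping.single (x, y) 1"
  interpret C: Modules.module "coord_scale :: _ \<Rightarrow> (_ \<Rightarrow>\<^sub>0 _) \<Rightarrow> _" by (rule module_coord_scale)
  have "(\<lambda>f. \<Sum>(x, y)\<in>Poly_Mapping.keys f. scaleT (Poly_Mapping.lookup f (x, y)) (\<tau> x y)) = free_ext scaleT ?b"
    by (auto simp: free_ext_def fun_eq_iff intro!: sum.cong)
  hence ker: "{f. free_ext scaleT ?b f = 0} = C.span (tensor_relations scaleM scaleN)"
    using T by (simp add: is_tensor_product_def Let_def)
  hence rel: "free_ext scaleT ?b f = 0" if "f \<in> tensor_relations scaleM scaleN" for f
    using that C.span_base by blast
  note fe = free_ext[OF modT]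
  have "?e x (y + y') - ?e x y - ?e x y' \<in> tensor_relations scaleM scaleN"
    unfolding tensor_relations_def Let_def by blast
  from rel[OF this] show "\<tau> x (y + y') = \<tau> x y + \<tau> x y'" by (simp add: fe algebra_simps)
  have "?e (scaleM r x) y - coord_scale r (?e x y) \<in> tensor_relations scaleM scaleN"
    unfolding tensor_relations_def Let_def by blast
  from rel[OF this] show "\<tau> (scaleM r x) y = scaleT r (\<tau> x y)" by (simp add: fe)
  have "?e x (scaleN r y) - coord_scale r (?e x y) \<in> tensor_relations scaleM scaleN"
    unfolding tensor_relations_def Let_def by blast
  from rel[OF this] show "\<tau> x (scaleN r y) = scaleT r (\<tau> x y)" by (simp add: fe)
qed

text \<open>The kernel of the extension of tau is spanned by the relations, and the extension of a
  bilinear beta kills these. A bilinear map can thus certify that a pure tensor is non-zero.\<close>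

lemma tensor_product_universal:
  assumes T: "is_tensor_product scaleM scaleN scaleT \<tau>" and modT: "Modules.module scaleT"
    and modU: "Modules.module scaleU"
    and \<beta>: "\<And>x x' y. \<beta> (x + x') y = \<beta> x y + \<beta> x' y" "\<And>x y y'. \<beta> x (y + y') = \<beta> x y + \<beta> x y'"
      "\<And>r x y. \<beta> (scaleM r x) y = scaleU r (\<beta> x y)" "\<And>r x y. \<beta> x (scaleN r y) = scaleU r (\<beta> x y)"
    and "\<tau> x y = 0"
  shows "\<beta> x y = 0"
proof -
  let ?b = "\<lambda>(x, y). \<tau> x y" and ?c = "\<lambda>(x, y). \<beta> x y" and ?e = "\<lambda>x y. Poly_Mapping.single (x, y) 1"
  interpret C: Modules.module "coord_scale :: _ \<Rightarrow> (_ \<Rightarrow>\<^sub>0 _) \<Rightarrow> _" by (rule module_coord_scale)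
  interpret U: Modules.module scaleU by (rule modU)
  have "(\<lambda>f. \<Sum>(x, y)\<in>Poly_Mapping.keys f. scaleT (Poly_Mapping.lookup f (x, y)) (\<tau> x y)) = free_ext scaleT ?b"
    by (auto simp: free_ext_def fun_eq_iff intro!: sum.cong)
  hence ker: "{f. free_ext scaleT ?b f = 0} = C.span (tensor_relations scaleM scaleN)"
    using T by (simp add: is_tensor_product_def Let_def)
  note fe = free_ext[OF modU, of ?c]
  have sub: "C.subspace {f. free_ext scaleU ?c f = 0}"
    by (rule C.subspaceI) (simp_all add: fe)
  have "tensor_relations scaleM scaleN \<subseteq> {f. free_ext scaleU ?c f = 0}"
    unfolding tensor_relations_def Let_def by (auto simp: fe \<beta>)
  hence "C.span (tensor_relations scaleM scaleN) \<subseteq> {f. free_ext scaleU ?c f = 0}"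
    using C.span_minimal sub by blast
  moreover have "?e x y \<in> {f. free_ext scaleT ?b f = 0}" using assms(8) by (simp add: free_ext[OF modT])
  ultimately have "?e x y \<in> {f. free_ext scaleU ?c f = 0}" unfolding ker by blast
  thus ?thesis by (simp add: fe)
qed

section \<open>The maximal order\<close>

lemma module_mult_hom:
  fixes h :: "'r :: comm_ring_1 \<Rightarrow> 'k :: comm_ring_1"
  assumes "\<And>x y. h (x + y) = h x + h y" "\<And>x y. h (x * y) = h x * h y" "h 1 = 1"
  shows "Modules.module (\<lambda>r. (*) (h r))"
  by unfold_locales (simp_all add: assms algebra_simps)

lemma padic_of_int_hom:
  fixes x y :: "'p :: prime_card padic_int"
  shows "padic_of_int (x + y) = padic_of_int x + padic_of_int y" "padic_of_int (x * y) = padic_of_int x * padic_of_int y"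
    "padic_of_int (1 :: 'p padic_int) = 1" "padic_of_int (0 :: 'p padic_int) = 0"
  by (simp_all add: One_fract_def Zero_fract_def)

lemma padic_of_int_of_nat: "padic_of_int (of_nat n :: 'p :: prime_card padic_int) = of_nat n"
  by (induction n) (simp_all only: padic_of_int_hom of_nat_0 of_nat_Suc)

lemma padic_of_int_card_power: "padic_of_int (of_nat n ^ k :: 'p :: prime_card padic_int) = of_nat n ^ k"
  by (simp only: of_nat_power[symmetric] padic_of_int_of_nat)

lemma of_nat_card_padic_neq_0: "of_nat CARD('p) \<noteq> (0 :: 'p :: prime_card padic)"
  using p_padic_neq_0[where 'p = 'p] unfolding padic_of_int_of_nat[symmetric] padic_of_int_hom(4)[symmetric]
  by simp

text \<open>A denominator is a power of p times a unit, and the unit can be moved to the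
  numerator.\<close>

lemma padic_denominator:
  fixes q :: "'p :: prime_card padic"
  shows "\<exists>k a. of_nat CARD('p) ^ k * q = padic_of_int a"
proof (cases q)
  case (Fract a b)
  then obtain k u where u: "padic_res u \<noteq> 0" "b = of_nat CARD('p) ^ k * u" using padic_int_factor by blast
  obtain v where v: "u * v = 1" using padic_res_neq_0_imp_unit[OF u(1)] by blast
  have "of_nat CARD('p) ^ k * q = padic_of_int (of_nat CARD('p) ^ k) * Fract a b"
    by (simp only: padic_of_int_card_power Fract)
  also have "\<dots> = padic_of_int (a * v)"
  proof -
    have "of_nat CARD('p) ^ k * a = of_nat CARD('p) ^ k * a * (u * v)" using v by simp
    also have "\<dots> = a * v * b" by (simp add: u(2) ac_simps)
    finally show ?thesis using Fract(2) by (simp add: eq_fract)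
  qed
  finally show ?thesis by blast
qed

lemma group_ring_single_0_mult: "Poly_Mapping.lookup (Poly_Mapping.single 0 c * x) g = c * Poly_Mapping.lookup x g"
  for x :: "'g :: {finite, comm_monoid_add} \<Rightarrow>\<^sub>0 'r :: comm_semiring_1"
proof -
  have "Poly_Mapping.single 0 c * x = (\<Sum>h\<in>UNIV. Poly_Mapping.single h (c * Poly_Mapping.lookup x h))"
    by (subst poly_mapping_decompose[of x]) (simp add: sum_distrib_left mult_single)
  thus ?thesis by (simp add: lookup_sum lookup_single when_def)
qed

definition incl :: "'p :: prime_card group_ring_Zp \<Rightarrow> 'p group_ring_Qp" where
  "incl r = (\<Sum>g\<in>UNIV. Poly_Mapping.single g (padic_of_int (Poly_Mapping.lookup r g)))"

lemma lookup_incl: "Poly_Mapping.lookup (incl r) g = padic_of_int (Poly_Mapping.lookup r g)"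
  by (simp add: incl_def lookup_sum lookup_single when_def)

lemma group_ring_denominator:
  fixes x :: "'p :: prime_card group_ring_Qp"
  shows "\<exists>k r. Poly_Mapping.single 0 (of_nat CARD('p) ^ k) * x = incl r"
proof -
  have "\<exists>k a. of_nat CARD('p) ^ k * Poly_Mapping.lookup x g = padic_of_int a" for g by (rule padic_denominator)
  then obtain k a where ka: "\<And>g. of_nat CARD('p) ^ k g * Poly_Mapping.lookup x g = padic_of_int (a g)" by metis
  let ?n = "\<Sum>g\<in>UNIV. k g"
  let ?r = "\<Sum>g\<in>UNIV. Poly_Mapping.single g (of_nat CARD('p) ^ (?n - k g) * a g)"
  have "Poly_Mapping.lookup (Poly_Mapping.single 0 (of_nat CARD('p) ^ ?n) * x) g = Poly_Mapping.lookup (incl ?r) g" for g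
  proof -
    have "k g \<le> ?n" by (rule member_le_sum) auto
    hence "of_nat CARD('p) ^ ?n * Poly_Mapping.lookup x g =
        of_nat CARD('p) ^ (?n - k g) * (of_nat CARD('p) ^ k g * Poly_Mapping.lookup x g)"
      by (simp only: mult.assoc[symmetric] power_add[symmetric] le_add_diff_inverse2)
    also have "\<dots> = padic_of_int (of_nat CARD('p) ^ (?n - k g) * a g)"
      by (simp only: ka padic_of_int_hom(2) padic_of_int_card_power)
    also have "\<dots> = Poly_Mapping.lookup (incl ?r) g"
      by (simp add: lookup_incl lookup_sum lookup_single when_def del: mult_fract)
    finally show ?thesis by (simp only: group_ring_single_0_mult)
  qed
  hence "Poly_Mapping.single 0 (of_nat CARD('p) ^ ?n) * x = incl ?r" by (rule poly_mapping_eqI)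
  thus ?thesis by blast
qed

interpretation augQ: group_eval_hom "to_ac :: 'p :: prime_card padic \<Rightarrow> _" 1 "group_eval to_ac 1 :: 'p group_ring_Qp \<Rightarrow> _"
  by unfold_locales simp_all

abbreviation augQ :: "'p :: prime_card group_ring_Qp \<Rightarrow> 'p padic alg_closure" where "augQ \<equiv> group_eval to_ac 1"

lemma padic_int_to_ac_sum: "padic_int_to_ac (\<Sum>i\<in>A. f i) = (\<Sum>i\<in>A. padic_int_to_ac (f i))"
  by (induction A rule: infinite_finite_induct) (simp_all add: padic_int_to_ac_hom del: add_fract to_ac_add)

lemma augQ_incl: "augQ (incl r) = padic_int_to_ac (augmentation r)"
  by (simp add: group_eval_def lookup_incl augmentation_def padic_int_to_ac_sum)

context cyclotomic
begin

abbreviation evQ :: "'p group_ring_Qp \<Rightarrow> 'p padic alg_closure" where "evQ \<equiv> group_eval to_ac \<omega>"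

sublocale evQ: group_eval_hom "to_ac :: 'p padic \<Rightarrow> _" \<omega> evQ
  by unfold_locales (simp_all add: omega_power)

sublocale Zp: residue_dvr "Zp_ac :: 'p padic alg_closure set" P res_Zp "CARD('p)" by (rule residue_dvr_Zp)

sublocale Zw: residue_dvr R t res "CARD('p)" by (rule residue_dvr_R)

lemma evQ_incl: "evQ (incl r) = ev r"
  by (simp add: group_eval_def lookup_incl ev.e_eq)

lemma res_P: "res_Zp P = 0" "res P = 0"
  using Zp.nat_mem(2)[of "CARD('p)"] Zw.nat_mem(2)[of "CARD('p)"] by simp_all

abbreviation scalar :: "'p padic \<Rightarrow> 'p group_ring_Qp" where "scalar \<equiv> Poly_Mapping.single 0"

lemma eval_scalar: "augQ (scalar c * x) = to_ac c * augQ x" "evQ (scalar c * x) = to_ac c * evQ x"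
  by (simp_all add: augQ.mult augQ.single_0 evQ.mult evQ.single_0)

lemma to_ac_card_power: "to_ac (of_nat CARD('p) ^ k :: 'p padic) = P ^ k"
  by (simp only: to_ac_power to_ac_of_nat)

lemma joint_kernel_rational:
  assumes "augQ x = 0" "evQ x = 0"
  shows "x = 0"
proof -
  obtain k r where r: "scalar (of_nat CARD('p) ^ k) * x = incl r" using group_ring_denominator by blast
  have "augQ (incl r) = 0" "evQ (incl r) = 0" unfolding r[symmetric] eval_scalar assms by simp_all
  hence "r = 0" unfolding augQ_incl evQ_incl
    by (intro joint_kernel) (metis padic_int_to_ac_hom(5,6))
  hence "of_nat CARD('p) ^ k * Poly_Mapping.lookup x g = 0" for g
    using arg_cong[OF r, of "\<lambda>y. Poly_Mapping.lookup y g"]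
    by (simp add: group_ring_single_0_mult lookup_incl padic_of_int_hom(4))
  thus ?thesis using of_nat_card_padic_neq_0[where 'p = 'p] by (intro poly_mapping_eqI) simp
qed

definition max_order :: "'p group_ring_Qp set" where
  "max_order = {x. augQ x \<in> Zp_ac \<and> evQ x \<in> R}"

text \<open>Both components of (p s1, p s2) have residue 0, so this pair lifts to the integral group
  ring; the lift is then divided by p.\<close>

lemma max_order_surj:
  assumes "s1 \<in> Zp_ac" "s2 \<in> R"
  shows "\<exists>x\<in>max_order. augQ x = s1 \<and> evQ x = s2"
proof -
  have "res_Zp (P * s1) = res (P * s2)"
    using assms Zp.nat_mem Zw.nat_mem by (simp add: Zp.res_mult Zw.res_mult res_P)
  then obtain r where r: "padic_int_to_ac (augmentation r) = P * s1" "ev r = P * s2"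
    using fibre_lift[OF Zp.mult[OF Zp.nat_mem(1) assms(1)] Zw.mult[OF Zw.nat_mem(1) assms(2)]] by meson
  let ?x = "scalar (inverse (of_nat CARD('p))) * incl r"
  have "augQ ?x = s1" "evQ ?x = s2"
    unfolding eval_scalar augQ_incl evQ_incl r using P_neq_0 by (simp_all add: to_ac_inverse)
  thus ?thesis using assms by (auto simp: max_order_def)
qed

lemma order_subset_max_order:
  assumes "is_order \<Gamma>"
  shows "\<Gamma> \<subseteq> max_order"
proof
  fix x assume x: "x \<in> \<Gamma>"
  let ?scale = "\<lambda>r. (*) (scalar (padic_of_int r))"
  interpret \<Gamma>: Modules.module ?scale
    by (rule module_mult_hom)
      (simp_all only: padic_of_int_hom mult_single single_add add_0_left single_one)
  obtain G where G: "finite G" "\<Gamma> = \<Gamma>.span G" using assms by (auto simp: is_order_def)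
  \<comment> \<open>Elements whose two values become integral after multiplication by p^k. These
    Z_p-modules grow with k and exhaust the group algebra, so one of them contains the finitely many
    generators.\<close>
  define Y where "Y k = {x. P ^ k * augQ x \<in> Zp_ac \<and> P ^ k * evQ x \<in> R}" for k
  have "\<exists>k. y \<in> Y k" for y
  proof -
    obtain k r where r: "scalar (of_nat CARD('p) ^ k) * y = incl r" using group_ring_denominator by blast
    have "P ^ k * augQ y = padic_int_to_ac (augmentation r)" "P ^ k * evQ y = ev r"
      unfolding augQ_incl[symmetric] evQ_incl[symmetric] r[symmetric] eval_scalar to_ac_card_power by simp_all
    thus ?thesis by (auto simp: Y_def)
  qed
  then obtain k where k: "\<And>y. y \<in> Y (k y)" by metis
  have mono: "Y i \<subseteq> Y j" if "i \<le> j" for i j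
  proof
    fix y assume y: "y \<in> Y i"
    have "P ^ j = P ^ (j - i) * P ^ i" using that by (simp flip: power_add)
    thus "y \<in> Y j" using y Zp.mult[OF Zp.pow[OF Zp.nat_mem(1)]] Zw.mult[OF Zw.pow[OF Zw.nat_mem(1)]]
      by (simp add: Y_def mult.assoc)
  qed
  define n where "n = Max (insert 0 (k ` G))"
  have "G \<subseteq> Y n"
  proof
    fix y assume "y \<in> G"
    hence "k y \<le> n" using G(1) by (simp add: n_def)
    thus "y \<in> Y n" using k mono by blast
  qed
  moreover have "\<Gamma>.subspace (Y n)"
  proof (rule \<Gamma>.subspaceI)
    show "0 \<in> Y n" using Zp.zero Zw.zero by (simp add: Y_def augQ.zero evQ.zero)
    show "y + z \<in> Y n" if "y \<in> Y n" "z \<in> Y n" for y z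
      using that Zp.add Zw.add by (simp add: Y_def augQ.add evQ.add distrib_left)
    show "scalar (padic_of_int c) * y \<in> Y n" if "y \<in> Y n" for c y
      using that Zp.mult[of "padic_int_to_ac c"] Zw.mult[OF R_closed(5)[of c]]
      by (simp add: Y_def eval_scalar mult.left_commute[of _ "padic_int_to_ac c"])
  qed
  ultimately have \<Gamma>: "\<Gamma> \<subseteq> Y n" unfolding G(2) by (rule \<Gamma>.span_minimal)
  have "x ^ i \<in> \<Gamma>" for i
    by (induction i) (use x assms in \<open>auto simp: is_order_def\<close>)
  hence "P ^ n * augQ x ^ i \<in> Zp_ac \<and> P ^ n * evQ x ^ i \<in> R" for i
    using \<Gamma> by (auto simp: Y_def augQ.power[symmetric] evQ.power[symmetric])
  moreover have "P ^ n \<noteq> 0" using P_neq_0 by simp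
  ultimately have "augQ x \<in> Zp_ac" "evQ x \<in> R"
    using Zp.bounded_powers_imp_mem[OF Zp.pow[OF Zp.nat_mem(1)]] Zw.bounded_powers_imp_mem[OF Zw.pow[OF Zw.nat_mem(1)]]
    by blast+
  thus "x \<in> max_order" by (simp only: max_order_def mem_Collect_eq)
qed

text \<open>Generators are an element with values (1, 0) and, for each group element g, one with
  values (0, omega^g): they reproduce every admissible pair of values, and the values determine the
  element.\<close>

lemma is_order_max_order: "is_order max_order"
proof -
  interpret Z: Modules.module "\<lambda>r. (*) (scalar (padic_of_int r))"
    by (rule module_mult_hom)
      (simp_all only: padic_of_int_hom mult_single single_add add_0_left single_one)
  interpret Q: Modules.module "\<lambda>q. (*) (scalar q)"
    by (rule module_mult_hom) (simp_all only: mult_single single_add add_0_left single_one)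
  have "\<exists>f. f \<in> max_order \<and> augQ f = 1 \<and> evQ f = 0" using max_order_surj[OF Zp.one Zw.zero] by blast
  then obtain f where f: "f \<in> max_order" "augQ f = 1" "evQ f = 0" by blast
  have "\<omega> \<in> R" using ev_gen by (metis rangeI)
  hence "\<exists>h. h \<in> max_order \<and> augQ h = 0 \<and> evQ h = \<omega> ^ nat (to_int_mod_ring g)" for g :: "'p mod_ring"
    using max_order_surj[OF Zp.zero R_closed(4)] by blast
  then obtain h where h: "h g \<in> max_order" "augQ (h g) = 0" "evQ (h g) = \<omega> ^ nat (to_int_mod_ring g)"
    for g :: "'p mod_ring" by metis
  let ?G = "insert f (range h)"
  have sub: "Z.subspace max_order"
  proof (rule Z.subspaceI)
    show "0 \<in> max_order" using Zp.zero Zw.zero by (simp add: max_order_def augQ.zero evQ.zero)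
    show "y + z \<in> max_order" if "y \<in> max_order" "z \<in> max_order" for y z
      using that Zp.add Zw.add by (simp add: max_order_def augQ.add evQ.add)
    show "scalar (padic_of_int c) * y \<in> max_order" if "y \<in> max_order" for c y
      using that Zp.mult[of "padic_int_to_ac c"] Zw.mult[OF R_closed(5)[of c]]
      by (simp add: max_order_def eval_scalar)
  qed
  have "max_order = Z.span ?G"
  proof (intro equalityI subsetI)
    fix x assume "x \<in> max_order"
    then obtain a r where ar: "augQ x = padic_int_to_ac a" "evQ x = ev r" by (auto simp: max_order_def)
    let ?y = "scalar (padic_of_int a) * f + (\<Sum>g\<in>UNIV. scalar (padic_of_int (Poly_Mapping.lookup r g)) * h g)"
    have "augQ (x - ?y) = 0"
      by (simp add: augQ.diff augQ.add augQ.sum eval_scalar f h ar)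
    moreover have "evQ (x - ?y) = 0"
    proof -
      have "evQ (x - ?y) = ev r - (\<Sum>g\<in>UNIV. padic_int_to_ac (Poly_Mapping.lookup r g) * \<omega> ^ nat (to_int_mod_ring g))"
        by (simp add: evQ.diff evQ.add evQ.sum eval_scalar f h ar)
      thus ?thesis by (simp add: ev.e_eq group_eval_def)
    qed
    ultimately have "x = ?y" using joint_kernel_rational[of "x - ?y"] by simp
    also have "?y \<in> Z.span ?G"
      by (intro Z.span_add Z.span_sum Z.span_scale Z.span_base) auto
    finally show "x \<in> Z.span ?G" .
  next
    show "x \<in> max_order" if "x \<in> Z.span ?G" for x
      using Z.span_minimal[OF _ sub, of ?G] f(1) h(1) that by blast
  qed
  moreover have "Q.span max_order = UNIV"
  proof (intro equalityI subsetI)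
    fix x :: "'p group_ring_Qp"
    obtain k r where r: "scalar (of_nat CARD('p) ^ k) * x = incl r" using group_ring_denominator by blast
    have "incl r \<in> max_order" by (simp add: max_order_def augQ_incl evQ_incl)
    hence "scalar (inverse (of_nat CARD('p) ^ k)) * incl r \<in> Q.span max_order"
      by (intro Q.span_scale Q.span_base)
    also have "scalar (inverse (of_nat CARD('p) ^ k)) * incl r = x"
      unfolding r[symmetric] mult.assoc[symmetric] mult_single
      using of_nat_card_padic_neq_0[where 'p = 'p] by (simp add: single_one)
    finally show "x \<in> Q.span max_order" .
  qed simp
  moreover have "1 \<in> max_order" using Zp.one Zw.one by (simp add: max_order_def augQ.one evQ.one)
  moreover have "x - y \<in> max_order \<and> x * y \<in> max_order" if "x \<in> max_order" "y \<in> max_order" for x y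
    using that Zp.diff Zw.diff Zp.mult Zw.mult
    by (simp add: max_order_def augQ.diff evQ.diff augQ.mult evQ.mult)
  moreover have "finite ?G" by simp
  ultimately show ?thesis unfolding is_order_def by blast
qed

lemma is_maximal_order_imp_eq: "is_maximal_order \<Gamma> \<Longrightarrow> \<Gamma> = max_order"
  using order_subset_max_order is_order_max_order unfolding is_maximal_order_def by metis

end

section \<open>The lattice as a fibre product\<close>

lemma scale_prod_simps:
  "scale_prod (r, r') (x, y) = (coord_scale r x, coord_scale r' y)"
  "scale_prod w (u + v) = scale_prod w u + scale_prod w v"
  "scale_prod w (u - v) = scale_prod w u - scale_prod w v"
  "scale_prod (r, r') (scale_prod (s, s') u) = scale_prod (r * s, r' * s') u"
  "scale_prod (r + s, r' + s') u = scale_prod (r, r') u + scale_prod (s, s') u"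
  "scale_prod (1, 1) u = u"
  "scale_prod w 0 = 0"
  by (simp_all add: scale_prod_def coord_scale_simps prod_eq_iff)

lemma (in fibre_lattice) fibre_projections: "fst ` fibre = L1" "snd ` fibre = L2"
proof -
  have "\<exists>y. (x, y) \<in> fibre" if x: "x \<in> L1" for x
  proof -
    have "\<phi> x \<in> \<psi> ` L2" unfolding Q2.phi_surj Q1.phi_surj[symmetric] using x by (rule imageI)
    thus ?thesis using x by (auto simp: fibre_def)
  qed
  thus "fst ` fibre = L1" by (force simp: fibre_def)
  have "\<exists>x. (x, y) \<in> fibre" if y: "y \<in> L2" for y
  proof -
    have "\<psi> y \<in> \<phi> ` L1" unfolding Q1.phi_surj Q2.phi_surj[symmetric] using y by (rule imageI)
    thus ?thesis using y by (fastforce simp: fibre_def)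
  qed
  thus "snd ` fibre = L2" by (force simp: fibre_def)
qed

locale cyclotomic_model =cyclotomic \<omega> for \<omega> :: "'p :: prime_card padic alg_closure" +
  fixes a b c :: nat
begin

text \<open>The first a and b coordinates are free; the gluing concerns the last c coordinates on
  either side.\<close>

sublocale fibre_lattice Zp_ac P res_Zp "CARD('p)" "a + c"
    "\<lambda>u. vec_of c (\<lambda>i. res_Zp (Poly_Mapping.lookup u (a + i)))" c
    R t res "b + c" "\<lambda>v. vec_of c (\<lambda>i. res (Poly_Mapping.lookup v (b + i)))"
  by (intro fibre_lattice.intro Zp.lattice_quotient_residue Zw.lattice_quotient_residue fibre_lattice_axioms.intro) simp_all

lemma fibre_iff:
  "(u, v) \<in> fibre \<longleftrightarrow> u \<in> L1 \<and> v \<in> L2 \<and>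
     (\<forall>i<c. res_Zp (Poly_Mapping.lookup u (a + i)) = res (Poly_Mapping.lookup v (b + i)))"
proof -
  have "vec_of c f = vec_of c g \<longleftrightarrow> (\<forall>i<c. f i = g i)" for f g :: "nat \<Rightarrow> 'p mod_ring"
  proof
    assume e: "vec_of c f = vec_of c g"
    show "\<forall>i<c. f i = g i"
      using e by (metis lookup_vec_of)
  qed (auto simp: lookup_vec_of intro!: poly_mapping_eqI)
  thus ?thesis by (simp add: fibre_def)
qed

text \<open>Each coordinate in the group ring is split into its augmentation, stored behind the a
  coordinates in Z_p, and its value at omega, stored behind the b coordinates in Z_p[omega].\<close>

definition emb :: "'p model \<Rightarrow> (nat \<Rightarrow>\<^sub>0 'p padic alg_closure) \<times> (nat \<Rightarrow>\<^sub>0 'p padic alg_closure)" where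
  "emb = (\<lambda>(x, y, z).
     (vec_of (a + c) (\<lambda>i. padic_int_to_ac
        (if i < a then Poly_Mapping.lookup x i else augmentation (Poly_Mapping.lookup z (i - a)))),
      vec_of (b + c) (\<lambda>i. if i < b then Poly_Mapping.lookup y i else ev (Poly_Mapping.lookup z (i - b)))))"

lemma emb_add: "emb (u + v) = emb u + emb v"
  by (cases u; cases v)
    (auto simp: emb_def lookup_vec_of lookup_add aug.add ev.add padic_int_to_ac_hom(1)
      simp del: to_ac_add add_fract intro!: poly_mapping_eqI)

lemma emb_scale: "emb (model_scale \<omega> r u) = scale_prod (padic_int_to_ac (augmentation r), ev r) (emb u)"
  by (cases u)
    (auto simp: emb_def model_scale_def scale_prod_simps lookup_vec_of aug.mult ev.mult ev_def[symmetric]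
      padic_int_to_ac_hom(3) simp del: to_ac_mult mult_fract intro!: poly_mapping_eqI)

text \<open>Injectivity on the last summand is \<open>joint_kernel\<close>, surjectivity is
  \<open>fibre_lift\<close>.\<close>

lemma bij_betw_emb: "bij_betw emb (model_lattice \<omega> a b c) fibre"
  unfolding bij_betw_def
proof (intro conjI equalityI subsetI inj_onI)
  fix u v assume uv: "u \<in> model_lattice \<omega> a b c" "v \<in> model_lattice \<omega> a b c" "emb u = emb v"
  obtain x y z x' y' z' where e: "u = (x, y, z)" "v = (x', y', z')" by (metis prod_cases3)
  have e1: "padic_int_to_ac (if i < a then Poly_Mapping.lookup x i else augmentation (Poly_Mapping.lookup z (i - a))) =
        padic_int_to_ac (if i < a then Poly_Mapping.lookup x' i else augmentation (Poly_Mapping.lookup z' (i - a)))"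
    if "i < a + c" for i
    using arg_cong[OF uv(3), of "\<lambda>w. Poly_Mapping.lookup (fst w) i"] that by (simp add: e emb_def lookup_vec_of)
  have e2: "(if i < b then Poly_Mapping.lookup y i else ev (Poly_Mapping.lookup z (i - b))) =
        (if i < b then Poly_Mapping.lookup y' i else ev (Poly_Mapping.lookup z' (i - b)))"
    if "i < b + c" for i
    using arg_cong[OF uv(3), of "\<lambda>w. Poly_Mapping.lookup (snd w) i"] that by (simp add: e emb_def lookup_vec_of)
  have out: "Poly_Mapping.lookup x i = 0 \<and> Poly_Mapping.lookup x' i = 0" if "\<not> i < a" for i
    using uv(1,2) that by (auto simp: e model_lattice_def coord_vecs_iff)
  have out': "Poly_Mapping.lookup y i = 0 \<and> Poly_Mapping.lookup y' i = 0" if "\<not> i < b" for i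
    using uv(1,2) that by (auto simp: e model_lattice_def coord_vecs_iff)
  have out'': "Poly_Mapping.lookup z i = 0 \<and> Poly_Mapping.lookup z' i = 0" if "\<not> i < c" for i
    using uv(1,2) that by (auto simp: e model_lattice_def coord_vecs_iff)
  have "x = x'"
  proof (rule poly_mapping_eqI)
    show "Poly_Mapping.lookup x i = Poly_Mapping.lookup x' i" for i
      using e1[of i] out[of i] by (cases "i < a") (simp_all add: padic_int_to_ac_hom(6))
  qed
  moreover have "y = y'"
  proof (rule poly_mapping_eqI)
    show "Poly_Mapping.lookup y i = Poly_Mapping.lookup y' i" for i
      using e2[of i] out'[of i] by (cases "i < b") simp_all
  qed
  moreover have "z = z'"
  proof (rule poly_mapping_eqI)
    show "Poly_Mapping.lookup z i = Poly_Mapping.lookup z' i" for i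
    proof (cases "i < c")
      case True
      have "augmentation (Poly_Mapping.lookup z i - Poly_Mapping.lookup z' i) = 0"
        using e1[of "a + i"] True by (simp add: padic_int_to_ac_hom(6) aug.diff)
      moreover have "ev (Poly_Mapping.lookup z i - Poly_Mapping.lookup z' i) = 0"
        using e2[of "b + i"] True by (simp add: ev.diff)
      ultimately show ?thesis using joint_kernel by fastforce
    qed (simp add: out'')
  qed
  ultimately show "u = v" by (simp add: e)
next
  fix w assume "w \<in> emb ` model_lattice \<omega> a b c"
  then obtain x y z where w: "(x, y, z) \<in> model_lattice \<omega> a b c" "w = emb (x, y, z)" by force
  thus "w \<in> fibre"
    by (auto simp: emb_def fibre_iff lookup_vec_of coord_vecs_iff model_lattice_def Zp_adjoin_eq res_ev)
next
  fix w assume "w \<in> fibre"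
  then obtain u v where w: "w = (u, v)" "(u, v) \<in> fibre" by (cases w) auto
  hence uv: "u \<in> L1" "v \<in> L2" by (simp_all add: fibre_iff)
  have "\<exists>x. padic_int_to_ac x = Poly_Mapping.lookup u i" for i
    using Zp.lookup_mem_S[OF uv(1), of i] by auto
  then obtain x where x: "\<And>i. padic_int_to_ac (x i) = Poly_Mapping.lookup u i" by metis
  \<comment> \<open>The implication inside the existential makes the choice of r total in i.\<close>
  have "\<exists>r. i < c \<longrightarrow> padic_int_to_ac (augmentation r) = Poly_Mapping.lookup u (a + i) \<and> ev r = Poly_Mapping.lookup v (b + i)" for i
    using fibre_lift[OF Zp.lookup_mem_S[OF uv(1)] Zw.lookup_mem_S[OF uv(2)], of "a + i" "b + i"] w(2)
    by (auto simp: fibre_iff)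
  then obtain z where z: "\<And>i. i < c \<Longrightarrow> padic_int_to_ac (augmentation (z i)) = Poly_Mapping.lookup u (a + i) \<and> ev (z i) = Poly_Mapping.lookup v (b + i)"
    by metis
  let ?m = "(vec_of a x, vec_of b (Poly_Mapping.lookup v), vec_of c z)"
  have "?m \<in> model_lattice \<omega> a b c"
    using Zw.lookup_mem_S[OF uv(2)] by (auto simp: model_lattice_def coord_vecs_iff lookup_vec_of Zp_adjoin_eq)
  moreover have "emb ?m = (u, v)"
  proof -
    have "fst (emb ?m) = u"
    proof (rule poly_mapping_eqI)
      show "Poly_Mapping.lookup (fst (emb ?m)) i = Poly_Mapping.lookup u i" for i
        using uv(1) x[of i] z[of "i - a"] by (auto simp: emb_def lookup_vec_of coord_vecs_iff)
    qed
    moreover have "snd (emb ?m) = v"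
    proof (rule poly_mapping_eqI)
      show "Poly_Mapping.lookup (snd (emb ?m)) i = Poly_Mapping.lookup v i" for i
        using uv(2) z[of "i - b"] by (auto simp: emb_def lookup_vec_of coord_vecs_iff)
    qed
    ultimately show ?thesis by (simp add: prod_eq_iff)
  qed
  ultimately show "w \<in> emb ` model_lattice \<omega> a b c" using w(1) by (metis image_eqI)
qed

lemma iso_to_model_imp_iso_to_fibre:
  assumes "iso_to_model scale \<omega> a b c"
  obtains J where "bij_betw J UNIV fibre" "\<And>x y. J (x + y) = J x + J y"
    "\<And>r x. J (scale r x) = scale_prod (padic_int_to_ac (augmentation r), ev r) (J x)"
proof -
  obtain \<theta> where \<theta>: "bij_betw \<theta> UNIV (model_lattice \<omega> a b c)" "\<And>x y. \<theta> (x + y) = \<theta> x + \<theta> y"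
    "\<And>r x. \<theta> (scale r x) = model_scale \<omega> r (\<theta> x)"
    using assms unfolding iso_to_model_def by blast
  show thesis
  proof (rule that)
    show "bij_betw (emb \<circ> \<theta>) UNIV fibre" using \<theta>(1) bij_betw_emb by (rule bij_betw_trans)
  qed (simp_all add: \<theta>(2,3) emb_add emb_scale)
qed

end

section \<open>The rational extension and the lattice generated over the maximal order\<close>

locale rational_extension = cyclotomic_model \<omega> a b c
  for \<omega> :: "'p :: prime_card padic alg_closure" and a b c :: nat +
  fixes scale :: "'p group_ring_Zp \<Rightarrow> 'l :: ab_group_add \<Rightarrow> 'l"
    and scaleV :: "'p group_ring_Qp \<Rightarrow> 'v :: ab_group_add \<Rightarrow> 'v"
    and \<tau> :: "'p padic \<Rightarrow> 'l \<Rightarrow> 'v"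
    and J
  assumes module_scale: "Modules.module scale"
    and rational_extension: "is_rational_extension scale scaleV \<tau>"
    and bij_J: "bij_betw J UNIV fibre" and J_add: "J (x + y) = J x + J y"
    and J_scale: "J (scale r x) = scale_prod (padic_int_to_ac (augmentation r), ev r) (J x)"
begin

sublocale L: Modules.module scale by (rule module_scale)

sublocale V: Modules.module scaleV using rational_extension by (simp add: is_rational_extension_def)

lemma J_0: "J 0 = 0" using J_add[of 0 0] by simp

lemma J_diff: "J (x - y) = J x - J y" using J_add[of "x - y" y] by simp

lemma J_eq_iff: "J x = J y \<longleftrightarrow> x = y" using bij_J by (auto simp: bij_betw_def inj_def)

lemma J_mem: "J x \<in> fibre" using bij_J by (auto simp: bij_betw_def)

lemma J_surj: "u \<in> fibre \<Longrightarrow> \<exists>x. J x = u" using bij_J by (force simp: bij_betw_def)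

text \<open>The group ring acts on the fibre product through its image under augmentation and
  evaluation, and by \<open>fibre_lift\<close> this image is the whole fibre ring.\<close>

theorem solomon_zeta_scale: "solomon_zeta CARD('p) UNIV scale UNIV = solomon_zeta CARD('p) fibre_ring scale_prod fibre"
proof (rule solomon_zeta_transfer[where f = J])
  show "\<exists>r'\<in>fibre_ring. \<forall>x\<in>UNIV. J (scale r x) = scale_prod r' (J x)" for r
    by (rule bexI[of _ "(padic_int_to_ac (augmentation r), ev r)"]) (simp_all add: J_scale fibre_ring_def res_ev)
  show "\<exists>r\<in>UNIV. \<forall>x\<in>UNIV. J (scale r x) = scale_prod r' (J x)" if r: "r' \<in> fibre_ring" for r'
  proof -
    obtain s1 s2 where r': "r' = (s1, s2)" by (cases r')
    obtain r where "padic_int_to_ac (augmentation r) = s1" "ev r = s2"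
      using fibre_lift[of s1 s2] r unfolding fibre_ring_def r' by auto
    thus ?thesis by (intro bexI[of _ r]) (simp_all add: J_scale r')
  qed
qed (use bij_J J_diff in \<open>auto simp: subgroup_set_def\<close>)

lemma tensor: "is_tensor_product (\<lambda>r. (*) (padic_of_int r)) (\<lambda>r. scale (Poly_Mapping.single 0 r))
    (\<lambda>r. scaleV (scalar (padic_of_int r))) \<tau>"
  and scaleV_tau: "scaleV (Poly_Mapping.single g q) (\<tau> q' x) = \<tau> (q * q') (scale (Poly_Mapping.single g 1) x)"
  using rational_extension by (simp_all add: is_rational_extension_def)

lemma module_scaleV_scalar: "Modules.module (\<lambda>r. scaleV (scalar (padic_of_int r)))"
  by unfold_locales
    (simp_all add: V.scale_right_distrib padic_of_int_hom(1,3) single_add V.scale_left_distrib mult_single single_one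
      del: add_fract)

lemmas tau_bilinear = tensor_product_bilinear[OF tensor module_scaleV_scalar]

lemma tau_0: "\<tau> q 0 = 0" using tau_bilinear(1)[of q 0 0] by simp

lemma tau_diff: "\<tau> q (x - y) = \<tau> q x - \<tau> q y" using tau_bilinear(1)[of q "x - y" y] by simp

lemma tau_sum: "\<tau> q (\<Sum>i\<in>A. f i) = (\<Sum>i\<in>A. \<tau> q (f i))"
  by (induction A rule: infinite_finite_induct) (simp_all add: tau_0 tau_bilinear(1))

text \<open>The bilinear map sending (q, x) to q * J x takes values in vectors over the algebraic
  closure and is injective in x at q = 1, so it detects the tensor of 1 and x.\<close>

lemma tau_eq_0_imp: "\<tau> 1 x = 0 \<Longrightarrow> x = 0"
proof -
  assume "\<tau> 1 x = 0"
  let ?\<beta> = "\<lambda>q x. scale_prod (to_ac q, to_ac q) (J x)"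
  have "?\<beta> 1 x = 0"
  proof (rule tensor_product_universal[OF tensor module_scaleV_scalar, where \<beta> = ?\<beta> and scaleU = "\<lambda>r. scale_prod (padic_int_to_ac r, padic_int_to_ac r)"])
    show "Modules.module (\<lambda>r. scale_prod (padic_int_to_ac r, padic_int_to_ac r)
        :: (nat \<Rightarrow>\<^sub>0 'p padic alg_closure) \<times> (nat \<Rightarrow>\<^sub>0 'p padic alg_closure) \<Rightarrow> _)"
      by unfold_locales
        (simp_all only: scale_prod_simps padic_int_to_ac_hom(1,3,4))
    show "?\<beta> (q + q') y = ?\<beta> q y + ?\<beta> q' y" for q q' y
      by (simp add: scale_prod_simps)
  qed (simp_all add: J_add scale_prod_simps J_scale aug.single_0 ev.single_0 mult.commute \<open>\<tau> 1 x = 0\<close>)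
  thus "x = 0" using J_eq_iff[of x 0] by (simp add: J_0 scale_prod_simps)
qed

lemma scaleV_incl_tau: "scaleV (incl r) (\<tau> 1 x) = \<tau> 1 (scale r x)"
proof -
  have "scaleV (Poly_Mapping.single g (padic_of_int d)) (\<tau> 1 x) = \<tau> 1 (scale (Poly_Mapping.single g d) x)" for g d
  proof -
    have "scaleV (Poly_Mapping.single g (padic_of_int d)) (\<tau> 1 x) = \<tau> (padic_of_int d * 1) (scale (Poly_Mapping.single g 1) x)"
      by (rule scaleV_tau)
    also have "\<dots> = \<tau> 1 (scale (Poly_Mapping.single 0 d) (scale (Poly_Mapping.single g 1) x))"
      by (simp only: tau_bilinear(2,3))
    finally show ?thesis by (simp add: mult_single)
  qed
  hence "scaleV (incl r) (\<tau> 1 x) = (\<Sum>g\<in>UNIV. \<tau> 1 (scale (Poly_Mapping.single g (Poly_Mapping.lookup r g)) x))"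
    by (simp add: incl_def V.scale_sum_left)
  also have "\<dots> = \<tau> 1 (scale (\<Sum>g\<in>UNIV. Poly_Mapping.single g (Poly_Mapping.lookup r g)) x)"
    by (simp add: L.scale_sum_left tau_sum)
  finally show ?thesis by (simp only: poly_mapping_decompose[symmetric])
qed

lemma incl_single_0: "incl (Poly_Mapping.single 0 d) = scalar (padic_of_int d)"
  by (rule poly_mapping_eqI) (simp add: lookup_incl lookup_single when_def padic_of_int_hom(4))

text \<open>Multiplication by p^k brings x into the integral group ring, where the injective J
  transfers the identity to the lattice; p^k is then inverted in V.\<close>

lemma scaleV_tau_J:
  assumes "J y = scale_prod (augQ x, evQ x) (J z)"
  shows "scaleV x (\<tau> 1 z) = \<tau> 1 y"
proof -
  obtain k r where r: "scalar (of_nat CARD('p) ^ k) * x = incl r" using group_ring_denominator by blast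
  let ?d = "Poly_Mapping.single 0 (of_nat CARD('p) ^ k) :: 'p group_ring_Zp"
  have d: "incl ?d = scalar (of_nat CARD('p) ^ k)" by (simp only: incl_single_0 padic_of_int_card_power)
  have "J (scale ?d y) = scale_prod (P ^ k, P ^ k) (J y)"
    by (simp add: J_scale aug.single_0 ev.single_0 padic_int_to_ac_power padic_int_to_ac_of_nat)
  also have "\<dots> = J (scale r z)"
    unfolding assms J_scale augQ_incl[symmetric] evQ_incl[symmetric] r[symmetric]
    by (simp add: eval_scalar scale_prod_simps to_ac_card_power)
  finally have "scale ?d y = scale r z" by (simp only: J_eq_iff)
  hence "scaleV (incl ?d) (\<tau> 1 y) = scaleV (incl r) (\<tau> 1 z)" by (simp only: scaleV_incl_tau)
  hence "scaleV (scalar (of_nat CARD('p) ^ k)) (\<tau> 1 y) = scaleV (scalar (of_nat CARD('p) ^ k)) (scaleV x (\<tau> 1 z))"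
    by (simp add: d r)
  hence "scaleV (scalar (inverse (of_nat CARD('p) ^ k)) * scalar (of_nat CARD('p) ^ k)) (\<tau> 1 y) =
      scaleV (scalar (inverse (of_nat CARD('p) ^ k)) * scalar (of_nat CARD('p) ^ k)) (scaleV x (\<tau> 1 z))"
    unfolding V.scale_scale[symmetric] by (rule arg_cong)
  thus ?thesis using of_nat_card_padic_neq_0[where 'p = 'p] by (simp add: mult_single single_one)
qed

lemma scale_P_mem: "u \<in> L1 \<times> L2 \<Longrightarrow> scale_prod (P, P) u \<in> fibre"
  using Zp.lattice_closed(5)[OF Zp.nat_mem(1)] Zw.lattice_closed(5)[OF Zw.nat_mem(1)]
  by (cases u) (auto simp: scale_prod_simps fibre_iff Zp.lookup_mem_S Zw.lookup_mem_S Zp.nat_mem(1) Zw.nat_mem(1)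
      Zp.res_mult Zw.res_mult res_P)

text \<open>Multiplication by \<open>p\<close> maps all of \<open>L1 \<times> L2\<close> into the fibre product, where \<open>\<tau> 1 \<circ> J\<^sup>-\<^sup>1\<close> is defined.\<close>

definition ext :: "(nat \<Rightarrow>\<^sub>0 'p padic alg_closure) \<times> (nat \<Rightarrow>\<^sub>0 'p padic alg_closure) \<Rightarrow> 'v" where
  "ext u = scaleV (scalar (inverse (of_nat CARD('p)))) (\<tau> 1 (the_inv J (scale_prod (P, P) u)))"

lemma J_the_inv: "u \<in> fibre \<Longrightarrow> J (the_inv J u) = u"
  using bij_J by (simp add: bij_betw_def f_the_inv_into_f)

lemma scale_L: "s \<in> Zp_ac \<times> R \<Longrightarrow> u \<in> L1 \<times> L2 \<Longrightarrow> scale_prod s u \<in> L1 \<times> L2"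
  using Zp.lattice_closed(5) Zw.lattice_closed(5) by (auto simp: scale_prod_def)

lemma subgroup_L1_L2: "subgroup_set (L1 \<times> L2)" by (intro subgroup_Times subgroup_L)

lemma ext_diff: "u \<in> L1 \<times> L2 \<Longrightarrow> v \<in> L1 \<times> L2 \<Longrightarrow> ext (u - v) = ext u - ext v"
proof -
  assume uv: "u \<in> L1 \<times> L2" "v \<in> L1 \<times> L2"
  have "J (the_inv J (scale_prod (P, P) (u - v))) =
      J (the_inv J (scale_prod (P, P) u) - the_inv J (scale_prod (P, P) v))"
    using uv scale_P_mem subgroup_setD(2)[OF subgroup_L1_L2] by (simp only: J_diff J_the_inv scale_prod_simps(3)[symmetric])
  thus ?thesis by (simp only: J_eq_iff ext_def tau_diff V.scale_right_diff_distrib)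
qed

lemma ext_scale:
  assumes "x \<in> max_order" "u \<in> L1 \<times> L2"
  shows "scaleV x (ext u) = ext (scale_prod (augQ x, evQ x) u)"
proof -
  have L: "scale_prod (augQ x, evQ x) u \<in> L1 \<times> L2" using assms by (intro scale_L) (auto simp: max_order_def)
  have "scaleV x (\<tau> 1 (the_inv J (scale_prod (P, P) u))) =
      \<tau> 1 (the_inv J (scale_prod (P, P) (scale_prod (augQ x, evQ x) u)))"
  proof (rule scaleV_tau_J)
    show "J (the_inv J (scale_prod (P, P) (scale_prod (augQ x, evQ x) u))) =
        scale_prod (augQ x, evQ x) (J (the_inv J (scale_prod (P, P) u)))"
      unfolding J_the_inv[OF scale_P_mem[OF L]] J_the_inv[OF scale_P_mem[OF assms(2)]]
      by (simp add: scale_prod_simps mult.commute)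
  qed
  thus ?thesis unfolding ext_def by (simp only: V.scale_scale mult.commute[of x]) (simp only: V.scale_scale[symmetric])
qed

lemma ext_J: "ext (J x) = \<tau> 1 x"
proof -
  have "J x \<in> L1 \<times> L2" using J_mem[of x] by (auto simp: fibre_def)
  thus ?thesis unfolding ext_def
    using P_neq_0 by (intro scaleV_tau_J)
      (simp add: augQ.single_0 evQ.single_0 J_the_inv scale_P_mem scale_prod_simps to_ac_inverse)
qed

lemma inj_ext: "inj_on ext (L1 \<times> L2)"
proof (rule inj_onI)
  fix u v assume uv: "u \<in> L1 \<times> L2" "v \<in> L1 \<times> L2" "ext u = ext v"
  let ?w = "the_inv J (scale_prod (P, P) (u - v))"
  have "scaleV (scalar (inverse (of_nat CARD('p)))) (\<tau> 1 ?w) = 0"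
    using ext_diff[OF uv(1,2)] uv(3) by (simp add: ext_def)
  hence "scaleV (scalar (of_nat CARD('p))) (scaleV (scalar (inverse (of_nat CARD('p)))) (\<tau> 1 ?w)) = 0" by simp
  hence "\<tau> 1 ?w = 0"
    unfolding V.scale_scale mult_single using of_nat_card_padic_neq_0[where 'p = 'p] by (simp add: single_one)
  hence "?w = 0" by (rule tau_eq_0_imp)
  hence "scale_prod (P, P) (u - v) = 0"
    using J_the_inv[OF scale_P_mem[OF subgroup_setD(2)[OF subgroup_L1_L2 uv(1,2)]]] J_0 by simp
  hence "scale_prod (inverse P, inverse P) (scale_prod (P, P) (u - v)) = 0" by (simp only: scale_prod_simps(7))
  thus "u = v" using P_neq_0 by (simp add: scale_prod_simps)
qed

lemma image_ext: "ext ` (L1 \<times> L2) = generated_submodule max_order scaleV (range (\<tau> 1))"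
proof (intro equalityI)
  have "is_submodule_over max_order scaleV (ext ` (L1 \<times> L2))"
    unfolding is_submodule_over_def
  proof (intro conjI ballI)
    have "ext 0 = 0" using ext_J[of 0] by (simp add: J_0 tau_0)
    thus "0 \<in> ext ` (L1 \<times> L2)" using subgroup_setD(1)[OF subgroup_L1_L2] by (metis imageI)
    show "x - y \<in> ext ` (L1 \<times> L2)" if xy: "x \<in> ext ` (L1 \<times> L2)" "y \<in> ext ` (L1 \<times> L2)" for x y
    proof -
      obtain u v where "u \<in> L1 \<times> L2" "v \<in> L1 \<times> L2" "x = ext u" "y = ext v" using xy by blast
      thus ?thesis using ext_diff[of u v] subgroup_setD(2)[OF subgroup_L1_L2, of u v] by (metis imageI)
    qed
    show "scaleV r x \<in> ext ` (L1 \<times> L2)" if r: "r \<in> max_order" "x \<in> ext ` (L1 \<times> L2)" for r x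
    proof -
      obtain u where u: "u \<in> L1 \<times> L2" "x = ext u" using r(2) by blast
      have "scale_prod (augQ r, evQ r) u \<in> L1 \<times> L2" using r(1) u(1) by (intro scale_L) (auto simp: max_order_def)
      thus ?thesis unfolding u(2) ext_scale[OF r(1) u(1)] by (rule imageI)
    qed
  qed
  moreover have "range (\<tau> 1) \<subseteq> ext ` (L1 \<times> L2)"
  proof
    fix y assume "y \<in> range (\<tau> 1)"
    then obtain x where "y = ext (J x)" by (auto simp: ext_J)
    thus "y \<in> ext ` (L1 \<times> L2)" using J_mem[of x] by (auto simp: fibre_def)
  qed
  ultimately show "generated_submodule max_order scaleV (range (\<tau> 1)) \<subseteq> ext ` (L1 \<times> L2)"
    unfolding generated_submodule_def by (intro hull_minimal)
next
  show "ext ` (L1 \<times> L2) \<subseteq> generated_submodule max_order scaleV (range (\<tau> 1))"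
    unfolding generated_submodule_def hull_def
  proof (intro Inter_greatest, clarify)
    fix Y u v assume Y: "is_submodule_over max_order scaleV Y" "range (\<tau> 1) \<subseteq> Y" and uv: "u \<in> L1" "v \<in> L2"
    note sY = subgroup_setD[OF is_submodule_overD(1)[OF Y(1)]] is_submodule_overD(2)[OF Y(1)]
    have E: "ext w \<in> Y" if "w \<in> fibre" for w using J_surj[OF that] Y(2) ext_J by auto
    have fibL: "fibre \<subseteq> L1 \<times> L2" by (auto simp: fibre_def)
    \<comment> \<open>These act as (1, 0) and (0, 1). Applied to (u, v') and (u', v) in the fibre
      product they produce (u, 0) and (0, v), which need not lie in it.\<close>
    obtain e1 e2 where e1: "e1 \<in> max_order" "augQ e1 = 1" "evQ e1 = 0"
      and e2: "e2 \<in> max_order" "augQ e2 = 0" "evQ e2 = 1"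
      using max_order_surj[OF Zp.one Zw.zero] max_order_surj[OF Zp.zero Zw.one] by blast
    obtain u' v' where u': "(u', v) \<in> fibre" and v': "(u, v') \<in> fibre"
      using uv unfolding fibre_projections[symmetric] by force
    have 1: "ext (u, 0) \<in> Y"
      using sY(5)[OF e1(1) E[OF v']] v' fibL by (subst (asm) ext_scale) (auto simp: e1 scale_prod_simps coord_scale_simps)
    have 2: "ext (0, v) \<in> Y"
      using sY(5)[OF e2(1) E[OF u']] u' fibL by (subst (asm) ext_scale) (auto simp: e2 scale_prod_simps coord_scale_simps)
    have "ext ((u, v) - (u, 0)) = ext (u, v) - ext (u, 0)"
      using uv Zw.lattice_closed(1) by (intro ext_diff) auto
    hence "ext (u, v) = ext (u, 0) + ext (0, v)" by simp
    thus "ext (u, v) \<in> Y" using 1 2 sY(4) by simp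
  qed
qed

theorem solomon_zeta_generated:
  "solomon_zeta CARD('p) max_order scaleV (generated_submodule max_order scaleV (range (\<tau> 1))) =
     solomon_zeta CARD('p) (Zp_ac \<times> R) scale_prod (L1 \<times> L2)"
proof (rule sym, rule solomon_zeta_transfer[where f = ext])
  show "bij_betw ext (L1 \<times> L2) (generated_submodule max_order scaleV (range (\<tau> 1)))"
    by (simp add: bij_betw_def inj_ext image_ext)
  show "\<exists>x\<in>max_order. \<forall>u\<in>L1 \<times> L2. ext (scale_prod r u) = scaleV x (ext u)"if r: "r \<in> Zp_ac \<times> R" for r
  proof -
    obtain x where "x \<in> max_order" "(augQ x, evQ x) = r"
      using r max_order_surj[of "fst r" "snd r"] by auto
    thus ?thesis using ext_scale by (intro bexI[of _ x]) auto
  qed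
  show "\<exists>r\<in>Zp_ac \<times> R. \<forall>u\<in>L1 \<times> L2. ext (scale_prod r u) = scaleV x (ext u)" if "x \<in> max_order" for x
    using that ext_scale by (intro bexI[of _ "(augQ x, evQ x)"]) (auto simp: max_order_def)
qed (use scale_L ext_diff subgroup_L1_L2 in auto)

end

theorem theorem1p2:
  fixes p a b c :: nat
    and \<omega> :: "'p :: prime_card padic alg_closure"
    and scale :: "'p group_ring_Zp \<Rightarrow> 'l :: ab_group_add \<Rightarrow> 'l"
    and \<Lambda>' :: "'p group_ring_Qp set"
    and scaleV :: "'p group_ring_Qp \<Rightarrow> 'v :: ab_group_add \<Rightarrow> 'v"
    and \<tau> :: "'p padic \<Rightarrow> 'l \<Rightarrow> 'v"
  assumes "p = CARD('p)"
    and "primitive_root_of_unity p \<omega>"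
    and "group_ring_lattice scale"
    and "iso_to_model scale \<omega> a b c"
    and "is_maximal_order \<Lambda>'"
    and "is_rational_extension scale scaleV \<tau>"
  shows "solomon_zeta p \<Lambda>' scaleV (generated_submodule \<Lambda>' scaleV (range (\<tau> 1))) =
           (\<Prod>h<a + c. inverse (1 - p_pow_minus_s p h)) *
           (\<Prod>i<b + c. inverse (1 - p_pow_minus_s p i)) \<and>
         solomon_zeta p UNIV scale UNIV /
           solomon_zeta p \<Lambda>' scaleV (generated_submodule \<Lambda>' scaleV (range (\<tau> 1))) =
           (\<Sum>j = 0..c. of_nat (gauss_binomial TYPE('p) c j) * fps_X ^ (c - j) *
              P_poly TYPE('p) a b c j * (\<Prod>k<j. (1 - p_pow_minus_s p k) ^ 2))"
proof -
  interpret C: cyclotomic_model \<omega> a b c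
    by unfold_locales (use assms(1,2) in simp)
  obtain J where "bij_betw J UNIV C.fibre" "\<And>x y. J (x + y) = J x + J y"
    "\<And>r x. J (scale r x) = scale_prod (padic_int_to_ac (augmentation r), C.ev r) (J x)"
    using C.iso_to_model_imp_iso_to_fibre[OF assms(4)] by blast
  moreover have "Modules.module scale" using assms(3) by (simp add: group_ring_lattice_def)
  ultimately interpret E: rational_extension \<omega> a b c scale scaleV \<tau> J
    using assms(6)
    by (intro rational_extension.intro rational_extension_axioms.intro C.cyclotomic_model_axioms)
  let ?Z' = "solomon_zeta p \<Lambda>' scaleV (generated_submodule \<Lambda>' scaleV (range (\<tau> 1)))"
  let ?Z = "(\<Prod>h<a + c. inverse (1 - p_pow_minus_s p h)) * (\<Prod>i<b + c. inverse (1 - p_pow_minus_s p i))"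
  have Z': "?Z' = ?Z"
    unfolding C.is_maximal_order_imp_eq[OF assms(5)] assms(1) E.solomon_zeta_generated by (rule C.solomon_zeta_Times)
  \<comment> \<open>The constant coefficient is 1. A non-zero divisor is what allows the quotient of
    the two series to be simplified.\<close>
  have "inverse (1 - p_pow_minus_s p h) \<noteq> 0" for h
    by (simp add: p_pow_minus_s_def fps_eq_iff exI[of _ 0])
  hence "?Z \<noteq> 0" by simp
  moreover have "P_poly TYPE('p) a b c j = C.P_series j" for j
    by (simp add: P_poly_def C.P_series_def gauss_binomial_eq card_GL_eq GL_order_def)
  ultimately show ?thesis
    unfolding Z' E.solomon_zeta_scale[folded assms(1)] C.solomon_zeta_fibre[folded assms(1)]
    by (simp add: gauss_binomial_eq assms(1))
qed

end
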